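(* Let $G=(V,E)$ be a finite graph with coupling constants $J_{uv}>0$ ($uv\in E$), inverse temperature $\beta>0$ and reference measures $(\lambda_v)_{v\in V}$, and let $\langle\cdot\rangle_G$ be the corresponding classical spin model with zero magnetic field. Let $W=\{v_1,\dots,v_n\}\subseteq V$ be an ordered set of distinct vertices and suppose that $\langle\cdot\rangle_G$ satisfies the Pfaffian relations on $W$. Then: (1) there exists a set $U\subseteq V$ of vertices of Ising type such that the path-induced graph $G'=(V',E')$ from $G$ by $V'=U\cup W$ is a planar graph with $W$ lying on one of its faces; (2) moreover, there exists an Ising model $\sigma\sim\langle\cdot\rangle_{G'}$ on $G'$ with ferromagnetic (nonnegative) coupling constants $J'$ such that for all $I\subseteq W$, $$\Big\langle\prod_{v\in I}\varphi_v\Big\rangle_G=\Big\langle\prod_{v\in I}\sigma_v\Big\rangle_{G'}.$$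
   Context: Classical spin model: given a finite graph $G=(V,E)$, coupling constants $J:E\to[0,\infty)$, $\beta\ge 0$, and a family $(\lambda_v)_{v\in V}$ of reference measures, $\langle\cdot\rangle_G$ is the expectation with respect to the probability measure on $\varphi\in\mathbb R^V$ proportional to $\exp\big(\beta\sum_{uv\in E}J_{uv}\varphi_u\varphi_v\big)\prod_{u\in V}\mathrm d\lambda_u(\varphi_u)$. Every reference measure is a symmetric probability measure on $\mathbb R$, different from $\delta_0$, with $\int_{\mathbb R}e^{\alpha x^2}\,\mathrm d\lambda_v(x)<\infty$ for every $\alpha\ge0$. A vertex $v$ is of Ising type if $\lambda_v=\frac12(\delta_s+\delta_{-s})$ for some $s>0$ (depending on $v$). An Ising model on a graph is a classical spin model for which every vertex is of Ising type (the values $s=s_v$ may vary with the vertex). Pfaffian relations on $W=\{v_1,\dots,v_n\}$ (with the given ordering): for every $I\subseteq\{1,\dots,n\}$, $\big\langle\prod_{i\in I}\varphi_{v_i}\big\rangle_G=\mathrm{Pf}(M_I)$, where $M$ is the $n\times n$ skew-symmetric matrix with $M_{ij}=\langle\varphi_{v_i}\varphi_{v_j}\rangle_G$ for $i<j$, $M_I$ is its restriction to $I\times I$, and $\mathrm{Pf}$ is the usual Pfaffian (equal to $0$ in odd dimension and to $1$ for $I=\emptyset$). For four points the relation reads $\langle\varphi_{v_1}\varphi_{v_2}\varphi_{v_3}\varphi_{v_4}\rangle=\langle\varphi_{v_1}\varphi_{v_2}\rangle\langle\varphi_{v_3}\varphi_{v_4}\rangle+\langle\varphi_{v_1}\varphi_{v_4}\rangle\langle\varphi_{v_2}\varphi_{v_3}\rangle-\langle\varphi_{v_1}\varphi_{v_3}\rangle\langle\varphi_{v_2}\varphi_{v_4}\rangle$.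 Path-induced graph: for $V'\subseteq V$, the path-induced graph from $G$ by $V'$ is $G'=(V',E')$, where $uv\in E'$ if and only if there is a simple path in $G$ connecting $u$ and $v$ and avoiding $V'$ except at its endpoints. "Planar with $W$ lying on one of its faces" means that $G'$ has a planar embedding in which all vertices of $W$ are incident to a common face. *)

theory Defs
  imports "HOL-Probability.Probability" "HOL-Combinatorics.Permutations"
begin

text \<open>Finite simple graphs; an edge \<open>uv\<close> is the two-element set \<open>{u, v}\<close>.\<close>

definition finite_graph :: "'v set \<Rightarrow> 'v set set \<Rightarrow> bool" where
  "finite_graph V E \<longleftrightarrow> finite V \<and> E \<subseteq> {e. e \<subseteq> V \<and> card e = 2}"

definition simple_path_between :: "'v set set \<Rightarrow> 'v \<Rightarrow> 'v list \<Rightarrow> 'v \<Rightarrow> bool" where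
  "simple_path_between E u p v \<longleftrightarrow>
     p \<noteq> [] \<and> hd p = u \<and> last p = v \<and> distinct p \<and> successively (\<lambda>x y. {x, y} \<in> E) p"

definition path_induced_edges :: "'v set set \<Rightarrow> 'v set \<Rightarrow> 'v set set" where
  "path_induced_edges E V' =
     {{u, v} | u v. u \<in> V' \<and> v \<in> V' \<and> u \<noteq> v \<and>
        (\<exists>p. simple_path_between E u p v \<and> set p \<inter> V' = {u, v})}"

definition planar_embedding ::
    "'v set \<Rightarrow> 'v set set \<Rightarrow> ('v \<Rightarrow> complex) \<Rightarrow> ('v set \<Rightarrow> real \<Rightarrow> complex) \<Rightarrow> bool" where
  "planar_embedding V E pos \<gamma> \<longleftrightarrow>
     inj_on pos V \<and>
     (\<forall>e\<in>E. arc (\<gamma> e) \<and> {pathstart (\<gamma> e), pathfinish (\<gamma> e)} = pos ` e) \<and>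
     (\<forall>e\<in>E. path_image (\<gamma> e) \<inter> pos ` V = pos ` e) \<and>
     (\<forall>e\<in>E. \<forall>f\<in>E. e \<noteq> f \<longrightarrow> path_image (\<gamma> e) \<inter> path_image (\<gamma> f) = pos ` (e \<inter> f))"

definition embedding_faces ::
    "'v set \<Rightarrow> 'v set set \<Rightarrow> ('v \<Rightarrow> complex) \<Rightarrow> ('v set \<Rightarrow> real \<Rightarrow> complex) \<Rightarrow> complex set set" where
  "embedding_faces V E pos \<gamma> = components (- (pos ` V \<union> (\<Union>e\<in>E. path_image (\<gamma> e))))"

definition planar_with_on_face :: "'v set \<Rightarrow> 'v set set \<Rightarrow> 'v set \<Rightarrow> bool" where
  "planar_with_on_face V E W \<longleftrightarrow>
     (\<exists>pos \<gamma>. planar_embedding V E pos \<gamma> \<and>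
        (\<exists>F\<in>embedding_faces V E pos \<gamma>. pos ` W \<subseteq> frontier F))"

definition reference_measure :: "real measure \<Rightarrow> bool" where
  "reference_measure M \<longleftrightarrow>
     prob_space M \<and> sets M = sets borel \<and>
     distr M borel uminus = M \<and>
     M \<noteq> return borel 0 \<and>
     (\<forall>\<alpha>\<ge>0. integrable M (\<lambda>x. exp (\<alpha> * x\<^sup>2)))"

text \<open>The measure \<open>(\<delta>\<^sub>s + \<delta>\<^sub>-\<^sub>s) / 2\<close> on the Borel sets: a \<open>measure_pmf\<close> itself would live on
  the discrete sigma-algebra.\<close>

definition ising_measure :: "real \<Rightarrow> real measure" where
  "ising_measure s = distr (measure_pmf (pmf_of_set {s, - s})) borel (\<lambda>x. x)"

definition ising_type :: "real measure \<Rightarrow> bool" where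
  "ising_type M \<longleftrightarrow> (\<exists>s>0. M = ising_measure s)"

text \<open>For an edge \<open>e = {u, v}\<close> the product over the vertices of \<open>e\<close> is \<open>\<phi> u * \<phi> v\<close>.\<close>

definition boltzmann_weight ::
    "'v set set \<Rightarrow> ('v set \<Rightarrow> real) \<Rightarrow> real \<Rightarrow> ('v \<Rightarrow> real) \<Rightarrow> real" where
  "boltzmann_weight E J \<beta> \<phi> = exp (\<beta> * (\<Sum>e\<in>E. J e * (\<Prod>u\<in>e. \<phi> u)))"

definition partition_function ::
    "'v set \<Rightarrow> 'v set set \<Rightarrow> ('v set \<Rightarrow> real) \<Rightarrow> real \<Rightarrow> ('v \<Rightarrow> real measure) \<Rightarrow> real" where
  "partition_function V E J \<beta> lam = (\<integral>\<phi>. boltzmann_weight E J \<beta> \<phi> \<partial>(PiM V lam))"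

definition spin_measure ::
    "'v set \<Rightarrow> 'v set set \<Rightarrow> ('v set \<Rightarrow> real) \<Rightarrow> real \<Rightarrow> ('v \<Rightarrow> real measure) \<Rightarrow> ('v \<Rightarrow> real) measure" where
  "spin_measure V E J \<beta> lam =
     density (PiM V lam)
       (\<lambda>\<phi>. ennreal (boltzmann_weight E J \<beta> \<phi> / partition_function V E J \<beta> lam))"

definition spin_expectation ::
    "'v set \<Rightarrow> 'v set set \<Rightarrow> ('v set \<Rightarrow> real) \<Rightarrow> real \<Rightarrow> ('v \<Rightarrow> real measure) \<Rightarrow>
     (('v \<Rightarrow> real) \<Rightarrow> real) \<Rightarrow> real" where
  "spin_expectation V E J \<beta> lam f = (\<integral>\<phi>. f \<phi> \<partial>(spin_measure V E J \<beta> lam))"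

text \<open>For skew-symmetric \<open>A\<close>: each perfect matching of the indices is counted once for every ordering
  of its pairs and of the two elements of each pair, hence the normalisation.\<close>

definition pfaffian :: "nat \<Rightarrow> (nat \<Rightarrow> nat \<Rightarrow> real) \<Rightarrow> real" where
  "pfaffian n A =
     (if odd n then 0
      else (\<Sum>p | p permutes {..<n}.
              of_int (sign p) * (\<Prod>i<n div 2. A (p (2 * i)) (p (2 * i + 1))))
           / (2 ^ (n div 2) * fact (n div 2)))"

text \<open>Pfaffian of the restriction of \<open>A\<close> to \<open>I \<times> I\<close>, for finite \<open>I\<close> listed increasingly.\<close>

definition pfaffian_on :: "nat set \<Rightarrow> (nat \<Rightarrow> nat \<Rightarrow> real) \<Rightarrow> real" where
  "pfaffian_on I A =
     pfaffian (card I) (\<lambda>i j. A (sorted_list_of_set I ! i) (sorted_list_of_set I ! j))"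

definition correlation_matrix ::
    "((('v \<Rightarrow> real) \<Rightarrow> real) \<Rightarrow> real) \<Rightarrow> 'v list \<Rightarrow> nat \<Rightarrow> nat \<Rightarrow> real" where
  "correlation_matrix expect ws i j =
     (if i < j then expect (\<lambda>\<phi>. \<phi> (ws ! i) * \<phi> (ws ! j))
      else if j < i then - expect (\<lambda>\<phi>. \<phi> (ws ! j) * \<phi> (ws ! i))
      else 0)"

definition pfaffian_relations ::
    "((('v \<Rightarrow> real) \<Rightarrow> real) \<Rightarrow> real) \<Rightarrow> 'v list \<Rightarrow> bool" where
  "pfaffian_relations expect ws \<longleftrightarrow>
     (\<forall>I \<subseteq> {..<length ws}.
        expect (\<lambda>\<phi>. \<Prod>i\<in>I. \<phi> (ws ! i)) = pfaffian_on I (correlation_matrix expect ws))"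

end

theory Submission
  imports Defs
begin

text \<open>Let \<open>\<phi>, \<phi>'\<close> be independent copies of the model. Expanding the weight in \<open>\<phi> + \<phi>'\<close> and
  \<open>\<phi> - \<phi>'\<close> (Ginibre) shows that the four-point Pfaffian relation fails strictly whenever
  \<open>v\<^sub>1, v\<^sub>3\<close> and \<open>v\<^sub>2, v\<^sub>4\<close> are joined by paths that share no vertex of Ising type. Hence crossing links
  between the marked vertices always meet in an Ising vertex.

  If every non-Ising vertex is blown up to a triangle, no two disjoint paths link the marked vertices
  crosswise. By a two-paths theorem the blow-up is planar with the marked vertices on one face, up to
  parts separated from them by at most three vertices. In terms of the original graph there is a set
  \<open>K\<close> of Ising vertices such that each component of the complement of \<open>K\<close> has at most three
  terminals (neighbours in \<open>K\<close>, or marked vertices inside it), and the path-induced graph on \<open>K\<close> and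
  the marked vertices is planar in the required sense.

  A component sees its surroundings only through the moments of at most three terminals, that is,
  through pair correlations. Griffiths' inequalities say exactly that these are realised by
  ferromagnetic Ising couplings on a triangle or on a chain of terminals, so the components can be
  replaced one by one.\<close>

section \<open>Connected sets and Menger's theorem\<close>

text \<open>The two-paths theorem is proved by an induction that never mentions faces: drawings live
  in a half-plane, and the marked list grows by neighbours of marked vertices until some marked
  vertex has no edge to unmarked ones; its edges along the line are redrawn and the vertex itself
  can be removed. The connectivity condition \<open>reduced\<close> supplies the fourth disjoint
  path that turns a bad configuration into a crossing; it is arranged beforehand by hiding as many
  vertices as possible behind at most three others. The number three returns in the analysis: an
  even function of three Ising spins is a combination of the constant and three pair products, and a
  triangle has three couplings besides the normalisation. The obstacle at the end is that the
  path-induced graph may lack an edge between two terminals, which forces their coupling to vanish.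
  This happens only when the component contains marked vertices, and their spin values in the new
  model are free: one of them is chosen so that the terminals form a Markov chain through that
  vertex.\<close>

abbreviation walk :: "'v set set \<Rightarrow> 'v list \<Rightarrow> bool" where
  "walk E p \<equiv> successively (\<lambda>x y. {x, y} \<in> E) p"

text \<open>The closure only controls the vertices that are entered, so membership of the start is a
  separate clause; every vertex visited then lies in \<open>S\<close>.\<close>

definition conn :: "'v set set \<Rightarrow> 'v set \<Rightarrow> 'v \<Rightarrow> 'v \<Rightarrow> bool" where
  "conn E S x y \<longleftrightarrow> x \<in> S \<and> (\<lambda>a b. {a, b} \<in> E \<and> b \<in> S)\<^sup>*\<^sup>* x y"

definition connected_in :: "'v set set \<Rightarrow> 'v set \<Rightarrow> bool" where
  "connected_in E C \<longleftrightarrow> (\<forall>x\<in>C. \<forall>y\<in>C. conn E C x y)"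

definition nbrs :: "'v set set \<Rightarrow> 'v set \<Rightarrow> 'v set" where
  "nbrs E C = {v. v \<notin> C \<and> (\<exists>c\<in>C. {c, v} \<in> E)}"

lemma conn_refl [simp]: "x \<in> S \<Longrightarrow> conn E S x x"
  by (simp add: conn_def)

lemma conn_fst: "conn E S x y \<Longrightarrow> x \<in> S"
  by (simp add: conn_def)

lemma conn_snd: "conn E S x y \<Longrightarrow> y \<in> S"
  unfolding conn_def by (metis (no_types, lifting) rtranclp.cases)

lemma conn_step: "conn E S x y \<Longrightarrow> {y, z} \<in> E \<Longrightarrow> z \<in> S \<Longrightarrow> conn E S x z"
  unfolding conn_def by (auto intro: rtranclp.rtrancl_into_rtrancl)

lemma conn_edge: "{x, y} \<in> E \<Longrightarrow> x \<in> S \<Longrightarrow> y \<in> S \<Longrightarrow> conn E S x y"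
  by (meson conn_refl conn_step)

lemma conn_trans: "conn E S x y \<Longrightarrow> conn E S y z \<Longrightarrow> conn E S x z"
  unfolding conn_def by auto

lemma conn_induct [consumes 1, case_names refl step]:
  assumes "conn E S x y" "x \<in> S \<Longrightarrow> P x"
    and "\<And>y z. conn E S x y \<Longrightarrow> P y \<Longrightarrow> {y, z} \<in> E \<Longrightarrow> z \<in> S \<Longrightarrow> P z"
  shows "P y"
proof -
  have x: "x \<in> S" using assms(1) by (rule conn_fst)
  have "(\<lambda>a b. {a, b} \<in> E \<and> b \<in> S)\<^sup>*\<^sup>* x y" using assms(1) by (simp add: conn_def)
  then have "conn E S x y \<and> P y"
    by (induction rule: rtranclp_induct) (use x assms(2,3) in \<open>auto intro: conn_step\<close>)
  then show ?thesis ..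
qed

lemma conn_sym: "conn E S x y \<Longrightarrow> conn E S y x"
proof (induction rule: conn_induct)
  case (step y z)
  have "conn E S z y" using step by (intro conn_edge) (auto simp: insert_commute dest: conn_snd)
  then show ?case using step conn_trans by metis
qed simp

lemma conn_mono: "conn E S x y \<Longrightarrow> S \<subseteq> T \<Longrightarrow> E \<subseteq> F \<Longrightarrow> conn F T x y"
proof (induction rule: conn_induct)
  case (step y z)
  then show ?case by (meson conn_step subsetD)
qed auto

lemma conn_mono': "conn E S x y \<Longrightarrow> S \<subseteq> T \<Longrightarrow> conn E T x y"
  by (rule conn_mono) auto

lemma conn_union: "conn E S x y \<Longrightarrow> conn E T y z \<Longrightarrow> conn E (S \<union> T) x z"
  by (meson conn_mono' conn_trans sup_ge1 sup_ge2)

lemma walk_conn: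
  assumes "walk E p" "x \<in> set p" "y \<in> set p"
  shows "conn E (set p) x y"
proof -
  have "walk E p \<Longrightarrow> \<forall>y\<in>set p. conn E (set p) (hd p) y" for p
  proof (induction p rule: induct_list012)
    case (3 a b xs)
    then have *: "\<forall>y\<in>set (b # xs). conn E (set (b # xs)) b y" by simp
    have ab: "conn E (set (a # b # xs)) a b" using 3(3) by (intro conn_edge) auto
    show ?case
    proof
      fix y assume y: "y \<in> set (a # b # xs)"
      show "conn E (set (a # b # xs)) (hd (a # b # xs)) y"
      proof (cases "y = a")
        case False
        then have "conn E (set (b # xs)) b y" using * y by auto
        then have "conn E (set (a # b # xs)) b y" by (rule conn_mono') auto
        then show ?thesis using ab conn_trans by fastforce
      qed auto
    qed
  qed auto
  from this[OF assms(1)] assms have "conn E (set p) (hd p) x" "conn E (set p) (hd p) y" by auto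
  then show ?thesis by (rule conn_trans[OF conn_sym])
qed

lemma walk_prefix: "walk E (p1 @ z # p2) \<Longrightarrow> walk E (p1 @ [z])"
  using successively_append_iff[of _ "p1 @ [z]" p2] by simp

lemma conn_path:
  assumes "conn E S x y"
  obtains p where "simple_path_between E x p y" "set p \<subseteq> S"
proof -
  from assms have "\<exists>p. simple_path_between E x p y \<and> set p \<subseteq> S"
  proof (induction rule: conn_induct)
    case refl
    then show ?case by (intro exI[of _ "[x]"]) (auto simp: simple_path_between_def)
  next
    case (step y z)
    then obtain p where p: "simple_path_between E x p y" "set p \<subseteq> S" by auto
    show ?case
    proof (cases "z \<in> set p")
      case True
      then obtain p1 p2 where "p = p1 @ z # p2" by (meson split_list)
      then have "simple_path_between E x (p1 @ [z]) z"
        using p walk_prefix[of E p1 z p2] by (cases p1) (auto simp: simple_path_between_def)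
      then show ?thesis using p \<open>p = _\<close> by (intro exI[of _ "p1 @ [z]"]) auto
    next
      case False
      then have "simple_path_between E x (p @ [z]) z"
        using p step by (auto simp: simple_path_between_def successively_append_iff)
      then show ?thesis using p step by (intro exI[of _ "p @ [z]"]) auto
    qed
  qed
  then show ?thesis using that by blast
qed

lemma path_conn: "simple_path_between E x p y \<Longrightarrow> conn E (set p) x y"
  unfolding simple_path_between_def by (intro walk_conn) auto

lemma component_connected: "connected_in E {y. conn E S x y}"
proof -
  let ?C = "{y. conn E S x y}"
  have *: "conn E ?C x y" if "conn E S x y" for y
    using that
  proof (induction rule: conn_induct)
    case (step y z)
    then have "conn E S x z" by (meson conn_step)
    with step show ?case by (meson conn_step mem_Collect_eq)
  qed auto
  have "conn E ?C y z" if "y \<in> ?C" "z \<in> ?C" for y z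
    using *[of y] *[of z] that conn_trans[OF conn_sym, of E ?C x y z] by auto
  then show ?thesis unfolding connected_in_def by blast
qed

lemma component_nbrs: "nbrs E {y. conn E S x y} \<inter> S = {}"
  unfolding nbrs_def by (auto dest: conn_step)

lemma connected_in_conn: "connected_in E C \<Longrightarrow> x \<in> C \<Longrightarrow> y \<in> C \<Longrightarrow> conn E C x y"
  by (simp add: connected_in_def)

lemma walk_connected: "walk E p \<Longrightarrow> connected_in E (set p)"
  by (simp add: connected_in_def walk_conn)

lemma connected_in_Un:
  assumes "connected_in E A" "connected_in E B"
    and "A \<inter> B \<noteq> {} \<or> (\<exists>a\<in>A. \<exists>b\<in>B. {a, b} \<in> E)"
  shows "connected_in E (A \<union> B)"
proof -
  have AB: "conn E (A \<union> B) x y" if "x \<in> A" "y \<in> B" for x y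
  proof -
    from assms(3) obtain a b where ab: "a \<in> A" "b \<in> B" "conn E (A \<union> B) a b"
    proof (elim disjE bexE)
      fix a b assume "a \<in> A" "b \<in> B" "{a, b} \<in> E"
      then show ?thesis by (intro that[of a b] conn_edge) auto
    next
      assume "A \<inter> B \<noteq> {}"
      then obtain c where "c \<in> A" "c \<in> B" by auto
      then show ?thesis by (intro that[of c c]) auto
    qed
    have "conn E (A \<union> B) x a" using connected_in_conn[OF assms(1) that(1) ab(1)] by (rule conn_mono') auto
    moreover have "conn E (A \<union> B) b y" using connected_in_conn[OF assms(2) ab(2) that(2)] by (rule conn_mono') auto
    ultimately show ?thesis by (rule conn_trans[OF conn_trans[OF _ ab(3)]])
  qed
  have "conn E (A \<union> B) x y" if "x \<in> A" "y \<in> A" for x y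
    using connected_in_conn[OF assms(1) that] by (rule conn_mono') auto
  moreover have "conn E (A \<union> B) x y" if "x \<in> B" "y \<in> B" for x y
    using connected_in_conn[OF assms(2) that] by (rule conn_mono') auto
  moreover have "conn E (A \<union> B) x y" if "x \<in> B" "y \<in> A" for x y
    using AB[OF that(2,1)] by (rule conn_sym)
  ultimately show ?thesis unfolding connected_in_def
    using AB by blast
qed

text \<open>Goering's proof of Menger's theorem: the augmented family keeps the endpoints in \<open>B\<close>,
  so one lets \<open>B\<close> grow.\<close>

definition ab_path :: "'v set set \<Rightarrow> 'v set \<Rightarrow> 'v set \<Rightarrow> 'v list \<Rightarrow> bool" where
  "ab_path E A B p \<longleftrightarrow> p \<noteq> [] \<and> walk E p \<and> distinct p \<and> hd p \<in> A \<and> last p \<in> B \<and>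
     set (butlast p) \<inter> B = {}"

definition disjoint_paths :: "'v list set \<Rightarrow> bool" where
  "disjoint_paths P \<longleftrightarrow> (\<forall>p\<in>P. \<forall>q\<in>P. p \<noteq> q \<longrightarrow> set p \<inter> set q = {})"

text \<open>A path of the enlarged problem meets \<open>B'\<close> only at its end. A tail inside
  \<open>B'\<close> therefore cannot touch its earlier vertices, and the concatenation reaches
  \<open>B\<close> only where the tail does.\<close>

lemma ab_path_extend:
  assumes "ab_path E A B' q" "walk E (last q # t)" "t \<noteq> []" "distinct t" "set t \<subseteq> B'"
    "last q \<notin> set t" "B \<subseteq> B'" "last q \<notin> B" "last t \<in> B" "set (butlast t) \<inter> B = {}"
  shows "ab_path E A B (q @ t)"
proof -
  have q: "q = butlast q @ [last q]" using assms(1) by (simp add: ab_path_def)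
  then have "set q = insert (last q) (set (butlast q))" by (metis list.simps(15) set_append Un_insert_right sup_bot.right_neutral list.set(1))
  moreover have "walk E (q @ t)"
    using assms by (cases t) (auto simp: ab_path_def successively_append_iff)
  ultimately show ?thesis using assms by (auto simp: ab_path_def butlast_append)
qed

text \<open>Cutting at the first vertex of \<open>B'\<close> transfers the hypothesis on small
  separators from \<open>B\<close> to the larger target \<open>B'\<close>.\<close>

lemma ab_path_shrink:
  assumes "ab_path E A B p" "B \<subseteq> B'"
  obtains q r where "p = q @ r" "ab_path E A B' q"
proof -
  have "\<exists>x\<in>set p. x \<in> B'" using assms by (auto simp: ab_path_def)
  then obtain ys x zs where "p = ys @ x # zs" "x \<in> B'" "\<forall>y\<in>set ys. y \<notin> B'"
    using split_list_first_prop[of p "\<lambda>x. x \<in> B'"] by blast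
  then show ?thesis using assms that[of "ys @ [x]" zs] walk_prefix[of E ys x zs]
    by (cases ys) (auto simp: ab_path_def)
qed

lemma disjoint_paths_last_inj:
  "disjoint_paths P \<Longrightarrow> [] \<notin> P \<Longrightarrow> inj_on last P"
  unfolding disjoint_paths_def inj_on_def by (metis disjoint_iff last_in_set)

text \<open>The last hypothesis says that no set of at most \<open>card P\<close> vertices separates
  \<open>A\<close> from \<open>B\<close>. That the old ends survive is what the theta graph argument
  relies on: its three given exits must stay in use when the fourth one is found.\<close>

theorem menger_augment:
  assumes "finite V" "B \<subseteq> V" "A \<subseteq> V" "E \<subseteq> Pow V"
    and "finite P" "\<forall>p\<in>P. ab_path E A B p" "disjoint_paths P"
    and "\<And>X. finite X \<Longrightarrow> card X \<le> card P \<Longrightarrow> \<exists>p. ab_path E A B p \<and> set p \<inter> X = {}"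
  shows "\<exists>Q. finite Q \<and> card Q = Suc (card P) \<and> (\<forall>p\<in>Q. ab_path E A B p) \<and> disjoint_paths Q \<and>
    last ` P \<subseteq> last ` Q"
  using assms
proof (induction "card (V - B)" arbitrary: B P rule: less_induct)
  case less
  note P = less.prems(5-7)
  have fP: "finite P" by fact
  have nilP: "[] \<notin> P" using P by (auto simp: ab_path_def)
  have "card (last ` P) \<le> card P" by (simp add: card_image_le fP)
  then obtain R where R: "ab_path E A B R" "set R \<inter> last ` P = {}"
    using less.prems(8)[of "last ` P"] fP by auto
  show ?case
  proof (cases "set R \<inter> \<Union>(set ` P) = {}")
    case True
    have "R \<noteq> []" using R by (simp add: ab_path_def)
    then have "R \<notin> P" using True by (metis UN_I disjoint_iff last_in_set)
    then have "card (insert R P) = Suc (card P)" using fP by simp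
    moreover have "disjoint_paths (insert R P)" using P True
      unfolding disjoint_paths_def by (auto; blast)
    ultimately show ?thesis using P R fP by (intro exI[of _ "insert R P"]) auto
  next
    case False
    \<comment> \<open>Let \<open>x\<close> be the last vertex of \<open>R\<close> on the family.
      After \<open>x\<close> the path \<open>R\<close> is free, so \<open>R2\<close> and the tail
      \<open>P2\<close> of the path \<open>p\<close> through \<open>x\<close> are two ways to
      continue from \<open>x\<close>.\<close>
    then have "\<exists>x\<in>set R. x \<in> \<Union>(set ` P)" by blast
    then obtain R1 x R2 where R12: "R = R1 @ x # R2" "x \<in> \<Union>(set ` P)"
      and R2: "\<forall>y\<in>set R2. y \<notin> \<Union>(set ` P)"
      using split_list_last_prop[of R "\<lambda>x. x \<in> \<Union>(set ` P)"] by blast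
    then obtain p where p: "p \<in> P" "x \<in> set p" by auto
    then obtain P1 P2 where p12: "p = P1 @ x # P2" by (meson split_list)
    have abp: "ab_path E A B p" using P p by auto
    have xB: "x \<notin> B"
    proof
      assume "x \<in> B"
      then have "P2 = []" using abp p12 by (auto simp: ab_path_def butlast_append split: if_splits)
      then have "x \<in> last ` P" using p p12 by (auto intro!: image_eqI[of _ _ p])
      then show False using R R12 by auto
    qed
    have ne: "P2 \<noteq> []" "R2 \<noteq> []" using abp R p12 R12 xB by (auto simp: ab_path_def)
    have "set p \<subseteq> V"
    proof
      fix v assume v: "v \<in> set p"
      \<comment> \<open>\<open>V\<close> is only known to contain the ends of edges, so each vertex
        of \<open>p\<close> must be seen to lie on an edge of \<open>p\<close>.\<close>
      have "length p \<ge> 2" using p12 ne by (cases P1; cases P2) auto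
      then obtain i where i: "i < length p" "p ! i = v" using v by (auto simp: in_set_conv_nth)
      have w: "walk E p" using abp by (simp add: ab_path_def)
      show "v \<in> V"
      proof (cases i)
        case 0
        then have "{p ! 0, p ! 1} \<in> E" using w \<open>length p \<ge> 2\<close> by (auto simp: successively_conv_nth)
        then show ?thesis using less.prems(4) i 0 by auto
      next
        case (Suc j)
        then have "{p ! j, p ! Suc j} \<in> E" using w i by (auto simp: successively_conv_nth)
        then show ?thesis using less.prems(4) i Suc by auto
      qed
    qed
    then have xV: "x \<in> V" using p by auto
    have rest_p: "set q \<inter> set p = {}" if "q \<in> P" "q \<noteq> p" for q
      using P p that by (auto simp: disjoint_paths_def)
    \<comment> \<open>Both tails from \<open>x\<close> join the target, and \<open>p\<close> is cut
      at \<open>x\<close>. Since \<open>x\<close> lies in \<open>V - B\<close>, the complement of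
      the target shrinks, and this drives the induction.\<close>
    define B' where "B' = B \<union> set (x # P2) \<union> set (x # R2)"
    have R2V: "set R \<subseteq> V"
    proof
      fix v assume v: "v \<in> set R"
      have "length R \<ge> 2" using R12 ne by (cases R1; cases R2) auto
      then obtain i where i: "i < length R" "R ! i = v" using v by (auto simp: in_set_conv_nth)
      have w: "walk E R" using R by (simp add: ab_path_def)
      show "v \<in> V"
      proof (cases i)
        case 0
        then have "{R ! 0, R ! 1} \<in> E" using w \<open>length R \<ge> 2\<close> by (auto simp: successively_conv_nth)
        then show ?thesis using less.prems(4) i 0 by auto
      next
        case (Suc j)
        then have "{R ! j, R ! Suc j} \<in> E" using w i by (auto simp: successively_conv_nth)
        then show ?thesis using less.prems(4) i Suc by auto
      qed
    qed
    have BV: "B' \<subseteq> V" unfolding B'_def using less.prems(2) \<open>set p \<subseteq> V\<close> R2V p12 R12 by auto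
    have BB: "B \<subseteq> B'" by (auto simp: B'_def)
    have "card (V - B') < card (V - B)"
      by (rule psubset_card_mono) (use less.prems(1) xV xB B'_def in auto)
    define P' where "P' = insert (P1 @ [x]) (P - {p})"
    have P1x: "P1 @ [x] \<notin> P - {p}"
      using rest_p p p12 by fastforce
    have cardP': "card P' = card P"
      using fP p P1x unfolding P'_def by (metis card.insert_remove card_Suc_Diff1 card_insert_disjoint finite_Diff)
    have abP': "\<forall>q\<in>P'. ab_path E A B' q"
    proof
      fix q assume "q \<in> P'"
      then consider "q = P1 @ [x]" | "q \<in> P" "q \<noteq> p" by (auto simp: P'_def)
      then show "ab_path E A B' q"
      proof cases
        case 1
        have "set P1 \<inter> set R2 = {}" using R2 p(1) unfolding p12 by fastforce
        moreover have "set P1 \<inter> B = {}" using abp p12 ne by (auto simp: ab_path_def butlast_append)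
        ultimately show ?thesis using 1 abp p12 walk_prefix[of E P1 x P2]
          by (cases P1) (auto simp: ab_path_def B'_def)
      next
        case 2
        have "ab_path E A B q" using P 2 by auto
        moreover have "set q \<inter> set (x # P2) = {}" using rest_p[OF 2] p12 by auto
        moreover have "set q \<inter> set (x # R2) = {}" using calculation(2) R2 2 by auto
        ultimately show ?thesis unfolding ab_path_def B'_def
          by (auto dest: in_set_butlastD)
      qed
    qed
    have disP': "disjoint_paths P'"
      unfolding disjoint_paths_def P'_def using rest_p P(3) p12
      by (auto simp: disjoint_paths_def; fastforce)
    have "\<exists>q. ab_path E A B' q \<and> set q \<inter> X = {}" if "finite X" "card X \<le> card P'" for X
    proof -
      obtain q where q: "ab_path E A B q" "set q \<inter> X = {}" using less.prems(8) \<open>card X \<le> _\<close> \<open>finite X\<close> cardP' by metis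
      then obtain q1 q2 where "q = q1 @ q2" "ab_path E A B' q1" using ab_path_shrink BB by metis
      then show ?thesis using q by (intro exI[of _ q1]) auto
    qed
    then obtain Q' where Q': "finite Q'" "card Q' = Suc (card P')" "\<forall>q\<in>Q'. ab_path E A B' q"
        "disjoint_paths Q'" "last ` P' \<subseteq> last ` Q'"
      using less.hyps[of B' P', OF \<open>card (V - B') < card (V - B)\<close> less.prems(1) BV less.prems(3,4)]
        fP abP' disP' by (auto simp: P'_def)
    have nilQ: "[] \<notin> Q'" using Q'(3) by (auto simp: ab_path_def)
    have injQ: "inj_on last Q'" using disjoint_paths_last_inj Q'(4) nilQ by auto
    have nilP': "[] \<notin> P'" using nilP by (auto simp: P'_def)
    have injP': "inj_on last P'" using disjoint_paths_last_inj disP' nilP' by auto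
    \<comment> \<open>\<open>Q'\<close> keeps the ends of \<open>P'\<close>, among them
      \<open>x\<close>, and has one path more; hence there is exactly one new end \<open>y\<close>.
      Only the paths ending at \<open>x\<close> and \<open>y\<close> may need a tail to get back to
      \<open>B\<close>.\<close>
    have "card (last ` Q' - last ` P') = 1"
      using Q' card_image[OF injQ] card_image[OF injP'] fP
      by (subst card_Diff_subset) (auto simp: P'_def)
    then obtain y where y: "last ` Q' - last ` P' = {y}" by (auto simp: card_1_singleton_iff)
    obtain qx where qx: "qx \<in> Q'" "last qx = x" using Q'(5) by (auto simp: P'_def)
    have "y \<in> last ` Q'" using y by blast
    then obtain qy where qy: "qy \<in> Q'" "last qy = y" by auto
    have yx: "y \<noteq> x" using y qx by (auto simp: P'_def)
    have yB': "y \<in> B'" using qy Q'(3) by (auto simp: ab_path_def)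
    define Q0 where "Q0 = Q' - {qx, qy}"
    have Q0last: "last q \<in> last ` (P - {p})" "q \<in> Q'" "set (butlast q) \<inter> B' = {}" "ab_path E A B' q" if "q \<in> Q0" for q
    proof -
      have "last q \<noteq> x" "last q \<noteq> y" using that qx qy injQ by (auto simp: Q0_def inj_on_def)
      moreover have "last q \<in> last ` Q'" using that by (auto simp: Q0_def)
      ultimately have "last q \<in> last ` P' - {x}" using y by blast
      then show "last q \<in> last ` (P - {p})" by (auto simp: P'_def)
      show "q \<in> Q'" using that by (auto simp: Q0_def)
      then show "ab_path E A B' q" using Q' by auto
      then show "set (butlast q) \<inter> B' = {}" by (simp add: ab_path_def)
    qed
    have lastP_avoid: "v \<notin> set p" "v \<notin> set R2" "v \<in> B" if v: "v \<in> last ` (P - {p})" for v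
    proof -
      obtain q where q: "q \<in> P" "q \<noteq> p" "v = last q" "q \<noteq> []" using v nilP by auto
      then show "v \<notin> set p" using rest_p by (metis disjoint_iff last_in_set)
      show "v \<notin> set R2" using R2 q by (metis UN_I last_in_set)
      show "v \<in> B" using q P by (auto simp: ab_path_def)
    qed
    have Q0B: "ab_path E A B q" if "q \<in> Q0" for q
      using Q0last[OF that] lastP_avoid BB unfolding ab_path_def by auto
    have setq: "set q = insert (last q) (set (butlast q))" if "q \<noteq> []" for q :: "'a list"
      using that by (metis append_butlast_last_id list.simps(15) set_append Un_insert_right sup_bot.right_neutral list.set(1))
    have Q0ext: "set q \<inter> set t = {}" if "q \<in> Q0" "set t \<subseteq> set P2 \<union> set R2" for q t
    proof -
      have "set q = insert (last q) (set (butlast q))" using that(1) nilQ by (intro setq) (auto simp: Q0_def)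
      moreover have "last q \<notin> set P2 \<union> set R2"
        using Q0last(1)[OF that(1)] lastP_avoid p12 by auto
      ultimately show ?thesis using that(2) Q0last(3)[OF that(1)] by (auto simp: B'_def)
    qed
    have qxy: "qx \<noteq> qy" using qx qy yx by auto
    have setqx: "set qx \<inter> set t = {}" if "set t \<subseteq> set P2 \<union> set R2" for t
    proof -
      have "set qx = insert x (set (butlast qx))" using setq[of qx] qx nilQ by auto
      moreover have "x \<notin> set P2 \<union> set R2" using abp R p12 R12 by (auto simp: ab_path_def)
      moreover have "set (butlast qx) \<inter> B' = {}" using Q'(3) qx by (auto simp: ab_path_def)
      ultimately show ?thesis using that by (auto simp: B'_def)
    qed
    have setqy: "set qy \<inter> set t = {}" if "set t \<subseteq> set P2 \<union> set R2" "y \<notin> set t" for t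
    proof -
      have "set qy = insert y (set (butlast qy))" using setq[of qy] qy nilQ by auto
      moreover have "set (butlast qy) \<inter> B' = {}" using Q'(3) qy by (auto simp: ab_path_def)
      ultimately show ?thesis using that by (auto simp: B'_def)
    qed
    have assemble: ?thesis
      if t: "ab_path E A B (qx @ t1)" "ab_path E A B (qy @ t2)" "set t1 \<inter> set t2 = {}"
         "set t1 \<union> set t2 \<subseteq> set P2 \<union> set R2" "y \<notin> set t1" "y \<notin> set t2"
         "last p \<in> {last (qx @ t1), last (qy @ t2)}" for t1 t2
    proof -
      let ?Q = "insert (qx @ t1) (insert (qy @ t2) Q0)"
      have d1: "set (qx @ t1) \<inter> set (qy @ t2) = {}"
      proof -
        have "set qx \<inter> set qy = {}" using qxy Q'(4) qx(1) qy(1) unfolding disjoint_paths_def by blast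
        then show ?thesis using setqx[of t2] setqy[of t1] t(3-5) by auto
      qed
      have d2: "set q \<inter> set (qx @ t1) = {}" "set q \<inter> set (qy @ t2) = {}" if "q \<in> Q0" for q
      proof -
        have "q \<in> Q'" "q \<noteq> qx" "q \<noteq> qy" using that by (auto simp: Q0_def)
        then have "set q \<inter> set qx = {}" "set q \<inter> set qy = {}"
          using Q'(4) qx(1) qy(1) unfolding disjoint_paths_def by blast+
        then show "set q \<inter> set (qx @ t1) = {}" "set q \<inter> set (qy @ t2) = {}"
          using Q0ext[OF that] t(4) by auto
      qed
      have nn: "qx \<noteq> []" "qy \<noteq> []" "\<And>q. q \<in> Q0 \<Longrightarrow> q \<noteq> []" using nilQ qx qy by (auto simp: Q0_def)
      have n1: "qx @ t1 \<notin> Q0" "qy @ t2 \<notin> Q0" "qx @ t1 \<noteq> qy @ t2"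
        using d1 d2 nn by (metis append_is_Nil_conv inf.idem set_empty)+
      have "card Q0 = card P' - 1"
        unfolding Q0_def using Q' qx qy qxy by (simp add: card_Diff_subset)
      moreover have "card P' \<ge> 1" using fP by (auto simp: P'_def card_gt_0_iff Suc_le_eq)
      moreover have "finite Q0" using Q' by (simp add: Q0_def)
      ultimately have "card ?Q = Suc (card P)" using n1 cardP' by simp
      moreover have "disjoint_paths ?Q"
      proof -
        have "set p \<inter> set q = {}" if "p \<in> Q0" "q \<in> Q0" "p \<noteq> q" for p q
          using Q'(4) that unfolding disjoint_paths_def Q0_def by blast
        then show ?thesis using d1 d2 unfolding disjoint_paths_def by (auto simp: Int_commute)
      qed
      moreover have "last ` P \<subseteq> last ` ?Q"
      proof
        fix v assume "v \<in> last ` P"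
        then consider "v = last p" | "v \<in> last ` (P - {p})" by blast
        then show "v \<in> last ` ?Q"
        proof cases
          case 2
          then have "v \<in> last ` P'" by (auto simp: P'_def)
          then obtain q where q: "q \<in> Q'" "last q = v" using Q'(5) by auto
          have "v \<noteq> x" using lastP_avoid(1)[OF 2] p by auto
          moreover have "v \<noteq> y" using y \<open>v \<in> last ` P'\<close> by blast
          ultimately have "q \<in> Q0" using q qx qy by (auto simp: Q0_def)
          then show ?thesis using q by auto
        qed (use t in auto)
      qed
      ultimately show ?thesis using t Q0B \<open>finite Q0\<close> by (intro exI[of _ ?Q]) auto
    qed
    have wP: "walk E (x # P2)" "distinct (x # P2)" "set (butlast P2) \<inter> B = {}" "last P2 \<in> B" "last P2 = last p"
      using abp p12 ne by (auto simp: ab_path_def successively_append_iff butlast_append)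
    have wR: "walk E (x # R2)" "distinct (x # R2)" "set (butlast R2) \<inter> B = {}" "last R2 \<in> B"
      using R(1) R12 ne by (auto simp: ab_path_def successively_append_iff butlast_append)
    have PR: "set P2 \<inter> set R2 = {}" using R2 p(1) unfolding p12 by fastforce
    show ?thesis
    \<comment> \<open>The two tails must be disjoint. If \<open>y\<close> is off \<open>P2\<close>,
      the path to \<open>x\<close> continues along \<open>P2\<close>, and \<open>y\<close> is in
      \<open>B\<close> or continues along \<open>R2\<close>. If \<open>y\<close> is on
      \<open>P2\<close>, the path to \<open>x\<close> takes \<open>R2\<close> and \<open>y\<close>
      follows the rest of \<open>P2\<close>, if any.\<close>
    proof (cases "y \<in> set P2")
      case False
      have e1: "ab_path E A B (qx @ P2)"
        by (rule ab_path_extend[of _ _ B']) (use Q'(3) qx wP ne BB xB in \<open>auto simp: B'_def\<close>)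
      show ?thesis
      proof (cases "y \<in> B")
        case True
        then have "ab_path E A B (qy @ [])" using Q'(3) qy BB by (auto simp: ab_path_def)
        then show ?thesis using e1 False wP ne by (intro assemble[of P2 "[]"]) auto
      next
        case yB: False
        then have "y \<in> set R2" using yB' False yx by (auto simp: B'_def)
        then obtain R21 R22 where R22: "R2 = R21 @ y # R22" by (meson split_list)
        then have "R22 \<noteq> []" using wR yB by auto
        have "ab_path E A B (qy @ R22)"
          by (rule ab_path_extend[of _ _ B'])
            (use Q'(3) qy wR yB BB R22 \<open>R22 \<noteq> []\<close> in \<open>auto simp: B'_def successively_append_iff butlast_append successively_Cons\<close>)
        then show ?thesis using e1 False wP wR ne PR R22 by (intro assemble[of P2 R22]) auto
      qed
    next
      case True
      then have yR: "y \<notin> set R2" using PR by auto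
      have e1: "ab_path E A B (qx @ R2)"
        by (rule ab_path_extend[of _ _ B']) (use Q'(3) qx wR ne BB xB in \<open>auto simp: B'_def\<close>)
      obtain P21 P22 where P22: "P2 = P21 @ y # P22" using True by (meson split_list)
      show ?thesis
      proof (cases "P22 = []")
        case True
        then have "y \<in> B" using wP P22 by auto
        then have "ab_path E A B (qy @ [])" using Q'(3) qy BB by (auto simp: ab_path_def)
        then show ?thesis using e1 yR wP wR P22 True ne qy by (intro assemble[of R2 "[]"]) auto
      next
        case False
        then have yB: "y \<notin> B" using wP P22 by (auto simp: butlast_append)
        have "ab_path E A B (qy @ P22)"
          by (rule ab_path_extend[of _ _ B'])
            (use Q'(3) qy wP yB BB P22 False in \<open>auto simp: B'_def successively_append_iff butlast_append successively_Cons\<close>)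
        then show ?thesis using e1 yR wP wR PR P22 False by (intro assemble[of R2 P22]) auto
      qed
    qed
  qed
qed

section \<open>Crossing links\<close>

text \<open>Disjoint connecting sets replace disjoint paths, so that links can be formed as unions
  of pieces without being made simple.\<close>

definition crossing :: "'v set set \<Rightarrow> 'v list \<Rightarrow> bool" where
  "crossing E ws \<longleftrightarrow> (\<exists>S T i k j l. i < k \<and> k < j \<and> j < l \<and> l < length ws \<and> S \<inter> T = {} \<and>
     conn E S (ws ! i) (ws ! j) \<and> conn E T (ws ! k) (ws ! l))"

text \<open>The connectivity hypothesis of the two-paths theorem. A part hanging on at most three
  vertices could be nonplanar without creating any crossing, so such parts are excluded.\<close>

definition reduced :: "'v set \<Rightarrow> 'v set set \<Rightarrow> 'v set \<Rightarrow> bool" where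
  "reduced V E W \<longleftrightarrow>
     (\<forall>C. C \<subseteq> V - W \<and> C \<noteq> {} \<and> connected_in E C \<longrightarrow> 4 \<le> card (nbrs E C))"

lemma crossingI:
  "i < k \<Longrightarrow> k < j \<Longrightarrow> j < l \<Longrightarrow> l < length ws \<Longrightarrow> S \<inter> T = {} \<Longrightarrow>
    conn E S (ws ! i) (ws ! j) \<Longrightarrow> conn E T (ws ! k) (ws ! l) \<Longrightarrow> crossing E ws"
  unfolding crossing_def by blast

lemma crossing_mono: "crossing E ws \<Longrightarrow> E \<subseteq> F \<Longrightarrow> crossing F ws"
  unfolding crossing_def by (metis conn_mono order_refl)

text \<open>Crossing depends only on the cyclic order: if the moved vertex was the end
  \<open>l\<close>, it becomes the first index and the two links exchange roles.\<close>

lemma crossing_rotate1: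
  assumes "crossing E (xs @ [x])"
  shows "crossing E (x # xs)"
proof -
  from assms obtain S T i k j l where *: "i < k" "k < j" "j < l" "l < length (xs @ [x])" "S \<inter> T = {}"
      "conn E S ((xs @ [x]) ! i) ((xs @ [x]) ! j)" "conn E T ((xs @ [x]) ! k) ((xs @ [x]) ! l)"
    unfolding crossing_def by blast
  show ?thesis
  proof (cases "l = length xs")
    case True
    have "conn E T ((x # xs) ! 0) ((x # xs) ! Suc k)" "conn E S ((x # xs) ! Suc i) ((x # xs) ! Suc j)"
      using * True by (auto simp: nth_append intro: conn_sym)
    then show ?thesis using * True by (intro crossingI[of 0 "Suc i" "Suc k" "Suc j" _ T S]) auto
  next
    case False
    then have "conn E S ((x # xs) ! Suc i) ((x # xs) ! Suc j)" "conn E T ((x # xs) ! Suc k) ((x # xs) ! Suc l)"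
      using * by (auto simp: nth_append)
    then show ?thesis using * False by (intro crossingI[of "Suc i" "Suc k" "Suc j" "Suc l" _ S T]) auto
  qed
qed

lemma crossing_rotate: "crossing E (xs @ ys) \<Longrightarrow> crossing E (ys @ xs)"
proof (induction ys arbitrary: xs rule: rev_induct)
  case (snoc y ys)
  then have "crossing E ((xs @ ys) @ [y])" by simp
  then have "crossing E ((y # xs) @ ys)" using crossing_rotate1 by fastforce
  then show ?case using snoc.IH[of "y # xs"] by simp
qed simp

text \<open>Whichever of \<open>c\<close>, \<open>d\<close> lies between \<open>a\<close> and
  \<open>b\<close>, the other lies on one of the two outer sides; relabelling and reversing the
  links covers every order.\<close>

lemma crossing_pairs:
  assumes "S \<inter> T = {}" "conn E S (ws ! a) (ws ! b)" "conn E T (ws ! c) (ws ! d)"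
    and "a < b" "distinct [a, b, c, d]" "c < length ws" "d < length ws" "b < length ws"
    and "(a < c \<and> c < b) \<noteq> (a < d \<and> d < b)"
  shows "crossing E ws"
proof -
  have *: "crossing E ws" if "conn E T (ws ! c) (ws ! d)" "a < c" "c < b" "\<not> (a < d \<and> d < b)"
    "distinct [a, b, c, d]" "d < length ws" for c d
  proof (cases "d < a")
    case True
    then show ?thesis using that assms
      by (intro crossingI[of d a c b _ T S]) (auto intro: conn_sym)
  next
    case False
    then show ?thesis using that assms by (intro crossingI[of a c b d _ S T]) auto
  qed
  show ?thesis
  proof (cases "a < c \<and> c < b")
    case True
    then show ?thesis using * assms by blast
  next
    case False
    then show ?thesis using *[of d c] assms conn_sym[OF assms(3)] by auto
  qed
qed

lemma crossing_pairs':
  assumes "S \<inter> T = {}" "conn E S (ws ! a) (ws ! b)" "conn E T (ws ! c) (ws ! d)"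
    and "distinct [a, b, c, d]" "c < length ws" "d < length ws" "a < length ws" "b < length ws"
    and "(min a b < c \<and> c < max a b) \<noteq> (min a b < d \<and> d < max a b)"
  shows "crossing E ws"
proof (cases "a < b")
  case True
  then show ?thesis using assms by (intro crossing_pairs[of S T E ws a b c d]) auto
next
  case False
  then show ?thesis using assms conn_sym[OF assms(2)]
    by (intro crossing_pairs[of S T E ws b a c d]) (auto simp: min_def max_def)
qed

declare conn_trans [trans]

lemma finite_nbrs: "finite V \<Longrightarrow> E \<subseteq> Pow V \<Longrightarrow> finite (nbrs E C)"
  by (rule finite_subset[of _ V]) (auto simp: nbrs_def)

lemma nbrs_subset: "E \<subseteq> Pow V \<Longrightarrow> nbrs E C \<subseteq> V"
  by (auto simp: nbrs_def)

lemma conn_subset: "E \<subseteq> Pow V \<Longrightarrow> x \<in> V \<Longrightarrow> conn E S x y \<Longrightarrow> y \<in> V"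
  by (erule conn_induct) auto

lemma walk_appendD: "walk E (xs @ ys) \<Longrightarrow> walk E xs \<and> walk E ys"
  by (simp add: successively_append_iff)

lemma walk_mid: "walk E (xs @ x # ys) \<longleftrightarrow> walk E (xs @ [x]) \<and> walk E (x # ys)"
  by (cases ys) (auto simp: successively_append_iff)

lemma walk_rev: "walk E (rev p) = walk E p"
  by (simp add: successively_rev insert_commute)

lemma disjoint_if_meets_once: "A \<inter> B = {v} \<Longrightarrow> v \<notin> M \<Longrightarrow> M \<subseteq> B \<Longrightarrow> A \<inter> M = {}"
  by auto

text \<open>A theta graph with three disjoint exits has, by Menger, a fourth one. Whichever way the four
  exits are paired, the theta graph contains two disjoint links realising the pairing, and one of the
  three pairings crosses.\<close>

lemma theta_crossing:
  assumes V: "finite V" "E \<subseteq> Pow V" "set ws \<subseteq> V" "reduced V E (set ws)"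
    and UG: "U \<subseteq> V" "G \<subseteq> V" "connected_in E U" "connected_in E G" "U \<inter> G = {}"
    and str: "distinct [s, t, r]" "{s, t, r} \<inter> (U \<union> G) = {}" "{s, t, r} \<subseteq> V"
    and adj: "\<And>x. x \<in> {s, t, r} \<Longrightarrow> (\<exists>u\<in>U. {u, x} \<in> E) \<and> (\<exists>g\<in>G. {g, x} \<in> E)"
    and P: "finite P" "\<forall>p\<in>P. ab_path E (set ws) ({s, t, r} \<union> U \<union> G) p" "disjoint_paths P"
      "last ` P = {s, t, r}"
  shows "crossing E ws"
proof -
  let ?B = "{s, t, r} \<union> U \<union> G"
  have nilP: "[] \<notin> P" using P by (auto simp: ab_path_def)
  have cardP: "card P = 3"
    using card_image[OF disjoint_paths_last_inj[OF P(3) nilP]] P(4) str(1) by simp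
  have BV: "?B \<subseteq> V" using UG str by auto
  have "\<exists>p. ab_path E (set ws) ?B p \<and> set p \<inter> X = {}" if X: "finite X" "card X \<le> 3" for X
  proof -
    \<comment> \<open>Three vertices cannot cover the five vertices \<open>s\<close>,
      \<open>t\<close>, \<open>r\<close>, \<open>u\<close>, \<open>g\<close> of the theta graph;
      from an uncovered one \<open>reduced\<close> gives an escape to \<open>ws\<close>.\<close>
    obtain u g where ug: "u \<in> U" "g \<in> G" using adj[of s] by auto
    have "u \<notin> {s, t, r}" "g \<notin> {s, t, r}" "u \<noteq> g" using ug str(2) UG(5) by blast+
    then have "card {s, t, r, u, g} = 5" using str(1) by auto
    then have "\<not> {s, t, r, u, g} \<subseteq> X" using card_mono[OF X(1), of "{s, t, r, u, g}"] X(2) by auto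
    then obtain x where x: "x \<in> ?B" "x \<notin> X" using ug by auto
    let ?C = "{y. conn E (V - X) x y}"
    have "?C \<inter> set ws \<noteq> {}"
    proof
      assume "?C \<inter> set ws = {}"
      then have "?C \<subseteq> V - set ws" by (auto dest: conn_snd)
      moreover have "x \<in> ?C" using x BV by auto
      ultimately have "4 \<le> card (nbrs E ?C)"
        using V(4) component_connected[of E "V - X" x] unfolding reduced_def by (metis empty_iff)
      moreover have "nbrs E ?C \<subseteq> X"
        using component_nbrs[of E "V - X" x] nbrs_subset[OF V(2), of ?C] by blast
      ultimately show False using card_mono[OF X(1), of "nbrs E ?C"] X(2) by auto
    qed
    then obtain w where w: "w \<in> set ws" "conn E (V - X) x w" by auto
    from conn_path[OF conn_sym[OF w(2)]] obtain p where p: "simple_path_between E w p x" "set p \<subseteq> V - X" .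
    then have "\<exists>y\<in>set p. y \<in> ?B" using x by (auto simp: simple_path_between_def intro!: bexI[of _ x])
    then obtain p1 y p2 where p12: "p = p1 @ y # p2" "y \<in> ?B" "\<forall>v\<in>set p1. v \<notin> ?B"
      using split_list_first_prop[of p "\<lambda>y. y \<in> ?B"] by blast
    then have "ab_path E (set ws) ?B (p1 @ [y])"
      using p w walk_prefix[of E p1 y p2] by (cases p1) (auto simp: ab_path_def simple_path_between_def)
    then show ?thesis using p p12 by (intro exI[of _ "p1 @ [y]"]) auto
  qed
  with menger_augment[OF V(1) BV V(3,2) P(1-3)] cardP obtain Q where
    Q: "finite Q" "card Q = 4" "\<forall>p\<in>Q. ab_path E (set ws) ?B p" "disjoint_paths Q"
      "{s, t, r} \<subseteq> last ` Q" using P(4) by auto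
  have nilQ: "[] \<notin> Q" using Q by (auto simp: ab_path_def)
  have "card (last ` Q) = 4" using card_image[OF disjoint_paths_last_inj[OF Q(4) nilQ]] Q by simp
  then have "card (last ` Q - {s, t, r}) = 1"
    using Q(1,5) str(1) by (subst card_Diff_subset) auto
  \<comment> \<open>The three old exits are kept, so the fourth path ends at a single new vertex
    \<open>z\<close>, which lies in one of the two branch sets.\<close>
  then obtain z where z: "last ` Q - {s, t, r} = {z}" by (auto simp: card_1_singleton_iff)
  have "\<exists>q. q \<in> Q \<and> last q = x" if "x \<in> {s, t, r, z}" for x
  proof -
    have "x \<in> last ` Q" using that z Q(5) by blast
    then show ?thesis by auto
  qed
  then obtain f where f: "\<And>x. x \<in> {s, t, r, z} \<Longrightarrow> f x \<in> Q \<and> last (f x) = x" by metis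
  have zstr: "z \<notin> {s, t, r}" using z by blast
  have "\<exists>e<length ws. ws ! e = hd (f x)" if "x \<in> {s, t, r, z}" for x
  proof -
    have "hd (f x) \<in> set ws" using f[OF that] Q(3) by (auto simp: ab_path_def)
    then show ?thesis by (auto simp: in_set_conv_nth)
  qed
  then obtain e where e: "\<And>x. x \<in> {s, t, r, z} \<Longrightarrow> e x < length ws \<and> ws ! e x = hd (f x)" by metis
  have disj: "set (f x) \<inter> set (f y) = {}" if "x \<in> {s, t, r, z}" "y \<in> {s, t, r, z}" "x \<noteq> y" for x y
    using f[OF that(1)] f[OF that(2)] that(3) Q(4) unfolding disjoint_paths_def by metis
  have fne: "f x \<noteq> []" if "x \<in> {s, t, r, z}" for x using f[OF that] nilQ by auto
  have einj: "e x \<noteq> e y" if "x \<in> {s, t, r, z}" "y \<in> {s, t, r, z}" "x \<noteq> y" for x y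
    using disj[OF that] e[OF that(1)] e[OF that(2)] fne[OF that(1)] fne[OF that(2)]
    by (metis disjoint_iff hd_in_set)
  have fB: "set (f x) \<inter> ?B = {x}" if "x \<in> {s, t, r, z}" for x
  proof -
    have "f x = butlast (f x) @ [x]" using f[OF that] fne[OF that] by (metis append_butlast_last_id)
    then have "set (f x) = set (butlast (f x)) \<union> {x}" by (metis list.simps(15) list.set(1) set_append)
    then show ?thesis using Q(3) f[OF that] by (auto simp: ab_path_def)
  qed
  have fconn: "conn E (set (f x)) (hd (f x)) x" if "x \<in> {s, t, r, z}" for x
    using f[OF that] fne[OF that] Q(3) last_in_set[OF fne[OF that]]
    by (intro walk_conn) (auto simp: ab_path_def)
  have in4: "v \<in> {s, t, r, z}" if "v \<in> {s, t, r}" for v using that by auto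
  have zUG: "z \<in> U \<or> z \<in> G" using fB[of z] zstr by blast
  have pair: "\<exists>S T. S \<inter> T = {} \<and> conn E S (ws ! e x) (ws ! e y) \<and> conn E T (ws ! e c) (ws ! e z)"
    if xyc: "x \<in> {s, t, r}" "y \<in> {s, t, r}" "c \<in> {s, t, r}" "x \<noteq> y" "x \<noteq> c" "y \<noteq> c" for x y c
  proof -
    \<comment> \<open>\<open>U'\<close> is the branch set containing \<open>z\<close>: the link from
      \<open>c\<close> to \<open>z\<close> runs through it, and the link from \<open>x\<close> to
      \<open>y\<close> through the other one.\<close>
    obtain U' G' where U': "z \<in> U'" "U' \<inter> G' = {}" "connected_in E U'" "connected_in E G'"
      "U' \<union> G' \<subseteq> U \<union> G" "\<And>x. x \<in> {s, t, r} \<Longrightarrow> (\<exists>u\<in>U'. {u, x} \<in> E) \<and> (\<exists>g\<in>G'. {g, x} \<in> E)"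
    proof (cases "z \<in> U")
      case True
      then show ?thesis using that[of U G] UG adj by auto
    next
      case False
      then show ?thesis using that[of G U] UG adj zUG by auto
    qed
    let ?S = "set (f x) \<union> (G' \<union> set (f y))" and ?T = "set (f c) \<union> (U' \<union> set (f z))"
    have "?S \<inter> ?T = {}"
    proof -
      have "set (f x) \<inter> U' = {}" "set (f y) \<inter> U' = {}" "set (f c) \<inter> G' = {}" "set (f z) \<inter> G' = {}"
      proof -
        have *: "set (f v) \<inter> M = {}" if "v \<in> {s, t, r}" "M \<subseteq> U \<union> G" for v M
        proof -
          have "set (f v) \<inter> ?B = {v}" using that(1) by (intro fB) auto
          moreover have "v \<notin> M" "M \<subseteq> ?B" using that str(2) by auto
          ultimately show ?thesis by (rule disjoint_if_meets_once)
        qed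
        show "set (f x) \<inter> U' = {}" "set (f y) \<inter> U' = {}" "set (f c) \<inter> G' = {}"
          by (rule *[OF xyc(1)] *[OF xyc(2)] *[OF xyc(3)]; use U'(5) in blast)+
        have "set (f z) \<inter> ?B = {z}" by (rule fB) simp
        moreover have "z \<notin> G'" "G' \<subseteq> ?B" using U'(1,2,5) by auto
        ultimately show "set (f z) \<inter> G' = {}" by (rule disjoint_if_meets_once)
      qed
      moreover have "set (f x) \<inter> set (f c) = {}" "set (f x) \<inter> set (f z) = {}"
        "set (f y) \<inter> set (f c) = {}" "set (f y) \<inter> set (f z) = {}"
      proof -
        have nz: "x \<noteq> z" "y \<noteq> z" using xyc(1,2) zstr by metis+
        have m: "x \<in> {s, t, r, z}" "y \<in> {s, t, r, z}" "c \<in> {s, t, r, z}" "z \<in> {s, t, r, z}"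
          by (rule in4[OF xyc(1)] in4[OF xyc(2)] in4[OF xyc(3)] | simp)+
        show "set (f x) \<inter> set (f c) = {}" "set (f x) \<inter> set (f z) = {}"
          "set (f y) \<inter> set (f c) = {}" "set (f y) \<inter> set (f z) = {}"
          using disj[OF m(1,3)] disj[OF m(1,4)] disj[OF m(2,3)] disj[OF m(2,4)] nz xyc(5,6) by simp_all
      qed
      ultimately show ?thesis using U'(2) by blast
    qed
    moreover have "conn E ?S (ws ! e x) (ws ! e y)"
    proof -
      obtain g1 g2 where g: "g1 \<in> G'" "{g1, x} \<in> E" "g2 \<in> G'" "{g2, y} \<in> E" using U'(6)[OF xyc(1)] U'(6)[OF xyc(2)] by blast
      have m: "x \<in> {s, t, r, z}" "y \<in> {s, t, r, z}" by (rule in4[OF xyc(1)] in4[OF xyc(2)])+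
      have x: "x \<in> set (f x)" "y \<in> set (f y)" using conn_snd[OF fconn[OF m(1)]] conn_snd[OF fconn[OF m(2)]] .
      have "conn E ?S (hd (f x)) x" using fconn[OF m(1)] by (rule conn_mono') auto
      also have "conn E ?S x g1" using g x by (intro conn_edge) (auto simp: insert_commute)
      also have "conn E ?S g1 g2" by (rule conn_mono'[OF connected_in_conn[OF U'(4) g(1,3)]]) auto
      also have "conn E ?S g2 y" using g x by (intro conn_edge) auto
      also have "conn E ?S y (hd (f y))"
        using conn_sym[OF fconn[OF m(2)]] by (rule conn_mono') auto
      finally have "conn E ?S (hd (f x)) (hd (f y))" .
      then show ?thesis using e[OF m(1)] e[OF m(2)] by simp
    qed
    moreover have "conn E ?T (ws ! e c) (ws ! e z)"
    proof -
      obtain g1 where g: "g1 \<in> U'" "{g1, c} \<in> E" using U'(6)[OF xyc(3)] by blast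
      have m: "c \<in> {s, t, r, z}" "z \<in> {s, t, r, z}" by (rule in4[OF xyc(3)] | simp)+
      have x: "c \<in> set (f c)" using conn_snd[OF fconn[OF m(1)]] .
      have "conn E ?T (hd (f c)) c" using fconn[OF m(1)] by (rule conn_mono') auto
      also have "conn E ?T c g1" using g x by (intro conn_edge) (auto simp: insert_commute)
      also have "conn E ?T g1 z" by (rule conn_mono'[OF connected_in_conn[OF U'(3) g(1) U'(1)]]) auto
      also have "conn E ?T z (hd (f z))"
        using conn_sym[OF fconn[OF m(2)]] by (rule conn_mono') auto
      finally have "conn E ?T (hd (f c)) (hd (f z))" .
      then show ?thesis using e[OF m(1)] e[OF m(2)] by simp
    qed
    ultimately show ?thesis by blast
  qed
  have pair': "crossing E ws"
    if xyc: "x \<in> {s, t, r}" "y \<in> {s, t, r}" "c \<in> {s, t, r}" "x \<noteq> y" "x \<noteq> c" "y \<noteq> c"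
      and "(min (e x) (e y) < e c \<and> e c < max (e x) (e y)) \<noteq> (min (e x) (e y) < e z \<and> e z < max (e x) (e y))"
    for x y c
  proof -
    obtain S T where "S \<inter> T = {}" "conn E S (ws ! e x) (ws ! e y)" "conn E T (ws ! e c) (ws ! e z)"
      using pair[OF xyc] by blast
    moreover have m: "x \<in> {s, t, r, z}" "y \<in> {s, t, r, z}" "c \<in> {s, t, r, z}" "z \<in> {s, t, r, z}"
      by (rule in4[OF xyc(1)] in4[OF xyc(2)] in4[OF xyc(3)] | simp)+
    moreover have "x \<noteq> z" "y \<noteq> z" "c \<noteq> z" using xyc(1-3) zstr by metis+
    then have "distinct [e x, e y, e c, e z]"
      using einj[OF m(1,2)] einj[OF m(1,3)] einj[OF m(1,4)] einj[OF m(2,3)] einj[OF m(2,4)] einj[OF m(3,4)] xyc(4-6) by simp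
    ultimately show ?thesis using that(7) e by (intro crossing_pairs'[of S T E ws "e x" "e y" "e c" "e z"]) auto
  qed
  have st: "s \<noteq> t" "s \<noteq> r" "t \<noteq> r" using str by auto
  have "e s \<noteq> e t" "e s \<noteq> e r" "e t \<noteq> e r" "e s \<noteq> e z" "e t \<noteq> e z" "e r \<noteq> e z"
    using einj[of s t] einj[of s r] einj[of t r] einj[of s z] einj[of t z] einj[of r z] st zstr by auto
  \<comment> \<open>Of the three ways to split four distinct positions into two pairs, one always
    interleaves.\<close>
  then have "(min (e s) (e t) < e r \<and> e r < max (e s) (e t)) \<noteq> (min (e s) (e t) < e z \<and> e z < max (e s) (e t)) \<or>
    (min (e s) (e r) < e t \<and> e t < max (e s) (e r)) \<noteq> (min (e s) (e r) < e z \<and> e z < max (e s) (e r)) \<or>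
    (min (e t) (e r) < e s \<and> e s < max (e t) (e r)) \<noteq> (min (e t) (e r) < e z \<and> e z < max (e t) (e r))"
    unfolding min_def max_def by presburger
  then show ?thesis using pair'[of s t r] pair'[of s r t] pair'[of t r s] st by blast
qed

lemma simple_path_ends: "simple_path_between E x p y \<Longrightarrow> x \<in> set p \<and> y \<in> set p"
  unfolding simple_path_between_def by (metis hd_in_set last_in_set)

lemma connected_in_append:
  assumes "walk E (xs @ [x])" "walk E (x # ys)"
  shows "connected_in E (insert x (set xs \<union> set ys))"
proof -
  have "walk E (xs @ x # ys)" using assms walk_mid[of E xs x ys] by blast
  from walk_connected[OF this] show ?thesis by simp
qed

text \<open>Among the paths from \<open>ws\<close> to its last vertex \<open>a\<close>, choose one that leaves as many vertices as
  possible connected to later vertices of \<open>ws\<close>; the last vertex before \<open>a\<close> can be inserted.\<close>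

lemma insert_after_last:
  assumes V: "finite V" "E \<subseteq> Pow V" "distinct ws" "set ws \<subseteq> V"
    and red: "reduced V E (set ws)" and ncr: "\<not> crossing E ws"
    and a: "ws = ws' @ [a]" "nbrs E {a} \<noteq> {}" "nbrs E {a} \<inter> set ws = {}"
  shows "\<exists>u. u \<in> V - set ws \<and> {a, u} \<in> E \<and> \<not> crossing E (ws @ [u])"
proof -
  define n where "n = length ws'"
  have lws: "length ws = Suc n" using a by (simp add: n_def)
  have wsn: "ws ! n = a" using a by (simp add: n_def)
  have aV: "a \<in> V" using a V by auto
  have Wlt: "\<exists>k<n. ws ! k = w" if w: "w \<in> set ws" "w \<noteq> a" for w
  proof -
    obtain k where "k < length ws" "ws ! k = w" using w(1) by (auto simp: in_set_conv_nth)
    then show ?thesis using w wsn lws by (intro exI[of _ k]) (auto simp: less_Suc_eq)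
  qed
  define is_Q where "is_Q i Q \<longleftrightarrow> i < n \<and> simple_path_between E (ws ! i) Q a" for i Q
  \<comment> \<open>\<open>F i Q\<close> collects what a path \<open>Q\<close> from position
    \<open>i\<close> to \<open>a\<close> leaves connected, off \<open>Q\<close>, to marked vertices
    after \<open>i\<close> and before \<open>a\<close>. The measure adds \<open>n - i\<close>, so
    that an earlier start wins whenever \<open>F\<close> does not shrink.\<close>
  define F where "F i Q = {x \<in> V. x \<notin> set Q \<and> (\<exists>k. i < k \<and> k < n \<and> conn E (- set Q) x (ws ! k))}" for i Q
  define \<mu> where "\<mu> = (\<lambda>(i, Q). card (F i Q) + (n - i))"
  have finF: "finite (F i Q)" for i Q using V by (auto simp: F_def)
  \<comment> \<open>The component, off \<open>ws\<close>, of a neighbour of \<open>a\<close> has at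
    least four neighbours, hence one in \<open>ws\<close> other than \<open>a\<close>; this yields a
    path.\<close>
  have ex_Q: "\<exists>i Q. is_Q i Q"
  proof -
    obtain u0 where u0: "u0 \<in> nbrs E {a}" using a by auto
    then have u0V: "u0 \<in> V - set ws" using nbrs_subset[OF V(2)] a(3) by auto
    let ?C = "{y. conn E (V - set ws) u0 y}"
    have "?C \<subseteq> V - set ws" "u0 \<in> ?C" using u0V by (auto dest: conn_snd)
    then have c4: "4 \<le> card (nbrs E ?C)"
      using red component_connected[of E "V - set ws" u0] unfolding reduced_def by (metis empty_iff)
    then have "\<not> nbrs E ?C \<subseteq> {a}" using card_mono[of "{a}" "nbrs E ?C"] by auto
    then obtain w where w: "w \<in> nbrs E ?C" "w \<noteq> a" by auto
    then have "w \<in> set ws" using nbrs_subset[OF V(2)] component_nbrs[of E "V - set ws" u0] by blast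
    then obtain i where i: "i < n" "ws ! i = w" using Wlt w by auto
    obtain c where c: "conn E (V - set ws) u0 c" "{c, w} \<in> E" using w by (auto simp: nbrs_def)
    have "conn E V u0 w" using conn_step[OF conn_mono'[OF c(1)] c(2), of V] V(4) \<open>w \<in> set ws\<close> by blast
    moreover have "conn E V a u0" using u0 u0V aV by (intro conn_edge) (auto simp: nbrs_def)
    ultimately have "conn E V w a" using conn_sym[OF conn_trans[of E V a u0 w]] by simp
    then obtain Q where "simple_path_between E w Q a" by (rule conn_path)
    then show ?thesis using i by (auto simp: is_Q_def)
  qed
  obtain i0 Q0 where Q0: "is_Q i0 Q0" using ex_Q by blast
  have "\<exists>p. (case p of (i, Q) \<Rightarrow> is_Q i Q) \<and> (\<forall>p'. (case p' of (i, Q) \<Rightarrow> is_Q i Q) \<longrightarrow> \<mu> p' \<le> \<mu> p)"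
  proof (rule ex_has_greatest_nat)
    show "case (i0, Q0) of (i, Q) \<Rightarrow> is_Q i Q" using Q0 by simp
    show "\<forall>p. (case p of (i, Q) \<Rightarrow> is_Q i Q) \<longrightarrow> \<mu> p < Suc (card V + n)"
    proof (intro allI impI)
      fix p :: "nat \<times> 'a list"
      have "card (F (fst p) (snd p)) \<le> card V" using V by (intro card_mono) (auto simp: F_def)
      then show "\<mu> p < Suc (card V + n)" by (auto simp: \<mu>_def split: prod.splits)
    qed
  qed
  then obtain i Q where Q: "is_Q i Q" and max: "\<And>e Q'. is_Q e Q' \<Longrightarrow> \<mu> (e, Q') \<le> \<mu> (i, Q)" by auto
  have i: "i < n" and spQ: "simple_path_between E (ws ! i) Q a" using Q by (auto simp: is_Q_def)
  have Qp: "Q \<noteq> []" "hd Q = ws ! i" "last Q = a" "distinct Q" "walk E Q"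
    using spQ by (auto simp: simple_path_between_def)
  have aQ: "a \<in> set Q" using Qp by (metis last_in_set)
  have Fconn: "\<exists>k. i < k \<and> k < n \<and> conn E (F i Q) x (ws ! k)" if x: "x \<in> F i Q" for x
  proof -
    obtain k where k: "i < k" "k < n" "conn E (- set Q) x (ws ! k)" using x by (auto simp: F_def)
    let ?C = "{y. conn E (- set Q) x y}"
    have "?C \<subseteq> F i Q"
    proof
      fix y assume "y \<in> ?C"
      then have y: "conn E (- set Q) x y" by simp
      have "y \<in> V" using conn_subset[OF V(2) _ y] x by (auto simp: F_def)
      moreover have "y \<notin> set Q" using y by (auto dest: conn_snd)
      moreover have "conn E (- set Q) y (ws ! k)" using conn_trans[OF conn_sym[OF y] k(3)] .
      ultimately show "y \<in> F i Q" using k by (auto simp: F_def)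
    qed
    moreover have "conn E ?C x (ws ! k)"
      using k conn_refl[OF conn_fst[OF k(3)]] by (intro connected_in_conn[OF component_connected]) auto
    ultimately have "conn E (F i Q) x (ws ! k)" using conn_mono' by metis
    then show ?thesis using k by blast
  qed
  \<comment> \<open>Rerouting \<open>Q\<close> off \<open>F i Q\<close> loses nothing, because the
    connections witnessing membership stay inside \<open>F i Q\<close>.\<close>
  have Fmono: "F i Q \<subseteq> F e Q'" if "e \<le> i" "set Q' \<inter> F i Q = {}" for e Q'
  proof
    fix x assume x: "x \<in> F i Q"
    obtain k where k: "i < k" "k < n" "conn E (F i Q) x (ws ! k)" using Fconn[OF x] by blast
    have "F i Q \<subseteq> - set Q'" using that(2) by blast
    with k(3) have "conn E (- set Q') x (ws ! k)" by (rule conn_mono')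
    then show "x \<in> F e Q'" using x k that by (auto simp: F_def)
  qed
  have FQ: "F i Q \<inter> set Q = {}" by (auto simp: F_def)
  \<comment> \<open>A path to \<open>a\<close> from an earlier marked vertex could be spliced into
    \<open>Q\<close> at its first meeting point. Before that point it cannot meet
    \<open>F i Q\<close>, since this would link \<open>e\<close> to some \<open>k\<close> off
    \<open>Q\<close> and cross \<open>Q\<close>; so the splice would have larger measure.\<close>
  have M1: "\<not> conn E S (ws ! e) a" if e: "e < i" for e S
  proof
    assume "conn E S (ws ! e) a"
    then obtain T' where T': "simple_path_between E (ws ! e) T' a" by (rule conn_path)
    then have "\<exists>y\<in>set T'. y \<in> set Q" using aQ by (auto simp: simple_path_between_def intro!: bexI[of _ a])
    then obtain T d T2 where T: "T' = T @ d # T2" "d \<in> set Q" "\<forall>y\<in>set T. y \<notin> set Q"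
      using split_list_first_prop[of T' "\<lambda>y. y \<in> set Q"] by blast
    obtain Qa Qb where Qab: "Q = Qa @ d # Qb" using T(2) by (meson split_list)
    have wT: "walk E (T @ [d])" using T' T(1) walk_prefix[of E T d T2] by (simp add: simple_path_between_def)
    have hT: "hd (T @ [d]) = ws ! e" using T' T(1) by (cases T) (auto simp: simple_path_between_def)
    let ?Q = "T @ d # Qb"
    have "walk E ?Q" using wT Qp(5) Qab walk_mid[of E Qa d Qb] walk_mid[of E T d Qb] by simp
    moreover have "distinct ?Q" using T' T Qp(4) Qab by (auto simp: simple_path_between_def)
    ultimately have "is_Q e ?Q" using hT e i Qp(3) Qab
      by (cases T) (auto simp: is_Q_def simple_path_between_def)
    then have "\<mu> (e, ?Q) \<le> \<mu> (i, Q)" by (rule max)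
    moreover have "set T \<inter> F i Q = {}"
    proof (rule ccontr)
      assume "set T \<inter> F i Q \<noteq> {}"
      then obtain y where y: "y \<in> set T" "y \<in> F i Q" by auto
      obtain k where k: "i < k" "k < n" "conn E (F i Q) y (ws ! k)" using Fconn[OF y(2)] by blast
      have "walk E T" using walk_appendD[OF wT] by simp
      moreover have "hd T = ws ! e" using hT y by (cases T) auto
      from this have "ws ! e \<in> set T" using y by (cases T) auto
      ultimately have "conn E (set T) (ws ! e) y" using y by (intro walk_conn) auto
      from conn_union[OF this k(3)] have "conn E (set T \<union> F i Q) (ws ! e) (ws ! k)" .
      moreover have "(set T \<union> F i Q) \<inter> set Q = {}" using T(3) FQ by auto
      ultimately have "crossing E ws"
        using crossingI[of e i k n ws "set T \<union> F i Q" "set Q" E] e k lws path_conn[OF spQ] wsn by auto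
      then show False using ncr by simp
    qed
    then have "F i Q \<subseteq> F e ?Q" using e FQ Qab by (intro Fmono) auto
    then have "card (F i Q) \<le> card (F e ?Q)" by (intro card_mono finF)
    ultimately show False using e i by (auto simp: \<mu>_def)
  qed
  have ai: "a \<noteq> ws ! i" using V(3) i lws wsn by (metis less_SucI less_irrefl nth_eq_iff_index_eq lessI)
  obtain Qs u where Qsu: "Q = Qs @ [u, a]"
  proof -
    have "Q = butlast Q @ [a]" using Qp by (metis append_butlast_last_id)
    moreover have "butlast Q \<noteq> []" using calculation Qp ai by (metis append_Nil list.sel(1))
    ultimately have "Q = butlast (butlast Q) @ [last (butlast Q), a]"
      by (metis append.assoc append_butlast_last_id append_Cons append_Nil)
    then show ?thesis using that by blast
  qed
  have ua: "{u, a} \<in> E" using Qp(5) Qsu by (auto simp: successively_append_iff)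
  have uV: "u \<in> V" using ua V by auto
  have uW: "u \<notin> set ws" using ua a(3) Qp(4) Qsu by (auto simp: nbrs_def insert_commute)
  have "\<not> crossing E (ws @ [u])"
  proof
    assume "crossing E (ws @ [u])"
    then obtain S1 S2 i' k' j' l' where C: "i' < k'" "k' < j'" "j' < l'" "l' < length (ws @ [u])" "S1 \<inter> S2 = {}"
        "conn E S1 ((ws @ [u]) ! i') ((ws @ [u]) ! j')" "conn E S2 ((ws @ [u]) ! k') ((ws @ [u]) ! l')"
      unfolding crossing_def by blast
    have l': "l' = Suc n"
    proof (rule ccontr)
      assume "l' \<noteq> Suc n"
      then have "crossing E ws" using C lws
        by (intro crossingI[of i' k' j' l' ws S1 S2]) (auto simp: nth_append)
      then show False using ncr by simp
    qed
    have S1: "conn E S1 (ws ! i') (ws ! j')" and S2: "conn E S2 (ws ! k') u" and j': "j' \<le> n"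
      using C l' lws by (auto simp: nth_append split: if_splits)
    obtain P' where P': "simple_path_between E (ws ! i') P' (ws ! j')" "set P' \<subseteq> S1" using conn_path[OF S1] .
    \<comment> \<open>Otherwise the link to \<open>u\<close> could be prolonged to \<open>a\<close>
      along the edge \<open>ua\<close>, giving a crossing that uses only \<open>ws\<close>.\<close>
    have aP: "a \<in> set P'"
    proof (rule ccontr)
      assume aP: "a \<notin> set P'"
      then have "j' \<noteq> n" using simple_path_ends[OF P'(1)] wsn by auto
      moreover have "conn E (insert a S2) (ws ! k') a"
        using conn_step[OF conn_mono'[OF S2] ua, of "insert a S2"] by blast
      ultimately have "crossing E ws" using C j' lws aP P' path_conn[OF P'(1)] wsn
        by (intro crossingI[of i' k' j' n ws "set P'" "insert a S2"]) auto
      then show False using ncr by simp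
    qed
    then obtain Pa Pb where Pab: "P' = Pa @ a # Pb" by (meson split_list)
    define Q' where "Q' = Pa @ [a]"
    have Q': "walk E Q'" "distinct Q'" "hd Q' = ws ! i'" "last Q' = a" "set Q' \<inter> S2 = {}" "Q' \<noteq> []"
      using P' Pab walk_prefix[of E Pa a Pb] C(5)
      by (cases Pa; auto simp: Q'_def simple_path_between_def)+
    have k'n: "k' < n" using C j' by simp
    have Q'conn: "conn E (set Q') x y" if "x \<in> set Q'" "y \<in> set Q'" for x y
      using Q'(1) that by (rule walk_conn)
    have Q'hd: "ws ! i' \<in> set Q'" "a \<in> set Q'" using Q' by (metis hd_in_set last_in_set)+
    have ii': "i \<le> i'" using M1[of i'] Q'conn[OF Q'hd] by force
    obtain R where R: "simple_path_between E (ws ! k') R u" "set R \<subseteq> S2" using conn_path[OF S2] .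
    have uQ: "u \<in> set Q" using Qsu by simp
    have "\<exists>y\<in>set R. y \<in> set Q" using R uQ by (auto simp: simple_path_between_def intro!: bexI[of _ u])
    then obtain Rz z Rt where Rz: "R = Rz @ z # Rt" "z \<in> set Q" "\<forall>y\<in>set Rz. y \<notin> set Q"
      using split_list_first_prop[of R "\<lambda>y. y \<in> set Q"] by blast
    define R' where "R' = Rz @ [z]"
    have R': "walk E R'" "distinct R'" "hd R' = ws ! k'" "set R' \<subseteq> S2" "set R' \<inter> set Q = {z}"
      using R Rz walk_prefix[of E Rz z Rt]
      by (cases Rz; auto simp: R'_def simple_path_between_def)+
    have R'conn: "conn E (set R') x y" if "x \<in> set R'" "y \<in> set R'" for x y
      using R'(1) that by (rule walk_conn)
    have R'hd: "ws ! k' \<in> set R'" "z \<in> set R'" using R' by (metis R'_def hd_in_set snoc_eq_iff_butlast) (simp add: R'_def)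
    have RQ': "set R' \<inter> set Q' = {}" using R'(4) Q'(5) by auto
    have za: "z \<noteq> a" using R'hd Q'hd RQ' by auto
    obtain Q1 Q2 where Q12: "Q = Q1 @ z # Q2" using Rz(2) by (meson split_list)
    have aQ2: "a \<in> set Q2" using Qp(3) Q12 za by (cases Q2 rule: rev_cases) auto
    have wQ1: "walk E (Q1 @ [z])" and wQ2: "walk E (z # Q2)" using Qp(5) Q12 walk_mid[of E Q1 z Q2] by auto
    have hQ1: "hd (Q1 @ [z]) = ws ! i" using Qp(2) Q12 by (cases Q1) auto
    \<comment> \<open>If \<open>Q'\<close> missed \<open>Q1\<close>, then \<open>Q1\<close> and
      \<open>R'\<close> would link \<open>i\<close> to \<open>k'\<close> while \<open>Q'\<close>
      links \<open>i'\<close> to \<open>a\<close>, and these cross.\<close>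
    have "\<exists>y\<in>set Q'. y \<in> set Q1"
    proof (rule ccontr)
      assume no: "\<not> (\<exists>y\<in>set Q'. y \<in> set Q1)"
      have "ws ! i \<in> set (Q1 @ [z])" using hQ1 by (cases Q1) auto
      then have "conn E (set (Q1 @ [z])) (ws ! i) z" using wQ1 by (intro walk_conn) auto
      from conn_union[OF this R'conn[OF R'hd(2,1)]]
      have c1: "conn E (set (Q1 @ [z]) \<union> set R') (ws ! i) (ws ! k')" .
      have d1: "(set (Q1 @ [z]) \<union> set R') \<inter> set Q' = {}" using no RQ' R'hd by auto
      have "ws ! i \<notin> set Q'" using d1 conn_fst[OF c1] by blast
      then have "i \<noteq> i'" using Q'hd by auto
      then have "crossing E ws"
        using ii' C k'n lws d1 c1 Q'conn[OF Q'hd] wsn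
        by (intro crossingI[of i i' k' n ws "set (Q1 @ [z]) \<union> set R'" "set Q'"]) auto
      then show False using ncr by simp
    qed
    \<comment> \<open>The stretch \<open>S0\<close> of \<open>Q'\<close> from its last vertex
      \<open>s\<close> on \<open>Q1\<close> to the next vertex \<open>t\<close> on \<open>Q2\<close>
      is a detour around \<open>z\<close>.\<close>
    then obtain A s B where AB: "Q' = A @ s # B" "s \<in> set Q1" "\<forall>y\<in>set B. y \<notin> set Q1"
      using split_list_last_prop[of Q' "\<lambda>y. y \<in> set Q1"] by blast
    have "a \<noteq> s" using AB aQ2 Qp(4) Q12 by auto
    then have "a \<in> set B" using AB Q'(4) by (cases B rule: rev_cases) auto
    then have "\<exists>y\<in>set B. y \<in> set Q2" using aQ2 by auto
    then obtain S0 t B2 where S0: "B = S0 @ t # B2" "t \<in> set Q2" "\<forall>y\<in>set S0. y \<notin> set Q2"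
      using split_list_first_prop[of B "\<lambda>y. y \<in> set Q2"] by blast
    have zQ': "z \<notin> set Q'" using R'hd RQ' by auto
    have S0Q: "set S0 \<inter> set Q = {}" using S0 AB zQ' Q12 by auto
    have S0Q': "set S0 \<subseteq> set Q'" "distinct (s # S0 @ [t])" "s \<in> set Q'" "t \<in> set Q'" using AB S0 Q'(2) by auto
    have S0R: "set S0 \<inter> set R' = {}" using S0Q' RQ' by auto
    have wS: "walk E (s # S0 @ [t])"
      using Q'(1) AB(1) S0(1) walk_mid[of E A s B] walk_prefix[of E "s # S0" t B2] by simp
    obtain Q11 Q12' where Q1s: "Q1 = Q11 @ s # Q12'" using AB(2) by (meson split_list)
    obtain Q21 Q22 where Q2t: "Q2 = Q21 @ t # Q22" using S0(2) by (meson split_list)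
    have Qfull: "Q = Q11 @ s # Q12' @ z # Q21 @ t # Q22" using Q12 Q1s Q2t by simp
    have wQ: "walk E (Q11 @ [s])" "walk E (s # Q12' @ [z])" "walk E (z # Q21 @ [t])" "walk E (t # Q22)"
    proof -
      have *: "walk E (Q11 @ [s])" "walk E (s # Q12' @ z # Q21 @ t # Q22)"
        using Qp(5) Qfull walk_mid[of E Q11 s "Q12' @ z # Q21 @ t # Q22"] by auto
      then have "walk E (s # Q12' @ [z])" "walk E (z # Q21 @ t # Q22)"
        using walk_mid[of E "s # Q12'" z "Q21 @ t # Q22"] by auto
      then show "walk E (Q11 @ [s])" "walk E (s # Q12' @ [z])" "walk E (z # Q21 @ [t])" "walk E (t # Q22)"
        using * walk_mid[of E "z # Q21" t Q22] by auto
    qed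
    have dQ: "distinct (Q11 @ s # Q12' @ z # Q21 @ t # Q22)" using Qp(4) Qfull by simp
    have hdQ11: "hd (Q11 @ [s]) = ws ! i" using Qp(2) Qfull by (cases Q11) auto
    have laQ22: "last (t # Q22) = a" using Qp(3) Qfull by (cases Q22 rule: rev_cases) auto
    \<comment> \<open>A detour off \<open>F i Q\<close> would contradict the choice of
      \<open>Q\<close>: the rerouted path keeps all of \<open>F i Q\<close> and in addition frees
      \<open>z\<close>, which \<open>R'\<close> joins to \<open>k'\<close>.\<close>
    have "set S0 \<inter> F i Q \<noteq> {}"
    proof
      assume S0F: "set S0 \<inter> F i Q = {}"
      let ?Q = "Q11 @ s # S0 @ t # Q22"
      have "walk E ?Q"
        using wQ(1,4) wS walk_mid[of E Q11 s "S0 @ t # Q22"] walk_mid[of E "s # S0" t Q22] by simp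
      moreover have "distinct ?Q" using dQ S0Q S0Q' Qfull by auto
      ultimately have "is_Q i ?Q" using i hdQ11 laQ22
        by (cases Q11) (auto simp: is_Q_def simple_path_between_def)
      then have "\<mu> (i, ?Q) \<le> \<mu> (i, Q)" by (rule max)
      moreover have sub: "F i Q \<subseteq> F i ?Q" using S0F FQ Qfull by (intro Fmono) auto
      moreover have "z \<in> F i ?Q"
      proof -
        have zn: "z \<notin> set ?Q" using dQ S0Q' zQ' by auto
        have "set R' \<inter> set ?Q = {}" using R'(5) zn S0R Qfull by auto
        then have "conn E (- set ?Q) z (ws ! k')"
          using R'conn[OF R'hd(2,1)] by (rule_tac conn_mono'[of _ "set R'"]) auto
        moreover have "z \<in> V"
        proof -
          have "ws ! k' \<in> V" using V(4) k'n lws by auto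
          then show ?thesis using conn_subset[OF V(2) _ R'conn[OF R'hd]] by simp
        qed
        ultimately show ?thesis using zn ii' C k'n unfolding F_def by (auto intro!: exI[of _ k'])
      qed
      moreover have "z \<notin> F i Q" using Rz(2) by (auto simp: F_def)
      ultimately have "card (F i Q) < card (F i ?Q)" by (intro psubset_card_mono finF) auto
      then show False using \<open>\<mu> (i, ?Q) \<le> \<mu> (i, Q)\<close> by (simp add: \<mu>_def)
    qed
    then obtain \<sigma>0 where \<sigma>0: "\<sigma>0 \<in> set S0" "\<sigma>0 \<in> F i Q" by auto
    obtain m where m: "i < m" "m < n" "conn E (F i Q) \<sigma>0 (ws ! m)" using Fconn[OF \<sigma>0(2)] by blast
    obtain Y where Y: "simple_path_between E (ws ! m) Y \<sigma>0" "set Y \<subseteq> F i Q" using conn_path[OF conn_sym[OF m(3)]] .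
    have "\<exists>y\<in>set Y. y \<in> set S0" using Y \<sigma>0 by (auto simp: simple_path_between_def intro!: bexI[of _ \<sigma>0])
    then obtain Ya \<sigma> Yt where Ya: "Y = Ya @ \<sigma> # Yt" "\<sigma> \<in> set S0" "\<forall>y\<in>set Ya. y \<notin> set S0"
      using split_list_first_prop[of Y "\<lambda>y. y \<in> set S0"] by blast
    have wY: "walk E (Ya @ [\<sigma>])" "hd (Ya @ [\<sigma>]) = ws ! m" "distinct (Ya @ [\<sigma>])"
      using Y Ya walk_prefix[of E Ya \<sigma> Yt] by (cases Ya; auto simp: simple_path_between_def)+
    have YQ: "set (Ya @ [\<sigma>]) \<inter> set Q = {}" using Y(2) Ya(1) FQ by auto
    obtain Sa Sb where Sab: "S0 = Sa @ \<sigma> # Sb" using Ya(2) by (meson split_list)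
    have wSab: "walk E (s # Sa @ [\<sigma>])" "walk E (\<sigma> # Sb @ [t])"
      using wS Sab walk_mid[of E "s # Sa" \<sigma> "Sb @ [t]"] by auto
    have sQ: "s \<in> set Q" "t \<in> set Q" using Qfull by auto
    have stR: "s \<notin> set R'" "t \<notin> set R'" using S0Q' RQ' by auto
    have \<sigma>R: "\<sigma> \<notin> set R'" using Ya(2) S0R by auto
    show False
    \<comment> \<open>If the path \<open>Ya\<close> from position \<open>m\<close> to the detour
      misses \<open>R'\<close>, two disjoint links made of parts of \<open>Q\<close> and of the
      detour already cross. Otherwise the last vertex \<open>r\<close> of \<open>Ya\<close> on
      \<open>R'\<close> completes a theta graph with ends \<open>s\<close>, \<open>t\<close>,
      \<open>r\<close>, one branch set around \<open>z\<close> and the other around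
      \<open>\<sigma>\<close>.\<close>
    proof (cases "set Ya \<inter> set R' = {}")
      case True
      have YR: "set (Ya @ [\<sigma>]) \<inter> set R' = {}" using True \<sigma>R by auto
      have wm: "ws ! m \<in> set (Ya @ [\<sigma>])" using wY(2) by (metis hd_in_set snoc_eq_iff_butlast)
      have mk: "m \<noteq> k'" using YR wm R'hd by auto
      have "ws ! i \<in> set (Q11 @ [s])" using hdQ11 by (cases Q11) auto
      then have c1: "conn E (set (Q11 @ [s])) (ws ! i) s" using wQ(1) by (intro walk_conn) auto
      have c2: "conn E (set (s # Q12' @ [z])) s z" using wQ(2) by (intro walk_conn) auto
      have c3: "conn E (set (z # Q21 @ [t])) z t" using wQ(3) by (intro walk_conn) auto
      have "a \<in> set (t # Q22)" using laQ22 last_in_set[of "t # Q22"] by auto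
      then have c4: "conn E (set (t # Q22)) t a" using wQ(4) by (intro walk_conn) auto
      have c5: "conn E (set (s # Sa @ [\<sigma>])) s \<sigma>" using wSab(1) by (intro walk_conn) auto
      have c6: "conn E (set (\<sigma> # Sb @ [t])) \<sigma> t" using wSab(2) by (intro walk_conn) auto
      have cY: "conn E (set (Ya @ [\<sigma>])) (ws ! m) \<sigma>" using wY wm by (intro walk_conn) auto
      show False
      proof (cases "m < k'")
        case True
        let ?A = "set (Ya @ [\<sigma>]) \<union> (set (\<sigma> # Sb @ [t]) \<union> set (t # Q22))"
        let ?B = "set (Q11 @ [s]) \<union> (set (s # Q12' @ [z]) \<union> set R')"
        have "conn E ?A (ws ! m) a"
          by (rule conn_union[OF cY conn_union[OF c6 c4]])
        moreover have "conn E ?B (ws ! i) (ws ! k')"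
          by (rule conn_union[OF c1 conn_union[OF c2 R'conn[OF R'hd(2,1)]]])
        moreover have "?B \<inter> ?A = {}"
          using dQ YR YQ S0R S0Q RQ' R'(5) stR Qfull Sab S0Q' zQ' by auto
        ultimately have "crossing E ws" using m True k'n lws wsn
          by (intro crossingI[of i m k' n ws ?B ?A]) auto
        then show False using ncr by simp
      next
        case False
        let ?A = "set (Q11 @ [s]) \<union> (set (s # Sa @ [\<sigma>]) \<union> set (Ya @ [\<sigma>]))"
        let ?B = "set R' \<union> (set (z # Q21 @ [t]) \<union> set (t # Q22))"
        have "conn E ?A (ws ! i) (ws ! m)"
          by (rule conn_union[OF c1 conn_union[OF c5 conn_sym[OF cY]]])
        moreover have "conn E ?B (ws ! k') a"
          by (rule conn_union[OF R'conn[OF R'hd] conn_union[OF c3 c4]])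
        moreover have "?A \<inter> ?B = {}"
          using dQ YR YQ S0R S0Q RQ' R'(5) stR Qfull Sab S0Q' zQ' by auto
        ultimately have "crossing E ws" using m False mk ii' C k'n lws wsn
          by (intro crossingI[of i k' m n ws ?A ?B]) auto
        then show False using ncr by simp
      qed
    next
      case False
      then have "\<exists>y\<in>set Ya. y \<in> set R'" by auto
      then obtain Y1 r Y2 where Yr: "Ya = Y1 @ r # Y2" "r \<in> set R'" "\<forall>y\<in>set Y2. y \<notin> set R'"
        using split_list_last_prop[of Ya "\<lambda>y. y \<in> set R'"] by blast
      have rQ: "r \<notin> set Q" using YQ Yr by auto
      then have "r \<in> set Rz" using Yr(2) Rz(2) by (auto simp: R'_def)
      then obtain R2 R1 where R12: "Rz = R2 @ r # R1" by (meson split_list)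
      have wR: "walk E (R2 @ [r])" "walk E (r # R1 @ [z])"
        using R'(1) R12 walk_mid[of E R2 r "R1 @ [z]"] by (auto simp: R'_def)
      have wY2: "walk E (r # Y2 @ [\<sigma>])"
        using wY(1) Yr(1) walk_mid[of E Y1 r "Y2 @ [\<sigma>]"] by auto
      let ?U = "insert z (set Q12' \<union> set Q21) \<union> set (R1 @ [z])"
      let ?G = "set S0 \<union> set (Y2 @ [\<sigma>])"
      let ?\<Theta> = "{s, t, r} \<union> ?U \<union> ?G"
      \<comment> \<open>The three exits of the theta graph lead to the marked positions
        \<open>i\<close>, \<open>n\<close> and \<open>k'\<close>.\<close>
      let ?P = "{Q11 @ [s], rev (t # Q22), R2 @ [r]}"
      have dR: "distinct (R2 @ r # R1 @ [z])" using R'(2) R12 by (simp add: R'_def)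
      have R'Q: "set (R2 @ r # R1) \<inter> set Q = {}" using Rz(3) R12 by auto
      have R'eq: "set R' = set (R2 @ r # R1 @ [z])" using R12 by (auto simp: R'_def)
      have "connected_in E ?U"
      proof (rule connected_in_Un)
        show "connected_in E (insert z (set Q12' \<union> set Q21))"
          using wQ(2,3) walk_appendD[of E "z # Q21" "[t]"] by (intro connected_in_append) (auto simp: successively_Cons split: list.splits)
        show "connected_in E (set (R1 @ [z]))"
          using wR(2) by (intro walk_connected) (auto simp: successively_Cons split: list.splits)
      qed auto
      moreover have "connected_in E ?G"
      proof (rule connected_in_Un)
        show "connected_in E (set S0)" 
          using wS walk_appendD[of E "s # S0" "[t]"] by (intro walk_connected) (auto simp: successively_Cons split: list.splits)
        show "connected_in E (set (Y2 @ [\<sigma>]))"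
          using wY2 by (intro walk_connected) (auto simp: successively_Cons split: list.splits)
      qed (use Ya(2) in auto)
      moreover have UG: "?U \<inter> ?G = {}"
        using S0Q S0R YQ Yr Qfull R'eq zQ' S0Q' \<sigma>R by auto
      moreover have d3: "distinct [s, t, r]" using dQ rQ Qfull by auto
      moreover have strUG: "{s, t, r} \<inter> (?U \<union> ?G) = {}"
        using dQ dR rQ Qfull S0Q YQ Yr R'Q R'eq stR wY(3) \<sigma>R S0R Ya(3) by auto
      moreover have "(\<exists>u\<in>?U. {u, x} \<in> E) \<and> (\<exists>g\<in>?G. {g, x} \<in> E)" if "x \<in> {s, t, r}" for x
      proof -
        have h: "{hd (Q12' @ [z]), s} \<in> E" "{last (z # Q21), t} \<in> E" "{hd (R1 @ [z]), r} \<in> E"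
          "{hd S0, s} \<in> E" "{last S0, t} \<in> E" "{hd (Y2 @ [\<sigma>]), r} \<in> E"
          using wQ(2) wQ(3) wR(2) wS wY2 Ya(2)
          by (auto simp: successively_Cons successively_append_iff insert_commute hd_append split: list.splits if_splits)
        have "hd (Q12' @ [z]) \<in> ?U" "last (z # Q21) \<in> ?U" "hd (R1 @ [z]) \<in> ?U"
          "hd S0 \<in> ?G" "last S0 \<in> ?G" "hd (Y2 @ [\<sigma>]) \<in> ?G"
          using Ya(2) by (auto simp: hd_append intro: hd_in_set last_in_set)
        then show ?thesis using h that by (elim insertE) blast+
      qed
      moreover have "\<forall>p\<in>?P. ab_path E (set ws) ?\<Theta> p"
      proof -
        have hws: "ws ! i \<in> set ws" "ws ! k' \<in> set ws" "a \<in> set ws" using i k'n lws wsn nth_mem[of n ws] by auto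
        have "ab_path E (set ws) ?\<Theta> (Q11 @ [s])"
          using wQ(1) dQ hdQ11 hws S0Q YQ Yr Rz(3) R12 Qfull by (auto simp: ab_path_def)
        moreover have "ab_path E (set ws) ?\<Theta> (R2 @ [r])"
        proof -
          have "hd (R2 @ [r]) = ws ! k'" using R'(3) R12 by (cases R2) (auto simp: R'_def)
          moreover have "set R2 \<inter> ?\<Theta> = {}"
            using dR R'Q Qfull stR S0R Yr(3) \<sigma>R R'eq by auto
          ultimately show ?thesis using wR(1) dR hws by (auto simp: ab_path_def)
        qed
        moreover have "ab_path E (set ws) ?\<Theta> (rev (t # Q22))"
        proof -
          have "hd (rev (t # Q22)) = a" using laQ22 by (simp only: hd_rev)
          moreover have "set Q22 \<inter> ?\<Theta> = {}" using dQ S0Q YQ Yr R'Q rQ Qfull by auto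
          moreover have "walk E (rev (t # Q22))" using wQ(4) walk_rev by metis
          ultimately show ?thesis using dQ hws by (auto simp: ab_path_def)
        qed
        ultimately show ?thesis by blast
      qed
      moreover have "disjoint_paths ?P"
      proof -
        have "set (Q11 @ [s]) \<inter> set (rev (t # Q22)) = {}" "set (Q11 @ [s]) \<inter> set (R2 @ [r]) = {}"
          "set (rev (t # Q22)) \<inter> set (R2 @ [r]) = {}"
          using dQ R'Q Qfull by auto
        then show ?thesis unfolding disjoint_paths_def by (auto simp: Int_commute)
      qed
      moreover have "last ` ?P = {s, t, r}" by simp
      moreover have "{s, t, r} \<subseteq> V" "?U \<subseteq> V" "?G \<subseteq> V"
      proof -
        have QV: "set Q \<subseteq> V"
          using conn_subset[OF V(2) aV] walk_conn[OF Qp(5) aQ] by blast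
        have "ws ! k' \<in> V" using V(4) k'n lws by auto
        then have RV: "set R' \<subseteq> V" using conn_subset[OF V(2)] R'conn[OF R'hd(1)] by blast
        have SV: "set Q' \<subseteq> V" using conn_subset[OF V(2) aV] Q'conn[OF Q'hd(2)] by blast
        have YV: "set Y \<subseteq> V" using Y(2) by (auto simp: F_def)
        show "{s, t, r} \<subseteq> V" "?U \<subseteq> V" "?G \<subseteq> V"
          using QV RV SV YV Qfull R'eq S0Q' Ya Yr by auto
      qed
      ultimately have "crossing E ws"
        using theta_crossing[OF V(1,2,4) red, of ?U ?G s t r ?P] by blast
      then show False using ncr by simp
    qed
  qed
  then show ?thesis using uV uW ua by (auto simp: insert_commute)
qed

section \<open>Drawings\<close>

text \<open>The drawings live in the closed upper half-plane with \<open>ws\<close> on the real line, in order.\<close>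

definition drawable :: "'v set \<Rightarrow> 'v set set \<Rightarrow> 'v list \<Rightarrow> bool" where
  "drawable V E ws \<longleftrightarrow> (\<exists>pos \<gamma>. planar_embedding V E pos \<gamma> \<and> (\<forall>v\<in>V. 0 \<le> Im (pos v)) \<and>
     (\<forall>e\<in>E. path_image (\<gamma> e) \<subseteq> {z. 0 \<le> Im z}) \<and> (\<forall>w\<in>set ws. Im (pos w) = 0) \<and>
     sorted_wrt (<) (map (\<lambda>w. Re (pos w)) ws))"

text \<open>The open lower half-plane is connected and avoids the drawing, so it lies in one face;
  the marked vertices on the real line are limits of its points.\<close>

lemma drawable_planar_with_on_face:
  assumes "drawable V E ws" "set ws \<subseteq> V"
  shows "planar_with_on_face V E (set ws)"
proof -
  obtain pos \<gamma> where d: "planar_embedding V E pos \<gamma>" "\<forall>v\<in>V. 0 \<le> Im (pos v)"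
    "\<forall>e\<in>E. path_image (\<gamma> e) \<subseteq> {z. 0 \<le> Im z}" "\<forall>w\<in>set ws. Im (pos w) = 0"
    using assms(1) unfolding drawable_def by blast
  let ?S = "- (pos ` V \<union> (\<Union>e\<in>E. path_image (\<gamma> e)))" and ?L = "{z. Im z < 0}"
  have L: "?L \<subseteq> ?S" using d(2,3) by fastforce
  have "connected ?L" by (simp add: convex_connected convex_halfspace_Im_lt)
  moreover have "- \<i> \<in> ?L" by simp
  then have "?S \<noteq> {}" using L by blast
  ultimately obtain F where F: "F \<in> components ?S" "?L \<subseteq> F"
    using exists_component_superset[OF L] by blast
  have "pos w \<in> frontier F" if w: "w \<in> set ws" for w
  proof -
    have "pos w \<in> closure ?L"
      using d(4) w unfolding closure_approachable
    proof (intro allI impI)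
      fix e :: real assume "0 < e"
      then show "\<exists>y\<in>?L. dist y (pos w) < e"
        using d(4) w by (intro bexI[of _ "pos w - \<i> * complex_of_real (e / 2)"]) (auto simp: dist_norm norm_mult)
    qed
    then have "pos w \<in> closure F" using closure_mono[OF F(2)] by blast
    moreover have "pos w \<notin> F" using in_components_subset[OF F(1)] assms(2) w by auto
    ultimately show ?thesis using interior_subset by (auto simp: frontier_def)
  qed
  then show ?thesis
    using d(1) F(1) unfolding planar_with_on_face_def embedding_faces_def by blast
qed

text \<open>One transport serves twice: with the identity it drops edges, and with the embedding of
  vertices as copies \<open>0\<close> it turns a drawing for the blow-up into one for the original
  graph.\<close>

lemma drawable_relabel:
  assumes d: "drawable V E (map f ws)" and f: "inj_on f V'" "f ` V' \<subseteq> V"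
    and E': "\<And>e. e \<in> E' \<Longrightarrow> e \<subseteq> V' \<and> f ` e \<in> E"
  shows "drawable V' E' ws"
proof -
  obtain pos \<gamma> where d: "planar_embedding V E pos \<gamma>" "\<forall>v\<in>V. 0 \<le> Im (pos v)"
    "\<forall>e\<in>E. path_image (\<gamma> e) \<subseteq> {z. 0 \<le> Im z}" "\<forall>w\<in>set (map f ws). Im (pos w) = 0"
    "sorted_wrt (<) (map (\<lambda>w. Re (pos w)) (map f ws))"
    using d unfolding drawable_def by blast
  have p: "inj_on pos V" "\<And>e. e \<in> E \<Longrightarrow> arc (\<gamma> e) \<and> {pathstart (\<gamma> e), pathfinish (\<gamma> e)} = pos ` e"
    "\<And>e. e \<in> E \<Longrightarrow> path_image (\<gamma> e) \<inter> pos ` V = pos ` e"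
    "\<And>e e'. e \<in> E \<Longrightarrow> e' \<in> E \<Longrightarrow> e \<noteq> e' \<Longrightarrow> path_image (\<gamma> e) \<inter> path_image (\<gamma> e') = pos ` (e \<inter> e')"
    using d(1) by (simp_all add: planar_embedding_def)
  have "planar_embedding V' E' (pos \<circ> f) (\<lambda>e. \<gamma> (f ` e))"
    unfolding planar_embedding_def
  proof (intro conjI ballI impI)
    show "inj_on (pos \<circ> f) V'" using f p(1) by (auto intro: comp_inj_on inj_on_subset)
    fix e assume e: "e \<in> E'"
    show "arc (\<gamma> (f ` e))" "{pathstart (\<gamma> (f ` e)), pathfinish (\<gamma> (f ` e))} = (pos \<circ> f) ` e"
      using p(2)[of "f ` e"] E'[OF e] by (auto simp: image_comp)
    have *: "path_image (\<gamma> (f ` e)) \<inter> pos ` V = pos ` f ` e" using p(3) E'[OF e] by blast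
    have "pos ` f ` e \<subseteq> pos ` f ` V'" using E'[OF e] by blast
    moreover have "pos ` f ` V' \<subseteq> pos ` V" using f by blast
    ultimately show "path_image (\<gamma> (f ` e)) \<inter> (pos \<circ> f) ` V' = (pos \<circ> f) ` e"
      using * unfolding image_comp[symmetric] by blast
    fix e' assume e': "e' \<in> E'" "e \<noteq> e'"
    have "f ` e \<noteq> f ` e'" using inj_on_image_eq_iff[OF f(1)] E' e e' by blast
    then have "path_image (\<gamma> (f ` e)) \<inter> path_image (\<gamma> (f ` e')) = pos ` (f ` e \<inter> f ` e')"
      using p(4) E' e e' by blast
    also have "f ` e \<inter> f ` e' = f ` (e \<inter> e')"
      using inj_on_image_Int[OF f(1)] E' e e' by metis
    finally show "path_image (\<gamma> (f ` e)) \<inter> path_image (\<gamma> (f ` e')) = (pos \<circ> f) ` (e \<inter> e')"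
      by (simp add: image_comp)
  qed
  moreover have "\<forall>v\<in>V'. 0 \<le> Im ((pos \<circ> f) v)" using d(2) f(2) by auto
  moreover have "\<forall>e\<in>E'. path_image (\<gamma> (f ` e)) \<subseteq> {z. 0 \<le> Im z}" using d(3) E' by blast
  moreover have "\<forall>w\<in>set ws. Im ((pos \<circ> f) w) = 0" using d(4) by auto
  moreover have "sorted_wrt (<) (map (\<lambda>w. Re ((pos \<circ> f) w)) ws)" using d(5) by (simp add: comp_def)
  ultimately show ?thesis unfolding drawable_def by (intro exI[of _ "pos \<circ> f"] exI[of _ "\<lambda>e. \<gamma> (f ` e)"]) simp
qed

lemma drawable_mono:
  assumes "drawable V E ws" "E' \<subseteq> E" "E \<subseteq> Pow V"
  shows "drawable V E' ws"
  by (rule drawable_relabel[of V E id]) (use assms in auto)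

lemma drawable_drop: "drawable V E (xs @ u # ys) \<Longrightarrow> drawable V E (xs @ ys)"
  unfolding drawable_def by (elim exE, intro exI) (auto simp: sorted_wrt_append)

lemma planar_embedding_homeo:
  assumes h: "inj h" "continuous_on UNIV h" and p: "planar_embedding V E pos \<gamma>"
  shows "planar_embedding V E (h \<circ> pos) (\<lambda>e. h \<circ> \<gamma> e)"
  unfolding planar_embedding_def
proof (intro conjI ballI impI)
  note p = p[unfolded planar_embedding_def]
  show "inj_on (h \<circ> pos) V" using p h by (auto intro: comp_inj_on inj_on_subset)
  fix e assume e: "e \<in> E"
  show "arc (h \<circ> \<gamma> e)"
    using p e h unfolding arc_def
    by (auto intro!: path_continuous_image comp_inj_on intro: continuous_on_subset inj_on_subset)
  show "{pathstart (h \<circ> \<gamma> e), pathfinish (h \<circ> \<gamma> e)} = (h \<circ> pos) ` e"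
  proof -
    have "{pathstart (\<gamma> e), pathfinish (\<gamma> e)} = pos ` e" using p e by simp
    then have "h ` {pathstart (\<gamma> e), pathfinish (\<gamma> e)} = h ` pos ` e" by (rule arg_cong)
    then show ?thesis by (simp add: pathstart_compose pathfinish_compose image_comp)
  qed
  show "path_image (h \<circ> \<gamma> e) \<inter> (h \<circ> pos) ` V = (h \<circ> pos) ` e"
    unfolding path_image_compose image_comp[symmetric] image_Int[OF h(1), symmetric] using p e by simp
  fix f assume f: "f \<in> E" "e \<noteq> f"
  show "path_image (h \<circ> \<gamma> e) \<inter> path_image (h \<circ> \<gamma> f) = (h \<circ> pos) ` (e \<inter> f)"
    unfolding path_image_compose image_comp[symmetric] image_Int[OF h(1), symmetric] using p e f by simp
qed

text \<open>A vertical shear: the identity outside the strip between \<open>p\<close> and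
  \<open>q\<close>, and inside it a lift by a parabola vanishing at both ends. Being injective and
  continuous, it carries drawings to drawings.\<close>

definition bump :: "real \<Rightarrow> real \<Rightarrow> complex \<Rightarrow> complex" where
  "bump p q z = Complex (Re z) (Im z + max 0 ((Re z - p) * (q - Re z)))"

lemma Re_bump [simp]: "Re (bump p q z) = Re z"
  by (simp add: bump_def)

lemma Im_bump: "Im (bump p q z) = Im z + max 0 ((Re z - p) * (q - Re z))"
  by (simp add: bump_def)

lemma inj_bump: "inj (bump p q)"
  by (auto simp: inj_def bump_def complex_eq_iff)

lemma continuous_bump: "continuous_on UNIV (bump p q)"
  unfolding bump_def by (intro continuous_intros)

lemma bump_id: "Re z \<le> p \<or> q \<le> Re z \<Longrightarrow> p \<le> q \<Longrightarrow> bump p q z = z"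
  by (auto simp: complex_eq_iff Im_bump max_def mult_le_0_iff zero_le_mult_iff)

lemma Im_bump_nonneg: "0 \<le> Im z \<Longrightarrow> 0 \<le> Im (bump p q z)"
  by (simp add: Im_bump)

lemma Im_bump_pos: "0 \<le> Im z \<Longrightarrow> p < Re z \<Longrightarrow> Re z < q \<Longrightarrow> 0 < Im (bump p q z)"
  by (simp add: Im_bump add_nonneg_pos max_def mult_le_0_iff)

text \<open>Lifting everything above the interval \<open>(p, q)\<close> of the real line frees that interval.\<close>

lemma drawing_bump:
  assumes "planar_embedding V E pos \<gamma>" "\<forall>v\<in>V. 0 \<le> Im (pos v)"
    "\<forall>e\<in>E. path_image (\<gamma> e) \<subseteq> {z. 0 \<le> Im z}"
  shows "planar_embedding V E (bump p q \<circ> pos) (\<lambda>e. bump p q \<circ> \<gamma> e)"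
    "\<forall>v\<in>V. 0 \<le> Im ((bump p q \<circ> pos) v)"
    "\<forall>e\<in>E. path_image (bump p q \<circ> \<gamma> e) \<subseteq> {z. 0 \<le> Im z}"
proof -
  show "planar_embedding V E (bump p q \<circ> pos) (\<lambda>e. bump p q \<circ> \<gamma> e)"
    using planar_embedding_homeo[OF inj_bump continuous_bump assms(1)] .
  show "\<forall>v\<in>V. 0 \<le> Im ((bump p q \<circ> pos) v)"
    using assms(2) Im_bump_nonneg by (simp add: comp_def)
  show "\<forall>e\<in>E. path_image (bump p q \<circ> \<gamma> e) \<subseteq> {z. 0 \<le> Im z}"
    using assms(3) Im_bump_nonneg unfolding path_image_compose by blast
qed

lemma real_segment:
  assumes "z \<in> closed_segment a b" "Im a = 0" "Im b = 0" "Re a < Re b"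
  shows "Im z = 0" "Re a \<le> Re z" "Re z \<le> Re b"
proof -
  obtain u where u: "0 \<le> u" "u \<le> 1" "z = (1 - u) *\<^sub>R a + u *\<^sub>R b"
    using assms(1) by (auto simp: in_segment)
  show "Im z = 0" using u assms by simp
  have "Re z = Re a + u * (Re b - Re a)" unfolding u(3) by (simp add: algebra_simps)
  moreover have "0 \<le> u * (Re b - Re a)" "u * (Re b - Re a) \<le> Re b - Re a"
    using u assms(4) by (auto simp: mult_left_le_one_le)
  ultimately show "Re a \<le> Re z" "Re z \<le> Re b" by linarith+
qed

text \<open>After the lift, the open interval between the neighbouring marked vertices
  \<open>a\<close> and \<open>b\<close> meets nothing, so a straight segment can join them. All
  marked vertices lie outside the open strip and stay in place.\<close>

lemma drawable_add_edge:
  assumes d: "drawable V E (xs @ a # b # ys)" and G: "E \<subseteq> Pow V" "set (xs @ a # b # ys) \<subseteq> V"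
    and nE: "{a, b} \<notin> E"
  shows "drawable V (insert {a, b} E) (xs @ a # b # ys)"
proof -
  let ?ws = "xs @ a # b # ys"
  obtain pos \<gamma> where d: "planar_embedding V E pos \<gamma>" "\<forall>v\<in>V. 0 \<le> Im (pos v)"
    "\<forall>e\<in>E. path_image (\<gamma> e) \<subseteq> {z. 0 \<le> Im z}" "\<forall>w\<in>set ?ws. Im (pos w) = 0"
    "sorted_wrt (<) (map (\<lambda>w. Re (pos w)) ?ws)"
    using d unfolding drawable_def by blast
  let ?p = "Re (pos a)" and ?q = "Re (pos b)"
  let ?h = "bump ?p ?q"
  have pq: "?p < ?q" using d(5) by (auto simp: sorted_wrt_append)
  have fix_ws: "?h (pos w) = pos w" if "w \<in> set ?ws" for w
    using d(5) that pq by (intro bump_id) (auto simp: sorted_wrt_append less_imp_le)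
  note e = drawing_bump[OF d(1-3), of ?p ?q]
  note p = d(1)[unfolded planar_embedding_def]
  note p' = e(1)[unfolded planar_embedding_def]
  note P1 = p'[THEN conjunct2, THEN conjunct1, rule_format]
    and P2 = p'[THEN conjunct2, THEN conjunct2, THEN conjunct1, rule_format]
    and P3 = p'[THEN conjunct2, THEN conjunct2, THEN conjunct2, rule_format]
  let ?S = "closed_segment (pos a) (pos b)"
  have im: "Im (pos a) = 0" "Im (pos b) = 0" using d(4) by auto
  have seg: "z = pos a \<or> z = pos b" if "?h z \<in> ?S" "0 \<le> Im z" for z
  proof -
    have *: "Im (?h z) = 0" "?p \<le> Re z" "Re z \<le> ?q" using real_segment[OF that(1) im pq] by auto
    then have "Re z = ?p \<or> Re z = ?q" using Im_bump_pos[of z ?p ?q] that(2) by force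
    moreover from this have "?h z = z" using pq by (intro bump_id) auto
    ultimately show ?thesis using * im by (auto simp: complex_eq_iff)
  qed
  define \<gamma>' where "\<gamma>' f = (if f = {a, b} then linepath (pos a) (pos b) else ?h \<circ> \<gamma> f)" for f
  have \<gamma>'1: "\<gamma>' {a, b} = linepath (pos a) (pos b)" by (simp add: \<gamma>'_def)
  have \<gamma>'2: "\<gamma>' f = ?h \<circ> \<gamma> f" if "f \<in> E" for f using that nE by (auto simp: \<gamma>'_def)
  have abV: "a \<in> V" "b \<in> V" using G by auto
  have fab: "?h (pos a) = pos a" "?h (pos b) = pos b" using fix_ws by auto
  have cross: "path_image (?h \<circ> \<gamma> f) \<inter> ?S = (?h \<circ> pos) ` (f \<inter> {a, b})" if f: "f \<in> E" for f
  proof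
    have pf: "path_image (\<gamma> f) \<inter> pos ` V = pos ` f" using p f by blast
    have mem: "x \<in> f" if "x \<in> V" "pos x \<in> path_image (\<gamma> f)" for x
    proof -
      have "pos x \<in> pos ` f" using pf that by blast
      then show ?thesis using p that f G(1) by (meson PowD inj_on_image_mem_iff subsetD)
    qed
    show "path_image (?h \<circ> \<gamma> f) \<inter> ?S \<subseteq> (?h \<circ> pos) ` (f \<inter> {a, b})"
    proof
      fix y assume "y \<in> path_image (?h \<circ> \<gamma> f) \<inter> ?S"
      then obtain z where z: "y = ?h z" "z \<in> path_image (\<gamma> f)" "?h z \<in> ?S" by (auto simp: path_image_compose)
      have "z = pos a \<or> z = pos b" using seg[OF z(3)] d(3) f z(2) by auto
      then show "y \<in> (?h \<circ> pos) ` (f \<inter> {a, b})" using mem[of a] mem[of b] abV z by auto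
    qed
    show "(?h \<circ> pos) ` (f \<inter> {a, b}) \<subseteq> path_image (?h \<circ> \<gamma> f) \<inter> ?S"
    proof
      fix y assume "y \<in> (?h \<circ> pos) ` (f \<inter> {a, b})"
      then obtain x where x: "x \<in> f" "x = a \<or> x = b" "y = ?h (pos x)" by auto
      have "pos x \<in> path_image (\<gamma> f)" using pf x(1) by blast
      moreover have "y \<in> ?S" using x(2,3) fab by auto
      ultimately show "y \<in> path_image (?h \<circ> \<gamma> f) \<inter> ?S" using x(3) unfolding path_image_compose by blast
    qed
  qed
  have "planar_embedding V (insert {a, b} E) (?h \<circ> pos) \<gamma>'"
    unfolding planar_embedding_def
  proof (intro conjI ballI impI)
    show "inj_on (?h \<circ> pos) V" using p' by blast
    fix f assume f: "f \<in> insert {a, b} E"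
    show "arc (\<gamma>' f)"
    proof (cases "f = {a, b}")
      case True
      moreover have "pos a \<noteq> pos b" using pq by auto
      ultimately show ?thesis using \<gamma>'1 by (simp add: arc_linepath)
    next
      case False
      then have "f \<in> E" using f by auto
      then show ?thesis using \<gamma>'2 P1 by simp
    qed
    show "{pathstart (\<gamma>' f), pathfinish (\<gamma>' f)} = (?h \<circ> pos) ` f"
    proof (cases "f = {a, b}")
      case True
      then show ?thesis using \<gamma>'1 fab by auto
    next
      case False
      then have "f \<in> E" using f by auto
      then show ?thesis unfolding \<gamma>'2[OF \<open>f \<in> E\<close>] by (rule P1[THEN conjunct2])
    qed
    show "path_image (\<gamma>' f) \<inter> (?h \<circ> pos) ` V = (?h \<circ> pos) ` f"
    proof (cases "f = {a, b}")
      case True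
      have "?S \<inter> (?h \<circ> pos) ` V \<subseteq> {pos a, pos b}" using seg d(2) fab by force
      moreover have "{pos a, pos b} \<subseteq> ?S \<inter> (?h \<circ> pos) ` V"
      proof -
        have "pos a \<in> (?h \<circ> pos) ` V" using abV(1) fab(1) by (intro image_eqI[of _ _ a]) simp_all
        moreover have "pos b \<in> (?h \<circ> pos) ` V" using abV(2) fab(2) by (intro image_eqI[of _ _ b]) simp_all
        ultimately show ?thesis by simp
      qed
      ultimately show ?thesis using True \<gamma>'1 fab by auto
    next
      case False
      then have "f \<in> E" using f by auto
      then show ?thesis unfolding \<gamma>'2[OF \<open>f \<in> E\<close>] by (rule P2)
    qed
    fix g assume g: "g \<in> insert {a, b} E" "f \<noteq> g"
    show "path_image (\<gamma>' f) \<inter> path_image (\<gamma>' g) = (?h \<circ> pos) ` (f \<inter> g)"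
    proof (cases "f = {a, b}")
      case True
      then have "g \<in> E" using g by auto
      then show ?thesis using cross[of g] True \<gamma>'1 \<gamma>'2 by (simp add: Int_commute)
    next
      case False
      then have fE: "f \<in> E" using f by auto
      show ?thesis
      proof (cases "g = {a, b}")
        case True
        then show ?thesis using cross[OF fE] \<gamma>'1 \<gamma>'2[OF fE] by simp
      next
        case False
        then have gE: "g \<in> E" using g by auto
        show ?thesis unfolding \<gamma>'2[OF fE] \<gamma>'2[OF gE] using fE gE g(2) by (rule P3)
      qed
    qed
  qed
  moreover have "\<forall>f\<in>insert {a, b} E. path_image (\<gamma>' f) \<subseteq> {z. 0 \<le> Im z}"
    using e(3) \<gamma>'1 \<gamma>'2 real_segment(1)[OF _ im pq] by auto
  moreover have "\<forall>w\<in>set ?ws. Im ((?h \<circ> pos) w) = 0"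
  proof
    fix w assume w: "w \<in> set ?ws"
    show "Im ((?h \<circ> pos) w) = 0" using fix_ws[OF w] d(4) w by (simp only: comp_apply)
  qed
  moreover have "sorted_wrt (<) (map (\<lambda>w. Re ((?h \<circ> pos) w)) ?ws)" using d(5) by (simp add: comp_def)
  ultimately show ?thesis using e(2) unfolding drawable_def by blast
qed

text \<open>The lift frees an interval between the last vertex of \<open>xs\<close> and the first of
  \<open>ys\<close>, and the new vertex takes its midpoint. It lies on no edge, so no arc has to be
  added.\<close>

lemma drawable_add_vertex:
  assumes d: "drawable V E (xs @ ys)" and G: "E \<subseteq> Pow V" "v \<notin> V" "set (xs @ ys) \<subseteq> V"
  shows "drawable (insert v V) E (xs @ v # ys)"
proof -
  obtain pos \<gamma> where d: "planar_embedding V E pos \<gamma>" "\<forall>v\<in>V. 0 \<le> Im (pos v)"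
    "\<forall>e\<in>E. path_image (\<gamma> e) \<subseteq> {z. 0 \<le> Im z}" "\<forall>w\<in>set (xs @ ys). Im (pos w) = 0"
    "sorted_wrt (<) (map (\<lambda>w. Re (pos w)) (xs @ ys))"
    using d unfolding drawable_def by blast
  \<comment> \<open>If one of the lists is empty, an interval of length one beyond the end of the
    other serves; if both are, the unit interval.\<close>
  have "\<exists>p q. p < q \<and> (\<forall>w\<in>set xs. Re (pos w) \<le> p) \<and> (\<forall>w\<in>set ys. q \<le> Re (pos w))"
  proof (cases "xs = []")
    case True
    show ?thesis
    proof (cases ys)
      case (Cons y ys')
      then show ?thesis using True d(5) by (intro exI[of _ "Re (pos y) - 1"] exI[of _ "Re (pos y)"]) (auto intro: less_imp_le)
    qed (use True in \<open>auto intro: exI[of _ 0] exI[of _ 1]\<close>)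
  next
    case False
    then obtain xs' x where xs: "xs = xs' @ [x]" by (metis rev_exhaust)
    show ?thesis
    proof (cases ys)
      case Nil
      then show ?thesis using xs d(5)
        by (intro exI[of _ "Re (pos x)"] exI[of _ "Re (pos x) + 1"]) (auto simp: sorted_wrt_append intro: less_imp_le)
    next
      case (Cons y ys')
      then show ?thesis using xs d(5)
        by (intro exI[of _ "Re (pos x)"] exI[of _ "Re (pos y)"]) (auto simp: sorted_wrt_append intro: less_imp_le)
    qed
  qed
  then obtain p q where pq: "p < q" "\<forall>w\<in>set xs. Re (pos w) \<le> p" "\<forall>w\<in>set ys. q \<le> Re (pos w)" by blast
  let ?h = "bump p q"
  note e = drawing_bump[OF d(1-3), of p q]
  note p' = e(1)[unfolded planar_embedding_def]
  note P1 = p'[THEN conjunct2, THEN conjunct1, rule_format]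
    and P2 = p'[THEN conjunct2, THEN conjunct2, THEN conjunct1, rule_format]
    and P3 = p'[THEN conjunct2, THEN conjunct2, THEN conjunct2, rule_format]
  define m where "m = Complex ((p + q) / 2) 0"
  have free: "?h z \<noteq> m" if "0 \<le> Im z" for z
  proof
    assume "?h z = m"
    then have "Re z = (p + q) / 2" "Im (?h z) = 0" by (auto simp: m_def complex_eq_iff)
    then show False using Im_bump_pos[OF that, of p q] pq(1) by auto
  qed
  define pos' where "pos' = (?h \<circ> pos)(v := m)"
  have posV: "pos' ` A = (?h \<circ> pos) ` A" if "A \<subseteq> V" for A
    using that G(2) by (intro image_cong) (auto simp: pos'_def)
  have mV: "m \<notin> (?h \<circ> pos) ` V" using free d(2) by auto
  have mE: "m \<notin> path_image (?h \<circ> \<gamma> f)" if "f \<in> E" for f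
    using free d(3) that unfolding path_image_compose by auto
  have img: "pos' ` insert v V = insert m ((?h \<circ> pos) ` V)" using posV[of V] by (auto simp: pos'_def)
  have EV: "f \<subseteq> V" if "f \<in> E" for f using that G(1) by auto
  have "planar_embedding (insert v V) E pos' (\<lambda>e. ?h \<circ> \<gamma> e)"
    unfolding planar_embedding_def
  proof (intro conjI ballI impI)
    have "inj_on pos' V" using p' G(2) by (auto simp: pos'_def inj_on_def)
    moreover have "pos' v \<notin> pos' ` V" using mV posV[of V] by (simp add: pos'_def)
    ultimately show "inj_on pos' (insert v V)" using G(2) by auto
    fix f assume f: "f \<in> E"
    show "arc (?h \<circ> \<gamma> f)" using P1[OF f] by simp
    show "{pathstart (?h \<circ> \<gamma> f), pathfinish (?h \<circ> \<gamma> f)} = pos' ` f"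
      unfolding posV[OF EV[OF f]] by (rule P1[OF f, THEN conjunct2])
    show "path_image (?h \<circ> \<gamma> f) \<inter> pos' ` insert v V = pos' ` f"
      unfolding posV[OF EV[OF f]] img using P2[OF f] mE[OF f] by simp
    fix g assume g: "g \<in> E" "f \<noteq> g"
    have "f \<inter> g \<subseteq> V" using EV[OF f] by blast
    then show "path_image (?h \<circ> \<gamma> f) \<inter> path_image (?h \<circ> \<gamma> g) = pos' ` (f \<inter> g)"
      using P3[OF f g] posV by simp
  qed
  moreover have "\<forall>w\<in>insert v V. 0 \<le> Im (pos' w)" using e(2) by (auto simp: pos'_def m_def)
  moreover have pw: "pos' w = pos w" if "w \<in> set xs \<union> set ys" for w
  proof -
    have "w \<noteq> v" using that G by auto
    moreover have "?h (pos w) = pos w" using that pq by (intro bump_id) auto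
    ultimately show ?thesis by (simp add: pos'_def)
  qed
  then have "\<forall>w\<in>set (xs @ v # ys). Im (pos' w) = 0" using d(4) by (auto simp: pos'_def m_def)
  moreover have "sorted_wrt (<) (map (\<lambda>w. Re (pos' w)) (xs @ v # ys))"
  proof -
    have "map (\<lambda>w. Re (pos' w)) xs = map (\<lambda>w. Re (pos w)) xs" "map (\<lambda>w. Re (pos' w)) ys = map (\<lambda>w. Re (pos w)) ys"
      using pw by auto
    moreover have "Re (pos' v) = (p + q) / 2" by (simp add: pos'_def m_def)
    moreover have "\<forall>w\<in>set xs. Re (pos w) < (p + q) / 2" "\<forall>w\<in>set ys. (p + q) / 2 < Re (pos w)"
      using pq by fastforce+
    moreover have "map (\<lambda>w. Re (pos' w)) (xs @ v # ys) =
        map (\<lambda>w. Re (pos' w)) xs @ [Re (pos' v)] @ map (\<lambda>w. Re (pos' w)) ys" by simp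
    ultimately have m: "map (\<lambda>w. Re (pos' w)) (xs @ v # ys) =
        map (\<lambda>w. Re (pos w)) xs @ [(p + q) / 2] @ map (\<lambda>w. Re (pos w)) ys"
      "\<forall>w\<in>set xs. Re (pos w) < (p + q) / 2" "\<forall>w\<in>set ys. (p + q) / 2 < Re (pos w)" by simp_all
    show ?thesis unfolding m(1) using d(5) m(2,3) pq(1) by (auto simp: sorted_wrt_append)
  qed
  ultimately show ?thesis using e(3) unfolding drawable_def by blast
qed

definition consecutive_edges :: "'v list \<Rightarrow> 'v set set" where
  "consecutive_edges ws = {{ws ! i, ws ! Suc i} | i. Suc i < length ws}"

lemma drawable_add_consecutive:
  assumes "drawable V E ws" "E \<subseteq> Pow V" "set ws \<subseteq> V"
  shows "drawable V (E \<union> consecutive_edges ws) ws"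
proof -
  have sub: "consecutive_edges ws \<subseteq> Pow V" using assms(3) by (auto simp: consecutive_edges_def)
  have "consecutive_edges ws = (\<lambda>i. {ws ! i, ws ! Suc i}) ` {i. Suc i < length ws}"
    by (auto simp: consecutive_edges_def)
  then have fin: "finite (consecutive_edges ws)"
    by (simp add: finite_subset[of "{i. Suc i < length ws}" "{..<length ws}"] subset_eq)
  have "finite X \<Longrightarrow> X \<subseteq> consecutive_edges ws \<Longrightarrow> drawable V (E \<union> X) ws" for X
  proof (induction X rule: finite_induct)
    case (insert x X)
    then have IH: "drawable V (E \<union> X) ws" by auto
    obtain i where i: "x = {ws ! i, ws ! Suc i}" "Suc i < length ws"
      using insert.prems by (auto simp: consecutive_edges_def)
    show ?case
    proof (cases "x \<in> E \<union> X")
      case True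
      then show ?thesis using IH by (simp add: insert_absorb)
    next
      case False
      have ws: "ws = take i ws @ ws ! i # ws ! Suc i # drop (Suc (Suc i)) ws"
        using i(2) by (metis Cons_nth_drop_Suc Suc_lessD append_take_drop_id)
      have "E \<union> X \<subseteq> Pow V" using assms(2) insert.prems sub by blast
      then have "drawable V (insert x (E \<union> X)) ws"
        using drawable_add_edge[of V "E \<union> X" "take i ws" "ws ! i" "ws ! Suc i" "drop (Suc (Suc i)) ws"]
          IH False i(1) assms(3) ws by metis
      then show ?thesis by simp
    qed
  qed (use assms in simp)
  then show ?thesis using fin by simp
qed

text \<open>Below a shortest chord there is a vertex without chords.\<close>

lemma chordless_vertex:
  assumes "ws \<noteq> []" "distinct ws" "\<not> crossing E ws" "\<forall>e\<in>E. card e = 2"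
  obtains m where "m < length ws"
    "\<And>l. l < length ws \<Longrightarrow> {ws ! m, ws ! l} \<in> E \<Longrightarrow> {ws ! m, ws ! l} \<in> consecutive_edges ws"
proof (cases "\<exists>i j. Suc i < j \<and> j < length ws \<and> {ws ! i, ws ! j} \<in> E")
  case False
  have "{ws ! 0, ws ! l} \<in> consecutive_edges ws" if l: "l < length ws" "{ws ! 0, ws ! l} \<in> E" for l
  proof -
    have "l \<noteq> 0"
    proof
      assume "l = 0"
      then have "card {ws ! 0} = 2" using l assms(4) by (metis insert_absorb2)
      then show False by simp
    qed
    then have "l = 1" using False l by (metis One_nat_def Suc_lessI neq0_conv)
    then show ?thesis using l by (auto simp: consecutive_edges_def intro!: exI[of _ 0])
  qed
  then show ?thesis using that[of 0] assms(1) by auto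
next
  case True
  \<comment> \<open>\<open>P d\<close> says that some edge joins positions at distance
    \<open>d\<close>, at least two. The vertex sought comes right after the left end of a shortest
    such chord: an edge of it that leaves the chord would cross it, and a long edge inside would be
    a shorter chord.\<close>
  define P where "P d \<longleftrightarrow> (\<exists>i. {ws ! i, ws ! (i + d)} \<in> E \<and> 2 \<le> d \<and> i + d < length ws)" for d
  from True obtain i j where "Suc i < j" "j < length ws" "{ws ! i, ws ! j} \<in> E" by blast
  then have "P (j - i)" unfolding P_def by (intro exI[of _ i]) auto
  then have PL: "P (LEAST d. P d)" by (rule LeastI)
  define d where "d = (LEAST d. P d)"
  obtain i where i: "{ws ! i, ws ! (i + d)} \<in> E" "2 \<le> d" "i + d < length ws"
    using PL[folded d_def] unfolding P_def by blast
  have min: "\<not> P d'" if "d' < d" for d' using that not_less_Least unfolding d_def by blast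
  have "{ws ! Suc i, ws ! l} \<in> consecutive_edges ws"
    if l: "l < length ws" "{ws ! Suc i, ws ! l} \<in> E" for l
  proof -
    have ne: "l \<noteq> Suc i"
    proof
      assume "l = Suc i"
      then have "card {ws ! Suc i} = 2" using l assms(4) by (metis insert_absorb2)
      then show False by simp
    qed
    have c1: "conn E {ws ! i, ws ! (i + d)} (ws ! i) (ws ! (i + d))" using i by (intro conn_edge) auto
    have c2: "conn E {ws ! Suc i, ws ! l} (ws ! Suc i) (ws ! l)" using l by (intro conn_edge) auto
    have out: False if "l < i \<or> i + d < l"
    proof -
      have "{ws ! i, ws ! (i + d)} \<inter> {ws ! Suc i, ws ! l} = {}"
        using that i l assms(2) by (auto simp: nth_eq_iff_index_eq)
      then have "crossing E ws"
        using crossing_pairs[OF _ c1 c2] that i l by auto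
      then show False using assms(3) by simp
    qed
    have "\<not> Suc (Suc i) < l"
    proof
      assume "Suc (Suc i) < l"
      then have "P (l - Suc i)" unfolding P_def using l by (intro exI[of _ "Suc i"]) auto
      moreover have "l - Suc i < d" using out i \<open>Suc (Suc i) < l\<close> by force
      ultimately show False using min by blast
    qed
    then consider "l = i" | "l = Suc (Suc i)" using out ne by force
    then show ?thesis
    proof cases
      case 1
      then show ?thesis using i by (auto simp: consecutive_edges_def insert_commute intro!: exI[of _ i])
    next
      case 2
      then show ?thesis using l by (auto simp: consecutive_edges_def intro!: exI[of _ "Suc i"])
    qed
  qed
  then show ?thesis using that[of "Suc i"] i by auto
qed

lemma crossing_insert:
  assumes "crossing E (xs @ ys)"
  shows "crossing E (xs @ a # ys)"
proof -
  from assms obtain S T i k j l where *: "i < k" "k < j" "j < l" "l < length (xs @ ys)" "S \<inter> T = {}"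
      "conn E S ((xs @ ys) ! i) ((xs @ ys) ! j)" "conn E T ((xs @ ys) ! k) ((xs @ ys) ! l)"
    unfolding crossing_def by blast
  define f where "f n = (if n < length xs then n else Suc n)" for n
  have "(xs @ a # ys) ! f n = (xs @ ys) ! n" for n by (auto simp: f_def nth_append Suc_diff_le)
  then show ?thesis using *
    by (intro crossingI[of "f i" "f k" "f j" "f l" _ S T]) (auto simp: f_def)
qed

text \<open>A chordless marked vertex \<open>a\<close> first loses its edges to other marked
  vertices; these are consecutive and can be redrawn on the line. If no edge is left,
  \<open>a\<close> is removed and later put back; otherwise a neighbour \<open>u\<close> is marked
  next to it, which makes \<open>au\<close> a consecutive edge. The factor two lets the measure drop
  also when \<open>a\<close> leaves both \<open>V\<close> and \<open>ws\<close>.\<close>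

theorem reduced_drawable:
  assumes "finite_graph V E" "distinct ws" "set ws \<subseteq> V" "reduced V E (set ws)" "\<not> crossing E ws"
  shows "drawable V E ws"
  using assms
proof (induction "2 * card V - length ws" arbitrary: V E ws rule: less_induct)
  case less
  note G = less.prems
  have V: "finite V" "E \<subseteq> Pow V" "\<forall>e\<in>E. card e = 2" using G(1) by (auto simp: finite_graph_def)
  show ?case
  proof (cases "V = {}")
    case True
    have "e \<notin> E" for e
    proof
      assume "e \<in> E"
      then have "e = {}" "card e = 2" using V(2,3) True by auto
      then show False by simp
    qed
    then have "E = {}" by blast
    moreover have "ws = []" using True G(3) by simp
    moreover note True
    ultimately have "E = {}" "ws = []" by simp_all
    then show ?thesis using True by (auto simp: drawable_def planar_embedding_def)
  next
    case False
    \<comment> \<open>Without marked vertices a whole component of the graph would be a connected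
      set with no neighbours, against \<open>reduced\<close>.\<close>
    have "ws \<noteq> []"
    proof
      assume ws: "ws = []"
      obtain x where x: "x \<in> V" using False by auto
      let ?C = "{y. conn E V x y}"
      have "?C \<subseteq> V - set ws" "x \<in> ?C" using x ws by (auto dest: conn_snd)
      then have "4 \<le> card (nbrs E ?C)"
        using G(4) component_connected[of E V x] unfolding reduced_def by (metis empty_iff)
      moreover have "nbrs E ?C = {}" using nbrs_subset[OF V(2)] component_nbrs[of E V x] by blast
      ultimately show False by simp
    qed
    then obtain m where m: "m < length ws"
      "\<And>l. l < length ws \<Longrightarrow> {ws ! m, ws ! l} \<in> E \<Longrightarrow> {ws ! m, ws ! l} \<in> consecutive_edges ws"
      using chordless_vertex[OF _ G(2,5) V(3)] by blast
    define a where "a = ws ! m"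
    define xs where "xs = take m ws"
    define ys where "ys = drop (Suc m) ws"
    have ws: "ws = xs @ a # ys" using m(1) by (simp add: a_def xs_def ys_def id_take_nth_drop)
    define E0 where "E0 = E - {e. a \<in> e \<and> e \<subseteq> set ws}"
    have E0E: "E0 \<subseteq> E" by (auto simp: E0_def)
    have EE: "E \<subseteq> E0 \<union> consecutive_edges ws"
    proof
      fix e assume e: "e \<in> E"
      show "e \<in> E0 \<union> consecutive_edges ws"
      proof (cases "a \<in> e \<and> e \<subseteq> set ws")
        case True
        then obtain b where b: "e = {a, b}" using e V(3) by (metis card_2_iff insertE insert_commute singletonD)
        then obtain l where "l < length ws" "b = ws ! l" using True by (auto simp: in_set_conv_nth)
        then show ?thesis using m(2) b e by (auto simp: a_def)
      qed (use e in \<open>auto simp: E0_def\<close>)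
    qed
    have E0V: "E0 \<subseteq> Pow V" using E0E V by blast
    have reduce: ?thesis if "drawable V E0 ws"
    proof -
      have "drawable V (E0 \<union> consecutive_edges ws) ws"
        using drawable_add_consecutive[OF that E0V G(3)] .
      moreover have "E0 \<union> consecutive_edges ws \<subseteq> Pow V" using E0V G(3) by (auto simp: consecutive_edges_def)
      ultimately show ?thesis using drawable_mono EE by blast
    qed
    have nb: "nbrs E0 {a} \<inter> set ws = {}" using ws by (auto simp: nbrs_def E0_def)
    have red0: "4 \<le> card (nbrs E0 C)" if C: "C \<subseteq> V - set ws" "C \<noteq> {}" "connected_in E0 C" for C
    proof -
      have "nbrs E0 C = nbrs E C" using C(1) by (auto simp: nbrs_def E0_def)
      moreover have "connected_in E C" using C(3) E0E unfolding connected_in_def by (meson conn_mono order_refl)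
      ultimately show ?thesis using G(4) C unfolding reduced_def by auto
    qed
    have ncr0: "\<not> crossing E0 ws" using G(5) crossing_mono E0E by blast
    have lenV: "length ws \<le> card V" using G(2,3) V(1) by (metis card_mono distinct_card)
    show ?thesis
    proof (cases "nbrs E0 {a} = {}")
      case True
      have aE0: "a \<notin> e" if "e \<in> E0" for e
      proof
        assume "a \<in> e"
        moreover have "card e = 2" using that E0E V by auto
        ultimately obtain b where "e = {a, b}" "a \<noteq> b" by (metis card_2_iff insertE insert_commute singletonD)
        then show False using True that by (auto simp: nbrs_def)
      qed
      have fg: "finite_graph (V - {a}) E0"
        using V E0E aE0 unfolding finite_graph_def by auto
      have dws: "distinct (xs @ ys)" "set (xs @ ys) \<subseteq> V - {a}" using G(2,3) ws by auto
      have "V - {a} - set (xs @ ys) = V - set ws" using ws by auto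
      then have "reduced (V - {a}) E0 (set (xs @ ys))" using red0 unfolding reduced_def by auto
      moreover have "\<not> crossing E0 (xs @ ys)" using ncr0 crossing_insert ws by metis
      moreover have aV: "a \<in> V" using G(3) ws by auto
      then have "2 * card (V - {a}) - length (xs @ ys) < 2 * card V - length ws"
        using lenV V(1) ws by (simp add: card_Diff_singleton)
      ultimately have "drawable (V - {a}) E0 (xs @ ys)" using less.hyps fg dws by blast
      then have "drawable (insert a (V - {a})) E0 (xs @ a # ys)"
        using dws E0V aE0 by (intro drawable_add_vertex) auto
      then show ?thesis using reduce ws aV by (simp add: insert_absorb)
    next
      case False
      \<comment> \<open>Rotate \<open>a\<close> to the end, where the insertion lemma applies;
        afterwards the list is rotated back.\<close>
      let ?ws' = "ys @ xs @ [a]"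
      have set': "set ?ws' = set ws" using ws by auto
      have n': "\<not> crossing E0 ?ws'" using ncr0 ws crossing_rotate[of E0 ys "xs @ [a]"] by auto
      have r': "reduced V E0 (set ?ws')" using red0 unfolding reduced_def set' by blast
      have d': "distinct ?ws'" "set ?ws' \<subseteq> V" using G(2,3) ws by auto
      have nb': "nbrs E0 {a} \<inter> set ?ws' = {}" using nb unfolding set' .
      have "?ws' = (ys @ xs) @ [a]" by simp
      from insert_after_last[OF V(1) E0V d' r' n' this False nb']
      obtain u where u: "u \<in> V - set ws" "\<not> crossing E0 (?ws' @ [u])"
        unfolding set' by blast
      have ncr: "\<not> crossing E0 (xs @ a # u # ys)"
        using u(2) crossing_rotate[of E0 "xs @ [a, u]" ys] by auto
      have "distinct (xs @ a # u # ys)" "set (xs @ a # u # ys) \<subseteq> V" using u G(2,3) ws by auto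
      moreover have "finite_graph V E0" using V E0E unfolding finite_graph_def by auto
      moreover have "reduced V E0 (set (xs @ a # u # ys))" using red0 ws unfolding reduced_def by auto
      moreover have "2 * card V - length (xs @ a # u # ys) < 2 * card V - length ws"
      proof -
        have "set (u # ws) \<subseteq> V" "distinct (u # ws)" using u G(2,3) by auto
        then have "Suc (length ws) \<le> card V" using V(1) by (metis card_mono distinct_card length_Cons)
        then show ?thesis using ws by auto
      qed
      ultimately have "drawable V E0 (xs @ a # u # ys)" using less.hyps ncr by blast
      then have "drawable V E0 ((xs @ [a]) @ u # ys)" by simp
      then have "drawable V E0 ws" using drawable_drop ws by fastforce
      then show ?thesis by (rule reduce)
    qed
  qed
qed

section \<open>Small hidden components\<close>

text \<open>The clause \<open>nbrs E C \<subseteq> V'\<close> makes \<open>C\<close> a full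
  component of the complement of \<open>V'\<close>. With at most three attachments such a component
  can serve only one of two disjoint links.\<close>

definition hidden_small :: "'v set \<Rightarrow> 'v set set \<Rightarrow> 'v set \<Rightarrow> bool" where
  "hidden_small V E V' \<longleftrightarrow> (\<forall>C. C \<subseteq> V - V' \<and> C \<noteq> {} \<and> connected_in E C \<and> nbrs E C \<subseteq> V' \<longrightarrow>
     card (nbrs E C) \<le> 3)"

lemma conn_closed:
  "conn E X y z \<Longrightarrow> y \<in> C \<Longrightarrow> nbrs E C \<inter> X = {} \<Longrightarrow> z \<in> C"
  by (induction rule: conn_induct) (auto simp: nbrs_def)

lemma conn_leaves:
  assumes "conn E X y z" "y \<in> D" "z \<notin> D"
  shows "\<exists>t\<in>X. t \<in> nbrs E D"
proof (rule ccontr)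
  assume "\<not> (\<exists>t\<in>X. t \<in> nbrs E D)"
  then have "nbrs E D \<inter> X = {}" by blast
  from conn_closed[OF assms(1,2) this] assms(3) show False by simp
qed

lemma path_induced_edgesD:
  assumes "{u, v} \<in> path_induced_edges E V'"
  shows "u \<in> V'" "v \<in> V'" "u \<noteq> v" "conn E ((- V') \<union> {u, v}) u v"
proof -
  obtain a b p where ab: "{u, v} = {a, b}" "a \<in> V'" "b \<in> V'" "a \<noteq> b" "simple_path_between E a p b"
    "set p \<inter> V' = {a, b}" using assms unfolding path_induced_edges_def by blast
  show "u \<in> V'" "v \<in> V'" "u \<noteq> v" using ab(1-4) by (auto simp: doubleton_eq_iff)
  have "conn E (set p) a b" using ab(5) by (rule path_conn)
  moreover have "set p \<subseteq> (- V') \<union> {u, v}" using ab(1,6) by blast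
  ultimately have "conn E ((- V') \<union> {u, v}) a b" by (rule conn_mono')
  note this conn_sym[OF this]
  moreover have "u = a \<and> v = b \<or> u = b \<and> v = a" using ab(1) by (auto simp: doubleton_eq_iff)
  ultimately show "conn E ((- V') \<union> {u, v}) u v" by metis
qed

lemma path_induced_edges_Pow: "path_induced_edges E V' \<subseteq> Pow V'"
  unfolding path_induced_edges_def by blast

lemma path_induced_edges_card: "e \<in> path_induced_edges E V' \<Longrightarrow> card e = 2"
  unfolding path_induced_edges_def by auto

lemma path_induced_edgeI:
  assumes "{u, v} \<in> E" "u \<in> V'" "v \<in> V'" "u \<noteq> v"
  shows "{u, v} \<in> path_induced_edges E V'"
proof -
  have "simple_path_between E u [u, v] v" "set [u, v] \<inter> V' = {u, v}"
    using assms by (auto simp: simple_path_between_def)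
  then show ?thesis using assms(2-4) unfolding path_induced_edges_def by blast
qed

lemma path_induced_via:
  assumes "C \<inter> V' = {}" "connected_in E C" "u \<in> nbrs E C" "v \<in> nbrs E C" "u \<in> V'" "v \<in> V'" "u \<noteq> v"
  shows "{u, v} \<in> path_induced_edges E V'"
proof -
  obtain c d where cd: "c \<in> C" "{c, u} \<in> E" "d \<in> C" "{d, v} \<in> E" using assms(3,4) by (auto simp: nbrs_def)
  have "conn E (C \<union> {u, v}) u c" using cd by (intro conn_edge) (auto simp: insert_commute)
  also have "conn E (C \<union> {u, v}) c d" by (rule conn_mono'[OF connected_in_conn[OF assms(2) cd(1,3)]]) auto
  also have "conn E (C \<union> {u, v}) d v" using cd by (intro conn_edge) auto
  finally obtain p where p: "simple_path_between E u p v" "set p \<subseteq> C \<union> {u, v}" by (rule conn_path)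
  have "u \<in> set p" "v \<in> set p"
    using p(1) unfolding simple_path_between_def by (metis hd_in_set, metis last_in_set)
  then have "set p \<inter> V' = {u, v}" using p(2) assms by auto
  then show ?thesis unfolding path_induced_edges_def using p(1) assms(5-7) by blast
qed

text \<open>The interior of a path avoiding \<open>V'\<close> is connected and lies in a single
  hidden component, which then has both ends as neighbours.\<close>

lemma path_induced_cases:
  assumes "{u, v} \<in> path_induced_edges E V'" "E \<subseteq> Pow V"
  shows "{u, v} \<in> E \<or> (\<exists>c\<in>V - V'. u \<in> nbrs E {y. conn E (V - V') c y} \<and> v \<in> nbrs E {y. conn E (V - V') c y})"
proof -
  note uv = path_induced_edgesD[OF assms(1)]
  show ?thesis
  proof (cases "{u, v} \<in> E")
    case False
    obtain p where p: "simple_path_between E u p v" "set p \<subseteq> - V' \<union> {u, v}" using conn_path[OF uv(4)] .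
    obtain q where q: "p = u # q" using p(1) by (cases p) (auto simp: simple_path_between_def)
    have "q \<noteq> []" using p q uv(3) by (auto simp: simple_path_between_def)
    then obtain mid where mid: "q = mid @ [v]" using p q by (metis append_butlast_last_id last_ConsR simple_path_between_def)
    have w: "walk E (u # mid @ [v])" and d: "distinct (u # mid @ [v])" using p q mid by (auto simp: simple_path_between_def)
    have "mid \<noteq> []" using w False by auto
    then obtain c mid' where c: "mid = c # mid'" by (cases mid) auto
    have wm: "walk E mid" using w by (auto simp: successively_Cons successively_append_iff split: list.splits)
    have e1: "{u, c} \<in> E" using w c by auto
    have e2: "{last mid, v} \<in> E" using w c by (auto simp: successively_append_iff successively_Cons split: if_splits)
    have "set mid \<subseteq> - V'" using p(2) q mid d by auto
    moreover have cV: "c \<in> V" using e1 assms(2) by auto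
    have "set mid \<subseteq> V" using conn_subset[OF assms(2) cV] walk_conn[OF wm, of c] c by (metis list.set_intros(1) subsetI)
    ultimately have mV: "set mid \<subseteq> V - V'" by auto
    let ?C = "{y. conn E (V - V') c y}"
    have "conn E (V - V') c y" if "y \<in> set mid" for y
      using walk_conn[OF wm, of c y] that c mV conn_mono' by fastforce
    then have "c \<in> ?C" "last mid \<in> ?C" using c by auto
    moreover have "u \<notin> ?C" "v \<notin> ?C" using uv by (auto dest: conn_snd)
    ultimately have "u \<in> nbrs E ?C" "v \<in> nbrs E ?C" using e1 e2 by (auto simp: nbrs_def insert_commute)
    then show ?thesis using mV c by auto
  qed simp
qed

lemma hidden_component:
  assumes "E \<subseteq> Pow V" "hidden_small V E V'" "V' \<subseteq> V" "c \<in> V - V'"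
  defines "C \<equiv> {y. conn E (V - V') c y}"
  shows "connected_in E C" "C \<subseteq> V - V'" "c \<in> C" "nbrs E C \<subseteq> V'" "card (nbrs E C) \<le> 3"
proof -
  show 1: "connected_in E C" unfolding C_def by (rule component_connected)
  show 2: "C \<subseteq> V - V'" unfolding C_def by (auto dest: conn_snd)
  show 3: "c \<in> C" unfolding C_def using assms(4) by simp
  show 4: "nbrs E C \<subseteq> V'" 
    using component_nbrs[of E "V - V'" c] nbrs_subset[OF assms(1)] unfolding C_def by blast
  show "card (nbrs E C) \<le> 3" using assms(2) 1 2 3 4 unfolding hidden_small_def by (metis empty_iff)
qed

text \<open>A link in the path-induced graph is lifted by adding every hidden component with two
  neighbours in it. With at most three neighbours, no component has two in each of two disjoint
  sets, so disjoint links lift to disjoint links.\<close>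

lemma crossing_path_induced:
  assumes V: "finite V" "E \<subseteq> Pow V" "V' \<subseteq> V" "hidden_small V E V'" "set ws \<subseteq> V'"
    and "crossing (path_induced_edges E V') ws"
  shows "crossing E ws"
proof -
  let ?E' = "path_induced_edges E V'"
  obtain S T i k j l where C: "i < k" "k < j" "j < l" "l < length ws" "S \<inter> T = {}"
    "conn ?E' S (ws ! i) (ws ! j)" "conn ?E' T (ws ! k) (ws ! l)"
    using assms(6) unfolding crossing_def by blast
  let ?C = "\<lambda>c. {y. conn E (V - V') c y}"
  define lift where "lift S = (S \<inter> V') \<union> {x \<in> V - V'. 2 \<le> card (nbrs E (?C x) \<inter> S)}" for S
  have "lift S \<inter> lift T = {}"
  proof (rule ccontr)
    assume "lift S \<inter> lift T \<noteq> {}"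
    then obtain x where x: "x \<in> V - V'" "2 \<le> card (nbrs E (?C x) \<inter> S)" "2 \<le> card (nbrs E (?C x) \<inter> T)"
      using C(5) by (auto simp: lift_def)
    have fin: "finite (nbrs E (?C x))" by (rule finite_nbrs[OF V(1,2)])
    have "card (nbrs E (?C x) \<inter> S) + card (nbrs E (?C x) \<inter> T) = card ((nbrs E (?C x) \<inter> S) \<union> (nbrs E (?C x) \<inter> T))"
      using C(5) fin by (intro card_Un_disjoint[symmetric]) auto
    also have "\<dots> \<le> card (nbrs E (?C x))" using fin by (intro card_mono) auto
    finally show False using x hidden_component(5)[OF V(2,4,3) x(1)] by linarith
  qed
  moreover have lift: "conn E (lift S) a b" if "conn ?E' S a b" "a \<in> V'" for S a b
    using that(1)
  proof (induction rule: conn_induct)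
    case refl
    then show ?case using that(2) by (simp add: lift_def)
  next
    case (step y z)
    note yz = path_induced_edgesD[OF step.hyps(2)]
    have yS: "y \<in> lift S" "z \<in> lift S" using conn_snd[OF step.hyps(1)] step.hyps(3) yz by (auto simp: lift_def)
    have "conn E (lift S) y z"
    proof (cases "{y, z} \<in> E")
      case True
      then show ?thesis using yS by (intro conn_edge)
    next
      case False
      then obtain c where c: "c \<in> V - V'" "y \<in> nbrs E (?C c)" "z \<in> nbrs E (?C c)"
        using path_induced_cases[OF step.hyps(2) V(2)] by blast
      note hc = hidden_component[OF V(2,4,3) c(1)]
      have "?C x = ?C c" if "x \<in> ?C c" for x
        using that conn_trans[of E "V - V'"] conn_sym[of E "V - V'" c x] by blast
      moreover have "2 \<le> card (nbrs E (?C c) \<inter> S)"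
      proof -
        have "{y, z} \<subseteq> nbrs E (?C c) \<inter> S" using c step conn_snd by auto
        then have "card {y, z} \<le> card (nbrs E (?C c) \<inter> S)"
          using finite_nbrs[OF V(1,2)] by (intro card_mono) auto
        then show ?thesis using yz(3) by simp
      qed
      ultimately have sub: "?C c \<subseteq> lift S" using hc(2) by (auto simp: lift_def)
      obtain d e where de: "d \<in> ?C c" "{d, y} \<in> E" "e \<in> ?C c" "{e, z} \<in> E" using c by (auto simp: nbrs_def)
      have "conn E (lift S) y d" using de sub yS by (intro conn_edge) (auto simp: insert_commute)
      also have "conn E (lift S) d e" by (rule conn_mono'[OF connected_in_conn[OF hc(1) de(1,3)] sub])
      also have "conn E (lift S) e z" using de sub yS by (intro conn_edge) auto
      finally show ?thesis .
    qed
    with step.IH show ?case by (rule conn_trans)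
  qed
  moreover have "ws ! i \<in> V'" "ws ! k \<in> V'" using C V(5) by auto
  ultimately show ?thesis using crossingI[OF C(1-4), of "lift S" "lift T"] C(6,7) by blast
qed

text \<open>\<open>V'\<close> is chosen of least size among the sets that contain \<open>ws\<close>
  and hide only small components. If a connected unmarked \<open>S\<close> had at most three
  neighbours in the path-induced graph, \<open>S\<close> could be hidden too: the component of the
  original graph that swallows \<open>S\<close> has no further neighbours.\<close>

theorem reduction:
  assumes V: "finite V" "E \<subseteq> Pow V" "set ws \<subseteq> V" and ncr: "\<not> crossing E ws"
  obtains V' where "set ws \<subseteq> V'" "V' \<subseteq> V" "hidden_small V E V'"
    "reduced V' (path_induced_edges E V') (set ws)" "\<not> crossing (path_induced_edges E V') ws"
proof -
  define ok where "ok V' \<longleftrightarrow> set ws \<subseteq> V' \<and> V' \<subseteq> V \<and> hidden_small V E V'" for V'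
  have "ok V" using V by (auto simp: ok_def hidden_small_def)
  then obtain V' where V': "ok V'" and min: "\<And>V2. ok V2 \<Longrightarrow> card V' \<le> card V2"
    using ex_has_least_nat[of ok V card] by blast
  have V'V: "set ws \<subseteq> V'" "V' \<subseteq> V" "hidden_small V E V'" using V' by (auto simp: ok_def)
  let ?E' = "path_induced_edges E V'"
  have "reduced V' ?E' (set ws)"
    unfolding reduced_def
  proof (intro allI impI, rule ccontr)
    fix S assume S: "S \<subseteq> V' - set ws \<and> S \<noteq> {} \<and> connected_in ?E' S" and "\<not> 4 \<le> card (nbrs ?E' S)"
    then have c3: "card (nbrs ?E' S) \<le> 3" by simp
    define V2 where "V2 = V' - S"
    have "hidden_small V E V2"
      unfolding hidden_small_def
    proof (intro allI impI)
      fix C assume C: "C \<subseteq> V - V2 \<and> C \<noteq> {} \<and> connected_in E C \<and> nbrs E C \<subseteq> V2"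
      show "card (nbrs E C) \<le> 3"
      proof (cases "C \<inter> S = {}")
        case True
        then have "C \<subseteq> V - V'" "nbrs E C \<subseteq> V'" using C by (auto simp: V2_def)
        then show ?thesis using C V'V(3) unfolding hidden_small_def by blast
      next
        case False
        then obtain s0 where s0: "s0 \<in> C" "s0 \<in> S" by auto
        have closed: "z \<in> C" if "conn E (V - V2) y z" "y \<in> C" for y z
          by (rule conn_closed[OF that]) (use C in auto)
        have "s \<in> C" if "conn ?E' S s0 s" for s
          using that
        proof (induction rule: conn_induct)
          case (step y z)
          have yz: "y \<in> S" "z \<in> S" using step conn_snd by auto
          have "y \<in> V" "z \<in> V" using yz S V'V by auto
          obtain p where p: "simple_path_between E y p z" "set p \<subseteq> - V' \<union> {y, z}"
            using conn_path[OF path_induced_edgesD(4)[OF step.hyps(2)]] .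
          have "conn E (set p) y z" using p(1) by (rule path_conn)
          then have "conn E (set p \<inter> V) y z"
          proof (induction rule: conn_induct)
            case (step a b)
            then have "b \<in> V" using V(2) by auto
            with step show ?case by (auto intro: conn_step)
          qed (use \<open>y \<in> V\<close> in auto)
          moreover have "set p \<inter> V \<subseteq> V - V2" using p(2) yz by (auto simp: V2_def)
          ultimately have "conn E (V - V2) y z" by (rule conn_mono')
          then show ?case using closed step.IH by blast
        qed (use s0 in simp)
        then have SC: "S \<subseteq> C" using S s0 unfolding connected_in_def by blast
        have CV': "x \<in> S" if "x \<in> C" "x \<in> V'" for x using that C by (auto simp: V2_def)
        have "nbrs E C \<subseteq> nbrs ?E' S"
        proof
          fix y assume y: "y \<in> nbrs E C"
          then have yV: "y \<in> V'" "y \<notin> S" using C by (auto simp: V2_def)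
          obtain c where c: "c \<in> C" "{c, y} \<in> E" "y \<notin> C" using y by (auto simp: nbrs_def)
          show "y \<in> nbrs ?E' S"
          proof (cases "c \<in> S")
            case True
            then have "{c, y} \<in> ?E'" using c yV S by (intro path_induced_edgeI) auto
            then show ?thesis using True yV by (auto simp: nbrs_def)
          next
            case False
            then have cV: "c \<in> V - V'" using c C CV' by auto
            let ?D = "{x. conn E (V - V') c x}"
            note hd = hidden_component[OF V(2) V'V(3,2) cV]
            have "s0 \<notin> ?D" using hd(2) s0 S by auto
            moreover have "conn E C c s0" using C c s0 unfolding connected_in_def by blast
            \<comment> \<open>A connection from \<open>c\<close> to \<open>s0\<close> inside
              \<open>C\<close> has to leave the hidden component \<open>?D\<close>, and it does so
              at a vertex \<open>t\<close> of \<open>S\<close>; thus \<open>t\<close> and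
              \<open>y\<close> are both attached to \<open>?D\<close>.\<close>
            ultimately obtain t where t: "t \<in> C" "t \<in> nbrs E ?D" using conn_leaves[OF _ hd(3)] by blast
            have tS: "t \<in> S" using t hd(4) CV' by auto
            have "y \<in> nbrs E ?D" using c hd(2,3) yV by (auto simp: nbrs_def)
            moreover have "t \<noteq> y" using tS yV by auto
            ultimately have "{t, y} \<in> ?E'" using t hd tS S yV by (intro path_induced_via[of ?D]) auto
            then show ?thesis using tS yV by (auto simp: nbrs_def)
          qed
        qed
        moreover have "finite (nbrs ?E' S)"
          using V(1) V'V(2) path_induced_edges_Pow[of E V'] by (intro finite_nbrs[of V']) (auto intro: finite_subset)
        ultimately show ?thesis using c3 card_mono le_trans by blast
      qed
    qed
    moreover have "set ws \<subseteq> V2" "V2 \<subseteq> V" using S V'V by (auto simp: V2_def)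
    ultimately have "card V' \<le> card V2" by (intro min) (simp add: ok_def)
    moreover have "V2 \<subset> V'" using S by (auto simp: V2_def)
    then have "card V2 < card V'" using V(1) V'V(2) by (meson finite_subset psubset_card_mono)
    ultimately show False by simp
  qed
  moreover have "\<not> crossing ?E' ws" using crossing_path_induced[OF V(1,2) V'V(2,3,1)] ncr by blast
  ultimately show ?thesis using that V'V by blast
qed

text \<open>The component of \<open>x\<close> off \<open>X\<close> has all its neighbours in
  \<open>X\<close>, too few for \<open>reduced\<close> unless it contains a marked vertex.\<close>

lemma reduced_escape:
  assumes "finite V" "E \<subseteq> Pow V" "reduced V E W" "x \<in> V" "x \<notin> X" "finite X" "card X \<le> 3"
  obtains w where "w \<in> W" "conn E (V - X) w x"
proof -
  let ?C = "{y. conn E (V - X) x y}"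
  have "?C \<inter> W \<noteq> {}"
  proof
    assume "?C \<inter> W = {}"
    then have "?C \<subseteq> V - W" by (auto dest: conn_snd)
    moreover have "x \<in> ?C" using assms by auto
    ultimately have "4 \<le> card (nbrs E ?C)"
      using assms(3) component_connected[of E "V - X" x] unfolding reduced_def by (metis empty_iff)
    moreover have "nbrs E ?C \<subseteq> X"
      using component_nbrs[of E "V - X" x] nbrs_subset[OF assms(2), of ?C] by blast
    ultimately show False using card_mono[OF assms(6), of "nbrs E ?C"] assms(7) by auto
  qed
  then obtain w where w: "w \<in> W" "conn E (V - X) x w" by auto
  from that[OF w(1) conn_sym[OF w(2)]] show ?thesis .
qed

lemma reduced_ab_path:
  assumes "finite V" "E \<subseteq> Pow V" "reduced V E W" "B \<subseteq> V" "4 \<le> card B" "finite X" "card X \<le> 3"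
  shows "\<exists>p. ab_path E W B p \<and> set p \<inter> X = {}"
proof -
  have "\<not> B \<subseteq> X" using card_mono[OF assms(6), of B] assms(5,7) by auto
  then obtain x where x: "x \<in> B" "x \<notin> X" by auto
  obtain w where w: "w \<in> W" "conn E (V - X) w x"
    using reduced_escape[OF assms(1-3) _ x(2) assms(6,7)] x assms(4) by blast
  obtain p where p: "simple_path_between E w p x" "set p \<subseteq> V - X" using conn_path[OF w(2)] .
  have "\<exists>y\<in>set p. y \<in> B" using p x by (intro bexI[of _ x]) (auto simp: simple_path_between_def)
  then obtain p1 y p2 where p12: "p = p1 @ y # p2" "y \<in> B" "\<forall>v\<in>set p1. v \<notin> B"
    using split_list_first_prop[of p "\<lambda>y. y \<in> B"] by blast
  then have "ab_path E W B (p1 @ [y])"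
    using p w walk_prefix[of E p1 y p2] by (cases p1) (auto simp: ab_path_def simple_path_between_def)
  then show ?thesis using p p12 by (intro exI[of _ "p1 @ [y]"]) auto
qed

text \<open>Menger's augmentation started from the empty family: as long as there are fewer than
  four paths, the sets to be avoided have at most three vertices, and \<open>reduced\<close>
  provides a path around them.\<close>

lemma reduced_four_paths:
  assumes V: "finite V" "E \<subseteq> Pow V" "reduced V E W" "W \<subseteq> V" "B \<subseteq> V" "4 \<le> card B"
  shows "\<exists>Q. finite Q \<and> card Q = 4 \<and> (\<forall>p\<in>Q. ab_path E W B p) \<and> disjoint_paths Q"
proof -
  have "n \<le> 4 \<Longrightarrow> \<exists>Q. finite Q \<and> card Q = n \<and> (\<forall>p\<in>Q. ab_path E W B p) \<and> disjoint_paths Q" for n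
  proof (induction n)
    case 0
    show ?case by (intro exI[of _ "{}"]) (auto simp: disjoint_paths_def)
  next
    case (Suc n)
    then obtain Q where Q: "finite Q" "card Q = n" "\<forall>p\<in>Q. ab_path E W B p" "disjoint_paths Q" by auto
    have "\<exists>p. ab_path E W B p \<and> set p \<inter> X = {}" if "finite X" "card X \<le> card Q" for X
      using reduced_ab_path[OF V(1-3,5,6) that(1)] that(2) Q(2) Suc.prems by simp
    from menger_augment[OF V(1,5,4,2) Q(1,3,4) this] show ?case using Q(2) by auto
  qed
  then show ?thesis by simp
qed

lemma four_sorted:
  fixes X :: "nat set"
  assumes "card X = 4"
  obtains i k j l where "X = {i, k, j, l}" "i < k" "k < j" "j < l"
proof -
  have fin: "finite X" using assms card.infinite by fastforce
  define xs where "xs = sorted_list_of_set X"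
  have xs: "sorted_wrt (<) xs" "set xs = X" "length xs = 4"
    using fin assms by (simp_all add: xs_def)
  then obtain i k j l where "xs = [i, k, j, l]"
    by (auto simp: numeral_eq_Suc length_Suc_conv)
  then show ?thesis using that xs by auto
qed

text \<open>Two adjacent vertices with the same further neighbours cannot both survive: four disjoint
  paths lead from their neighbourhood to \<open>ws\<close>, and the two vertices link these crosswise.\<close>

lemma twins_crossing:
  assumes V: "finite V" "E \<subseteq> Pow V" "reduced V E (set ws)" "set ws \<subseteq> V"
    and xy: "{x, y} \<subseteq> V - set ws" "{x, y} \<in> E" "x \<noteq> y"
    and twin: "\<And>a. a \<noteq> x \<Longrightarrow> a \<noteq> y \<Longrightarrow> {x, a} \<in> E \<longleftrightarrow> {y, a} \<in> E"
  shows "crossing E ws"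
proof -
  let ?A = "nbrs E {x, y}"
  have "connected_in E {x, y}" using xy unfolding connected_in_def
    by (auto intro!: conn_edge simp: insert_commute)
  then have A4: "4 \<le> card ?A" using V(3) xy unfolding reduced_def by blast
  obtain Q where Q: "finite Q" "card Q = 4" "\<forall>p\<in>Q. ab_path E (set ws) ?A p" "disjoint_paths Q"
    using reduced_four_paths[OF V(1-4) nbrs_subset[OF V(2)] A4] by blast
  have adj: "{x, a} \<in> E" "{y, a} \<in> E" "a \<notin> {x, y}" if "a \<in> ?A" for a
    using that twin[of a] by (auto simp: nbrs_def)
  \<comment> \<open>A path from \<open>ws\<close> would pass a vertex of \<open>?A\<close> before
    entering \<open>{x, y}\<close>, but it meets \<open>?A\<close> only at its end.\<close>
  have avoid: "set p \<inter> {x, y} = {}" if p: "p \<in> Q" for p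
  proof (rule ccontr)
    assume ne: "set p \<inter> {x, y} \<noteq> {}"
    have ab: "ab_path E (set ws) ?A p" using Q(3) p by blast
    from ne have "\<exists>z\<in>set p. z \<in> {x, y}" by blast
    then obtain p1 z p2 where p12: "p = p1 @ z # p2" "z \<in> {x, y}" "\<forall>v\<in>set p1. v \<notin> {x, y}"
      using split_list_first_prop[of p "\<lambda>z. z \<in> {x, y}"] by blast
    have "p1 \<noteq> []" using ab p12 xy(1) by (auto simp: ab_path_def)
    then obtain p1' t where t: "p1 = p1' @ [t]" by (metis rev_exhaust)
    have "{t, z} \<in> E" using ab p12 t by (auto simp: ab_path_def successively_append_iff)
    then have "t \<in> ?A" using p12 t by (auto simp: nbrs_def insert_commute)
    moreover have "t \<in> set (butlast p)" using p12 t by (auto simp: butlast_append)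
    ultimately show False using ab by (auto simp: ab_path_def)
  qed
  have nilQ: "[] \<notin> Q" using Q by (auto simp: ab_path_def)
  have "\<exists>e<length ws. ws ! e = hd p" if "p \<in> Q" for p
  proof -
    have "hd p \<in> set ws" using Q(3) that by (auto simp: ab_path_def)
    then show ?thesis by (meson in_set_conv_nth)
  qed
  then obtain e where e: "\<And>p. p \<in> Q \<Longrightarrow> e p < length ws \<and> ws ! e p = hd p" by metis
  have "inj_on e Q"
  proof (rule inj_onI, rule ccontr)
    fix p q assume pq: "p \<in> Q" "q \<in> Q" "e p = e q" "p \<noteq> q"
    have "hd p = hd q" using e[OF pq(1)] e[OF pq(2)] pq(3) by simp
    moreover have "set p \<inter> set q = {}" using Q(4) pq unfolding disjoint_paths_def by blast
    moreover have "p \<noteq> []" "q \<noteq> []" using nilQ pq by auto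
    ultimately show False by (metis disjoint_iff hd_in_set)
  qed
  then have "card (e ` Q) = 4" using Q(2) by (simp add: card_image)
  then obtain i k j l where ikjl: "e ` Q = {i, k, j, l}" "i < k" "k < j" "j < l" by (rule four_sorted)
  have ex: "\<exists>p\<in>Q. e p = m" if "m \<in> {i, k, j, l}" for m
    using that ikjl(1) by (metis imageE)
  obtain pi' where pi': "pi' \<in> Q" "e pi' = i" using ex[of i] by auto
  obtain pk where pk: "pk \<in> Q" "e pk = k" using ex[of k] by auto
  obtain pj where pj: "pj \<in> Q" "e pj = j" using ex[of j] by auto
  obtain pl where pl: "pl \<in> Q" "e pl = l" using ex[of l] by auto
  note p = pi' pk pj pl
  have ne: "pi' \<noteq> pk" "pi' \<noteq> pl" "pj \<noteq> pk" "pj \<noteq> pl" using p ikjl by auto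
  have dis: "set p \<inter> set q = {}" if "p \<in> Q" "q \<in> Q" "p \<noteq> q" for p q
    using Q(4) that unfolding disjoint_paths_def by blast
  have pq: "conn E (set p \<union> ({v} \<union> set q)) (hd p) (hd q)" if "p \<in> Q" "q \<in> Q" "v \<in> {x, y}" for p q v
  proof -
    have ab: "ab_path E (set ws) ?A p" "ab_path E (set ws) ?A q" using Q(3) that by auto
    have pn: "p \<noteq> []" "q \<noteq> []" using nilQ that by auto
    let ?S = "set p \<union> ({v} \<union> set q)"
    have "conn E ?S (hd p) (last p)"
      by (rule conn_mono'[OF walk_conn[of E p]]) (use ab pn in \<open>auto simp: ab_path_def\<close>)
    also have "conn E ?S (last p) v"
      using adj[of "last p"] ab pn that(3) by (intro conn_edge) (auto simp: ab_path_def insert_commute)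
    also have "conn E ?S v (last q)"
      using adj[of "last q"] ab pn that(3) by (intro conn_edge) (auto simp: ab_path_def)
    also have "conn E ?S (last q) (hd q)"
      by (rule conn_mono'[OF walk_conn[of E q]]) (use ab pn in \<open>auto simp: ab_path_def\<close>)
    finally show ?thesis .
  qed
  let ?S = "set pi' \<union> ({x} \<union> set pj)" and ?T = "set pk \<union> ({y} \<union> set pl)"
  have "?S \<inter> ?T = {}"
  proof -
    have "x \<notin> set q \<and> y \<notin> set q" if "q \<in> Q" for q using avoid[OF that] by auto
    then show ?thesis
      using dis[OF p(1,3) ne(1)] dis[OF p(1,7) ne(2)] dis[OF p(5,3) ne(3)] dis[OF p(5,7) ne(4)] p(1,3,5,7) xy(3)
      by (simp add: Int_Un_distrib Int_Un_distrib2)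
  qed
  moreover have "conn E ?S (ws ! i) (ws ! j)" "conn E ?T (ws ! k) (ws ! l)"
    using pq[OF p(1,5), of x] pq[OF p(3,7), of y] e[OF p(1)] e[OF p(3)] e[OF p(5)] e[OF p(7)] p(2,4,6,8) by simp_all
  moreover have "l < length ws" using e[OF p(7)] p(8) by simp
  ultimately show ?thesis using crossingI[OF ikjl(2-4)] by metis
qed

section \<open>Blowing up the non-Ising vertices\<close>

text \<open>Three copies rather than two: copy \<open>0\<close> may be marked, and the argument that
  hides twins works with a pair of unmarked ones, the copies \<open>1\<close> and
  \<open>2\<close>.\<close>

definition blow_up_vertices :: "('v \<Rightarrow> bool) \<Rightarrow> 'v set \<Rightarrow> ('v \<times> nat) set" where
  "blow_up_vertices h V = {(v, c). v \<in> V \<and> c \<le> 2 \<and> (h v \<longrightarrow> c = 0)}"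

definition blow_up_edges :: "('v \<Rightarrow> bool) \<Rightarrow> 'v set \<Rightarrow> 'v set set \<Rightarrow> ('v \<times> nat) set set" where
  "blow_up_edges h V E = {{x, y} | x y. x \<in> blow_up_vertices h V \<and> y \<in> blow_up_vertices h V \<and> x \<noteq> y \<and>
     ({fst x, fst y} \<in> E \<or> fst x = fst y)}"

lemma finite_blow_up: "finite V \<Longrightarrow> finite (blow_up_vertices h V)"
  by (rule finite_subset[of _ "V \<times> {..2}"]) (auto simp: blow_up_vertices_def)

lemma blow_up_edges_Pow: "blow_up_edges h V E \<subseteq> Pow (blow_up_vertices h V)"
  by (auto simp: blow_up_edges_def)

lemma blow_up_edge_iff:
  "{x, y} \<in> blow_up_edges h V E \<longleftrightarrow> x \<in> blow_up_vertices h V \<and> y \<in> blow_up_vertices h V \<and> x \<noteq> y \<and>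
     ({fst x, fst y} \<in> E \<or> fst x = fst y)"
proof
  assume "{x, y} \<in> blow_up_edges h V E"
  then obtain a b where "{x, y} = {a, b}" "a \<in> blow_up_vertices h V" "b \<in> blow_up_vertices h V" "a \<noteq> b"
    "{fst a, fst b} \<in> E \<or> fst a = fst b"
    unfolding blow_up_edges_def by blast
  then show "x \<in> blow_up_vertices h V \<and> y \<in> blow_up_vertices h V \<and> x \<noteq> y \<and> ({fst x, fst y} \<in> E \<or> fst x = fst y)"
    by (auto simp: doubleton_eq_iff insert_commute)
next
  assume "x \<in> blow_up_vertices h V \<and> y \<in> blow_up_vertices h V \<and> x \<noteq> y \<and> ({fst x, fst y} \<in> E \<or> fst x = fst y)"
  then show "{x, y} \<in> blow_up_edges h V E" unfolding blow_up_edges_def by blast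
qed

lemma path_induced_edgeE:
  assumes "e \<in> path_induced_edges E V'"
  obtains u v p where "e = {u, v}" "u \<in> V'" "v \<in> V'" "u \<noteq> v" "simple_path_between E u p v" "set p \<inter> V' = {u, v}"
  using assms unfolding path_induced_edges_def by blast

lemma path_induced_edge_path:
  assumes "simple_path_between E u p v" "set p \<inter> V' = {u, v}" "u \<noteq> v"
  shows "{u, v} \<in> path_induced_edges E V'"
proof -
  have "u \<in> V'" "v \<in> V'" using assms(2) by blast+
  then show ?thesis unfolding path_induced_edges_def using assms by blast
qed

text \<open>Every non-hard vertex (\<open>\<not> h v\<close>) is replaced by a triangle, so paths may share it freely.
  Copy \<open>0\<close> serves as the endpoint of paths.\<close>

lemma crossing_blow_up:
  assumes E: "E \<subseteq> Pow V" "set ws \<subseteq> V"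
    and meet: "\<And>i k j l p q. \<lbrakk>i < k; k < j; j < l; l < length ws; simple_path_between E (ws ! i) p (ws ! j);
      simple_path_between E (ws ! k) q (ws ! l)\<rbrakk> \<Longrightarrow> \<exists>v\<in>set p \<inter> set q. h v"
  shows "\<not> crossing (blow_up_edges h V E) (map (\<lambda>w. (w, 0)) ws)"
proof
  let ?E = "blow_up_edges h V E" and ?V = "blow_up_vertices h V"
  assume "crossing ?E (map (\<lambda>w. (w, 0)) ws)"
  then obtain S T i k j l where C: "i < k" "k < j" "j < l" "l < length (map (\<lambda>w. (w, 0::nat)) ws)" "S \<inter> T = {}"
    "conn ?E S (map (\<lambda>w. (w, 0)) ws ! i) (map (\<lambda>w. (w, 0)) ws ! j)"
    "conn ?E T (map (\<lambda>w. (w, 0)) ws ! k) (map (\<lambda>w. (w, 0)) ws ! l)"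
    unfolding crossing_def by blast
  have project: "conn E (fst ` (S \<inter> ?V)) (fst x) (fst y)" if "conn ?E S x y" "x \<in> ?V" for S x y
    using that(1)
  proof (induction rule: conn_induct)
    case refl
    then show ?case using that(2) by simp
  next
    case (step y z)
    have yz: "z \<in> ?V" "{fst y, fst z} \<in> E \<or> fst y = fst z"
      using step.hyps(2) unfolding blow_up_edge_iff by auto
    then have "fst z \<in> fst ` (S \<inter> ?V)" using step.hyps(3) by blast
    then show ?case using yz(2) step.IH by (auto intro: conn_step)
  qed
  have len: "i < length ws" "k < length ws" "j < length ws" "l < length ws" using C by auto
  have V0: "(ws ! m, 0) \<in> ?V" if "m < length ws" for m
    using E(2) that nth_mem by (fastforce simp: blow_up_vertices_def)
  have "conn E (fst ` (S \<inter> ?V)) (ws ! i) (ws ! j)" "conn E (fst ` (T \<inter> ?V)) (ws ! k) (ws ! l)"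
    using project[OF C(6)] project[OF C(7)] V0 len by auto
  then obtain p q where pq: "simple_path_between E (ws ! i) p (ws ! j)" "set p \<subseteq> fst ` (S \<inter> ?V)"
    "simple_path_between E (ws ! k) q (ws ! l)" "set q \<subseteq> fst ` (T \<inter> ?V)"
    using conn_path by metis
  then obtain v where v: "v \<in> set p" "v \<in> set q" "h v" using meet[OF C(1-3) len(4) pq(1,3)] by blast
  then have "v \<in> fst ` (S \<inter> ?V)" "v \<in> fst ` (T \<inter> ?V)" using pq by auto
  then have "(v, 0) \<in> S" "(v, 0) \<in> T" using v(3) by (auto simp: blow_up_vertices_def)
  then show False using C(5) by blast
qed

text \<open>A path-induced edge at \<open>x\<close> is an edge of the graph or passes through a
  hidden component attached to \<open>x\<close>; either way the twin \<open>y\<close> has the same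
  attachment.\<close>

lemma twin_neighbours:
  assumes E: "E \<subseteq> Pow V" and V': "V' \<subseteq> V"
    and twin: "{x, y} \<in> E" "x \<noteq> y" "\<And>a. a \<noteq> x \<Longrightarrow> a \<noteq> y \<Longrightarrow> {x, a} \<in> E \<Longrightarrow> {y, a} \<in> E"
    and xy: "x \<in> V'" "y \<in> V'" and a: "a \<noteq> x" "a \<noteq> y" "{x, a} \<in> path_induced_edges E V'"
  shows "{y, a} \<in> path_induced_edges E V'"
proof -
  note xa = path_induced_edgesD[OF a(3)]
  show ?thesis
  proof (cases "{x, a} \<in> E")
    case True
    then show ?thesis using twin(3) a xa xy by (intro path_induced_edgeI) auto
  next
    case False
    then obtain c where c: "c \<in> V - V'" "x \<in> nbrs E {y. conn E (V - V') c y}" "a \<in> nbrs E {y. conn E (V - V') c y}"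
      using path_induced_cases[OF a(3) E] by blast
    let ?C = "{y. conn E (V - V') c y}"
    obtain d where d: "d \<in> ?C" "{d, x} \<in> E" using c(2) by (auto simp: nbrs_def)
    have C: "?C \<inter> V' = {}" by (auto dest: conn_snd)
    then have "{y, d} \<in> E" using d twin(3)[of d] xy by (auto simp: insert_commute)
    then have "y \<in> nbrs E ?C" using d(1) C xy by (auto simp: nbrs_def insert_commute)
    then show ?thesis using component_connected[of E "V - V'" c] C c(3) xy a xa
      by (intro path_induced_via[of ?C]) auto
  qed
qed

text \<open>A hidden twin \<open>y\<close> sees everything that \<open>x\<close> sees: each
  path-induced neighbour of \<open>x\<close> is attached to the hidden component of
  \<open>y\<close>, and this has at most three neighbours.\<close>

lemma hidden_twin_small:
  assumes E: "finite V" "E \<subseteq> Pow V" and V': "V' \<subseteq> V" "hidden_small V E V'"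
    and twin: "\<And>a. a \<noteq> x \<Longrightarrow> a \<noteq> y \<Longrightarrow> {x, a} \<in> E \<Longrightarrow> {y, a} \<in> E" "{x, y} \<in> E"
    and xy: "x \<in> V'" "y \<in> V - V'"
  shows "card (nbrs (path_induced_edges E V') {x}) \<le> 3"
proof -
  let ?C = "{z. conn E (V - V') y z}"
  note hc = hidden_component[OF E(2) V'(2,1) xy(2)]
  have "nbrs (path_induced_edges E V') {x} \<subseteq> nbrs E ?C"
  proof
    fix a assume "a \<in> nbrs (path_induced_edges E V') {x}"
    then have a: "a \<noteq> x" "{x, a} \<in> path_induced_edges E V'" by (auto simp: nbrs_def)
    note xa = path_induced_edgesD[OF a(2)]
    have ay: "a \<noteq> y" using xa xy by auto
    show "a \<in> nbrs E ?C"
    proof (cases "{x, a} \<in> E")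
      case True
      then have "{y, a} \<in> E" using twin(1) a ay by blast
      then show ?thesis using hc(2,3) xa by (auto simp: nbrs_def)
    next
      case False
      then obtain c where c: "c \<in> V - V'" "x \<in> nbrs E {y. conn E (V - V') c y}" "a \<in> nbrs E {y. conn E (V - V') c y}"
        using path_induced_cases[OF a(2) E(2)] by blast
      obtain d where d: "conn E (V - V') c d" "{d, x} \<in> E" using c(2) by (auto simp: nbrs_def)
      have dV: "d \<in> V - V'" using conn_snd[OF d(1)] .
      have "d = y \<or> {y, d} \<in> E" using twin(1)[of d] d dV xy by (auto simp: insert_commute)
      then have "conn E (V - V') y d" using dV xy by (auto intro: conn_edge)
      then have yc: "conn E (V - V') y c" using conn_sym[OF d(1)] by (rule conn_trans)
      have "{z. conn E (V - V') c z} = ?C"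
        using conn_trans[OF yc] conn_trans[OF conn_sym[OF yc]] by blast
      then show ?thesis using c(3) by simp
    qed
  qed
  then show ?thesis using hc(5) card_mono[OF finite_nbrs[OF E], of _ ?C] le_trans by blast
qed

text \<open>The kept vertices \<open>K\<close> are hard; a component \<open>C\<close> of the rest communicates with at most three
  terminals, its neighbours and the vertices of \<open>ws\<close> inside it.\<close>

theorem planar_decomposition:
  assumes G: "finite_graph V E" and ws: "distinct ws" "set ws \<subseteq> V"
    and meet: "\<And>i k j l p q. \<lbrakk>i < k; k < j; j < l; l < length ws; simple_path_between E (ws ! i) p (ws ! j);
      simple_path_between E (ws ! k) q (ws ! l)\<rbrakk> \<Longrightarrow> \<exists>v\<in>set p \<inter> set q. h v"
  obtains K where "K \<subseteq> V" "\<And>v. v \<in> K \<Longrightarrow> h v"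
    "\<And>C. C \<subseteq> V - K \<Longrightarrow> C \<noteq> {} \<Longrightarrow> connected_in E C \<Longrightarrow> nbrs E C \<subseteq> K \<Longrightarrow>
       card (nbrs E C) + card (C \<inter> set ws) \<le> 3"
    "planar_with_on_face (K \<union> set ws) (path_induced_edges E (K \<union> set ws)) (set ws)"
proof -
  let ?H = "blow_up_edges h V E" and ?V = "blow_up_vertices h V"
  let ?f = "\<lambda>v. (v, 0::nat)"
  define wz where "wz = map ?f ws"
  have V: "finite V" "E \<subseteq> Pow V" "\<And>e. e \<in> E \<Longrightarrow> card e = 2" using G by (auto simp: finite_graph_def)
  have fH: "finite ?V" using V by (simp add: finite_blow_up)
  have HP: "?H \<subseteq> Pow ?V" by (rule blow_up_edges_Pow)
  have wzV: "set wz \<subseteq> ?V" using ws(2) by (auto simp: wz_def blow_up_vertices_def)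
  have dwz: "distinct wz" using ws(1) by (auto simp: wz_def distinct_map inj_on_def)
  have "\<not> crossing ?H wz" unfolding wz_def by (rule crossing_blow_up[OF V(2) ws(2) meet])
  then obtain V' where V': "set wz \<subseteq> V'" "V' \<subseteq> ?V" "hidden_small ?V ?H V'"
    "reduced V' (path_induced_edges ?H V') (set wz)" "\<not> crossing (path_induced_edges ?H V') wz"
    using reduction[OF fH HP wzV] by blast
  let ?E' = "path_induced_edges ?H V'"
  have fV': "finite V'" using V'(2) fH finite_subset by blast
  have twin: "{(x, d), a} \<in> ?H" if "{(x, c), a} \<in> ?H" "a \<noteq> (x, d)" "(x, d) \<in> ?V" for x c d a
    using that unfolding blow_up_edge_iff by auto
  have adj: "{(x, c), (x, d)} \<in> ?H" if "(x, c) \<in> ?V" "(x, d) \<in> ?V" "c \<noteq> d" for x c d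
    using that unfolding blow_up_edge_iff by auto
  have copies: "(x, c) \<in> ?V" if "x \<in> V" "\<not> h x" "c \<le> 2" for x c
    using that by (auto simp: blow_up_vertices_def)
  \<comment> \<open>An unmarked kept copy with a hidden twin would have at most three neighbours,
    against \<open>reduced\<close>.\<close>
  have only_W: "(x, d) \<in> set wz" if x: "(x, d) \<in> V'" "(x, c) \<in> ?V - V'" for x c d
  proof (rule ccontr)
    assume W: "(x, d) \<notin> set wz"
    have cd: "(x, d) \<in> ?V" "(x, c) \<in> ?V" "c \<noteq> d" using x V'(2) by auto
    have "card (nbrs ?E' {(x, d)}) \<le> 3"
      using hidden_twin_small[OF fH HP V'(2,3) _ _ x] twin[of x d _ c] adj[OF cd(1,2)] cd by metis
    moreover have "connected_in ?E' {(x, d)}" by (simp add: connected_in_def)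
    then have "4 \<le> card (nbrs ?E' {(x, d)})"
      using V'(4)[unfolded reduced_def, rule_format, of "{(x, d)}"] W x(1) by simp
    ultimately show False by linarith
  qed
  \<comment> \<open>Copies \<open>1\<close> and \<open>2\<close> are never marked, so by the
    previous step they are kept together or hidden together. If kept, they are adjacent twins of the
    path-induced graph and produce a crossing.\<close>
  have hidden: "(x, 1) \<notin> V' \<and> (x, 2) \<notin> V'" if x: "x \<in> V" "\<not> h x" for x
  proof (rule ccontr)
    assume "\<not> ((x, 1) \<notin> V' \<and> (x, 2) \<notin> V')"
    moreover have nW: "(x, 1) \<notin> set wz" "(x, 2) \<notin> set wz" by (auto simp: wz_def)
    ultimately have "(x, 1) \<in> V'" "(x, 2) \<in> V'"
      using only_W[of x 1 2] only_W[of x 2 1] copies[OF x] by auto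
    moreover have "{(x, 1), a} \<in> ?E' \<longleftrightarrow> {(x, 2), a} \<in> ?E'" if "a \<noteq> (x, 1)" "a \<noteq> (x, 2)" for a
      using twin_neighbours[OF HP V'(2) _ _ _ calculation that]
        twin_neighbours[OF HP V'(2) _ _ _ calculation(2,1) that(2,1)]
        adj[of x 1 2] adj[of x 2 1] copies[OF x] twin[of x 1 _ 2] twin[of x 2 _ 1] by auto
    moreover have "{(x, 1), (x, 2)} \<in> ?E'"
      using calculation(1,2) adj[of x 1 2] copies[OF x] by (intro path_induced_edgeI) auto
    ultimately have "crossing ?E' wz"
      using nW by (intro twins_crossing[OF fV' path_induced_edges_Pow V'(4,1), of "(x, 1)" "(x, 2)"]) auto
    then show False using V'(5) by simp
  qed
  define K where "K = {v \<in> V. h v \<and> (v, 0) \<in> V'}"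
  have V'eq: "V' = ?f ` (K \<union> set ws)"
  proof
    show "V' \<subseteq> ?f ` (K \<union> set ws)"
    proof
      fix y assume y: "y \<in> V'"
      obtain x c where yx: "y = (x, c)" by (cases y)
      have x: "x \<in> V" "c \<le> 2" "h x \<longrightarrow> c = 0" using y yx V'(2) by (auto simp: blow_up_vertices_def)
      show "y \<in> ?f ` (K \<union> set ws)"
      proof (cases "h x")
        case True
        then show ?thesis using x y yx by (auto simp: K_def)
      next
        case False
        then have "(x, 1) \<in> ?V - V'" using hidden[OF x(1)] copies[OF x(1)] by auto
        then have "y \<in> set wz" using only_W[of x c 1] y yx by simp
        then show ?thesis by (auto simp: wz_def)
      qed
    qed
    show "?f ` (K \<union> set ws) \<subseteq> V'" using V'(1) by (auto simp: K_def wz_def)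
  qed
  have KW: "w \<in> K" if "w \<in> set ws" "h w" for w using that V'(1) ws(2) by (auto simp: K_def wz_def)
  have "planar_with_on_face (K \<union> set ws) (path_induced_edges E (K \<union> set ws)) (set ws)"
  proof (rule drawable_planar_with_on_face)
    have fg: "finite_graph V' ?E'"
      using fV' path_induced_edges_Pow[of ?H V'] path_induced_edges_card[of _ ?H V'] unfolding finite_graph_def by blast
    have dr: "drawable V' ?E' (map ?f ws)"
      using reduced_drawable[OF fg dwz V'(1,4,5)] by (simp add: wz_def)
    show "drawable (K \<union> set ws) (path_induced_edges E (K \<union> set ws)) ws"
    proof (rule drawable_relabel[OF dr])
      show "inj_on ?f (K \<union> set ws)" by (auto simp: inj_on_def)
      show "?f ` (K \<union> set ws) \<subseteq> V'" using V'eq by simp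
      fix e assume e: "e \<in> path_induced_edges E (K \<union> set ws)"
      then obtain u v p where uv: "e = {u, v}" "u \<in> K \<union> set ws" "v \<in> K \<union> set ws" "u \<noteq> v"
        "simple_path_between E u p v" "set p \<inter> (K \<union> set ws) = {u, v}"
        by (rule path_induced_edgeE)
      \<comment> \<open>The path is lifted to the blow-up: its ends and the hard vertices use copy
        \<open>0\<close>, the remaining vertices use copy \<open>1\<close>, which is never in
        \<open>V'\<close>.\<close>
      define g where "g x = (x, if x \<in> K \<union> set ws \<or> h x then 0 else 1::nat)" for x
      have pV: "set p \<subseteq> V"
      proof
        fix y assume "y \<in> set p"
        moreover have "u \<in> set p" using uv(6) by blast
        moreover have "walk E p" using uv(5) by (simp add: simple_path_between_def)
        ultimately have uy: "conn E (set p) u y" by (intro walk_conn)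
        have "u \<in> V" using uv(2) ws(2) by (auto simp: K_def)
        then show "y \<in> V" using conn_subset[OF V(2) _ uy] by blast
      qed
      have gV: "g x \<in> ?V" if "x \<in> set p" for x using that pV by (auto simp: g_def blow_up_vertices_def K_def)
      have "simple_path_between ?H (g u) (map g p) (g v)"
      proof -
        have "distinct (map g p)" using uv(5) by (auto simp: distinct_map inj_on_def g_def simple_path_between_def)
        moreover have "walk ?H (map g p)"
          unfolding successively_map
        proof (rule successively_mono[where P = "\<lambda>x y. {x, y} \<in> E"])
          show "walk E p" using uv(5) by (simp add: simple_path_between_def)
          fix x y assume xy: "x \<in> set p" "y \<in> set p" "{x, y} \<in> E"
          then have "x \<noteq> y" using V(3) by fastforce
          then show "{g x, g y} \<in> ?H" using xy gV unfolding blow_up_edge_iff by (auto simp: g_def)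
        qed
        ultimately show ?thesis using uv(5) by (auto simp: simple_path_between_def hd_map last_map)
      qed
      moreover have guv: "g u = (u, 0)" "g v = (v, 0)" using uv by (auto simp: g_def)
      moreover have "set (map g p) \<inter> V' = {(u, 0), (v, 0)}"
      proof
        show "set (map g p) \<inter> V' \<subseteq> {(u, 0), (v, 0)}"
          using uv(6) unfolding V'eq g_def by auto
        have "u \<in> set p" "v \<in> set p" using uv(6) by blast+
        then show "{(u, 0), (v, 0)} \<subseteq> set (map g p) \<inter> V'" using guv uv(2,3) V'eq by force
      qed
      ultimately have "{(u, 0), (v, 0)} \<in> ?E'"
        using uv(4) by (intro path_induced_edge_path[of _ "(u, 0)" "map g p"]) simp_all
      then show "e \<subseteq> K \<union> set ws \<and> ?f ` e \<in> ?E'" using uv by auto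
    qed
  qed auto
  moreover have "card (nbrs E C) + card (C \<inter> set ws) \<le> 3"
    if C: "C \<subseteq> V - K" "C \<noteq> {}" "connected_in E C" "nbrs E C \<subseteq> K" for C
  proof -
    \<comment> \<open>The hidden copies over \<open>C\<close>. The neighbours of \<open>C\<close>
      and its marked vertices all appear as distinct neighbours of \<open>C'\<close>, through their
      copies \<open>0\<close>; this turns the bound on neighbours into a bound on terminals.\<close>
    define C' where "C' = {y \<in> ?V - V'. fst y \<in> C}"
    have hid: "\<exists>c. (v, c) \<in> C'" if "v \<in> C" for v
    proof (cases "h v")
      case True
      have "v \<in> V" "v \<notin> K" using that C(1) by blast+
      then have "(v, 0) \<in> ?V" "(v, 0) \<notin> V'" using True by (simp_all add: blow_up_vertices_def K_def)
      then show ?thesis using that by (intro exI[of _ 0]) (simp add: C'_def)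
    next
      case False
      have "v \<in> V" using that C(1) by blast
      then have "(v, 1) \<in> ?V" "(v, 1) \<notin> V'" using False hidden[of v] copies[of v 1] by simp_all
      then show ?thesis using that by (intro exI[of _ 1]) (simp add: C'_def)
    qed
    have "C' \<noteq> {}" using C(2) hid by blast
    have lift: "conn ?H C' y (v, c)" if "conn E C (fst y) v" "y \<in> C'" "(v, c) \<in> C'" for y v c
      using that(1,3)
    proof (induction arbitrary: c rule: conn_induct)
      case refl
      show ?case
      proof (cases "snd y = c")
        case True
        then have "y = (fst y, c)" by (simp add: prod_eq_iff)
        then show ?thesis using that(2) conn_refl by metis
      next
        case False
        have "{(fst y, snd y), (fst y, c)} \<in> ?H"
          using that(2) refl False by (intro adj) (auto simp: C'_def)
        then show ?thesis using that(2) refl by (intro conn_edge) simp_all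
      qed
    next
      case (step u v)
      obtain d where d: "(u, d) \<in> C'" using hid conn_snd[OF step.hyps(1)] by blast
      have "u \<noteq> v" using step.hyps(2) V(3) by fastforce
      have "(u, d) \<in> ?V" "(v, c) \<in> ?V" using d step.prems by (simp_all add: C'_def)
      then have "{(u, d), (v, c)} \<in> ?H"
        unfolding blow_up_edge_iff using \<open>u \<noteq> v\<close> step.hyps(2) by simp
      then show ?case by (rule conn_step[OF step.IH[OF d] _ step.prems])
    qed
    have "connected_in ?H C'"
      unfolding connected_in_def
    proof (intro ballI)
      fix x y assume xy: "x \<in> C'" "y \<in> C'"
      then have "conn E C (fst x) (fst y)" using C(3) by (auto simp: connected_in_def C'_def)
      then show "conn ?H C' x y" using lift[of x "fst y" "snd y"] xy by simp
    qed
    moreover have "nbrs ?H C' \<subseteq> V'"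
    proof
      fix y assume "y \<in> nbrs ?H C'"
      then obtain x where x: "x \<in> C'" "{x, y} \<in> ?H" "y \<notin> C'" by (auto simp: nbrs_def)
      then have y: "y \<in> ?V" "{fst x, fst y} \<in> E \<or> fst x = fst y" by (auto simp: blow_up_edge_iff)
      show "y \<in> V'"
      proof (cases "fst y \<in> C")
        case True
        then show ?thesis using x y by (auto simp: C'_def)
      next
        case False
        then have "fst y \<in> nbrs E C" using x y by (auto simp: nbrs_def C'_def)
        then have "fst y \<in> K" using C(4) by blast
        then show ?thesis using y(1) by (cases y) (auto simp: K_def blow_up_vertices_def)
      qed
    qed
    moreover have "C' \<subseteq> ?V - V'" by (auto simp: C'_def)
    ultimately have c3: "card (nbrs ?H C') \<le> 3" using V'(3) \<open>C' \<noteq> {}\<close> unfolding hidden_small_def by blast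
    have "?f ` (nbrs E C \<union> (C \<inter> set ws)) \<subseteq> nbrs ?H C'"
    proof
      fix y assume "y \<in> ?f ` (nbrs E C \<union> (C \<inter> set ws))"
      then obtain v where v: "y = (v, 0)" "v \<in> nbrs E C \<union> (C \<inter> set ws)" by auto
      have yV': "y \<in> V'" using v C(4) V'eq by auto
      then have yn: "y \<notin> C'" "y \<in> ?V" using V'(2) by (auto simp: C'_def)
      show "y \<in> nbrs ?H C'"
      proof (cases "v \<in> C")
        case True
        then have vC: "v \<in> set ws" using v by (auto simp: nbrs_def)
        obtain c where c: "(v, c) \<in> C'" using hid True by blast
        then have "(v, c) \<noteq> y" using yn(1) by metis
        then have "{(v, c), y} \<in> ?H" using c yn v(1) by (auto simp: blow_up_edge_iff C'_def)
        then show ?thesis using c yn by (auto simp: nbrs_def)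
      next
        case False
        then obtain u where u: "u \<in> C" "{u, v} \<in> E" using v by (auto simp: nbrs_def)
        obtain c where c: "(u, c) \<in> C'" using hid u by blast
        have "u \<noteq> v" using u(1) False by metis
        then have "{(u, c), y} \<in> ?H" using c yn v(1) u(2) by (auto simp: blow_up_edge_iff C'_def)
        then show ?thesis using c yn by (auto simp: nbrs_def)
      qed
    qed
    then have "card (?f ` (nbrs E C \<union> (C \<inter> set ws))) \<le> card (nbrs ?H C')"
      using finite_nbrs[OF fH HP] by (intro card_mono)
    moreover have "card (?f ` (nbrs E C \<union> (C \<inter> set ws))) = card (nbrs E C \<union> (C \<inter> set ws))"
      by (intro card_image) (auto simp: inj_on_def)
    moreover have "card (nbrs E C \<union> (C \<inter> set ws)) = card (nbrs E C) + card (C \<inter> set ws)"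
      using finite_nbrs[OF V(1,2)] by (intro card_Un_disjoint) (auto simp: nbrs_def)
    ultimately show ?thesis using c3 by linarith
  qed
  moreover have "K \<subseteq> V" "\<And>v. v \<in> K \<Longrightarrow> h v" by (auto simp: K_def)
  ultimately show ?thesis using that by blast
qed

section \<open>Reference measures and duplicated variables\<close>

lemma emeasure_ising_measure:
  assumes "A \<in> sets borel" "s > 0"
  shows "emeasure (ising_measure s) A = ennreal ((indicator A s + indicator A (- s)) / 2)"
proof -
  have "emeasure (ising_measure s) A = emeasure (measure_pmf (pmf_of_set {s, - s})) A"
    unfolding ising_measure_def using assms by (subst emeasure_distr) auto
  also have "\<dots> = ennreal (measure (measure_pmf (pmf_of_set {s, - s})) A)"
    by (rule measure_pmf.emeasure_eq_measure)
  also have "measure (measure_pmf (pmf_of_set {s, - s})) A = (indicator A s + indicator A (- s)) / 2"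
    using assms(2) by (subst measure_pmf_of_set) (auto simp: indicator_def card_insert_if)
  finally show ?thesis .
qed

lemma sets_ising_measure [simp]: "sets (ising_measure s) = sets borel"
  by (simp add: ising_measure_def)

lemma space_ising_measure [simp]: "space (ising_measure s) = UNIV"
  by (simp add: ising_measure_def)

lemma integral_ising_measure:
  fixes f :: "real \<Rightarrow> real"
  assumes "f \<in> borel_measurable borel" "s > 0"
  shows "(\<integral>x. f x \<partial>ising_measure s) = (f s + f (- s)) / 2"
proof -
  have "(\<integral>x. f x \<partial>ising_measure s) = (\<integral>x. f x \<partial>measure_pmf (pmf_of_set {s, - s}))"
    unfolding ising_measure_def using assms by (subst integral_distr) auto
  also have "\<dots> = (f s + f (- s)) / 2"
    using assms(2) by (subst integral_pmf_of_set) (auto simp: card_insert_if)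
  finally show ?thesis .
qed

lemma prob_space_ising_measure [simp]: "prob_space (ising_measure s)"
  unfolding ising_measure_def by (intro prob_space.prob_space_distr measure_pmf.prob_space_axioms) auto

lemma AE_ising_measure: "s > 0 \<Longrightarrow> AE x in ising_measure s. x = s \<or> x = - s"
  unfolding ising_measure_def
  by (subst AE_distr_iff) (auto simp: AE_measure_pmf_iff)

lemma integrable_ising_measure:
  fixes f :: "real \<Rightarrow> real"
  assumes "f \<in> borel_measurable borel" "s > 0"
  shows "integrable (ising_measure s) f"
  unfolding ising_measure_def using assms
  by (subst integrable_distr_eq) (auto intro: integrable_measure_pmf_finite)

lemma reference_measure_ising:
  assumes s: "s > 0"
  shows "reference_measure (ising_measure s)"
  unfolding reference_measure_def
proof (intro conjI allI impI)
  show "distr (ising_measure s) borel uminus = ising_measure s"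
  proof (rule measure_eqI)
    fix A assume A: "A \<in> sets (distr (ising_measure s) borel uminus)"
    then have Ab: "A \<in> sets borel" by simp
    have "uminus -` A \<in> sets borel" using measurable_sets[OF borel_measurable_uminus[OF measurable_ident_sets[OF refl]] Ab] by simp
    then show "emeasure (distr (ising_measure s) borel uminus) A = emeasure (ising_measure s) A"
      using Ab s by (subst emeasure_distr)
        (auto simp: emeasure_ising_measure indicator_def measurable_cong_sets[OF sets_ising_measure refl])
  qed simp
  show "ising_measure s \<noteq> return borel 0"
  proof
    assume "ising_measure s = return borel 0"
    then have "emeasure (ising_measure s) {0} = 1" by simp
    then show False using s by (subst (asm) emeasure_ising_measure) auto
  qed
  show "integrable (ising_measure s) (\<lambda>x. exp (\<alpha> * x\<^sup>2))" for \<alpha>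
    using s by (intro integrable_ising_measure) auto
qed auto

lemma abs_le_exp_square: "\<bar>x\<bar> \<le> exp (x\<^sup>2)" for x :: real
proof -
  have "0 \<le> (\<bar>x\<bar> - 1)\<^sup>2" by simp
  then have "2 * \<bar>x\<bar> \<le> 1 + x\<^sup>2" by (simp add: power2_diff)
  moreover have "0 \<le> \<bar>x\<bar>" by simp
  ultimately have "\<bar>x\<bar> \<le> 1 + x\<^sup>2" by (smt (verit) zero_le_power2)
  then show ?thesis using exp_ge_add_one_self[of "x\<^sup>2"] by linarith
qed

text \<open>The assumption covers indices outside \<open>V\<close> as well, so that
  \<open>lam\<close> is a family of probability measures everywhere; the main proof fills in Ising
  measures there.\<close>

locale reference_family =
  fixes V :: "'v set" and lam :: "'v \<Rightarrow> real measure"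
  assumes finite_V: "finite V" and reference: "\<And>v. reference_measure (lam v)"
begin

lemma sets_lam [simp]: "sets (lam v) = sets borel"
  using reference[of v] by (simp add: reference_measure_def)

lemma space_lam [simp]: "space (lam v) = UNIV"
  using sets_eq_imp_space_eq[OF sets_lam[of v]] by simp

lemma prob_space_lam: "prob_space (lam v)"
  using reference[of v] by (simp add: reference_measure_def)

lemma exp_integrable_lam: "\<alpha> \<ge> 0 \<Longrightarrow> integrable (lam v) (\<lambda>x. exp (\<alpha> * x\<^sup>2))"
  using reference[of v] by (simp add: reference_measure_def)

lemma measurable_lam [measurable_cong]: "sets (lam v) = sets borel"
  by simp

interpretation product_prob_space lam V
  by (simp add: product_prob_space_def product_prob_space_axioms_def product_sigma_finite_def
      prob_space_lam prob_space_imp_sigma_finite)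

abbreviation M where "M \<equiv> PiM V lam"

interpretation PS: prob_space M
  by (rule prob_space_PiM) (rule prob_space_lam)

interpretation MM: pair_prob_space M M ..

lemma measurable_coord:
  assumes "v \<in> V"
  shows "(\<lambda>x. x v) \<in> borel_measurable M"
proof -
  have "(\<lambda>x. x v) \<in> measurable M (lam v)" using assms by (rule measurable_component_singleton)
  then show ?thesis by (simp cong: measurable_cong_sets)
qed

definition sq :: "('v \<Rightarrow> real) \<Rightarrow> real" where
  "sq x = (\<Sum>v\<in>V. (x v)\<^sup>2)"

lemma sq_nonneg: "0 \<le> sq x"
  unfolding sq_def by (intro sum_nonneg) auto

lemma measurable_sq: "sq \<in> borel_measurable M"
  unfolding sq_def by (intro borel_measurable_sum borel_measurable_power measurable_coord)

lemma measurable_sq2: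
  "(\<lambda>z. sq (fst z)) \<in> borel_measurable (M \<Otimes>\<^sub>M M)" "(\<lambda>z. sq (snd z)) \<in> borel_measurable (M \<Otimes>\<^sub>M M)"
  using measurable_compose[OF measurable_fst measurable_sq] measurable_compose[OF measurable_snd measurable_sq] by auto

lemma measurable_coord2:
  assumes "v \<in> V"
  shows "(\<lambda>z. fst z v) \<in> borel_measurable (M \<Otimes>\<^sub>M M)" "(\<lambda>z. snd z v) \<in> borel_measurable (M \<Otimes>\<^sub>M M)"
  using measurable_compose[OF measurable_fst measurable_coord[OF assms]]
    measurable_compose[OF measurable_snd measurable_coord[OF assms]] by auto

lemma coord_le_sq: "v \<in> V \<Longrightarrow> (x v)\<^sup>2 \<le> sq x"
  unfolding sq_def using finite_V by (intro member_le_sum) auto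

lemma integrable_exp_sq: "\<alpha> \<ge> 0 \<Longrightarrow> integrable M (\<lambda>x. exp (\<alpha> * sq x))"
  unfolding sq_def sum_distrib_left exp_sum[OF finite_V]
  by (intro product_integrable_prod finite_V exp_integrable_lam)

text \<open>Growth at most \<open>exp (\<alpha> (|x|\<^sup>2 + |y|\<^sup>2))\<close> is integrable for reference measures, and this
  class of functions is closed under products.\<close>

definition tame :: "(('v \<Rightarrow> real) \<times> ('v \<Rightarrow> real) \<Rightarrow> real) \<Rightarrow> bool" where
  "tame f \<longleftrightarrow> f \<in> borel_measurable (M \<Otimes>\<^sub>M M) \<and>
     (\<exists>A\<ge>0. \<exists>\<alpha>\<ge>0. \<forall>x y. \<bar>f (x, y)\<bar> \<le> A * exp (\<alpha> * (sq x + sq y)))"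

lemma integrable_exp_sq2:
  assumes "\<alpha> \<ge> 0"
  shows "integrable (M \<Otimes>\<^sub>M M) (\<lambda>(x, y). exp (\<alpha> * (sq x + sq y)))"
proof (rule MM.Fubini_integrable)
  have *: "exp (\<alpha> * (sq x + sq y)) = exp (\<alpha> * sq x) * exp (\<alpha> * sq y)" for x y
    by (simp add: exp_add distrib_left)
  show "integrable M (\<lambda>x. \<integral>y. norm (case (x, y) of (x, y) \<Rightarrow> exp (\<alpha> * (sq x + sq y))) \<partial>M)"
    using integrable_exp_sq[OF assms] by (simp add: *)
  show "AE x in M. integrable M (\<lambda>y. case (x, y) of (x, y) \<Rightarrow> exp (\<alpha> * (sq x + sq y)))"
    using integrable_exp_sq[OF assms] by (simp add: *)
  show "(\<lambda>(x, y). exp (\<alpha> * (sq x + sq y))) \<in> borel_measurable (M \<Otimes>\<^sub>M M)"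
  proof -
    note measurable_sq2 [measurable]
    show ?thesis unfolding case_prod_unfold by measurable
  qed
qed

lemma tameI:
  "f \<in> borel_measurable (M \<Otimes>\<^sub>M M) \<Longrightarrow> 0 \<le> A \<Longrightarrow> 0 \<le> \<alpha> \<Longrightarrow>
    (\<And>x y. \<bar>f (x, y)\<bar> \<le> A * exp (\<alpha> * (sq x + sq y))) \<Longrightarrow> tame f"
  unfolding tame_def by blast

lemma tame_integrable:
  assumes "tame f"
  shows "integrable (M \<Otimes>\<^sub>M M) f"
proof -
  obtain A \<alpha> where A: "f \<in> borel_measurable (M \<Otimes>\<^sub>M M)" "A \<ge> 0" "\<alpha> \<ge> 0"
    "\<And>x y. \<bar>f (x, y)\<bar> \<le> A * exp (\<alpha> * (sq x + sq y))"
    using assms unfolding tame_def by blast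
  have "integrable (M \<Otimes>\<^sub>M M) (\<lambda>z. A * (case z of (x, y) \<Rightarrow> exp (\<alpha> * (sq x + sq y))))"
    using integrable_exp_sq2[OF A(3)] by simp
  then show ?thesis
    by (rule Bochner_Integration.integrable_bound) (use A in \<open>auto simp: abs_mult\<close>)
qed

lemma tame_const [simp]: "tame (\<lambda>_. c)"
  by (rule tameI[of _ "\<bar>c\<bar>" 0]) auto

lemma tame_mult:
  assumes "tame f" "tame g"
  shows "tame (\<lambda>z. f z * g z)"
proof -
  obtain A \<alpha> where A: "f \<in> borel_measurable (M \<Otimes>\<^sub>M M)" "A \<ge> 0" "\<alpha> \<ge> 0"
    "\<And>x y. \<bar>f (x, y)\<bar> \<le> A * exp (\<alpha> * (sq x + sq y))" using assms(1) unfolding tame_def by blast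
  obtain B \<beta> where B: "g \<in> borel_measurable (M \<Otimes>\<^sub>M M)" "B \<ge> 0" "\<beta> \<ge> 0"
    "\<And>x y. \<bar>g (x, y)\<bar> \<le> B * exp (\<beta> * (sq x + sq y))" using assms(2) unfolding tame_def by blast
  have "\<bar>f (x, y) * g (x, y)\<bar> \<le> (A * B) * exp ((\<alpha> + \<beta>) * (sq x + sq y))" for x y
  proof -
    have "\<bar>f (x, y) * g (x, y)\<bar> \<le> (A * exp (\<alpha> * (sq x + sq y))) * (B * exp (\<beta> * (sq x + sq y)))"
      unfolding abs_mult using A B by (intro mult_mono) auto
    then show ?thesis by (simp add: exp_add distrib_right mult_ac)
  qed
  moreover have "(\<lambda>z. f z * g z) \<in> borel_measurable (M \<Otimes>\<^sub>M M)" using A(1) B(1) by (rule borel_measurable_times)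
  ultimately show ?thesis using A(2,3) B(2,3) by (intro tameI[of _ "A * B" "\<alpha> + \<beta>"]) auto
qed

lemma tame_add:
  assumes "tame f" "tame g"
  shows "tame (\<lambda>z. f z + g z)"
proof -
  obtain A \<alpha> where A: "f \<in> borel_measurable (M \<Otimes>\<^sub>M M)" "A \<ge> 0" "\<alpha> \<ge> 0"
    "\<And>x y. \<bar>f (x, y)\<bar> \<le> A * exp (\<alpha> * (sq x + sq y))" using assms(1) unfolding tame_def by blast
  obtain B \<beta> where B: "g \<in> borel_measurable (M \<Otimes>\<^sub>M M)" "B \<ge> 0" "\<beta> \<ge> 0"
    "\<And>x y. \<bar>g (x, y)\<bar> \<le> B * exp (\<beta> * (sq x + sq y))" using assms(2) unfolding tame_def by blast
  have "\<bar>f (x, y) + g (x, y)\<bar> \<le> (A + B) * exp ((\<alpha> + \<beta>) * (sq x + sq y))" for x y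
  proof -
    let ?q = "sq x + sq y"
    have q: "0 \<le> ?q" using sq_nonneg by (simp add: add_nonneg_nonneg)
    have "A * exp (\<alpha> * ?q) \<le> A * exp ((\<alpha> + \<beta>) * ?q)" "B * exp (\<beta> * ?q) \<le> B * exp ((\<alpha> + \<beta>) * ?q)"
      using A B q by (auto intro!: mult_left_mono mult_right_mono)
    then show ?thesis using A(4)[of x y] B(4)[of x y] by (simp add: distrib_right)
  qed
  moreover have "(\<lambda>z. f z + g z) \<in> borel_measurable (M \<Otimes>\<^sub>M M)" using A(1) B(1) by (rule borel_measurable_add)
  ultimately show ?thesis using A(2,3) B(2,3) by (intro tameI[of _ "A + B" "\<alpha> + \<beta>"]) auto
qed

lemma tame_power: "tame f \<Longrightarrow> tame (\<lambda>z. f z ^ n)"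
  by (induction n) (auto intro: tame_mult)

lemma tame_prod: "(\<And>i. i \<in> I \<Longrightarrow> tame (f i)) \<Longrightarrow> tame (\<lambda>z. \<Prod>i\<in>I. f i z)"
  by (induction I rule: infinite_finite_induct) (auto intro: tame_mult)

lemma tame_sum: "(\<And>i. i \<in> I \<Longrightarrow> tame (f i)) \<Longrightarrow> tame (\<lambda>z. \<Sum>i\<in>I. f i z)"
  by (induction I rule: infinite_finite_induct) (auto intro: tame_add)

lemma tame_coord:
  assumes "v \<in> V"
  shows "tame (\<lambda>(x, y). x v)" "tame (\<lambda>(x, y). y v)"
proof -
  have *: "\<bar>x v\<bar> \<le> exp (sq x + sq y)" "\<bar>x v\<bar> \<le> exp (sq y + sq x)" for x y :: "'v \<Rightarrow> real"
  proof -
    have "(x v)\<^sup>2 \<le> sq x + sq y" using coord_le_sq[OF assms, of x] sq_nonneg[of y] by linarith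
    then have "exp ((x v)\<^sup>2) \<le> exp (sq x + sq y)" by simp
    then show "\<bar>x v\<bar> \<le> exp (sq x + sq y)" using abs_le_exp_square[of "x v"] by linarith
    then show "\<bar>x v\<bar> \<le> exp (sq y + sq x)" by (simp add: add.commute)
  qed
  show "tame (\<lambda>(x, y). x v)" "tame (\<lambda>(x, y). y v)"
    unfolding case_prod_unfold using measurable_coord2[OF assms] *
    by (auto intro!: tameI[of _ 1 1])
qed

lemma tame_exp:
  assumes "b \<in> borel_measurable (M \<Otimes>\<^sub>M M)" "\<alpha> \<ge> 0" "\<And>x y. b (x, y) \<le> \<alpha> * (sq x + sq y)"
  shows "tame (\<lambda>z. exp (b z))"
  using assms by (intro tameI[of _ 1 \<alpha>]) auto

text \<open>Monomials in the Ginibre variables \<xi> = x + y and \<eta> = x - y, with exponents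
  \<open>k\<close> and \<open>l\<close> respectively.\<close>

definition mono :: "('v \<Rightarrow> nat) \<Rightarrow> ('v \<Rightarrow> nat) \<Rightarrow> ('v \<Rightarrow> real) \<times> ('v \<Rightarrow> real) \<Rightarrow> real" where
  "mono k l = (\<lambda>(x, y). \<Prod>v\<in>V. (x v + y v) ^ k v * (x v - y v) ^ l v)"

lemma tame_mono: "tame (mono k l)"
proof -
  have "tame (\<lambda>z. (fst z v + snd z v) ^ k v * (fst z v - snd z v) ^ l v)" if "v \<in> V" for v
  proof -
    have "tame (\<lambda>z. fst z v)" "tame (\<lambda>z. snd z v)" using tame_coord[OF that] by (auto simp: case_prod_unfold)
    then have "tame (\<lambda>z. fst z v + snd z v)" "tame (\<lambda>z. fst z v + (-1) * snd z v)"
      by (intro tame_add tame_mult tame_const; simp)+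
    then show ?thesis by (intro tame_mult tame_power) simp_all
  qed
  from tame_prod[of V, OF this] show ?thesis by (simp add: mono_def case_prod_unfold)
qed

lemma mono_mult: "mono k l z * mono k' l' z = mono (\<lambda>v. k v + k' v) (\<lambda>v. l v + l' v) z"
  by (simp add: mono_def case_prod_unfold power_add prod.distrib[symmetric] mult_ac)

lemma mono_power: "mono k l z ^ n = mono (\<lambda>v. n * k v) (\<lambda>v. n * l v) z"
  by (simp add: mono_def case_prod_unfold prod_power_distrib power_mult_distrib power_mult[symmetric] mult.commute)

abbreviation PI :: "(('v \<Rightarrow> real) \<times> ('v \<Rightarrow> real) \<Rightarrow> real) \<Rightarrow> real" where
  "PI f \<equiv> integral\<^sup>L (M \<Otimes>\<^sub>M M) f"

definition moment2 :: "real measure \<Rightarrow> nat \<Rightarrow> nat \<Rightarrow> real" where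
  "moment2 \<mu> k l = (\<integral>x. (\<integral>y. (x + y) ^ k * (x - y) ^ l \<partial>\<mu>) \<partial>\<mu>)"

lemma integrable_power_lam: "integrable (lam v) (\<lambda>x. x ^ n)"
proof (rule Bochner_Integration.integrable_bound[OF exp_integrable_lam[of "real n"]])
  have "\<bar>x ^ n\<bar> \<le> exp (real n * x\<^sup>2)" for x :: real
    using power_mono[OF abs_le_exp_square[of x], of n] by (simp add: power_abs exp_of_nat_mult)
  then show "AE x in lam v. norm (x ^ n) \<le> norm (exp (real n * x\<^sup>2))" by simp
qed auto

lemma PI_product:
  assumes "integrable M f" "integrable M g"
  shows "integrable (M \<Otimes>\<^sub>M M) (\<lambda>(x, y). f x * g y)" "PI (\<lambda>(x, y). f x * g y) = integral\<^sup>L M f * integral\<^sup>L M g"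
proof -
  show i: "integrable (M \<Otimes>\<^sub>M M) (\<lambda>(x, y). f x * g y)"
  proof (rule MM.Fubini_integrable)
    show "integrable M (\<lambda>x. \<integral>y. norm (case (x, y) of (x, y) \<Rightarrow> f x * g y) \<partial>M)"
      using assms(1) by (simp add: abs_mult)
    show "AE x in M. integrable M (\<lambda>y. case (x, y) of (x, y) \<Rightarrow> f x * g y)"
      using assms(2) by simp
    have "(\<lambda>z. f (fst z)) \<in> borel_measurable (M \<Otimes>\<^sub>M M)" "(\<lambda>z. g (snd z)) \<in> borel_measurable (M \<Otimes>\<^sub>M M)"
      using measurable_compose[OF measurable_fst borel_measurable_integrable[OF assms(1)]]
        measurable_compose[OF measurable_snd borel_measurable_integrable[OF assms(2)]] by auto
    then show "(\<lambda>(x, y). f x * g y) \<in> borel_measurable (M \<Otimes>\<^sub>M M)"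
      unfolding case_prod_unfold by (intro borel_measurable_times)
  qed
  have "PI (\<lambda>(x, y). f x * g y) = (\<integral>x. (\<integral>y. f x * g y \<partial>M) \<partial>M)"
    using MM.integral_fst'[OF i] by simp
  then show "PI (\<lambda>(x, y). f x * g y) = integral\<^sup>L M f * integral\<^sup>L M g" by simp
qed

lemma binomial_expansion2:
  "(x + y) ^ k * (x - y) ^ l =
    (\<Sum>p\<in>{..k} \<times> {..l}. real (k choose fst p) * real (l choose snd p) * (-1) ^ (l - snd p) *
       (x ^ (fst p + snd p) * y ^ ((k - fst p) + (l - snd p))))" for x y :: real
proof -
  have "(x + y) ^ k * (x - y) ^ l = (x + y) ^ k * (x + - y) ^ l" by simp
  also have "\<dots> = (\<Sum>i\<le>k. real (k choose i) * x ^ i * y ^ (k - i)) * (\<Sum>j\<le>l. real (l choose j) * x ^ j * (- y) ^ (l - j))"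
    unfolding binomial_ring by simp
  also have "\<dots> = (\<Sum>p\<in>{..k} \<times> {..l}. (real (k choose fst p) * x ^ fst p * y ^ (k - fst p)) *
      (real (l choose snd p) * x ^ snd p * (- y) ^ (l - snd p)))"
    by (simp add: sum_product sum.cartesian_product case_prod_unfold)
  also have "\<dots> = (\<Sum>p\<in>{..k} \<times> {..l}. real (k choose fst p) * real (l choose snd p) * (-1) ^ (l - snd p) *
       (x ^ (fst p + snd p) * y ^ ((k - fst p) + (l - snd p))))"
    by (intro sum.cong refl) (simp add: power_minus[of y] power_add mult_ac)
  finally show ?thesis .
qed

lemma moment2_expand:
  "moment2 (lam v) k l = (\<Sum>p\<in>{..k} \<times> {..l}. real (k choose fst p) * real (l choose snd p) * (-1) ^ (l - snd p) *
     ((\<integral>x. x ^ (fst p + snd p) \<partial>lam v) * (\<integral>y. y ^ ((k - fst p) + (l - snd p)) \<partial>lam v)))"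
  unfolding moment2_def binomial_expansion2
  by (subst Bochner_Integration.integral_sum | subst Bochner_Integration.integral_mult_right_zero |
      simp add: integrable_power_lam integrable_sum)+

text \<open>The pair space is a product of two configuration spaces, not a product over sites. The
  factorisation is therefore reached by expanding all factors binomially, integrating the powers of
  \<open>x v\<close> and \<open>y v\<close> site by site, and resumming.\<close>

lemma PI_mono: "PI (mono k l) = (\<Prod>v\<in>V. moment2 (lam v) (k v) (l v))"
proof -
  let ?P = "\<lambda>v. {..k v} \<times> {..l v}"
  let ?c = "\<lambda>v p. real (k v choose fst p) * real (l v choose snd p) * (-1) ^ (l v - snd p)"
  let ?a = "\<lambda>p. fst p + snd p" and ?b = "\<lambda>v p. (k v - fst p) + (l v - snd p)"
  have m: "mono k l (x, y) = (\<Sum>f\<in>PiE V ?P. (\<Prod>v\<in>V. ?c v (f v)) * ((\<Prod>v\<in>V. x v ^ ?a (f v)) * (\<Prod>v\<in>V. y v ^ ?b v (f v))))" for x y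
    unfolding mono_def binomial_expansion2 using finite_V
    by (simp add: prod_sum_PiE prod.distrib)
  have i: "integrable M (\<lambda>x. \<Prod>v\<in>V. x v ^ n v)" for n
    by (intro product_integrable_prod finite_V integrable_power_lam)
  have e: "(\<integral>x. (\<Prod>v\<in>V. x v ^ n v) \<partial>M) = (\<Prod>v\<in>V. \<integral>x. x ^ n v \<partial>lam v)" for n
    by (intro product_integral_prod finite_V integrable_power_lam)
  have "mono k l = (\<lambda>z. \<Sum>f\<in>PiE V ?P. (\<Prod>v\<in>V. ?c v (f v)) *
      (case z of (x, y) \<Rightarrow> (\<Prod>v\<in>V. x v ^ ?a (f v)) * (\<Prod>v\<in>V. y v ^ ?b v (f v))))"
    using m by auto
  then have "PI (mono k l) = (\<Sum>f\<in>PiE V ?P. (\<Prod>v\<in>V. ?c v (f v)) *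
      ((\<Prod>v\<in>V. \<integral>x. x ^ ?a (f v) \<partial>lam v) * (\<Prod>v\<in>V. \<integral>x. x ^ ?b v (f v) \<partial>lam v)))"
    by (simp add: Bochner_Integration.integral_sum PI_product[OF i i] e)
  also have "\<dots> = (\<Sum>f\<in>PiE V ?P. \<Prod>v\<in>V. ?c v (f v) * ((\<integral>x. x ^ ?a (f v) \<partial>lam v) * (\<integral>x. x ^ ?b v (f v) \<partial>lam v)))"
    by (simp add: prod.distrib)
  also have "\<dots> = (\<Prod>v\<in>V. \<Sum>p\<in>?P v. ?c v p * ((\<integral>x. x ^ ?a p \<partial>lam v) * (\<integral>x. x ^ ?b v p \<partial>lam v)))"
    by (rule prod_sum_PiE[symmetric]) (auto simp: finite_V)
  finally show ?thesis by (simp add: moment2_expand)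
qed

end

text \<open>Symmetry gives the points \<open>s\<close> and \<open>- s\<close> equal mass, and
  together they carry everything.\<close>

lemma ising_measureI:
  fixes \<mu> :: "real measure"
  assumes "prob_space \<mu>" "sets \<mu> = sets borel" "distr \<mu> borel uminus = \<mu>" "s > 0" "AE y in \<mu>. y = s \<or> y = - s"
  shows "\<mu> = ising_measure s"
proof (rule measure_eqI)
  interpret prob_space \<mu> by fact
  show "sets \<mu> = sets (ising_measure s)" using assms(2) by simp
  fix A assume "A \<in> sets \<mu>"
  then have A: "A \<in> sets borel" using assms(2) by simp
  have sp: "space \<mu> = UNIV" using sets_eq_imp_space_eq[OF assms(2)] by simp
  have um: "uminus \<in> measurable \<mu> borel"
    by (subst measurable_cong_sets[OF assms(2) refl]) measurable
  have "prob {- s} = measure (distr \<mu> borel uminus) {- s}" using assms(3) by simp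
  also have "\<dots> = prob (uminus -` {- s} \<inter> space \<mu>)" by (rule measure_distr[OF um]) simp
  also have "uminus -` {- s} \<inter> space \<mu> = {s}" using sp by auto
  finally have eq: "prob {- s} = prob {s}" .
  have sets [simp]: "B \<in> sets borel \<Longrightarrow> B \<in> events" for B using assms(2) by simp
  have "prob {s, - s} = 1"
    using assms(5) by (subst prob_eq_1) auto
  moreover have "prob {s, - s} = prob {s} + prob {- s}"
    using finite_measure_Union[of "{s}" "{- s}"] assms(4) by (simp add: insert_is_Un[of s "{- s}"])
  ultimately have half: "prob {s} = 1 / 2" "prob {- s} = 1 / 2" using eq by auto
  have "prob A = prob (A \<inter> {s, - s})"
    using assms(5) A by (intro finite_measure_eq_AE) auto
  also have "\<dots> = (indicator A s + indicator A (- s)) / 2"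
  proof -
    consider "s \<in> A" "- s \<in> A" | "s \<in> A" "- s \<notin> A" | "s \<notin> A" "- s \<in> A" | "s \<notin> A" "- s \<notin> A" by blast
    then show ?thesis
    proof cases
      case 1
      then have "A \<inter> {s, - s} = {s, - s}" by auto
      then show ?thesis using 1 \<open>prob {s, - s} = 1\<close> by simp
    next
      case 2
      then have "A \<inter> {s, - s} = {s}" by auto
      then show ?thesis using 2 half by simp
    next
      case 3
      then have "A \<inter> {s, - s} = {- s}" by auto
      then show ?thesis using 3 half by simp
    qed simp
  qed
  finally show "emeasure \<mu> A = emeasure (ising_measure s) A"
    using A assms(4) by (simp add: emeasure_ising_measure emeasure_eq_measure)
qed

lemma AE_ising_measureD:
  assumes "AE y in ising_measure s. P y" "s > 0"
  shows "P s" "P (- s)"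
proof -
  have "\<forall>y\<in>{s, - s}. P y"
  proof -
    obtain N where N: "{y. \<not> P y} \<subseteq> N" "N \<in> sets borel" "emeasure (ising_measure s) N = 0"
      using assms(1) by (auto elim!: AE_E simp: null_sets_def)
    then have "s \<notin> N" "- s \<notin> N"
      using assms(2) by (auto simp: emeasure_ising_measure indicator_def of_bool_def split: if_splits)
    then show ?thesis using N(1) by auto
  qed
  then show "P s" "P (- s)" by auto
qed

context reference_family
begin

interpretation product_prob_space lam V
  by (simp add: product_prob_space_def product_prob_space_axioms_def product_sigma_finite_def
      prob_space_lam prob_space_imp_sigma_finite)
interpretation PS: prob_space M
  by (rule prob_space_PiM) (rule prob_space_lam)
interpretation MM: pair_prob_space M M ..

lemma integral_lam_uminus:
  assumes "f \<in> borel_measurable borel"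
  shows "(\<integral>x. f (- x) \<partial>lam v) = (\<integral>x. (f x :: real) \<partial>lam v)"
proof -
  have d: "distr (lam v) borel uminus = lam v" using reference[of v] by (simp add: reference_measure_def)
  have "(\<integral>x. f x \<partial>lam v) = (\<integral>x. f x \<partial>distr (lam v) borel uminus)" using d by simp
  also have "\<dots> = (\<integral>x. f (- x) \<partial>lam v)"
    using assms by (intro integral_distr) (auto simp: measurable_cong_sets[OF sets_lam refl])
  finally show ?thesis by simp
qed

lemma moment_odd: "odd n \<Longrightarrow> (\<integral>x. x ^ n \<partial>lam v) = 0"
  using integral_lam_uminus[of "\<lambda>x. x ^ n" v] by (simp add: power_minus_odd)

lemma moment2_swap: "moment2 (lam v) k l = (\<integral>x. (\<integral>y. (y + x) ^ k * (y - x) ^ l \<partial>lam v) \<partial>lam v)"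
  unfolding moment2_expand binomial_expansion2
  by (simp add: Bochner_Integration.integral_sum integrable_power_lam mult_ac)

text \<open>Exchanging the two copies changes the sign when \<open>l\<close> is odd. When only
  \<open>k\<close> is odd, the total degree is odd, and each term of the expansion contains an odd
  moment of a symmetric measure.\<close>

lemma moment2_odd:
  assumes "odd k \<or> odd l"
  shows "moment2 (lam v) k l = 0"
proof (cases "odd l")
  case True
  have "(y + x) ^ k * (y - x) ^ l = - ((x + y) ^ k * (x - y) ^ l)" for x y :: real
    using True power_minus_odd[of l "x - y"] by (simp add: add.commute)
  note eq = this
  have "moment2 (lam v) k l = (\<integral>x. (\<integral>y. (y + x) ^ k * (y - x) ^ l \<partial>lam v) \<partial>lam v)" by (rule moment2_swap)
  also have "\<dots> = (\<integral>x. (\<integral>y. - ((x + y) ^ k * (x - y) ^ l) \<partial>lam v) \<partial>lam v)" 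
    by (intro Bochner_Integration.integral_cong refl eq)
  also have "\<dots> = - moment2 (lam v) k l" by (simp add: moment2_def)
  finally show ?thesis by simp
next
  case False
  then have kl: "odd (k + l)" using assms by simp
  have "(\<integral>x. x ^ (fst p + snd p) \<partial>lam v) * (\<integral>y. y ^ ((k - fst p) + (l - snd p)) \<partial>lam v) = 0"
    if "p \<in> {..k} \<times> {..l}" for p
  proof -
    have "k + l = (fst p + snd p) + ((k - fst p) + (l - snd p))" using that by auto
    then have "odd (fst p + snd p) \<or> odd ((k - fst p) + (l - snd p))" using kl by (metis even_add)
    then show ?thesis by (metis moment_odd mult_eq_0_iff)
  qed
  then show ?thesis unfolding moment2_expand by (intro sum.neutral) auto
qed

lemma moment2_nonneg: "0 \<le> moment2 (lam v) k l"
proof (cases "even k \<and> even l")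
  case True
  then show ?thesis unfolding moment2_def
    by (intro integral_nonneg_AE AE_I2 mult_nonneg_nonneg) (auto simp: zero_le_even_power)
next
  case False
  then show ?thesis using moment2_odd[of k l v] by auto
qed

text \<open>If the moment vanished, then for some fixed \<open>x\<close> the integrand would vanish
  for almost every \<open>y\<close>, so the measure would sit on \<open>{x, - x}\<close>. It is not
  the point mass at 0, hence it is of Ising type; there only a product of a \<xi>-power and an
  \<eta>-power can vanish, not a power of one of them.\<close>

lemma moment2_pos:
  assumes "even k" "even l" "k = 0 \<or> l = 0 \<or> \<not> ising_type (lam v)"
  shows "0 < moment2 (lam v) k l"
proof (rule ccontr)
  let ?f = "\<lambda>x y. (x + y) ^ k * (x - y) ^ l"
  assume "\<not> 0 < moment2 (lam v) k l"
  then have 0: "(\<integral>x. (\<integral>y. ?f x y \<partial>lam v) \<partial>lam v) = 0" using moment2_nonneg[of v k l] by (simp add: moment2_def)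
  have nn: "0 \<le> ?f x y" for x y :: real using assms(1,2) by (simp add: zero_le_even_power)
  have int1: "integrable (lam v) (\<lambda>y. ?f x y)" for x
    unfolding binomial_expansion2 by (intro Bochner_Integration.integrable_sum integrable_mult_right integrable_power_lam)
  have int2: "integrable (lam v) (\<lambda>x. \<integral>y. ?f x y \<partial>lam v)"
    unfolding binomial_expansion2
    by (simp add: Bochner_Integration.integral_sum integrable_power_lam)
  have "AE x in lam v. (\<integral>y. ?f x y \<partial>lam v) = 0"
    using integral_nonneg_eq_0_iff_AE[OF int2] 0 nn by (simp add: integral_nonneg_AE)
  from eventually_happens'[OF prob_space.ae_filter_bot[OF prob_space_lam] this] obtain x where "(\<integral>y. ?f x y \<partial>lam v) = 0" by blast
  then have AE0: "AE y in lam v. ?f x y = 0"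
    using integral_nonneg_eq_0_iff_AE[OF int1[of x]] nn by simp
  define s where "s = \<bar>x\<bar>"
  have AEs: "AE y in lam v. y = s \<or> y = - s"
    using AE0 by (rule AE_mp) (auto simp: s_def)
  show False
  proof (cases "s = 0")
    case True
    then have "AE y in lam v. y = 0" using AEs by simp
    then have "lam v = return borel 0"
    proof (intro measure_eqI)
      fix A assume A: "A \<in> sets (lam v)" and AE: "AE y in lam v. y = 0"
      have "emeasure (lam v) A = emeasure (lam v) (if 0 \<in> A then space (lam v) else {})"
        using AE A by (intro emeasure_eq_AE) auto
      then show "emeasure (lam v) A = emeasure (return borel 0) A"
        using A prob_space.emeasure_space_1[OF prob_space_lam, of v] by (auto simp: indicator_def)
    qed simp
    then show False using reference[of v] by (simp add: reference_measure_def)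
  next
    case False
    then have s: "s > 0" by (simp add: s_def)
    have isng: "lam v = ising_measure s"
      using reference[of v] s AEs by (intro ising_measureI) (auto simp: reference_measure_def)
    from this have "k = 0 \<or> l = 0" using assms(3) s by (auto simp: ising_type_def)
    moreover have "?f x s = 0" "?f x (- s) = 0" using AE_ising_measureD[OF AE0[unfolded isng] s] by auto
    ultimately show False using s by (auto simp: s_def abs_if split: if_splits)
  qed
qed

lemma PI_mono_nonneg: "0 \<le> PI (mono k l)"
  unfolding PI_mono by (intro prod_nonneg moment2_nonneg)

lemma PI_mono_pos:
  assumes "\<And>v. v \<in> V \<Longrightarrow> even (k v) \<and> even (l v) \<and> (k v = 0 \<or> l v = 0 \<or> \<not> ising_type (lam v))"
  shows "0 < PI (mono k l)"
  unfolding PI_mono using assms by (intro prod_pos moment2_pos) auto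

text \<open>Termwise integration by dominated convergence: the partial sums are bounded by
  \<open>\<bar>g z\<bar> * exp \<bar>b z\<bar>\<close>, which is integrable for tame
  functions.\<close>

lemma PI_exp_series:
  assumes g: "tame g" and b: "tame b" "tame (\<lambda>z. exp \<bar>b z\<bar>)"
  shows "(\<lambda>n. PI (\<lambda>z. g z * b z ^ n) / fact n) sums PI (\<lambda>z. g z * exp (b z))"
proof -
  let ?s = "\<lambda>N z. \<Sum>n<N. g z * b z ^ n / fact n"
  have int: "integrable (M \<Otimes>\<^sub>M M) (\<lambda>z. g z * b z ^ n)" for n
    using g b by (intro tame_integrable tame_mult tame_power)
  have meas: "?s N \<in> borel_measurable (M \<Otimes>\<^sub>M M)" for N
    by (intro borel_measurable_integrable Bochner_Integration.integrable_sum integrable_divide int)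
  have lim: "(\<lambda>N. ?s N z) \<longlonglongrightarrow> g z * exp (b z)" for z
  proof -
    have "(\<lambda>n. g z * (b z ^ n /\<^sub>R fact n)) sums (g z * exp (b z))"
      by (intro sums_mult exp_converges)
    then show ?thesis unfolding sums_def by (simp add: divide_inverse mult_ac)
  qed
  have "(\<lambda>N. PI (?s N)) \<longlonglongrightarrow> PI (\<lambda>z. g z * exp (b z))"
  proof (rule integral_dominated_convergence[where w = "\<lambda>z. \<bar>g z\<bar> * exp \<bar>b z\<bar>"])
    have "g \<in> borel_measurable (M \<Otimes>\<^sub>M M)" "b \<in> borel_measurable (M \<Otimes>\<^sub>M M)"
      using g b by (auto simp: tame_def)
    then show "(\<lambda>z. g z * exp (b z)) \<in> borel_measurable (M \<Otimes>\<^sub>M M)" by simp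
    have "integrable (M \<Otimes>\<^sub>M M) (\<lambda>z. g z * exp \<bar>b z\<bar>)" using g b by (intro tame_integrable tame_mult)
    from integrable_abs[OF this] show "integrable (M \<Otimes>\<^sub>M M) (\<lambda>z. \<bar>g z\<bar> * exp \<bar>b z\<bar>)"
      by (simp add: abs_mult)
    have "\<bar>?s N z\<bar> \<le> \<bar>g z\<bar> * exp \<bar>b z\<bar>" for N z
    proof -
      have "\<bar>?s N z\<bar> \<le> (\<Sum>n<N. \<bar>g z\<bar> * (\<bar>b z\<bar> ^ n /\<^sub>R fact n))"
        by (rule order_trans[OF sum_abs]) (auto intro!: sum_mono simp: abs_mult power_abs divide_inverse)
      also have "\<dots> = \<bar>g z\<bar> * (\<Sum>n<N. \<bar>b z\<bar> ^ n /\<^sub>R fact n)" by (simp add: sum_distrib_left)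
      also have "\<dots> \<le> \<bar>g z\<bar> * exp \<bar>b z\<bar>"
        unfolding exp_def by (intro mult_left_mono sum_le_suminf summable_exp_generic) auto
      finally show ?thesis .
    qed
    then show "AE z in M \<Otimes>\<^sub>M M. norm (?s N z) \<le> \<bar>g z\<bar> * exp \<bar>b z\<bar>" for N by simp
  qed (use meas lim in auto)
  moreover have "PI (?s N) = (\<Sum>n<N. PI (\<lambda>z. g z * b z ^ n) / fact n)" for N
    using int by (simp add: Bochner_Integration.integral_sum)
  ultimately show ?thesis by (simp add: sums_def)
qed

text \<open>Densities that keep all Ginibre moments nonnegative; the class is closed under
  multiplication by the edge factors of the weight.\<close>

definition Qpos :: "(('v \<Rightarrow> real) \<times> ('v \<Rightarrow> real) \<Rightarrow> real) \<Rightarrow> bool" where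
  "Qpos f \<longleftrightarrow> tame f \<and> (\<forall>k l. 0 \<le> PI (\<lambda>z. mono k l z * f z))"

text \<open>In the exponential series every term is a nonnegative moment, and the zeroth term gives
  the lower bound. For the last claim, the series of the monomial with an extra factor
  \<open>mono u w\<close> reappears shifted by one in the series of the shorter monomial, which
  therefore inherits positivity.\<close>

lemma Qpos_exp:
  assumes f: "Qpos f" and c: "0 \<le> c" and t: "tame (\<lambda>z. exp \<bar>c * mono u w z\<bar>)" "tame (\<lambda>z. exp (c * mono u w z))"
  shows "Qpos (\<lambda>z. f z * exp (c * mono u w z))"
    and "PI (\<lambda>z. mono k l z * f z) \<le> PI (\<lambda>z. mono k l z * (f z * exp (c * mono u w z)))"
    and "0 < c \<Longrightarrow> 0 < PI (\<lambda>z. mono (\<lambda>v. k v + u v) (\<lambda>v. l v + w v) z * (f z * exp (c * mono u w z))) \<Longrightarrow>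
      0 < PI (\<lambda>z. mono k l z * (f z * exp (c * mono u w z)))"
proof -
  have tf: "tame f" and Q: "\<And>k l. 0 \<le> PI (\<lambda>z. mono k l z * f z)" using f by (auto simp: Qpos_def)
  define A where "A n k l = PI (\<lambda>z. mono (\<lambda>v. k v + n * u v) (\<lambda>v. l v + n * w v) z * f z)" for n k l
  define T where "T k l = PI (\<lambda>z. mono k l z * (f z * exp (c * mono u w z)))" for k l
  have A0: "0 \<le> A n k l" for n k l using Q by (simp add: A_def)
  have S: "(\<lambda>n. c ^ n / fact n * A n k l) sums T k l" for k l
  proof -
    have "(\<lambda>n. PI (\<lambda>z. (mono k l z * f z) * (c * mono u w z) ^ n) / fact n) sums
        PI (\<lambda>z. (mono k l z * f z) * exp (c * mono u w z))"
      using t tf by (intro PI_exp_series tame_mult tame_mono tame_const)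
    moreover have "PI (\<lambda>z. (mono k l z * f z) * (c * mono u w z) ^ n) = c ^ n * A n k l" for n
    proof -
      have "(mono k l z * f z) * (c * mono u w z) ^ n =
          c ^ n * (mono (\<lambda>v. k v + n * u v) (\<lambda>v. l v + n * w v) z * f z)" for z
        unfolding mono_mult[symmetric] mono_power[symmetric] by (simp add: power_mult_distrib mult_ac)
      then show ?thesis by (simp only: A_def Bochner_Integration.integral_mult_right_zero)
    qed
    ultimately show ?thesis by (simp add: T_def mult.assoc)
  qed
  have nn: "0 \<le> c ^ n / fact n * A n k l" for n k l using c A0 by simp
  have ge: "c ^ n / fact n * A n k l \<le> T k l" for n k l
  proof -
    have "(\<Sum>m\<in>{n}. c ^ m / fact m * A m k l) \<le> T k l"
      unfolding sums_unique[OF S] using nn by (intro sum_le_suminf sums_summable[OF S]) auto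
    then show ?thesis by simp
  qed
  have T0: "0 \<le> T k l" for k l using ge[of 0 k l] A0[of 0 k l] by simp
  show "Qpos (\<lambda>z. f z * exp (c * mono u w z))"
    unfolding Qpos_def using tf t T0 by (auto intro: tame_mult simp: T_def)
  show "PI (\<lambda>z. mono k l z * f z) \<le> PI (\<lambda>z. mono k l z * (f z * exp (c * mono u w z)))"
    using ge[of 0 k l] by (simp add: A_def T_def)
  assume c0: "0 < c" and pos: "0 < PI (\<lambda>z. mono (\<lambda>v. k v + u v) (\<lambda>v. l v + w v) z * (f z * exp (c * mono u w z)))"
  have "\<exists>n. 0 < A n (\<lambda>v. k v + u v) (\<lambda>v. l v + w v)"
  proof (rule ccontr)
    assume "\<not> (\<exists>n. 0 < A n (\<lambda>v. k v + u v) (\<lambda>v. l v + w v))"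
    then have "A n (\<lambda>v. k v + u v) (\<lambda>v. l v + w v) = 0" for n using A0 by (meson antisym_conv2 not_less)
    then have "(\<lambda>n. 0) sums T (\<lambda>v. k v + u v) (\<lambda>v. l v + w v)"
      using S[of "\<lambda>v. k v + u v" "\<lambda>v. l v + w v"] by simp
    then have "T (\<lambda>v. k v + u v) (\<lambda>v. l v + w v) = 0" using sums_unique2 sums_zero by blast
    then show False using pos by (simp add: T_def)
  qed
  then obtain n where n: "0 < A n (\<lambda>v. k v + u v) (\<lambda>v. l v + w v)" by blast
  have "A n (\<lambda>v. k v + u v) (\<lambda>v. l v + w v) = A (Suc n) k l"
    by (simp add: A_def add.assoc)
  then have "0 < c ^ Suc n / fact (Suc n) * A (Suc n) k l" using n c0 by (simp del: fact_Suc)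
  then show "0 < PI (\<lambda>z. mono k l z * (f z * exp (c * mono u w z)))"
    using ge[of "Suc n" k l] by (simp add: T_def)
qed

abbreviation ind :: "'v set \<Rightarrow> 'v \<Rightarrow> nat" where
  "ind e \<equiv> (\<lambda>v. if v \<in> e then 1 else 0)"

lemma mono_ind:
  assumes "e \<subseteq> V"
  shows "mono (ind e) (\<lambda>_. 0) z = (\<Prod>v\<in>e. fst z v + snd z v)"
    "mono (\<lambda>_. 0) (ind e) z = (\<Prod>v\<in>e. fst z v - snd z v)"
proof -
  have *: "(\<Prod>v\<in>V. g v ^ ind e v) = (\<Prod>v\<in>e. g v)" for g :: "'v \<Rightarrow> real"
  proof -
    have "(\<Prod>v\<in>V. g v ^ ind e v) = (\<Prod>v\<in>V. if v \<in> e then g v else 1)" by (intro prod.cong) auto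
    also have "\<dots> = (\<Prod>v\<in>V \<inter> e. g v)" using finite_V by (simp add: prod.inter_restrict)
    also have "V \<inter> e = e" using assms by blast
    finally show ?thesis .
  qed
  show "mono (ind e) (\<lambda>_. 0) z = (\<Prod>v\<in>e. fst z v + snd z v)"
    "mono (\<lambda>_. 0) (ind e) z = (\<Prod>v\<in>e. fst z v - snd z v)"
    using * by (simp_all add: mono_def case_prod_unfold)
qed

definition weight2 :: "'v set set \<Rightarrow> ('v set \<Rightarrow> real) \<Rightarrow> real \<Rightarrow> ('v \<Rightarrow> real) \<times> ('v \<Rightarrow> real) \<Rightarrow> real" where
  "weight2 E J \<beta> z = boltzmann_weight E J \<beta> (fst z) * boltzmann_weight E J \<beta> (snd z)"

text \<open>Polarisation: for an edge ab, x_a x_b + y_a y_b is half of \<xi>_a \<xi>_b + \<eta>_a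
  \<eta>_b, which explains the couplings \<open>\<beta> * J e / 2\<close>.\<close>

lemma weight2_insert:
  assumes "finite E" "e \<notin> E" "e \<subseteq> V" "card e = 2"
  shows "weight2 (insert e E) J \<beta> z = weight2 E J \<beta> z *
    exp (\<beta> * J e / 2 * mono (ind e) (\<lambda>_. 0) z) * exp (\<beta> * J e / 2 * mono (\<lambda>_. 0) (ind e) z)"
proof -
  obtain a b where e: "e = {a, b}" "a \<noteq> b" using assms(4) by (meson card_2_iff)
  have "\<beta> * (J e * (fst z a * fst z b)) + \<beta> * (J e * (snd z a * snd z b)) =
    \<beta> * J e / 2 * ((fst z a + snd z a) * (fst z b + snd z b)) + \<beta> * J e / 2 * ((fst z a - snd z a) * (fst z b - snd z b))"
    by (simp add: field_simps)
  then show ?thesis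
    using assms e unfolding weight2_def boltzmann_weight_def mono_ind[OF assms(3)]
    by (simp add: distrib_left exp_add[symmetric])
qed

text \<open>A product of two sums or differences is bounded by a sum of squares, so each edge factor
  grows at most like a Gaussian exponential, which reference measures integrate.\<close>

lemma tame_exp_edge:
  assumes "e \<subseteq> V" "card e = 2"
  shows "tame (\<lambda>z. exp (c * mono (ind e) (\<lambda>_. 0) z))" "tame (\<lambda>z. exp (c * mono (\<lambda>_. 0) (ind e) z))"
    "tame (\<lambda>z. exp \<bar>c * mono (ind e) (\<lambda>_. 0) z\<bar>)" "tame (\<lambda>z. exp \<bar>c * mono (\<lambda>_. 0) (ind e) z\<bar>)"
proof -
  obtain a b where e: "e = {a, b}" "a \<noteq> b" using assms(2) by (meson card_2_iff)
  have ab: "a \<in> V" "b \<in> V" using assms(1) e by auto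
  have *: "\<bar>(p + q) * (r + t)\<bar> \<le> p\<^sup>2 + q\<^sup>2 + r\<^sup>2 + t\<^sup>2" for p q r t :: real
  proof -
    have "0 \<le> ((p + q) - (r + t))\<^sup>2" "0 \<le> ((p + q) + (r + t))\<^sup>2" "0 \<le> (p - q)\<^sup>2" "0 \<le> (r - t)\<^sup>2" by simp_all
    then show ?thesis unfolding abs_le_iff power2_eq_square by (auto simp: algebra_simps)
  qed
  have le: "(x a)\<^sup>2 + (y a)\<^sup>2 + (x b)\<^sup>2 + (y b)\<^sup>2 \<le> 2 * (sq x + sq y)" for x y
    using add_mono[OF add_mono[OF coord_le_sq[OF ab(1), of x] coord_le_sq[OF ab(1), of y]]
        add_mono[OF coord_le_sq[OF ab(2), of x] coord_le_sq[OF ab(2), of y]]]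
    by simp
  have B: "\<bar>c * mono (ind e) (\<lambda>_. 0) (x, y)\<bar> \<le> (2 * \<bar>c\<bar>) * (sq x + sq y)"
    "\<bar>c * mono (\<lambda>_. 0) (ind e) (x, y)\<bar> \<le> (2 * \<bar>c\<bar>) * (sq x + sq y)" for x y
  proof -
    have "\<bar>(x a + y a) * (x b + y b)\<bar> \<le> 2 * (sq x + sq y)" "\<bar>(x a - y a) * (x b - y b)\<bar> \<le> 2 * (sq x + sq y)"
      using *[of "x a" "y a" "x b" "y b"] *[of "x a" "- y a" "x b" "- y b"] le[of x y] by auto
    then have "\<bar>c\<bar> * \<bar>(x a + y a) * (x b + y b)\<bar> \<le> \<bar>c\<bar> * (2 * (sq x + sq y))"
      "\<bar>c\<bar> * \<bar>(x a - y a) * (x b - y b)\<bar> \<le> \<bar>c\<bar> * (2 * (sq x + sq y))"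
      by (intro mult_left_mono; simp)+
    then show "\<bar>c * mono (ind e) (\<lambda>_. 0) (x, y)\<bar> \<le> (2 * \<bar>c\<bar>) * (sq x + sq y)"
      "\<bar>c * mono (\<lambda>_. 0) (ind e) (x, y)\<bar> \<le> (2 * \<bar>c\<bar>) * (sq x + sq y)"
      unfolding mono_ind[OF assms(1)] using e by (simp_all add: abs_mult mult_ac)
  qed
  have m: "mono k l \<in> borel_measurable (M \<Otimes>\<^sub>M M)" for k l using tame_mono by (simp add: tame_def)
  show "tame (\<lambda>z. exp (c * mono (ind e) (\<lambda>_. 0) z))" "tame (\<lambda>z. exp (c * mono (\<lambda>_. 0) (ind e) z))"
    "tame (\<lambda>z. exp \<bar>c * mono (ind e) (\<lambda>_. 0) z\<bar>)" "tame (\<lambda>z. exp \<bar>c * mono (\<lambda>_. 0) (ind e) z\<bar>)"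
    using B abs_le_D1[OF B(1)] abs_le_D1[OF B(2)] m
    by (intro tame_exp[of _ "2 * \<bar>c\<bar>"]; simp)+
qed

lemma weight2_Qpos:
  assumes "finite E" "\<And>e. e \<in> E \<Longrightarrow> e \<subseteq> V \<and> card e = 2" "\<And>e. e \<in> E \<Longrightarrow> 0 \<le> J e" "0 \<le> \<beta>"
  shows "Qpos (weight2 E J \<beta>) \<and> (\<forall>k l. PI (mono k l) \<le> PI (\<lambda>z. mono k l z * weight2 E J \<beta> z))"
  using assms(1-3)
proof (induction E rule: finite_induct)
  case empty
  then show ?case using PI_mono_nonneg by (simp add: Qpos_def weight2_def boltzmann_weight_def)
next
  case (insert e E)
  have e: "e \<subseteq> V" "card e = 2" "0 \<le> \<beta> * J e / 2" using insert.prems[of e] assms(4) by auto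
  have IH: "Qpos (weight2 E J \<beta>)" "PI (mono k l) \<le> PI (\<lambda>z. mono k l z * weight2 E J \<beta> z)" for k l
    using insert.IH insert.prems by auto
  note t = tame_exp_edge[OF e(1,2), of "\<beta> * J e / 2"]
  note s1 = Qpos_exp[OF IH(1) e(3) t(3,1)]
  note s2 = Qpos_exp[OF s1(1) e(3) t(4,2)]
  have w: "weight2 (insert e E) J \<beta> = (\<lambda>z. weight2 E J \<beta> z *
    exp (\<beta> * J e / 2 * mono (ind e) (\<lambda>_. 0) z) * exp (\<beta> * J e / 2 * mono (\<lambda>_. 0) (ind e) z))"
    using weight2_insert[OF insert.hyps e(1,2)] by blast
  show ?case unfolding w
    using s2(1) order_trans[OF IH(2) order_trans[OF s1(2) s2(2)]] by blast
qed

text \<open>The tool for shortening monomials: an edge with positive coupling can be removed from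
  the \<xi>-exponents or from the \<eta>-exponents without losing positivity. The matching
  exponential of that edge is put last so that the series argument applies to it.\<close>

lemma weight2_edge:
  assumes "finite E" "\<And>e. e \<in> E \<Longrightarrow> e \<subseteq> V \<and> card e = 2" "\<And>e. e \<in> E \<Longrightarrow> 0 < J e" "0 < \<beta>" "e \<in> E"
  shows "0 < PI (\<lambda>z. mono (\<lambda>v. k v + ind e v) l z * weight2 E J \<beta> z) \<Longrightarrow> 0 < PI (\<lambda>z. mono k l z * weight2 E J \<beta> z)"
    "0 < PI (\<lambda>z. mono k (\<lambda>v. l v + ind e v) z * weight2 E J \<beta> z) \<Longrightarrow> 0 < PI (\<lambda>z. mono k l z * weight2 E J \<beta> z)"
proof -
  have e: "e \<subseteq> V" "card e = 2" "0 < \<beta> * J e / 2" "0 \<le> \<beta> * J e / 2" using assms(2-5) by (auto simp: less_imp_le)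
  have Q: "Qpos (weight2 (E - {e}) J \<beta>)"
    using weight2_Qpos[of "E - {e}" J \<beta>] assms by (auto simp: less_imp_le)
  note t = tame_exp_edge[OF e(1,2), of "\<beta> * J e / 2"]
  have w: "weight2 E J \<beta> z = weight2 (E - {e}) J \<beta> z *
    exp (\<beta> * J e / 2 * mono (ind e) (\<lambda>_. 0) z) * exp (\<beta> * J e / 2 * mono (\<lambda>_. 0) (ind e) z)" for z
    using weight2_insert[of "E - {e}" e J \<beta> z] e assms(1,5) by (simp add: insert_absorb)
  then have w': "weight2 E J \<beta> z = weight2 (E - {e}) J \<beta> z *
    exp (\<beta> * J e / 2 * mono (\<lambda>_. 0) (ind e) z) * exp (\<beta> * J e / 2 * mono (ind e) (\<lambda>_. 0) z)" for z
    by (simp add: mult_ac)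
  show "0 < PI (\<lambda>z. mono (\<lambda>v. k v + ind e v) l z * weight2 E J \<beta> z) \<Longrightarrow> 0 < PI (\<lambda>z. mono k l z * weight2 E J \<beta> z)"
    using Qpos_exp(3)[OF Qpos_exp(1)[OF Q e(4) t(4,2)] e(4) t(3,1) e(3), of k l] by (simp add: w')
  show "0 < PI (\<lambda>z. mono k (\<lambda>v. l v + ind e v) z * weight2 E J \<beta> z) \<Longrightarrow> 0 < PI (\<lambda>z. mono k l z * weight2 E J \<beta> z)"
    using Qpos_exp(3)[OF Qpos_exp(1)[OF Q e(4) t(3,1)] e(4) t(4,2) e(3), of k l] by (simp add: w)
qed

end

context reference_family
begin

interpretation product_prob_space lam V
  by (simp add: product_prob_space_def product_prob_space_axioms_def product_sigma_finite_def
      prob_space_lam prob_space_imp_sigma_finite)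
interpretation PS: prob_space M
  by (rule prob_space_PiM) (rule prob_space_lam)
interpretation MM: pair_prob_space M M ..

definition tame1 :: "(('v \<Rightarrow> real) \<Rightarrow> real) \<Rightarrow> bool" where
  "tame1 f \<longleftrightarrow> tame (\<lambda>z. f (fst z)) \<and> tame (\<lambda>z. f (snd z))"

lemma tame1_integrable:
  assumes "tame1 f"
  shows "integrable M f"
proof -
  have "integrable (M \<Otimes>\<^sub>M M) (\<lambda>z. f (fst z))" using assms tame_integrable by (simp add: tame1_def)
  from MM.integrable_fst'[OF this] show ?thesis
    by (simp add: prob_space.prob_space[OF prob_space_PiM, OF prob_space_lam])
qed

lemma tame1_const [simp]: "tame1 (\<lambda>_. c)"
  by (simp add: tame1_def)

lemma tame1_coord: "v \<in> V \<Longrightarrow> tame1 (\<lambda>x. x v)"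
  using tame_coord[of v] by (simp add: tame1_def case_prod_unfold)

lemma tame1_mult: "tame1 f \<Longrightarrow> tame1 g \<Longrightarrow> tame1 (\<lambda>x. f x * g x)"
  unfolding tame1_def by (auto intro: tame_mult)

lemma tame1_prod: "(\<And>i. i \<in> I \<Longrightarrow> tame1 (f i)) \<Longrightarrow> tame1 (\<lambda>x. \<Prod>i\<in>I. f i x)"
  unfolding tame1_def by (auto intro: tame_prod)

lemma tame1_exp_pair:
  assumes "a \<in> V" "b \<in> V"
  shows "tame1 (\<lambda>x. exp (c * (x a * x b)))"
proof -
  have *: "c * (x a * x b) \<le> \<bar>c\<bar> * (sq x + sq y)" for x y
  proof -
    have "0 \<le> (x a - x b)\<^sup>2" "0 \<le> (x a + x b)\<^sup>2" by simp_all
    then have "2 * \<bar>x a * x b\<bar> \<le> (x a)\<^sup>2 + (x b)\<^sup>2"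
      by (simp add: power2_diff power2_sum abs_le_iff abs_if algebra_simps)
    also have "\<dots> \<le> 2 * sq x" using coord_le_sq[OF assms(1), of x] coord_le_sq[OF assms(2), of x] by linarith
    finally have "\<bar>x a * x b\<bar> \<le> sq x + sq y" using sq_nonneg[of y] by linarith
    then have "\<bar>c\<bar> * \<bar>x a * x b\<bar> \<le> \<bar>c\<bar> * (sq x + sq y)" by (rule mult_left_mono) simp
    then show ?thesis by (metis abs_ge_self abs_mult order_trans)
  qed
  have **: "c * (y a * y b) \<le> \<bar>c\<bar> * (sq x + sq y)" for x y using *[of y x] by (simp add: add.commute)
  show ?thesis unfolding tame1_def
    using measurable_coord2[OF assms(1)] measurable_coord2[OF assms(2)] * **
    by (auto intro!: tame_exp[of _ "\<bar>c\<bar>"])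
qed

lemma tame1_boltzmann_weight:
  assumes "finite_graph V E"
  shows "tame1 (boltzmann_weight E J \<beta>)"
proof -
  have E: "finite E" "\<And>e. e \<in> E \<Longrightarrow> e \<subseteq> V \<and> card e = 2"
    using assms finite_subset[of E "Pow V"] by (auto simp: finite_graph_def)
  have "boltzmann_weight E J \<beta> = (\<lambda>x. \<Prod>e\<in>E. exp (\<beta> * (J e * (\<Prod>u\<in>e. x u))))"
    unfolding boltzmann_weight_def sum_distrib_left exp_sum[OF E(1)] ..
  moreover have "tame1 (\<lambda>x. exp (\<beta> * (J e * (\<Prod>u\<in>e. x u))))" if eE: "e \<in> E" for e
  proof -
    obtain a b where e: "e = {a, b}" "a \<noteq> b" using E(2)[OF eE] by (meson card_2_iff)
    then have "a \<in> V" "b \<in> V" using E(2)[OF eE] by auto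
    from tame1_exp_pair[OF this, of "\<beta> * J e"] show ?thesis using e by (simp add: mult.assoc)
  qed
  ultimately show ?thesis using tame1_prod[of E] by simp
qed

lemma spin_expectation_ratio:
  assumes G: "finite_graph V E" and f: "tame1 f" and Z: "0 < (\<integral>x. boltzmann_weight E J \<beta> x \<partial>M)"
  shows "spin_expectation V E J \<beta> lam f =
    (\<integral>x. f x * boltzmann_weight E J \<beta> x \<partial>M) / (\<integral>x. boltzmann_weight E J \<beta> x \<partial>M)"
proof -
  let ?W = "boltzmann_weight E J \<beta>" and ?Z = "partition_function V E J \<beta> lam"
  have Z': "?Z = (\<integral>x. ?W x \<partial>M)" by (simp add: partition_function_def)
  have "?W \<in> borel_measurable M" using tame1_integrable[OF tame1_boltzmann_weight[OF G]] by simp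
  then have "(\<lambda>x. ?W x / ?Z) \<in> borel_measurable M" by simp
  moreover have "0 \<le> ?W x / ?Z" for x using Z Z' by (simp add: boltzmann_weight_def)
  moreover have "f \<in> borel_measurable M" using tame1_integrable[OF f] by simp
  ultimately have "spin_expectation V E J \<beta> lam f = (\<integral>x. ?W x / ?Z * f x \<partial>M)"
    unfolding spin_expectation_def spin_measure_def by (subst integral_density) auto
  also have "\<dots> = (\<integral>x. f x * ?W x \<partial>M) / ?Z" by (simp add: mult.commute)
  finally show ?thesis using Z' by simp
qed

end

section \<open>Correlation inequalities\<close>

locale ferromagnet = reference_family V lam for V :: "'v set" and lam :: "'v \<Rightarrow> real measure" +
  fixes E :: "'v set set" and J :: "'v set \<Rightarrow> real" and \<beta> :: real
  assumes graph: "finite_graph V E" and J_pos: "\<And>e. e \<in> E \<Longrightarrow> 0 < J e" and \<beta>_pos: "0 < \<beta>"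
begin

interpretation product_prob_space lam V
  by (simp add: product_prob_space_def product_prob_space_axioms_def product_sigma_finite_def
      prob_space_lam prob_space_imp_sigma_finite)
interpretation PS: prob_space M
  by (rule prob_space_PiM) (rule prob_space_lam)
interpretation MM: pair_prob_space M M ..

lemma E_facts: "finite E" "\<And>e. e \<in> E \<Longrightarrow> e \<subseteq> V \<and> card e = 2" "E \<subseteq> Pow V"
  using graph finite_subset[of E "Pow V"] by (auto simp: finite_graph_def)

abbreviation W where "W \<equiv> boltzmann_weight E J \<beta>"
abbreviation W2 where "W2 \<equiv> weight2 E J \<beta>"

text \<open>The unnormalised expectation. The normalising constant is
  \<open>Ex (\<lambda>_. 1)\<close>, so the correlation inequalities become homogeneous and free of
  division.\<close>

definition Ex :: "(('v \<Rightarrow> real) \<Rightarrow> real) \<Rightarrow> real" where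
  "Ex f = (\<integral>x. f x * W x \<partial>M)"

lemma tame1_W: "tame1 W"
  by (rule tame1_boltzmann_weight[OF graph])

lemma integrable_W: "tame1 f \<Longrightarrow> integrable M (\<lambda>x. f x * W x)"
  by (intro tame1_integrable tame1_mult tame1_W)

lemma PI_Ex:
  assumes "tame1 f" "tame1 g"
  shows "has_bochner_integral (M \<Otimes>\<^sub>M M) (\<lambda>z. f (fst z) * g (snd z) * W2 z) (Ex f * Ex g)"
proof -
  have "has_bochner_integral (M \<Otimes>\<^sub>M M) (\<lambda>(x, y). (f x * W x) * (g y * W y)) (Ex f * Ex g)"
    unfolding has_bochner_integral_iff Ex_def
    using PI_product[OF integrable_W[OF assms(1)] integrable_W[OF assms(2)]] by blast
  then show ?thesis by (simp add: case_prod_unfold weight2_def mult_ac)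
qed

lemma W2_nonneg: "0 \<le> PI (\<lambda>z. mono k l z * W2 z)"
  and W2_ge: "PI (mono k l) \<le> PI (\<lambda>z. mono k l z * W2 z)"
  using weight2_Qpos[of E J \<beta>] E_facts J_pos \<beta>_pos by (auto simp: Qpos_def less_imp_le)

lemma tame_W2: "tame W2"
  using weight2_Qpos[of E J \<beta>] E_facts J_pos \<beta>_pos by (auto simp: Qpos_def less_imp_le)

lemma has_integral_mono: "has_bochner_integral (M \<Otimes>\<^sub>M M) (\<lambda>z. mono k l z * W2 z) (PI (\<lambda>z. mono k l z * W2 z))"
  by (simp add: has_bochner_integral_iff tame_integrable tame_mult tame_mono tame_W2)

text \<open>Removing the edges of a path one by one turns its squared vertices into its two ends.\<close>

lemma path_exponents:
  assumes R: "\<And>e k. e \<in> E \<Longrightarrow> R (\<lambda>v. k v + ind e v) \<Longrightarrow> R k"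
    and "walk E p" "distinct p" "p \<noteq> []" "R (\<lambda>v. k v + 2 * ind (set p) v)"
  shows "R (\<lambda>v. k v + (ind {hd p} v + ind {last p} v))"
  using assms(2-5)
proof (induction p arbitrary: k rule: induct_list012)
  case (2 x)
  have "(\<lambda>v. k v + 2 * ind (set [x]) v) = (\<lambda>v. k v + (ind {x} v + ind {x} v))" by auto
  with 2 show ?case by simp
next
  case (3 x y zs)
  \<comment> \<open>The square at \<open>x\<close> is kept aside while the tail is treated. The tail
    leaves one factor at \<open>y\<close>, and removing the edge \<open>xy\<close> then leaves one
    factor at \<open>x\<close>.\<close>
  let ?k = "\<lambda>v. k v + 2 * ind {x} v"
  have "(\<lambda>v. k v + 2 * ind (set (x # y # zs)) v) = (\<lambda>v. ?k v + 2 * ind (set (y # zs)) v)"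
    using 3(4) by auto
  then have "R (\<lambda>v. ?k v + 2 * ind (set (y # zs)) v)" using 3(6) by simp
  moreover have "walk E (y # zs)" "distinct (y # zs)" using 3(3,4) by (simp_all add: successively_Cons)
  ultimately have "R (\<lambda>v. ?k v + (ind {hd (y # zs)} v + ind {last (y # zs)} v))"
    by (intro 3(2)) simp_all
  then have "R (\<lambda>v. ?k v + (ind {y} v + ind {last (y # zs)} v))" by (simp only: list.sel)
  moreover have "(\<lambda>v. ?k v + (ind {y} v + ind {last (y # zs)} v)) =
      (\<lambda>v. (k v + (ind {x} v + ind {last (y # zs)} v)) + ind {x, y} v)"
    using 3(4) by auto
  ultimately have "R (\<lambda>v. (k v + (ind {x} v + ind {last (y # zs)} v)) + ind {x, y} v)" by simp
  moreover have "{x, y} \<in> E" using 3(3) by (simp add: successively_Cons)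
  ultimately have "R (\<lambda>v. k v + (ind {x} v + ind {last (y # zs)} v))" by (rule R[rotated])
  then show ?case by simp
qed simp

lemma path_pos_S:
  assumes p: "simple_path_between E a p c"
    and pos: "0 < PI (\<lambda>z. mono (\<lambda>v. k v + 2 * ind (set p) v) l z * W2 z)"
  shows "0 < PI (\<lambda>z. mono (\<lambda>v. k v + (ind {a} v + ind {c} v)) l z * W2 z)"
  using path_exponents[where R = "\<lambda>k. 0 < PI (\<lambda>z. mono k l z * W2 z)" and p = p and k = k] p pos
    weight2_edge(1)[OF E_facts(1,2) J_pos \<beta>_pos]
  by (auto simp: simple_path_between_def)

lemma path_pos_D:
  assumes p: "simple_path_between E a p c"
    and pos: "0 < PI (\<lambda>z. mono k (\<lambda>v. l v + 2 * ind (set p) v) z * W2 z)"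
  shows "0 < PI (\<lambda>z. mono k (\<lambda>v. l v + (ind {a} v + ind {c} v)) z * W2 z)"
  using path_exponents[where R = "\<lambda>l. 0 < PI (\<lambda>z. mono k l z * W2 z)" and p = p and k = l] p pos
    weight2_edge(2)[OF E_facts(1,2) J_pos \<beta>_pos]
  by (auto simp: simple_path_between_def)

lemma mono_single:
  assumes "a \<in> V"
  shows "mono (ind {a}) (\<lambda>_. 0) z = fst z a + snd z a" "mono (\<lambda>_. 0) (ind {a}) z = fst z a - snd z a"
  using mono_ind[of "{a}" z] assms by simp_all

lemma mono4:
  assumes "a \<in> V" "b \<in> V" "c \<in> V" "d \<in> V"
  shows "mono (\<lambda>v. ind {a} v + ind {c} v) (\<lambda>v. ind {b} v + ind {d} v) z =
    (fst z a + snd z a) * (fst z c + snd z c) * ((fst z b - snd z b) * (fst z d - snd z d))"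
proof -
  have "mono (\<lambda>v. ind {a} v + ind {c} v) (\<lambda>v. ind {b} v + ind {d} v) z =
    (mono (ind {a}) (\<lambda>_. 0) z * mono (ind {c}) (\<lambda>_. 0) z) * (mono (\<lambda>_. 0) (ind {b}) z * mono (\<lambda>_. 0) (ind {d}) z)"
    unfolding mono_mult by simp
  then show ?thesis
    unfolding mono_single(1)[OF assms(1)] mono_single(1)[OF assms(3)] mono_single(2)[OF assms(2)] mono_single(2)[OF assms(4)] .
qed

lemma mono2:
  assumes "a \<in> V" "c \<in> V"
  shows "mono (\<lambda>v. ind {a} v + ind {c} v) (\<lambda>_. 0) z = (fst z a + snd z a) * (fst z c + snd z c)"
    "mono (\<lambda>_. 0) (\<lambda>v. ind {a} v + ind {c} v) z = (fst z a - snd z a) * (fst z c - snd z c)"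
proof -
  have "mono (\<lambda>v. ind {a} v + ind {c} v) (\<lambda>_. 0) z = mono (ind {a}) (\<lambda>_. 0) z * mono (ind {c}) (\<lambda>_. 0) z"
    "mono (\<lambda>_. 0) (\<lambda>v. ind {a} v + ind {c} v) z = mono (\<lambda>_. 0) (ind {a}) z * mono (\<lambda>_. 0) (ind {c}) z"
    unfolding mono_mult by simp_all
  then show "mono (\<lambda>v. ind {a} v + ind {c} v) (\<lambda>_. 0) z = (fst z a + snd z a) * (fst z c + snd z c)"
    "mono (\<lambda>_. 0) (\<lambda>v. ind {a} v + ind {c} v) z = (fst z a - snd z a) * (fst z c - snd z c)"
    unfolding mono_single(1)[OF assms(1)] mono_single(1)[OF assms(2)] mono_single(2)[OF assms(1)] mono_single(2)[OF assms(2)]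
    by simp_all
qed

text \<open>The square of the partition function is the weighted moment of the trivial monomial,
  which is at least the positive moment without weight.\<close>

lemma Ex_1_pos: "0 < Ex (\<lambda>_. 1)"
proof -
  have "0 < PI (mono (\<lambda>_. 0) (\<lambda>_. 0))" by (rule PI_mono_pos) auto
  also have "\<dots> \<le> PI (\<lambda>z. mono (\<lambda>_. 0) (\<lambda>_. 0) z * W2 z)" by (rule W2_ge)
  also have "\<dots> = PI W2" by (simp add: mono_def case_prod_unfold)
  also have "\<dots> = Ex (\<lambda>_. 1) * Ex (\<lambda>_. 1)"
    using PI_Ex[of "\<lambda>_. 1" "\<lambda>_. 1"] by (simp add: has_bochner_integral_iff)
  finally have "Ex (\<lambda>_. 1) \<noteq> 0" by auto
  moreover have "0 \<le> Ex (\<lambda>_. 1)" unfolding Ex_def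
    by (intro integral_nonneg_AE AE_I2) (simp add: boltzmann_weight_def)
  ultimately show ?thesis by simp
qed

lemma tame1_2: "a \<in> V \<Longrightarrow> b \<in> V \<Longrightarrow> tame1 (\<lambda>x. x a * x b)"
  by (intro tame1_mult tame1_coord)

lemma tame1_4: "a \<in> V \<Longrightarrow> b \<in> V \<Longrightarrow> c \<in> V \<Longrightarrow> d \<in> V \<Longrightarrow> tame1 (\<lambda>x. x a * x b * (x c * x d))"
  by (intro tame1_mult tame1_coord)

text \<open>With \<open>\<xi> = x + y\<close> and \<open>\<eta> = x - y\<close> for two independent copies, the left-hand sides below are
  correlations in \<open>\<xi>\<close> and \<open>\<eta>\<close>, which are nonnegative by Ginibre's argument.\<close>

lemma four_point_identity:
  assumes V: "a \<in> V" "b \<in> V" "c \<in> V" "d \<in> V"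
  shows "PI (\<lambda>z. mono (\<lambda>v. ind {a} v + ind {c} v) (\<lambda>v. ind {b} v + ind {d} v) z * W2 z) +
      PI (\<lambda>z. mono (\<lambda>v. ind {b} v + ind {d} v) (\<lambda>v. ind {a} v + ind {c} v) z * W2 z) =
    4 * (Ex (\<lambda>x. x a * x b * (x c * x d)) * Ex (\<lambda>_. 1) + Ex (\<lambda>x. x a * x c) * Ex (\<lambda>x. x b * x d)
      - Ex (\<lambda>x. x a * x b) * Ex (\<lambda>x. x c * x d) - Ex (\<lambda>x. x a * x d) * Ex (\<lambda>x. x b * x c))"
proof -
  note t2 = tame1_2 tame1_4 tame1_const
  let ?m1 = "\<lambda>z. mono (\<lambda>v. ind {a} v + ind {c} v) (\<lambda>v. ind {b} v + ind {d} v) z * W2 z"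
  let ?m2 = "\<lambda>z. mono (\<lambda>v. ind {b} v + ind {d} v) (\<lambda>v. ind {a} v + ind {c} v) z * W2 z"
  let ?t = "\<lambda>f g z. f (fst z) * g (snd z) * W2 z"
  let ?abcd = "\<lambda>x. x a * x b * (x c * x d)" and ?one = "\<lambda>_ :: 'v \<Rightarrow> real. 1 :: real"
  let ?ac = "\<lambda>x. x a * x c" and ?bd = "\<lambda>x. x b * x d" and ?ab = "\<lambda>x. x a * x b" and ?cd = "\<lambda>x. x c * x d"
    and ?ad = "\<lambda>x. x a * x d" and ?bc = "\<lambda>x. x b * x c"
  have "has_bochner_integral (M \<Otimes>\<^sub>M M) (\<lambda>z. ?m1 z + ?m2 z) (PI ?m1 + PI ?m2)"
    by (intro has_bochner_integral_add has_integral_mono)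
  moreover have "has_bochner_integral (M \<Otimes>\<^sub>M M)
     (\<lambda>z. 2 * ((((?t ?abcd ?one z + ?t ?one ?abcd z) + (?t ?ac ?bd z + ?t ?bd ?ac z))
        - (?t ?ab ?cd z + ?t ?cd ?ab z)) - (?t ?ad ?bc z + ?t ?bc ?ad z)))
     (2 * ((((Ex ?abcd * Ex ?one + Ex ?one * Ex ?abcd) + (Ex ?ac * Ex ?bd + Ex ?bd * Ex ?ac))
        - (Ex ?ab * Ex ?cd + Ex ?cd * Ex ?ab)) - (Ex ?ad * Ex ?bc + Ex ?bc * Ex ?ad)))"
    using V by (intro has_bochner_integral_mult_right has_bochner_integral_diff has_bochner_integral_add PI_Ex t2)
  moreover have "?m1 z + ?m2 z = 2 * ((((?t ?abcd ?one z + ?t ?one ?abcd z) + (?t ?ac ?bd z + ?t ?bd ?ac z))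
        - (?t ?ab ?cd z + ?t ?cd ?ab z)) - (?t ?ad ?bc z + ?t ?bc ?ad z))" for z
    unfolding mono4[OF V] mono4[OF V(2,1,4,3)] by (simp add: algebra_simps)
  ultimately have "PI ?m1 + PI ?m2 = 2 * ((((Ex ?abcd * Ex ?one + Ex ?one * Ex ?abcd) + (Ex ?ac * Ex ?bd + Ex ?bd * Ex ?ac))
        - (Ex ?ab * Ex ?cd + Ex ?cd * Ex ?ab)) - (Ex ?ad * Ex ?bc + Ex ?bc * Ex ?ad))"
    using has_bochner_integral_eq by (simp only:)
  then show ?thesis by (simp add: algebra_simps)
qed

text \<open>Start from squares of \<xi> along \<open>p\<close> and of \<eta> along \<open>q\<close>.
  This moment is positive because no Ising vertex carries both variables. Removing the edges of both
  paths leaves the first correlation of the identity, and the second one is nonnegative.\<close>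

theorem four_point_strict:
  assumes V: "a \<in> V" "b \<in> V" "c \<in> V" "d \<in> V"
    and p: "simple_path_between E a p c" and q: "simple_path_between E b q d"
    and pq: "\<And>v. v \<in> set p \<inter> set q \<Longrightarrow> \<not> ising_type (lam v)"
  shows "Ex (\<lambda>x. x a * x b) * Ex (\<lambda>x. x c * x d) + Ex (\<lambda>x. x a * x d) * Ex (\<lambda>x. x b * x c) <
    Ex (\<lambda>x. x a * x b * (x c * x d)) * Ex (\<lambda>_. 1) + Ex (\<lambda>x. x a * x c) * Ex (\<lambda>x. x b * x d)"
proof -
  have "0 < PI (mono (\<lambda>v. 2 * ind (set p) v) (\<lambda>v. 2 * ind (set q) v))"
    using pq by (intro PI_mono_pos) auto
  also have "\<dots> \<le> PI (\<lambda>z. mono (\<lambda>v. 2 * ind (set p) v) (\<lambda>v. 2 * ind (set q) v) z * W2 z)" by (rule W2_ge)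
  finally have "0 < PI (\<lambda>z. mono (\<lambda>v. 0 + 2 * ind (set p) v) (\<lambda>v. 0 + 2 * ind (set q) v) z * W2 z)" by simp
  from path_pos_D[OF q path_pos_S[OF p this]]
  have "0 < PI (\<lambda>z. mono (\<lambda>v. ind {a} v + ind {c} v) (\<lambda>v. ind {b} v + ind {d} v) z * W2 z)" by simp
  moreover have "0 \<le> PI (\<lambda>z. mono (\<lambda>v. ind {b} v + ind {d} v) (\<lambda>v. ind {a} v + ind {c} v) z * W2 z)"
    by (rule W2_nonneg)
  ultimately have "0 < 4 * (Ex (\<lambda>x. x a * x b * (x c * x d)) * Ex (\<lambda>_. 1) + Ex (\<lambda>x. x a * x c) * Ex (\<lambda>x. x b * x d)
      - Ex (\<lambda>x. x a * x b) * Ex (\<lambda>x. x c * x d) - Ex (\<lambda>x. x a * x d) * Ex (\<lambda>x. x b * x c))"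
    unfolding four_point_identity[OF V, symmetric] by (rule add_pos_nonneg)
  moreover have "0 < 4 * (A + B - C - D) \<Longrightarrow> C + D < A + B" for A B C D :: real by simp
  ultimately show ?thesis by blast
qed

lemma pair_identity:
  assumes V: "a \<in> V" "c \<in> V"
  shows "PI (\<lambda>z. mono (\<lambda>v. ind {a} v + ind {c} v) (\<lambda>_. 0) z * W2 z) +
      PI (\<lambda>z. mono (\<lambda>_. 0) (\<lambda>v. ind {a} v + ind {c} v) z * W2 z) = 4 * (Ex (\<lambda>x. x a * x c) * Ex (\<lambda>_. 1))"
proof -
  let ?m1 = "\<lambda>z. mono (\<lambda>v. ind {a} v + ind {c} v) (\<lambda>_. 0) z * W2 z"
  let ?m2 = "\<lambda>z. mono (\<lambda>_. 0) (\<lambda>v. ind {a} v + ind {c} v) z * W2 z"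
  let ?t = "\<lambda>f g z. f (fst z) * g (snd z) * W2 z"
  let ?ac = "\<lambda>x. x a * x c" and ?one = "\<lambda>_ :: 'v \<Rightarrow> real. 1 :: real"
  have "has_bochner_integral (M \<Otimes>\<^sub>M M) (\<lambda>z. ?m1 z + ?m2 z) (PI ?m1 + PI ?m2)"
    by (intro has_bochner_integral_add has_integral_mono)
  moreover have "has_bochner_integral (M \<Otimes>\<^sub>M M) (\<lambda>z. 2 * (?t ?ac ?one z + ?t ?one ?ac z))
      (2 * (Ex ?ac * Ex ?one + Ex ?one * Ex ?ac))"
    using V by (intro has_bochner_integral_mult_right has_bochner_integral_add PI_Ex tame1_2 tame1_const)
  moreover have "?m1 z + ?m2 z = 2 * (?t ?ac ?one z + ?t ?one ?ac z)" for z
    unfolding mono2[OF V] by (simp add: algebra_simps)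
  ultimately have "PI ?m1 + PI ?m2 = 2 * (Ex ?ac * Ex ?one + Ex ?one * Ex ?ac)"
    using has_bochner_integral_eq by (simp only:)
  then show ?thesis by simp
qed

text \<open>The same scheme with squares of \<xi> alone, whose moments are positive at every vertex,
  Ising or not.\<close>

lemma pair_pos:
  assumes V: "a \<in> V" "c \<in> V" and p: "simple_path_between E a p c"
  shows "0 < Ex (\<lambda>x. x a * x c)"
proof -
  have "0 < PI (mono (\<lambda>v. 2 * ind (set p) v) (\<lambda>_. 0))" by (intro PI_mono_pos) auto
  also have "\<dots> \<le> PI (\<lambda>z. mono (\<lambda>v. 2 * ind (set p) v) (\<lambda>_. 0) z * W2 z)" by (rule W2_ge)
  finally have "0 < PI (\<lambda>z. mono (\<lambda>v. 0 + 2 * ind (set p) v) (\<lambda>_. 0) z * W2 z)" by simp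
  from path_pos_S[OF p this] have "0 < PI (\<lambda>z. mono (\<lambda>v. ind {a} v + ind {c} v) (\<lambda>_. 0) z * W2 z)" by simp
  then have "0 < 4 * (Ex (\<lambda>x. x a * x c) * Ex (\<lambda>_. 1))"
    unfolding pair_identity[OF V, symmetric] by (rule add_pos_nonneg[OF _ W2_nonneg])
  then show ?thesis using Ex_1_pos by (simp add: zero_less_mult_iff)
qed

text \<open>The four correlations are chosen so that the products of the pp and qr correlations
  cancel in the sum, which leaves only the two terms of a Griffiths inequality.\<close>

lemma griffiths_identity:
  assumes V: "p \<in> V" "q \<in> V" "r \<in> V"
  shows "PI (\<lambda>z. mono (\<lambda>v. ind {p} v + ind {p} v) (\<lambda>v. ind {q} v + ind {r} v) z * W2 z) +
      PI (\<lambda>z. mono (\<lambda>v. ind {p} v + ind {r} v) (\<lambda>v. ind {p} v + ind {q} v) z * W2 z) +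
      (PI (\<lambda>z. mono (\<lambda>v. ind {p} v + ind {q} v) (\<lambda>v. ind {p} v + ind {r} v) z * W2 z) +
      PI (\<lambda>z. mono (\<lambda>v. ind {q} v + ind {r} v) (\<lambda>v. ind {p} v + ind {p} v) z * W2 z)) =
    8 * (Ex (\<lambda>x. x p * x p * (x q * x r)) * Ex (\<lambda>_. 1) - Ex (\<lambda>x. x p * x q) * Ex (\<lambda>x. x p * x r))"
proof -
  let ?m = "\<lambda>a c b d z. mono (\<lambda>v. ind {a} v + ind {c} v) (\<lambda>v. ind {b} v + ind {d} v) z * W2 z"
  let ?t = "\<lambda>f g z. f (fst z) * g (snd z) * W2 z"
  let ?ppqr = "\<lambda>x. x p * x p * (x q * x r)" and ?one = "\<lambda>_ :: 'v \<Rightarrow> real. 1 :: real"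
  let ?pq = "\<lambda>x. x p * x q" and ?pr = "\<lambda>x. x p * x r"
  have "has_bochner_integral (M \<Otimes>\<^sub>M M) (\<lambda>z. (?m p p q r z + ?m p r p q z) + (?m p q p r z + ?m q r p p z))
      ((PI (?m p p q r) + PI (?m p r p q)) + (PI (?m p q p r) + PI (?m q r p p)))"
    by (intro has_bochner_integral_add has_integral_mono)
  moreover have "has_bochner_integral (M \<Otimes>\<^sub>M M)
      (\<lambda>z. 4 * ((?t ?ppqr ?one z + ?t ?one ?ppqr z) - (?t ?pq ?pr z + ?t ?pr ?pq z)))
      (4 * ((Ex ?ppqr * Ex ?one + Ex ?one * Ex ?ppqr) - (Ex ?pq * Ex ?pr + Ex ?pr * Ex ?pq)))"
    using V by (intro has_bochner_integral_mult_right has_bochner_integral_diff has_bochner_integral_add PI_Ex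
        tame1_2 tame1_4 tame1_const)
  moreover have "(?m p p q r z + ?m p r p q z) + (?m p q p r z + ?m q r p p z) =
      4 * ((?t ?ppqr ?one z + ?t ?one ?ppqr z) - (?t ?pq ?pr z + ?t ?pr ?pq z))" for z
    unfolding mono4[OF V(1,2,1,3)] mono4[OF V(1,1,3,2)] mono4[OF V(1,1,2,3)] mono4[OF V(2,1,3,1)]
    by (simp add: algebra_simps)
  ultimately have "(PI (?m p p q r) + PI (?m p r p q)) + (PI (?m p q p r) + PI (?m q r p p)) =
      4 * ((Ex ?ppqr * Ex ?one + Ex ?one * Ex ?ppqr) - (Ex ?pq * Ex ?pr + Ex ?pr * Ex ?pq))"
    using has_bochner_integral_eq by (simp only:)
  then show ?thesis by (simp add: algebra_simps)
qed

lemma Ex_ising_square: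
  assumes p: "p \<in> V" "lam p = ising_measure s" "0 < s" and f: "tame1 f"
  shows "Ex (\<lambda>x. x p * x p * f x) = s\<^sup>2 * Ex f"
proof -
  have "AE t in lam p. t * t = s\<^sup>2"
    using AE_ising_measure[OF p(3)] unfolding p(2) by (rule AE_mp) (auto simp: power2_eq_square)
  then have AE: "AE x in M. x p * x p = s\<^sup>2"
    using AE_PiM_component[of V lam p "\<lambda>t. t * t = s\<^sup>2"] prob_space_lam p(1) by blast
  have "Ex (\<lambda>x. x p * x p * f x) = (\<integral>x. s\<^sup>2 * (f x * W x) \<partial>M)"
    unfolding Ex_def
  proof (rule integral_cong_AE)
    show "(\<lambda>x. x p * x p * f x * W x) \<in> borel_measurable M"
      using p(1) f by (intro borel_measurable_integrable integrable_W tame1_mult tame1_coord)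
    show "(\<lambda>x. s\<^sup>2 * (f x * W x)) \<in> borel_measurable M"
      using integrable_W[OF f] by simp
    show "AE x in M. x p * x p * f x * W x = s\<^sup>2 * (f x * W x)" using AE by (rule AE_mp) auto
  qed
  then show ?thesis by (simp add: Ex_def)
qed

text \<open>For an Ising vertex \<open>p\<close> the factor \<open>x p * x p\<close> is almost
  surely the constant \<open>s\<^sup>2\<close>, so the identity compares pair correlations. For
  strictness, squares of \<xi> at \<open>p\<close> and of \<eta> along a path missing
  \<open>p\<close> share no vertex, which makes the first of the four correlations positive.\<close>

theorem griffiths:
  assumes V: "p \<in> V" "q \<in> V" "r \<in> V" and s: "lam p = ising_measure s" "0 < s"
  shows "Ex (\<lambda>x. x p * x q) * Ex (\<lambda>x. x p * x r) \<le> s\<^sup>2 * Ex (\<lambda>x. x q * x r) * Ex (\<lambda>_. 1)"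
    and "simple_path_between E q \<pi> r \<Longrightarrow> p \<notin> set \<pi> \<Longrightarrow>
      Ex (\<lambda>x. x p * x q) * Ex (\<lambda>x. x p * x r) < s\<^sup>2 * Ex (\<lambda>x. x q * x r) * Ex (\<lambda>_. 1)"
proof -
  note id = griffiths_identity[OF V, unfolded Ex_ising_square[OF V(1) s tame1_2[OF V(2,3)]]]
  show "Ex (\<lambda>x. x p * x q) * Ex (\<lambda>x. x p * x r) \<le> s\<^sup>2 * Ex (\<lambda>x. x q * x r) * Ex (\<lambda>_. 1)"
  proof -
    have "0 \<le> 8 * (s\<^sup>2 * Ex (\<lambda>x. x q * x r) * Ex (\<lambda>_. 1) - Ex (\<lambda>x. x p * x q) * Ex (\<lambda>x. x p * x r))"
      unfolding id[symmetric] by (intro add_nonneg_nonneg W2_nonneg)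
    moreover have "0 \<le> 8 * (A - B) \<Longrightarrow> B \<le> A" for A B :: real by simp
    ultimately show ?thesis by blast
  qed
  assume \<pi>: "simple_path_between E q \<pi> r" "p \<notin> set \<pi>"
  have "0 < PI (mono (\<lambda>v. 2 * ind {p} v) (\<lambda>v. 2 * ind (set \<pi>) v))"
    using \<pi>(2) by (intro PI_mono_pos) auto
  also have "\<dots> \<le> PI (\<lambda>z. mono (\<lambda>v. 2 * ind {p} v) (\<lambda>v. 2 * ind (set \<pi>) v) z * W2 z)" by (rule W2_ge)
  finally have "0 < PI (\<lambda>z. mono (\<lambda>v. 2 * ind {p} v) (\<lambda>v. 0 + 2 * ind (set \<pi>) v) z * W2 z)" by simp
  from path_pos_D[OF \<pi>(1) this]
  have "0 < PI (\<lambda>z. mono (\<lambda>v. ind {p} v + ind {p} v) (\<lambda>v. ind {q} v + ind {r} v) z * W2 z)"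
    by (simp add: mult_2)
  note pos = this
  show "Ex (\<lambda>x. x p * x q) * Ex (\<lambda>x. x p * x r) < s\<^sup>2 * Ex (\<lambda>x. x q * x r) * Ex (\<lambda>_. 1)"
  proof -
    have "0 < 8 * (s\<^sup>2 * Ex (\<lambda>x. x q * x r) * Ex (\<lambda>_. 1) - Ex (\<lambda>x. x p * x q) * Ex (\<lambda>x. x p * x r))"
      unfolding id[symmetric] by (intro add_pos_nonneg add_nonneg_nonneg W2_nonneg pos)
    moreover have "0 < 8 * (A - B) \<Longrightarrow> B < A" for A B :: real by simp
    ultimately show ?thesis by blast
  qed
qed

end

section \<open>Pfaffian relations\<close>

text \<open>Expansion over the 24 permutations by repeated insertion of an index. Each of the three
  matchings occurs eight times, which is the normalisation \<open>2 ^ 2 * fact 2\<close>.\<close>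

lemma pfaffian_4:
  assumes "\<And>i j. A j i = - A i j"
  shows "pfaffian 4 A = A 0 1 * A 2 3 - A 0 2 * A 1 3 + A 0 3 * A 1 2"
proof -
  have set4: "{..<4::nat} = insert 0 (insert 1 (insert 2 (insert 3 {})))" by auto
  have perm: "permutation q" if "q permutes S" "finite S" for q :: "nat \<Rightarrow> nat" and S
    using that permutation_permutes by blast
  have step: "(\<Sum>p | p permutes insert a S. f p) = (\<Sum>b\<in>insert a S. \<Sum>q | q permutes S. f (Transposition.transpose a b \<circ> q))"
    if "finite S" "a \<notin> S" for f :: "(nat \<Rightarrow> nat) \<Rightarrow> real" and a S
    using sum_over_permutations_insert[OF that] by simp
  let ?f = "\<lambda>p. real_of_int (sign p) * (A (p 0) (p 1) * A (p 2) (p 3))"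
  have sgn: "sign (Transposition.transpose a b \<circ> q) = (if a = b then 1 else -1) * sign q" if "permutation q" for a b :: nat and q
    using that by (simp add: sign_compose sign_swap_id permutation_swap_id)
  have pT: "permutation (Transposition.transpose a b \<circ> q)" if "permutation q" for a b :: nat and q
    using that by (simp add: permutation_compose permutation_swap_id)
  have "(\<Sum>p | p permutes {..<4}. ?f p) = 8 * (A 0 1 * A 2 3 - A 0 2 * A 1 3 + A 0 3 * A 1 2)"
    unfolding set4
    by (simp add: step sgn pT permutation_id permutation_swap_id sign_swap_id sign_id Transposition.transpose_def permutes_empty
        assms[of "Suc 0" 0] assms[of 2 0] assms[of 3 0] assms[of 2 "Suc 0"] assms[of 3 "Suc 0"] assms[of 3 2])
  moreover have "{..<(4::nat) div 2} = {0, 1}" by auto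
  then have "(\<Prod>i<(4::nat) div 2. A (p (2 * i)) (p (2 * i + 1))) = A (p 0) (p 1) * A (p 2) (p 3)" for p
    by (simp add: numeral_2_eq_2 numeral_3_eq_3)
  ultimately show ?thesis unfolding pfaffian_def by (simp add: fact_numeral)
qed

lemma pfaffian_on_4:
  assumes "i < k" "k < j" "j < l" and A: "\<And>i j. A j i = - A i j"
  shows "pfaffian_on {i, k, j, l} A = A i k * A j l - A i j * A k l + A i l * A k j"
proof -
  have "sorted_list_of_set (set [i, k, j, l]) = [i, k, j, l]"
    using assms(1-3) by (intro sorted_list_of_set.idem_if_sorted_distinct) auto
  then have s: "sorted_list_of_set {i, k, j, l} = [i, k, j, l]" by simp
  have c: "card {i, k, j, l} = 4" using assms(1-3) by auto
  let ?x = "[i, k, j, l]"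
  have "pfaffian 4 (\<lambda>a b. A (?x ! a) (?x ! b)) = A (?x ! 0) (?x ! 1) * A (?x ! 2) (?x ! 3)
      - A (?x ! 0) (?x ! 2) * A (?x ! 1) (?x ! 3) + A (?x ! 0) (?x ! 3) * A (?x ! 1) (?x ! 2)"
    by (rule pfaffian_4) (rule A)
  then show ?thesis unfolding pfaffian_on_def s c by (simp add: numeral_2_eq_2 numeral_3_eq_3)
qed

context ferromagnet
begin

lemma clear_denominators:
  fixes z :: real
  shows "0 < z \<Longrightarrow> x / z = a / z * (b / z) - c / z * (d / z) + f / z * (g / z) \<Longrightarrow> x * z = a * b - c * d + f * g"
  by (simp add: field_simps)

lemma spin_expectation_Ex:
  assumes "tame1 f"
  shows "spin_expectation V E J \<beta> lam f = Ex f / Ex (\<lambda>_. 1)"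
  using spin_expectation_ratio[OF graph assms] Ex_1_pos by (simp add: Ex_def)

text \<open>For two paths without a common Ising vertex, the four-point Pfaffian relation would be
  an equation where \<open>four_point_strict\<close> has a strict inequality.\<close>

theorem pfaffian_paths_meet:
  assumes ws: "set ws \<subseteq> V" "distinct ws" and pf: "pfaffian_relations (spin_expectation V E J \<beta> lam) ws"
    and ord: "i < k" "k < j" "j < l" "l < length ws"
    and p: "simple_path_between E (ws ! i) p (ws ! j)" and q: "simple_path_between E (ws ! k) q (ws ! l)"
  shows "\<exists>v\<in>set p \<inter> set q. ising_type (lam v)"
proof (rule ccontr)
  assume "\<not> ?thesis"
  then have no: "\<And>v. v \<in> set p \<inter> set q \<Longrightarrow> \<not> ising_type (lam v)" by blast
  let ?e = "spin_expectation V E J \<beta> lam" and ?Z = "Ex (\<lambda>_. 1)"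
  let ?A = "correlation_matrix ?e ws"
  define a b c d where "a = ws ! i" and "b = ws ! k" and "c = ws ! j" and "d = ws ! l"
  have V: "a \<in> V" "b \<in> V" "c \<in> V" "d \<in> V" using ws(1) ord by (auto simp: a_def b_def c_def d_def)
  have "{i, k, j, l} \<subseteq> {..<length ws}" using ord by auto
  with pf have "?e (\<lambda>\<phi>. \<Prod>m\<in>{i, k, j, l}. \<phi> (ws ! m)) = pfaffian_on {i, k, j, l} ?A"
    unfolding pfaffian_relations_def by blast
  also have "\<dots> = ?A i k * ?A j l - ?A i j * ?A k l + ?A i l * ?A k j"
    using ord by (intro pfaffian_on_4) (auto simp: correlation_matrix_def)
  also have "(\<lambda>\<phi>. \<Prod>m\<in>{i, k, j, l}. \<phi> (ws ! m)) = (\<lambda>\<phi>. \<phi> a * \<phi> b * (\<phi> c * \<phi> d))"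
    using ord by (auto simp: a_def b_def c_def d_def mult_ac)
  finally have "?e (\<lambda>\<phi>. \<phi> a * \<phi> b * (\<phi> c * \<phi> d)) = ?e (\<lambda>\<phi>. \<phi> a * \<phi> b) * ?e (\<lambda>\<phi>. \<phi> c * \<phi> d)
      - ?e (\<lambda>\<phi>. \<phi> a * \<phi> c) * ?e (\<lambda>\<phi>. \<phi> b * \<phi> d) + ?e (\<lambda>\<phi>. \<phi> a * \<phi> d) * ?e (\<lambda>\<phi>. \<phi> b * \<phi> c)"
    using ord by (simp add: correlation_matrix_def a_def b_def c_def d_def)
  then have "Ex (\<lambda>x. x a * x b * (x c * x d)) * ?Z = Ex (\<lambda>x. x a * x b) * Ex (\<lambda>x. x c * x d)
      - Ex (\<lambda>x. x a * x c) * Ex (\<lambda>x. x b * x d) + Ex (\<lambda>x. x a * x d) * Ex (\<lambda>x. x b * x c)"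
    unfolding spin_expectation_Ex[OF tame1_4[OF V]] spin_expectation_Ex[OF tame1_2[OF V(1,2)]]
      spin_expectation_Ex[OF tame1_2[OF V(1,3)]] spin_expectation_Ex[OF tame1_2[OF V(1,4)]]
      spin_expectation_Ex[OF tame1_2[OF V(2,3)]] spin_expectation_Ex[OF tame1_2[OF V(2,4)]]
      spin_expectation_Ex[OF tame1_2[OF V(3,4)]]
    using clear_denominators[OF Ex_1_pos] by blast
  moreover have "Ex (\<lambda>x. x a * x b) * Ex (\<lambda>x. x c * x d) + Ex (\<lambda>x. x a * x d) * Ex (\<lambda>x. x b * x c) <
    Ex (\<lambda>x. x a * x b * (x c * x d)) * ?Z + Ex (\<lambda>x. x a * x c) * Ex (\<lambda>x. x b * x d)"
    using four_point_strict[OF V _ _ no] p q by (simp add: a_def b_def c_def d_def)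
  ultimately show False by linarith
qed

end

section \<open>Conditioning on Ising spins and independence of blocks of coordinates\<close>

context reference_family
begin

interpretation product_prob_space lam V
  by (simp add: product_prob_space_def product_prob_space_axioms_def product_sigma_finite_def
      prob_space_lam prob_space_imp_sigma_finite)
lemma prob_space_M: "prob_space M"
  by (rule prob_space_PiM) (rule prob_space_lam)

lemma tame1_measurable: "tame1 f \<Longrightarrow> f \<in> borel_measurable M"
  using tame1_integrable by blast

lemma tame1_bound:
  assumes "tame1 f"
  obtains A \<alpha> where "A \<ge> 0" "\<alpha> \<ge> 0" "\<And>x. \<bar>f x\<bar> \<le> A * exp (\<alpha> * sq x)"
proof -
  obtain A \<alpha> where A: "A \<ge> 0" "\<alpha> \<ge> 0" "\<And>x y. \<bar>f x\<bar> \<le> A * exp (\<alpha> * (sq x + sq y))"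
    using assms unfolding tame1_def tame_def by auto
  have "\<bar>f x\<bar> \<le> A * exp (\<alpha> * sq x)" for x using A(3)[of x "\<lambda>_. 0"] by (simp add: sq_def)
  then show ?thesis using A(1,2) that by blast
qed

lemma tame1I:
  assumes f: "f \<in> borel_measurable M" and A: "A \<ge> 0" "\<alpha> \<ge> 0" "\<And>x. \<bar>f x\<bar> \<le> A * exp (\<alpha> * sq x)"
  shows "tame1 f"
proof -
  have *: "A * exp (\<alpha> * sq x) \<le> A * exp (\<alpha> * (sq x + sq y))" for x y
    using A(1,2) sq_nonneg[of y] by (intro mult_left_mono) (auto intro!: mult_left_mono)
  have m: "(\<lambda>z. f (fst z)) \<in> borel_measurable (M \<Otimes>\<^sub>M M)" "(\<lambda>z. f (snd z)) \<in> borel_measurable (M \<Otimes>\<^sub>M M)"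
    using measurable_compose[OF measurable_fst f] measurable_compose[OF measurable_snd f] by auto
  have 1: "\<bar>f x\<bar> \<le> A * exp (\<alpha> * (sq x + sq y))" for x y using A(3)[of x] *[of x y] by linarith
  have 2: "\<bar>f y\<bar> \<le> A * exp (\<alpha> * (sq x + sq y))" for x y using 1[of y x] by (simp add: add.commute)
  show ?thesis unfolding tame1_def
    using tameI[of "\<lambda>z. f (fst z)" A \<alpha>] tameI[of "\<lambda>z. f (snd z)" A \<alpha>] m A 1 2 by simp
qed

lemma tame1_add:
  assumes "tame1 f" "tame1 g"
  shows "tame1 (\<lambda>x. f x + g x)"
  using assms unfolding tame1_def by (auto intro: tame_add)

lemma tame1_sum: "(\<And>i. i \<in> I \<Longrightarrow> tame1 (f i)) \<Longrightarrow> tame1 (\<lambda>x. \<Sum>i\<in>I. f i x)"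
  unfolding tame1_def by (auto intro: tame_sum)

lemma measurable_override:
  assumes "K \<subseteq> V" "\<tau> \<in> PiE K (\<lambda>_. UNIV)"
  shows "(\<lambda>x. override_on x \<tau> K) \<in> measurable M M"
proof (rule measurable_PiM_single')
  show "(\<lambda>x. override_on x \<tau> K v) \<in> measurable M (lam v)" if "v \<in> V" for v
    using measurable_component_singleton[OF that, of lam] by (cases "v \<in> K") (simp_all add: override_on_def)
  show "(\<lambda>x. override_on x \<tau> K) \<in> space M \<rightarrow> (\<Pi>\<^sub>E i\<in>V. space (lam i))"
    using assms(1) by (auto simp: space_PiM override_on_def PiE_def extensional_def)
qed

lemma tame1_override:
  assumes K: "K \<subseteq> V" "\<tau> \<in> PiE K (\<lambda>_. UNIV)" and f: "tame1 f"
  shows "tame1 (\<lambda>x. f (override_on x \<tau> K))"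
proof -
  obtain A \<alpha> where A: "A \<ge> 0" "\<alpha> \<ge> 0" "\<And>x. \<bar>f x\<bar> \<le> A * exp (\<alpha> * sq x)"
    using tame1_bound[OF f] by blast
  let ?c = "\<Sum>v\<in>V. (\<tau> v)\<^sup>2"
  have sq: "sq (override_on x \<tau> K) \<le> ?c + sq x" for x
    unfolding sq_def sum.distrib[symmetric] by (intro sum_mono) (simp add: override_on_def)
  show ?thesis
  proof (rule tame1I)
    show "(\<lambda>x. f (override_on x \<tau> K)) \<in> borel_measurable M"
      by (rule measurable_compose[OF measurable_override[OF K] tame1_measurable[OF f]])
    show "0 \<le> A * exp (\<alpha> * ?c)" "0 \<le> \<alpha>" using A by simp_all
    fix x
    have "\<alpha> * sq (override_on x \<tau> K) \<le> \<alpha> * (?c + sq x)" using sq A(2) by (rule mult_left_mono)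
    then have "exp (\<alpha> * sq (override_on x \<tau> K)) \<le> exp (\<alpha> * ?c) * exp (\<alpha> * sq x)"
      by (simp add: exp_add[symmetric] distrib_left)
    then have "A * exp (\<alpha> * sq (override_on x \<tau> K)) \<le> A * (exp (\<alpha> * ?c) * exp (\<alpha> * sq x))"
      using A(1) by (rule mult_left_mono)
    then show "\<bar>f (override_on x \<tau> K)\<bar> \<le> A * exp (\<alpha> * ?c) * exp (\<alpha> * sq x)"
      using A(3)[of "override_on x \<tau> K"] by simp
  qed
qed

definition local_on :: "'v set \<Rightarrow> (('v \<Rightarrow> real) \<Rightarrow> real) \<Rightarrow> bool" where
  "local_on A f \<longleftrightarrow> (\<forall>x y. (\<forall>v\<in>A. x v = y v) \<longrightarrow> f x = f y)"

lemma local_onD: "local_on A f \<Longrightarrow> (\<And>v. v \<in> A \<Longrightarrow> x v = y v) \<Longrightarrow> f x = f y"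
  unfolding local_on_def by blast

lemma indep_coordinates: "prob_space.indep_vars M lam (\<lambda>v x. x v) V"
proof (cases "V = {}")
  case True
  show ?thesis unfolding prob_space.indep_vars_def[OF prob_space_M] prob_space.indep_sets_def[OF prob_space_M]
    using True by simp
next
  case False
  have "distr M (PiM V lam) (\<lambda>x. \<lambda>v\<in>V. x v) = distr M M (\<lambda>x. x)"
    by (intro distr_cong) (auto simp: space_PiM)
  also have "\<dots> = PiM V lam" by (rule distr_id)
  also have "PiM V lam = PiM V (\<lambda>v. distr M (lam v) (\<lambda>x. x v))"
    by (intro PiM_cong refl) (simp add: PiM_component)
  finally show ?thesis
    using False by (subst prob_space.indep_vars_iff_distr_eq_PiM'[OF prob_space_M]) auto
qed

text \<open>Coordinates are independent under a product measure, hence so are functions of disjoint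
  blocks of them.\<close>

lemma integral_blocks:
  assumes "finite I" and D: "\<And>i. i \<in> I \<Longrightarrow> D i \<subseteq> V" "disjoint_family_on D I"
    and f: "\<And>i. i \<in> I \<Longrightarrow> tame1 (f i)" "\<And>i. i \<in> I \<Longrightarrow> local_on (D i) (f i)"
  shows "(\<integral>x. (\<Prod>i\<in>I. f i x) \<partial>M) = (\<Prod>i\<in>I. \<integral>x. f i x \<partial>M)"
proof (rule prob_space.indep_vars_lebesgue_integral[OF prob_space_M, OF assms(1)])
  show "integrable M (f i)" if "i \<in> I" for i using f(1)[OF that] by (rule tame1_integrable)
  \<comment> \<open>An arbitrary base point: it completes a block of coordinates to a full
    configuration, and \<open>f i\<close> does not see it.\<close>
  define z where "z = (\<lambda>v\<in>V. 0::real)"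
  have "prob_space.indep_vars M (\<lambda>i. PiM (D i) lam) (\<lambda>i x. \<lambda>v\<in>D i. x v) I"
    by (rule prob_space.indep_vars_restrict[OF prob_space_M, OF indep_coordinates D])
  then have 1: "prob_space.indep_vars M (\<lambda>_. borel) (\<lambda>i x. f i (override_on z (\<lambda>v\<in>D i. x v) (D i))) I"
  proof (rule prob_space.indep_vars_compose2[OF prob_space_M])
    fix i assume i: "i \<in> I"
    have "(\<lambda>x. override_on z x (D i)) \<in> measurable (PiM (D i) lam) M"
    proof (rule measurable_PiM_single')
      show "(\<lambda>x. override_on z x (D i) v) \<in> measurable (PiM (D i) lam) (lam v)" if "v \<in> V" for v
        using measurable_component_singleton[of v "D i" lam] by (cases "v \<in> D i") (simp_all add: override_on_def)
      show "(\<lambda>x. override_on z x (D i)) \<in> space (PiM (D i) lam) \<rightarrow> (\<Pi>\<^sub>E i\<in>V. space (lam i))"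
        using D(1)[OF i] by (auto simp: space_PiM override_on_def z_def PiE_def extensional_def)
    qed
    from measurable_compose[OF this tame1_measurable[OF f(1)[OF i]]]
    show "(\<lambda>x. f i (override_on z x (D i))) \<in> borel_measurable (PiM (D i) lam)" .
  qed
  have 2: "f i (override_on z (\<lambda>v\<in>D i. x v) (D i)) = f i x" if "i \<in> I" for i x
    by (rule local_onD[OF f(2)[OF that]]) (simp add: override_on_def)
  have "prob_space.indep_vars M (\<lambda>_. borel) (\<lambda>i x. f i (override_on z (\<lambda>v\<in>D i. x v) (D i))) I \<longleftrightarrow>
      prob_space.indep_vars M (\<lambda>_. borel) f I"
    by (intro prob_space.indep_vars_cong[OF prob_space_M] refl) (simp add: 2)
  with 1 show "prob_space.indep_vars M (\<lambda>_. borel) f I" by blast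
qed

text \<open>The indicator of the event that an Ising spin configuration equals \<open>\<tau>\<close>, as a polynomial.\<close>

definition pin :: "('v \<Rightarrow> real) \<Rightarrow> ('v \<Rightarrow> real) \<Rightarrow> 'v set \<Rightarrow> ('v \<Rightarrow> real) \<Rightarrow> real" where
  "pin s \<tau> K x = (\<Prod>v\<in>K. (1 + x v * (\<tau> v / (s v)\<^sup>2)) / 2)"

lemma local_on_pin: "local_on K (pin s \<tau> K)"
  unfolding local_on_def pin_def by simp

lemma tame1_pin: "K \<subseteq> V \<Longrightarrow> tame1 (pin s \<tau> K)"
  unfolding pin_def divide_inverse by (intro tame1_prod tame1_mult tame1_add tame1_const tame1_coord) auto

lemma tame1_coords: "A \<subseteq> V \<Longrightarrow> tame1 (\<lambda>x. \<Prod>v\<in>A. x v)"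
  by (intro tame1_prod tame1_coord) auto

lemma pin_expand:
  assumes "finite K"
  shows "pin s \<tau> K x = (\<Sum>B\<in>Pow K. (\<Prod>v\<in>B. \<tau> v / (s v)\<^sup>2) * (\<Prod>v\<in>B. x v)) / 2 ^ card K"
proof -
  have "pin s \<tau> K x = (\<Prod>v\<in>K. x v * (\<tau> v / (s v)\<^sup>2) + 1) / 2 ^ card K"
    unfolding pin_def prod_dividef by (simp add: add.commute)
  also have "(\<Prod>v\<in>K. x v * (\<tau> v / (s v)\<^sup>2) + 1) = (\<Sum>B\<in>Pow K. (\<Prod>v\<in>B. \<tau> v / (s v)\<^sup>2) * (\<Prod>v\<in>B. x v))"
    unfolding prod_add[OF assms] prod.distrib by (intro sum.cong refl) (simp add: mult.commute)
  finally show ?thesis .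
qed

text \<open>At each vertex the factors for \<open>s v\<close> and \<open>- s v\<close> add up to one
  identically, so this partition of unity holds at every real configuration and not just almost
  everywhere.\<close>

lemma sum_pin:
  assumes "finite K" "\<And>v. v \<in> K \<Longrightarrow> 0 < s v"
  shows "(\<Sum>\<tau>\<in>PiE K (\<lambda>v. {s v, - s v}). pin s \<tau> K x) = 1"
proof -
  have "(\<Sum>\<tau>\<in>PiE K (\<lambda>v. {s v, - s v}). pin s \<tau> K x) =
    (\<Prod>v\<in>K. \<Sum>t\<in>{s v, - s v}. (1 + x v * (t / (s v)\<^sup>2)) / 2)"
    unfolding pin_def by (rule prod_sum_PiE[symmetric]) (use assms in auto)
  also have "\<dots> = 1"
  proof (rule prod.neutral, rule ballI)
    fix v assume "v \<in> K"
    then have "s v \<noteq> - s v" using assms(2)[of v] by auto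
    then show "(\<Sum>t\<in>{s v, - s v}. (1 + x v * (t / (s v)\<^sup>2)) / 2) = 1" by (simp add: field_simps)
  qed
  finally show ?thesis .
qed

lemma AE_ising_family:
  assumes "K \<subseteq> V" "\<And>v. v \<in> K \<Longrightarrow> lam v = ising_measure (s v)" "\<And>v. v \<in> K \<Longrightarrow> 0 < s v"
  shows "AE x in M. \<forall>v\<in>K. x v \<in> {s v, - s v}"
proof (rule AE_finite_allI)
  show "finite K" using assms(1) finite_V finite_subset by blast
  fix v assume v: "v \<in> K"
  have "AE t in lam v. t \<in> {s v, - s v}"
    unfolding assms(2)[OF v] using AE_ising_measure[OF assms(3)[OF v]] by simp
  then show "AE x in M. x v \<in> {s v, - s v}"
    using AE_PiM_component[of V lam v "\<lambda>t. t \<in> {s v, - s v}"] prob_space_lam assms(1) v by blast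
qed

text \<open>On Ising configurations \<open>pin\<close> vanishes unless \<open>x\<close> agrees with
  \<open>\<tau>\<close> on \<open>K\<close>, and in that case overriding the coordinates of
  \<open>L\<close> does not change what \<open>f\<close> reads.\<close>

lemma pin_override:
  assumes "finite K" "\<And>v. v \<in> K \<Longrightarrow> 0 < s v" "\<tau> \<in> PiE K (\<lambda>v. {s v, - s v})"
    "\<forall>v\<in>K. x v \<in> {s v, - s v}" and f: "local_on A f" "A \<inter> L \<subseteq> K" "K \<subseteq> L"
    and \<tau>': "\<And>v. v \<in> K \<Longrightarrow> \<tau>' v = \<tau> v"
  shows "pin s \<tau> K x * f x = pin s \<tau> K x * f (override_on x \<tau>' L)"
proof (cases "\<forall>v\<in>K. x v = \<tau> v")
  case True
  have "f x = f (override_on x \<tau>' L)"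
    by (rule local_onD[OF f(1)]) (use True f(2) \<tau>' in \<open>auto simp: override_on_def\<close>)
  then show ?thesis by simp
next
  case False
  then obtain v where v: "v \<in> K" "x v \<noteq> \<tau> v" by blast
  have "\<tau> v \<in> {s v, - s v}" "x v \<in> {s v, - s v}" using assms(3,4) v(1) by (auto simp: PiE_def Pi_def)
  then have "x v * \<tau> v = - (s v)\<^sup>2" using v(2) by (auto simp: power2_eq_square)
  then have "1 + x v * (\<tau> v / (s v)\<^sup>2) = 0" using assms(2)[OF v(1)] by simp
  then have "pin s \<tau> K x = 0" unfolding pin_def using v(1) assms(1) by (intro prod_zero) auto
  then show ?thesis by simp
qed

text \<open>Orthogonality of spin products: each site contributes a moment of exponent 0, 1 or 2,
  and the vanishing exponent 1 occurs unless \<open>S = R\<close>.\<close>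

lemma integral_coords2:
  assumes S: "S \<subseteq> V" "R \<subseteq> V" "\<And>v. v \<in> S \<union> R \<Longrightarrow> lam v = ising_measure (s v)" "\<And>v. v \<in> S \<union> R \<Longrightarrow> 0 < s v"
  shows "(\<integral>x. (\<Prod>v\<in>S. x v) * (\<Prod>v\<in>R. x v) \<partial>M) = (if S = R then \<Prod>v\<in>S. (s v)\<^sup>2 else 0)"
proof -
  define k where "k v = (if v \<in> S then 1 else 0) + (if v \<in> R then 1 else 0 :: nat)" for v
  have pw: "(\<Prod>v\<in>A. x v) = (\<Prod>v\<in>V. x v ^ (if v \<in> A then 1 else 0))" if "A \<subseteq> V" for A and x :: "'v \<Rightarrow> real"
    using that finite_V by (intro prod.mono_neutral_cong_left) auto
  have "(\<Prod>v\<in>S. x v) * (\<Prod>v\<in>R. x v) = (\<Prod>v\<in>V. x v ^ k v)" for x :: "'v \<Rightarrow> real"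
    unfolding pw[OF S(1)] pw[OF S(2)] k_def by (simp add: prod.distrib[symmetric] power_add)
  then have "(\<integral>x. (\<Prod>v\<in>S. x v) * (\<Prod>v\<in>R. x v) \<partial>M) = (\<Prod>v\<in>V. \<integral>t. t ^ k v \<partial>lam v)"
    using product_integral_prod[OF finite_V, of "\<lambda>v t. t ^ k v"] integrable_power_lam by simp
  also have "\<dots> = (\<Prod>v\<in>V. if v \<in> S \<union> R then (if v \<in> S \<inter> R then (s v)\<^sup>2 else 0) else 1)"
  proof (rule prod.cong[OF refl])
    fix v assume "v \<in> V"
    show "(\<integral>t. t ^ k v \<partial>lam v) = (if v \<in> S \<union> R then (if v \<in> S \<inter> R then (s v)\<^sup>2 else 0) else 1)"
    proof (cases "v \<in> S \<union> R")
      case True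
      have "(\<integral>t. t ^ k v \<partial>lam v) = (s v ^ k v + (- s v) ^ k v) / 2"
        unfolding S(3)[OF True] by (rule integral_ising_measure) (use S(4)[OF True] in auto)
      then show ?thesis using True by (auto simp: k_def power2_eq_square)
    next
      case False
      then show ?thesis using prob_space.prob_space[OF prob_space_lam[of v]] by (simp add: k_def)
    qed
  qed
  also have "\<dots> = (if S = R then \<Prod>v\<in>S. (s v)\<^sup>2 else 0)"
  proof (cases "S = R")
    case True
    then show ?thesis using S(1) finite_V by (simp, intro prod.mono_neutral_cong_right) auto
  next
    case False
    then obtain v where "v \<in> S \<union> R" "v \<notin> S \<inter> R" by blast
    then show ?thesis using False S(1,2) finite_V by (auto intro!: prod_zero)
  qed
  finally show ?thesis .
qed

lemma integral_pin:
  assumes K: "K \<subseteq> V" "\<And>v. v \<in> K \<Longrightarrow> lam v = ising_measure (s v)" "\<And>v. v \<in> K \<Longrightarrow> 0 < s v"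
  shows "(\<integral>x. pin s \<tau> K x \<partial>M) = 1 / 2 ^ card K"
proof -
  have fK: "finite K" using K(1) finite_V finite_subset by blast
  have "(\<integral>x. pin s \<tau> K x \<partial>M) = (\<Sum>B\<in>Pow K. (\<Prod>v\<in>B. \<tau> v / (s v)\<^sup>2) * (\<integral>x. (\<Prod>v\<in>B. x v) \<partial>M)) / 2 ^ card K"
    unfolding pin_expand[OF fK] using K(1)
    by (subst integral_divide_zero, subst Bochner_Integration.integral_sum) (auto intro!: tame1_integrable tame1_mult tame1_coords)
  also have "(\<Sum>B\<in>Pow K. (\<Prod>v\<in>B. \<tau> v / (s v)\<^sup>2) * (\<integral>x. (\<Prod>v\<in>B. x v) \<partial>M)) =
    (\<Sum>B\<in>Pow K. if B = {} then 1 else 0)"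
  proof (rule sum.cong[OF refl])
    fix B assume "B \<in> Pow K"
    then have "(\<integral>x. (\<Prod>v\<in>B. x v) * (\<Prod>v\<in>{}. x v) \<partial>M) = (if B = {} then \<Prod>v\<in>B. (s v)\<^sup>2 else 0)"
      using K by (intro integral_coords2) auto
    then show "(\<Prod>v\<in>B. \<tau> v / (s v)\<^sup>2) * (\<integral>x. (\<Prod>v\<in>B. x v) \<partial>M) = (if B = {} then 1 else 0)"
      by (auto split: if_splits)
  qed
  also have "\<dots> = 1" using fK by (simp add: sum.delta)
  finally show ?thesis .
qed

text \<open>The product measure is invariant under the simultaneous flip of all spins, because each
  reference measure is symmetric.\<close>

lemma integral_odd:
  assumes "\<And>x. f (\<lambda>v. - x v) = - f x" and f: "tame1 f" "local_on V f"
  shows "(\<integral>x. f x \<partial>M) = 0"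
proof -
  have "product_prob_space lam"
    by (rule product_prob_spaceI) (rule prob_space_lam)
  then have "distr M M (compose V uminus) = PiM V (\<lambda>v. distr (lam v) (lam v) uminus)"
    by (intro distr_PiM_finite_prob_space finite_V) (auto simp: measurable_cong_sets[OF sets_lam sets_lam])
  also have "\<dots> = M"
  proof (rule PiM_cong[OF refl])
    fix v
    have "distr (lam v) (lam v) uminus = distr (lam v) borel uminus" by (rule distr_cong) auto
    then show "distr (lam v) (lam v) uminus = lam v" using reference[of v] by (simp add: reference_measure_def)
  qed
  finally have d: "distr M M (compose V uminus) = M" .
  have m: "compose V uminus \<in> measurable M M"
  proof (rule measurable_PiM_single')
    show "(\<lambda>x. compose V uminus x v) \<in> measurable M (lam v)" if "v \<in> V" for v
      using that measurable_coord[OF that] by (simp add: compose_def measurable_cong_sets[OF refl sets_lam])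
  qed (auto simp: space_PiM compose_def)
  have "(\<integral>x. f x \<partial>M) = (\<integral>x. f x \<partial>distr M M (compose V uminus))" by (simp only: d)
  also have "\<dots> = (\<integral>x. f (compose V uminus x) \<partial>M)" by (rule integral_distr[OF m tame1_measurable[OF f(1)]])
  also have "\<dots> = (\<integral>x. - f x \<partial>M)"
  proof (rule Bochner_Integration.integral_cong[OF refl])
    fix x
    have "f (compose V uminus x) = f (\<lambda>v. - x v)" by (rule local_onD[OF f(2)]) (simp add: compose_def)
    then show "f (compose V uminus x) = - f x" using assms(1) by simp
  qed
  finally show ?thesis by simp
qed

lemma prod_option:
  fixes f :: "'i option \<Rightarrow> real"
  assumes "finite I"
  shows "(\<Prod>j\<in>insert None (Some ` I). f j) = f None * (\<Prod>i\<in>I. f (Some i))"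
proof -
  have "(\<Prod>j\<in>Some ` I. f j) = (\<Prod>i\<in>I. f (Some i))" by (subst prod.reindex) simp_all
  then show ?thesis using assms by (subst prod.insert) auto
qed

text \<open>With the spins \<tau> on \<open>K\<close> fixed, the cells are independent. Each
  conditional cell integral is turned into unconditioned moments by expanding the pins on its
  boundary \<open>N i\<close>. The right-hand side sees a cell only through these moments, so cells
  with proportional moments are interchangeable.\<close>

theorem cell_expansion:
  assumes K: "K \<subseteq> V" "\<And>v. v \<in> K \<Longrightarrow> lam v = ising_measure (s v)" "\<And>v. v \<in> K \<Longrightarrow> 0 < s v"
    and I: "finite I" "\<And>i. i \<in> I \<Longrightarrow> D i \<subseteq> V - K" "disjoint_family_on D I" "\<And>i. i \<in> I \<Longrightarrow> N i \<subseteq> K"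
    and h: "\<And>i. i \<in> I \<Longrightarrow> tame1 (h i)" "\<And>i. i \<in> I \<Longrightarrow> local_on (N i \<union> D i) (h i)"
    and g: "tame1 g" "local_on K g"
  shows "(\<integral>x. g x * (\<Prod>i\<in>I. h i x) \<partial>M) =
    (\<Sum>\<tau>\<in>PiE K (\<lambda>v. {s v, - s v}). g \<tau> / 2 ^ card K *
      (\<Prod>i\<in>I. \<Sum>B\<in>Pow (N i). (\<Prod>v\<in>B. \<tau> v / (s v)\<^sup>2) * (\<integral>x. (\<Prod>v\<in>B. x v) * h i x \<partial>M)))"
proof -
  have fK: "finite K" using K(1) finite_V finite_subset by blast
  let ?P = "PiE K (\<lambda>v. {s v, - s v})"
  have fP: "finite ?P" using fK by (intro finite_PiE) auto
  have AE: "AE x in M. \<forall>v\<in>K. x v \<in> {s v, - s v}" by (rule AE_ising_family) (use K in auto)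
  have pinK: "(\<integral>x. pin s \<tau> K x \<partial>M) = 1 / 2 ^ card K" for \<tau> by (rule integral_pin) (use K in auto)
  have tame_f: "tame1 (\<lambda>x. g x * (\<Prod>i\<in>I. h i x))" by (intro tame1_mult tame1_prod g(1) h(1))
  \<comment> \<open>Pinning the boundary \<open>N i\<close> suffices, because \<open>h i\<close>
    reads no other coordinate of \<open>K\<close>. Independence then splits off the factor
    \<open>1 / 2 ^ card (N i)\<close>, which cancels the denominator of the expanded pin.\<close>
  have cell: "(\<Sum>B\<in>Pow (N i). (\<Prod>v\<in>B. \<tau> v / (s v)\<^sup>2) * (\<integral>x. (\<Prod>v\<in>B. x v) * h i x \<partial>M)) =
      (\<integral>x. h i (override_on x \<tau> K) \<partial>M)" if i: "i \<in> I" and \<tau>: "\<tau> \<in> ?P" for i \<tau>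
  proof -
    have Ni: "N i \<subseteq> K" "N i \<subseteq> V" "finite (N i)" using I(4)[OF i] K(1) fK finite_subset by auto
    let ?c = "2 ^ card (N i) :: real"
    let ?\<tau> = "restrict \<tau> (N i)"
    have \<tau>U: "\<tau> \<in> PiE K (\<lambda>_. UNIV)" using \<tau> by (auto simp: PiE_def)
    have "(\<Sum>B\<in>Pow (N i). (\<Prod>v\<in>B. \<tau> v / (s v)\<^sup>2) * (\<integral>x. (\<Prod>v\<in>B. x v) * h i x \<partial>M)) / ?c =
      (\<integral>x. (\<Sum>B\<in>Pow (N i). (\<Prod>v\<in>B. \<tau> v / (s v)\<^sup>2) * ((\<Prod>v\<in>B. x v) * h i x)) / ?c \<partial>M)"
      using Ni(2) h(1)[OF i]
      by (subst integral_divide_zero, subst Bochner_Integration.integral_sum)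
        (auto intro!: tame1_integrable tame1_mult tame1_coords)
    also have "\<dots> = (\<integral>x. pin s \<tau> (N i) x * h i x \<partial>M)"
      unfolding pin_expand[OF Ni(3)] sum_divide_distrib sum_distrib_right by (simp add: mult_ac)
    also have "\<dots> = (\<integral>x. pin s \<tau> (N i) x * h i (override_on x \<tau> K) \<partial>M)"
    proof (rule integral_cong_AE)
      show "AE x in M. pin s \<tau> (N i) x * h i x = pin s \<tau> (N i) x * h i (override_on x \<tau> K)"
        using AE
      proof (rule AE_mp, intro AE_I2 impI)
        fix x assume x: "\<forall>v\<in>K. x v \<in> {s v, - s v}"
        have "pin s \<tau> (N i) x = pin s ?\<tau> (N i) x" by (simp add: pin_def)
        moreover have "pin s ?\<tau> (N i) x * h i x = pin s ?\<tau> (N i) x * h i (override_on x \<tau> K)"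
        proof (rule pin_override[OF Ni(3) _ _ _ h(2)[OF i]])
          show "?\<tau> \<in> PiE (N i) (\<lambda>v. {s v, - s v})" using \<tau> Ni(1) by (auto simp: PiE_def Pi_def)
          show "(N i \<union> D i) \<inter> K \<subseteq> N i" using I(2)[OF i] by blast
        qed (use K(3) Ni(1) x in auto)
        ultimately show "pin s \<tau> (N i) x * h i x = pin s \<tau> (N i) x * h i (override_on x \<tau> K)" by simp
      qed
    qed (intro tame1_measurable tame1_mult tame1_pin tame1_override h(1) i K(1) Ni(2) \<tau>U)+
    also have "\<dots> = (\<integral>x. (\<Prod>b\<in>{True, False}. (if b then pin s \<tau> (N i) x else h i (override_on x \<tau> K))) \<partial>M)"
      by simp
    also have "\<dots> = (\<Prod>b\<in>{True, False}. \<integral>x. (if b then pin s \<tau> (N i) x else h i (override_on x \<tau> K)) \<partial>M)"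
    proof (rule integral_blocks[where D = "\<lambda>b. if b then N i else D i"])
      show "disjoint_family_on (\<lambda>b. if b then N i else D i) {True, False}"
        using I(2)[OF i] Ni(1) by (auto simp: disjoint_family_on_def)
      show "(if b then N i else D i) \<subseteq> V" for b using I(2)[OF i] Ni(2) by auto
      show "tame1 (\<lambda>x. if b then pin s \<tau> (N i) x else h i (override_on x \<tau> K))" for b
        using tame1_pin[OF Ni(2)] tame1_override[OF K(1) \<tau>U h(1)[OF i]] by (cases b) simp_all
      show "local_on (if b then N i else D i) (\<lambda>x. if b then pin s \<tau> (N i) x else h i (override_on x \<tau> K))" for b
      proof (cases b)
        case True
        then show ?thesis using local_on_pin[of "N i" s \<tau>] by simp
      next
        case False
        have "h i (override_on x \<tau> K) = h i (override_on y \<tau> K)" if "\<And>v. v \<in> D i \<Longrightarrow> x v = y v" for x y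
          by (rule local_onD[OF h(2)[OF i]]) (use that Ni(1) in \<open>auto simp: override_on_def\<close>)
        then have "local_on (D i) (\<lambda>x. h i (override_on x \<tau> K))" unfolding local_on_def by blast
        then show ?thesis using False by simp
      qed
    qed simp
    also have "\<dots> = (1 / ?c) * (\<integral>x. h i (override_on x \<tau> K) \<partial>M)"
    proof -
      have "(\<integral>x. pin s \<tau> (N i) x \<partial>M) = 1 / ?c" using K Ni(1,2) by (intro integral_pin) auto
      then show ?thesis by simp
    qed
    finally show ?thesis by simp
  qed
  have "(\<integral>x. g x * (\<Prod>i\<in>I. h i x) \<partial>M) =
      (\<integral>x. (\<Sum>\<tau>\<in>?P. pin s \<tau> K x * (g x * (\<Prod>i\<in>I. h i x))) \<partial>M)"
    unfolding sum_distrib_right[symmetric] using sum_pin[OF fK K(3)] by simp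
  also have "\<dots> = (\<Sum>\<tau>\<in>?P. \<integral>x. pin s \<tau> K x * (g x * (\<Prod>i\<in>I. h i x)) \<partial>M)"
    by (intro Bochner_Integration.integral_sum tame1_integrable tame1_mult[OF tame1_pin tame_f] K(1))
  also have "\<dots> = (\<Sum>\<tau>\<in>?P. g \<tau> / 2 ^ card K *
      (\<Prod>i\<in>I. \<Sum>B\<in>Pow (N i). (\<Prod>v\<in>B. \<tau> v / (s v)\<^sup>2) * (\<integral>x. (\<Prod>v\<in>B. x v) * h i x \<partial>M)))"
  proof (rule sum.cong[OF refl])
    fix \<tau> assume \<tau>: "\<tau> \<in> ?P"
    have \<tau>U: "\<tau> \<in> PiE K (\<lambda>_. UNIV)" using \<tau> by (auto simp: PiE_def)
    have Ksub: "D i \<subseteq> V" if "i \<in> I" for i using I(2)[OF that] by blast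
    have loc: "local_on V (\<lambda>x. g x * (\<Prod>i\<in>I. h i x))"
      unfolding local_on_def
    proof (intro allI impI)
      fix x y :: "'v \<Rightarrow> real" assume xy: "\<forall>v\<in>V. x v = y v"
      have "g x = g y" by (rule local_onD[OF g(2)]) (use xy K(1) in auto)
      moreover have "(\<Prod>i\<in>I. h i x) = (\<Prod>i\<in>I. h i y)"
      proof (rule prod.cong[OF refl])
        fix i assume i: "i \<in> I"
        show "h i x = h i y" by (rule local_onD[OF h(2)[OF i]]) (use xy K(1) I(4)[OF i] Ksub[OF i] in auto)
      qed
      ultimately show "g x * (\<Prod>i\<in>I. h i x) = g y * (\<Prod>i\<in>I. h i y)" by simp
    qed
    \<comment> \<open>Index \<open>None\<close> carries the pin on \<open>K\<close> and
      \<open>Some i\<close> the cell \<open>i\<close>, so that one application of the block lemma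
      factors everything.\<close>
    define F where "F j = (case j of None \<Rightarrow> pin s \<tau> K | Some i \<Rightarrow> (\<lambda>x. h i (override_on x \<tau> K)))" for j
    have F: "F None = pin s \<tau> K" "F (Some i) = (\<lambda>x. h i (override_on x \<tau> K))" for i by (simp_all add: F_def)
    define D' where "D' j = (case j of None \<Rightarrow> K | Some i \<Rightarrow> D i)" for j
    have D': "D' None = K" "D' (Some i) = D i" for i by (simp_all add: D'_def)
    have g\<tau>: "g (override_on x \<tau> K) = g \<tau>" for x
      by (rule local_onD[OF g(2)]) (simp add: override_on_def)
    have ho: "tame1 (\<lambda>x. h i (override_on x \<tau> K))" if "i \<in> I" for i
      by (rule tame1_override[OF K(1) \<tau>U h(1)[OF that]])
    have m1: "tame1 (\<lambda>x. pin s \<tau> K x * (g x * (\<Prod>i\<in>I. h i x)))"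
      by (rule tame1_mult[OF tame1_pin[OF K(1)] tame_f])
    have m2: "tame1 (\<lambda>x. pin s \<tau> K x * (g \<tau> * (\<Prod>i\<in>I. h i (override_on x \<tau> K))))"
      by (rule tame1_mult[OF tame1_pin[OF K(1)] tame1_mult[OF tame1_const tame1_prod[OF ho]]])
    have "(\<integral>x. pin s \<tau> K x * (g x * (\<Prod>i\<in>I. h i x)) \<partial>M) =
        (\<integral>x. pin s \<tau> K x * (g \<tau> * (\<Prod>i\<in>I. h i (override_on x \<tau> K))) \<partial>M)"
    proof (rule integral_cong_AE)
      show "AE x in M. pin s \<tau> K x * (g x * (\<Prod>i\<in>I. h i x)) =
          pin s \<tau> K x * (g \<tau> * (\<Prod>i\<in>I. h i (override_on x \<tau> K)))"
        using AE
      proof (rule AE_mp, intro AE_I2 impI)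
        fix x assume x: "\<forall>v\<in>K. x v \<in> {s v, - s v}"
        show "pin s \<tau> K x * (g x * (\<Prod>i\<in>I. h i x)) = pin s \<tau> K x * (g \<tau> * (\<Prod>i\<in>I. h i (override_on x \<tau> K)))"
          using pin_override[OF fK K(3) \<tau> x loc _ subset_refl, of \<tau>] g\<tau> by simp
      qed
    qed (rule tame1_measurable[OF m1], rule tame1_measurable[OF m2])
    also have "\<dots> = (\<integral>x. g \<tau> * (\<Prod>j\<in>insert None (Some ` I). F j x) \<partial>M)"
      unfolding prod_option[OF I(1)] F by (simp only: mult.left_commute)
    also have "\<dots> = g \<tau> * (\<integral>x. (\<Prod>j\<in>insert None (Some ` I). F j x) \<partial>M)"
      by (rule integral_mult_right_zero)
    also have "(\<integral>x. (\<Prod>j\<in>insert None (Some ` I). F j x) \<partial>M) =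
      (\<Prod>j\<in>insert None (Some ` I). \<integral>x. F j x \<partial>M)"
    proof (rule integral_blocks[where D = D'])
      show "disjoint_family_on D' (insert None (Some ` I))"
      proof -
        have "D i \<inter> D j = {}" if "i \<in> I" "j \<in> I" "i \<noteq> j" for i j
          using I(3) that unfolding disjoint_family_on_def by blast
        moreover have "D i \<inter> K = {}" "K \<inter> D i = {}" if "i \<in> I" for i using I(2)[OF that] by auto
        ultimately show ?thesis unfolding disjoint_family_on_def by (auto simp: D')
      qed
      fix j assume j: "j \<in> insert None (Some ` I)"
      show "D' j \<subseteq> V"
      proof (cases j)
        case (Some i)
        then have "i \<in> I" using j by auto
        then show ?thesis using Some Ksub by (simp add: D')
      qed (simp add: D' K(1))
      show "tame1 (F j)"
        using j tame1_pin[OF K(1)] tame1_override[OF K(1) \<tau>U h(1)] by (auto simp: F)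
      show "local_on (D' j) (F j)"
      proof (cases j)
        case None
        then show ?thesis using local_on_pin[of K s \<tau>] by (simp add: F D')
      next
        case (Some i)
        then have i: "i \<in> I" using j by auto
        have "h i (override_on x \<tau> K) = h i (override_on y \<tau> K)" if "\<And>v. v \<in> D i \<Longrightarrow> x v = y v" for x y
          by (rule local_onD[OF h(2)[OF i]]) (use that I(4)[OF i] in \<open>auto simp: override_on_def\<close>)
        then have "local_on (D i) (\<lambda>x. h i (override_on x \<tau> K))" unfolding local_on_def by blast
        then show ?thesis using Some by (simp add: F D')
      qed
    qed (use I(1) in simp)
    also have "\<dots> = 1 / 2 ^ card K * (\<Prod>i\<in>I. \<integral>x. h i (override_on x \<tau> K) \<partial>M)"
      unfolding prod_option[OF I(1)] F pinK ..
    also have "(\<Prod>i\<in>I. \<integral>x. h i (override_on x \<tau> K) \<partial>M) =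
      (\<Prod>i\<in>I. \<Sum>B\<in>Pow (N i). (\<Prod>v\<in>B. \<tau> v / (s v)\<^sup>2) * (\<integral>x. (\<Prod>v\<in>B. x v) * h i x \<partial>M))"
      using cell[OF _ \<tau>] by (intro prod.cong) simp_all
    finally show "(\<integral>x. pin s \<tau> K x * (g x * (\<Prod>i\<in>I. h i x)) \<partial>M) = g \<tau> / 2 ^ card K *
      (\<Prod>i\<in>I. \<Sum>B\<in>Pow (N i). (\<Prod>v\<in>B. \<tau> v / (s v)\<^sup>2) * (\<integral>x. (\<Prod>v\<in>B. x v) * h i x \<partial>M))" by simp
  qed
  finally show ?thesis .
qed

end

section \<open>Ising cells with three terminals\<close>

text \<open>The couplings are read off from the four values of the right-hand side, which are the
  probabilities of the spin configurations up to a global flip.\<close>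

lemma triangle_couplings:
  fixes x y z :: real
  assumes x: "0 \<le> x" "x < 1" "y * z \<le> x" and y: "0 \<le> y" "y < 1" "x * z \<le> y" and z: "0 \<le> z" "z < 1" "x * y \<le> z"
  obtains a b c Q where "0 \<le> a" "0 \<le> b" "0 \<le> c" "0 < Q" "x = y * z \<Longrightarrow> a = 0" "y = x * z \<Longrightarrow> b = 0" "z = x * y \<Longrightarrow> c = 0"
    "\<And>u v w. u \<in> {1, -1} \<Longrightarrow> v \<in> {1, -1} \<Longrightarrow> w \<in> {1, -1} \<Longrightarrow>
      exp (a * (u * v) + b * (v * w) + c * (u * w)) = Q * (1 + x * (u * v) + y * (v * w) + z * (u * w))"
proof -
  define p0 p1 p2 p3 where p: "p0 = 1 + x + y + z" "p1 = 1 + x - y - z" "p2 = 1 - x + y - z" "p3 = 1 - x - y + z"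
  \<comment> \<open>For instance \<open>p1 = (1 - y) * (1 - z) + (x - y * z)\<close>, so the bounds
    of Griffiths type make all four values positive.\<close>
  have "0 < (1 - y) * (1 - z)" "0 < (1 - x) * (1 - z)" "0 < (1 - x) * (1 - y)" using x y z by simp_all
  then have pos: "0 < p0" "0 < p1" "0 < p2" "0 < p3" using x y z unfolding p by (simp_all add: algebra_simps)
  define l0 l1 l2 l3 where l: "l0 = ln p0" "l1 = ln p1" "l2 = ln p2" "l3 = ln p3"
  have lexp: "exp l0 = p0" "exp l1 = p1" "exp l2 = p2" "exp l3 = p3" using pos by (simp_all add: l)
  \<comment> \<open>The differences of the two sides are \<open>4 * (x - y * z)\<close> and its
    analogues; they decide the signs of the couplings and when a coupling vanishes.\<close>
  have ge: "p2 * p3 \<le> p0 * p1" "p1 * p3 \<le> p0 * p2" "p1 * p2 \<le> p0 * p3"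
    using x y z unfolding p by (simp_all add: algebra_simps)
  have lge: "l2 + l3 \<le> l0 + l1" "l1 + l3 \<le> l0 + l2" "l1 + l2 \<le> l0 + l3"
    using ge pos by (simp_all add: l ln_mult_pos[symmetric])
  \<comment> \<open>The solution of the equation \<open>exp (a + b + c) = Q * p0\<close> and its
    three companions, which is a linear system for the logarithms.\<close>
  define a b c Q where abc: "a = (l0 + l1 - l2 - l3) / 4" "b = (l0 + l2 - l1 - l3) / 4" "c = (l0 + l3 - l1 - l2) / 4"
    "Q = exp (- (l0 + l1 + l2 + l3) / 4)"
  have Qp: "exp (l - (l0 + l1 + l2 + l3) / 4) = Q * exp l" for l
    by (simp only: abc(4) exp_add[symmetric] minus_divide_left[symmetric] diff_conv_add_uminus add.commute)
  have E: "exp (a + b + c) = Q * p0" "exp (a - b - c) = Q * p1" "exp (b - a - c) = Q * p2" "exp (c - a - b) = Q * p3"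
    unfolding lexp[symmetric] Qp[symmetric] by (simp_all add: abc field_simps)
  show ?thesis
  proof (rule that[of a b c Q])
    show "0 \<le> a" "0 \<le> b" "0 \<le> c" using lge by (simp_all add: abc)
    show "0 < Q" by (simp add: abc)
    show "a = 0" if "x = y * z"
    proof -
      have "p0 * p1 = p2 * p3" using that unfolding p by (simp add: algebra_simps)
      then have "l0 + l1 = l2 + l3" using pos by (simp add: l ln_mult_pos[symmetric])
      then show ?thesis by (simp add: abc)
    qed
    show "b = 0" if "y = x * z"
    proof -
      have "p0 * p2 = p1 * p3" using that unfolding p by (simp add: algebra_simps)
      then have "l0 + l2 = l1 + l3" using pos by (simp add: l ln_mult_pos[symmetric])
      then show ?thesis by (simp add: abc)
    qed
    show "c = 0" if "z = x * y"
    proof -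
      have "p0 * p3 = p1 * p2" using that unfolding p by (simp add: algebra_simps)
      then have "l0 + l3 = l1 + l2" using pos by (simp add: l ln_mult_pos[symmetric])
      then show ?thesis by (simp add: abc)
    qed
    fix u v w :: real assume "u \<in> {1, -1}" "v \<in> {1, -1}" "w \<in> {1, -1}"
    then show "exp (a * (u * v) + b * (v * w) + c * (u * w)) = Q * (1 + x * (u * v) + y * (v * w) + z * (u * w))"
      using E unfolding p by (auto simp: algebra_simps)
  qed
qed

text \<open>The spins of a cell with terminals \<open>T\<close>, of which those in \<open>F\<close> may be chosen freely:
  if \<open>F\<close> is nonempty, the terminals form a chain whose middle vertex belongs to \<open>F\<close>.\<close>

lemma cell_spins:
  fixes c :: "'v set \<Rightarrow> real" and s0 :: "'v \<Rightarrow> real"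
  assumes T: "finite T" "card T \<le> 3" "F \<subseteq> T" and s0: "\<And>v. 0 < s0 v"
    and c: "\<And>p q. p \<in> T \<Longrightarrow> q \<in> T \<Longrightarrow> p \<noteq> q \<Longrightarrow> 0 < c {p, q}"
    and fixed: "\<And>p q. p \<in> T - F \<Longrightarrow> q \<in> T - F \<Longrightarrow> p \<noteq> q \<Longrightarrow> c {p, q} < s0 p * s0 q"
    and griffiths: "\<And>p q r. p \<in> T - F \<Longrightarrow> q \<in> T \<Longrightarrow> r \<in> T \<Longrightarrow> p \<noteq> q \<Longrightarrow> p \<noteq> r \<Longrightarrow> q \<noteq> r \<Longrightarrow>
      c {p, q} * c {p, r} < (s0 p)\<^sup>2 * c {q, r}"
    and edges0: "\<And>p q. F = {} \<Longrightarrow> p \<in> T \<Longrightarrow> q \<in> T \<Longrightarrow> p \<noteq> q \<Longrightarrow> {p, q} \<in> E'"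
    and edges1: "\<And>x w. x \<in> T \<Longrightarrow> w \<in> F \<Longrightarrow> x \<noteq> w \<Longrightarrow> \<exists>w'\<in>F - {x}. {x, w'} \<in> E'"
  obtains s where "\<And>v. 0 < s v" "\<And>v. v \<notin> F \<Longrightarrow> s v = s0 v"
    "\<And>p q. p \<in> T \<Longrightarrow> q \<in> T \<Longrightarrow> p \<noteq> q \<Longrightarrow> c {p, q} < s p * s q"
    "\<And>p q r. p \<in> T \<Longrightarrow> q \<in> T \<Longrightarrow> r \<in> T \<Longrightarrow> p \<noteq> q \<Longrightarrow> p \<noteq> r \<Longrightarrow> q \<noteq> r \<Longrightarrow> c {p, q} * c {p, r} \<le> (s p)\<^sup>2 * c {q, r}"
    "\<And>p q. p \<in> T \<Longrightarrow> q \<in> T \<Longrightarrow> p \<noteq> q \<Longrightarrow> {p, q} \<notin> E' \<Longrightarrow>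
      \<exists>r\<in>T - {p, q}. c {p, r} * c {q, r} = (s r)\<^sup>2 * c {p, q}"
proof (cases "F = {}")
  case True
  show ?thesis
  proof (rule that[of s0])
    show "\<And>p q. p \<in> T \<Longrightarrow> q \<in> T \<Longrightarrow> p \<noteq> q \<Longrightarrow> c {p, q} < s0 p * s0 q" using fixed True by simp
    show "\<And>p q r. p \<in> T \<Longrightarrow> q \<in> T \<Longrightarrow> r \<in> T \<Longrightarrow> p \<noteq> q \<Longrightarrow> p \<noteq> r \<Longrightarrow> q \<noteq> r \<Longrightarrow> c {p, q} * c {p, r} \<le> (s0 p)\<^sup>2 * c {q, r}"
      using griffiths True by (simp add: less_imp_le)
    show "\<And>p q. p \<in> T \<Longrightarrow> q \<in> T \<Longrightarrow> p \<noteq> q \<Longrightarrow> {p, q} \<notin> E' \<Longrightarrow>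
      \<exists>r\<in>T - {p, q}. c {p, r} * c {q, r} = (s0 r)\<^sup>2 * c {p, q}" using edges0 True by blast
  qed (use s0 in auto)
next
  case False
  then obtain w0 where w0: "w0 \<in> F" by blast
  have "card T \<noteq> 0" using w0 T by auto
  then consider "card T = 1" | "card T = 2" | "card T = 3" using T(2) by linarith
  then show ?thesis
  proof cases
    case 1
    then obtain t where t: "T = {t}" by (auto simp: card_1_singleton_iff)
    show ?thesis by (rule that[of s0]) (use s0 t in auto)
  next
    case 2
    then obtain p where T2: "T = {p, w0}" "p \<noteq> w0" using w0 T(3) by (auto simp: card_2_iff)
    \<comment> \<open>With a single pair no chain identity has to hold, so the free spin is just
      taken large; the summand one makes \<open>c {p, w0} < s p * s w0\<close> strict.\<close>
    define s where "s = s0(w0 := c {p, w0} / s0 p + 1, p := s0 p)"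
    have cpw: "0 < c {p, w0}" using c T2 by simp
    have s: "s w0 = c {p, w0} / s0 p + 1" "s p = s0 p" "\<And>v. v \<noteq> w0 \<Longrightarrow> s v = s0 v" using T2(2) by (auto simp: s_def)
    have big: "c {p, w0} < s p * s w0" unfolding s(1,2) using s0[of p] by (simp add: field_simps)
    have edge: "{p, w0} \<in> E'" using edges1[of p w0] w0 T(3) T2 by auto
    show ?thesis
    proof (rule that[of s])
      show "0 < s v" for v using s(1,3) s0[of p] s0[of v] cpw by (cases "v = w0") (auto intro: add_nonneg_pos)
      show "s v = s0 v" if "v \<notin> F" for v using s(3) that w0 by metis
      show "c {a, b} < s a * s b" if "a \<in> T" "b \<in> T" "a \<noteq> b" for a b
        using that big unfolding T2 by (auto simp: insert_commute mult.commute)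
      show "c {a, b} * c {a, d} \<le> (s a)\<^sup>2 * c {b, d}" if "a \<in> T" "b \<in> T" "d \<in> T" "a \<noteq> b" "a \<noteq> d" "b \<noteq> d" for a b d
        using that unfolding T2 by auto
      show "\<exists>r\<in>T - {a, b}. c {a, r} * c {b, r} = (s r)\<^sup>2 * c {a, b}"
        if "a \<in> T" "b \<in> T" "a \<noteq> b" "{a, b} \<notin> E'" for a b
        using that edge unfolding T2 by (auto simp: insert_commute)
    qed
  next
    case 3
    \<comment> \<open>Each terminal has an edge to a free one whenever there is a free one other
      than itself. With three terminals, this gives a free one joined to both others, the middle of
      the chain.\<close>
    have "\<exists>w\<in>F. \<forall>x\<in>T - {w}. {x, w} \<in> E'"
    proof (cases "F = {w0}")
      case True
      have "{x, w0} \<in> E'" if "x \<in> T - {w0}" for x using edges1[of x w0] that True by auto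
      then show ?thesis using True by blast
    next
      case False
      then obtain w1 where w1: "w1 \<in> F" "w1 \<noteq> w0" using w0 by blast
      obtain t where t: "T = {w0, w1, t}" "t \<noteq> w0" "t \<noteq> w1"
      proof -
        have "card (T - {w0, w1}) = 1" using 3 w0 w1 T by (subst card_Diff_subset) auto
        then obtain t where "T - {w0, w1} = {t}" by (auto simp: card_1_singleton_iff)
        then have "T = {w0, w1, t}" "t \<noteq> w0" "t \<noteq> w1" using w0 w1 T(3) by auto
        then show thesis by (rule that)
      qed
      have F: "F \<subseteq> {w0, w1, t}" using T(3) t by simp
      have "\<exists>w'\<in>F - {w0}. {w0, w'} \<in> E'" using edges1[of w0 w1] w0 w1 T(3) by blast
      then have 0: "{w0, w1} \<in> E' \<or> ({w0, t} \<in> E' \<and> t \<in> F)" using F by blast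
      have "\<exists>w'\<in>F - {w1}. {w1, w'} \<in> E'" using edges1[of w1 w0] w0 w1 T(3) by blast
      then have 1: "{w1, w0} \<in> E' \<or> ({w1, t} \<in> E' \<and> t \<in> F)" using F by blast
      have "\<exists>w'\<in>F - {t}. {t, w'} \<in> E'" using edges1[of t w0] w0 t by blast
      then have 2: "{t, w0} \<in> E' \<or> {t, w1} \<in> E'" using F by blast
      have A: ?thesis if "{w0, w1} \<in> E'" "{t, w0} \<in> E'"
        by (rule bexI[OF _ w0]) (use that t in \<open>auto simp: insert_commute\<close>)
      have B: ?thesis if "{w0, w1} \<in> E'" "{t, w1} \<in> E'"
        by (rule bexI[OF _ w1(1)]) (use that t in \<open>auto simp: insert_commute\<close>)
      have C: ?thesis if "t \<in> F" "{w0, t} \<in> E'" "{w1, t} \<in> E'"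
        by (rule bexI[OF _ that(1)]) (use that t in \<open>auto simp: insert_commute\<close>)
      show ?thesis
      proof (cases "{w0, w1} \<in> E'")
        case True
        then show ?thesis using 2 A B by blast
      next
        case False
        then have "{w1, w0} \<notin> E'" by (simp add: insert_commute)
        then show ?thesis using 0 1 False C by blast
      qed
    qed
    then obtain w where w: "w \<in> F" "\<And>x. x \<in> T \<Longrightarrow> x \<noteq> w \<Longrightarrow> {x, w} \<in> E'" by blast
    have "card (T - {w}) = 2" using 3 w(1) T by (subst card_Diff_subset) auto
    then obtain p q where pq: "T - {w} = {p, q}" "p \<noteq> q" by (auto simp: card_2_iff)
    then have Tpq: "T = {p, q, w}" "p \<noteq> w" "q \<noteq> w" using w(1) T(3) by auto
    have c0: "0 < c {p, w}" "0 < c {q, w}" "0 < c {p, q}" using c Tpq pq(2) by simp_all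
    \<comment> \<open>Forced by the chain identity
      \<open>c {p, w} * c {q, w} = (s w)\<^sup>2 * c {p, q}\<close>, which makes the coupling
      between the two ends vanish.\<close>
    define sw where "sw = sqrt (c {p, w} * c {q, w} / c {p, q})"
    have sw: "0 < sw" "sw\<^sup>2 = c {p, w} * c {q, w} / c {p, q}" using c0 by (simp_all add: sw_def)
    define s where "s v = (if v = w then sw else if v \<in> F then c {v, w} / sw + 1 else s0 v)" for v
    \<comment> \<open>A free end is simply chosen large enough; for a fixed end the bound is the
      strict Griffiths inequality at that end.\<close>
    have end_spin: "c {x, w} < s x * sw"
      if x: "x \<in> T" "y \<in> T" "x \<noteq> w" "y \<noteq> w" "x \<noteq> y" "{x, y} = {p, q}" for x y
    proof (cases "x \<in> F")
      case True
      then show ?thesis using sw(1) x(3) by (simp add: s_def field_simps)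
    next
      case False
      have wT: "w \<in> T" using Tpq by simp
      have gr: "c {x, w} * c {x, y} < (s0 x)\<^sup>2 * c {w, y}" using griffiths[of x w y] x False wT by auto
      have cc: "0 < c {x, w}" "0 < c {x, y}" "0 < c {w, y}" using c[of x w] c[of x y] c[of w y] x(1-5) wT by auto
      have sw2: "sw\<^sup>2 = c {x, w} * c {w, y} / c {x, y}"
        using sw(2) x(6) by (auto simp: doubleton_eq_iff insert_commute mult.commute)
      have "(c {x, w})\<^sup>2 * c {x, y} < (s0 x)\<^sup>2 * (c {x, w} * c {w, y})"
        using mult_strict_left_mono[OF gr cc(1)] by (simp add: power2_eq_square mult_ac)
      then have "(c {x, w})\<^sup>2 < (s0 x)\<^sup>2 * sw\<^sup>2" unfolding sw2 using cc(2) by (simp add: field_simps)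
      then have "(c {x, w})\<^sup>2 < (s0 x * sw)\<^sup>2" by (simp add: power_mult_distrib)
      moreover have "0 \<le> s0 x * sw" using s0[of x] sw(1) by simp
      ultimately have "c {x, w} < s0 x * sw" by (rule power_less_imp_less_base)
      then show ?thesis using False x(3) by (simp add: s_def)
    qed
    have pw: "c {p, w} < s p * s w" "c {q, w} < s q * s w"
      using end_spin[of p q] end_spin[of q p] Tpq pq(2) by (simp_all add: s_def insert_commute)
    have spos: "0 < s v" if "v \<in> T" for v
    proof (cases "v \<in> F")
      case True
      then show ?thesis using sw(1) c[of v w] that w(1) T(3) by (auto simp: s_def intro!: add_pos_pos divide_pos_pos)
    next
      case False
      then show ?thesis using s0 sw(1) by (auto simp: s_def)
    qed
    have chain: "c {p, w} * c {q, w} = (s w)\<^sup>2 * c {p, q}" using sw(2) c0 by (simp add: s_def field_simps)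
    have sw0: "0 < s w" using sw(1) by (simp add: s_def)
    have pq': "c {p, q} < s p * s q"
    proof -
      have "c {p, w} * c {q, w} < (s p * s w) * (s q * s w)" using pw c0 by (intro mult_strict_mono) auto
      then have "(s w)\<^sup>2 * c {p, q} < (s w)\<^sup>2 * (s p * s q)" unfolding chain by (simp add: power2_eq_square mult_ac)
      then show ?thesis using sw0 by simp
    qed
    have gr_end: "c {x, w} * c {p, q} \<le> (s x)\<^sup>2 * c {y, w}" if xy: "x = p \<and> y = q \<or> x = q \<and> y = p" for x y
    proof -
      have xw: "c {x, w} < s x * s w" "0 < c {x, w}" "0 < c {y, w}" using xy pw c0 by auto
      have "(c {x, w})\<^sup>2 \<le> (s x * s w)\<^sup>2" using xw by (intro power_mono) auto
      then have "(c {x, w})\<^sup>2 * c {y, w} \<le> (s x)\<^sup>2 * (s w)\<^sup>2 * c {y, w}"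
        using xw(3) by (intro mult_right_mono) (auto simp: power_mult_distrib)
      moreover have "(c {x, w})\<^sup>2 * c {y, w} = c {x, w} * ((s w)\<^sup>2 * c {p, q})"
        unfolding chain[symmetric] using xy by (auto simp: power2_eq_square mult_ac)
      ultimately have "(s w)\<^sup>2 * (c {x, w} * c {p, q}) \<le> (s w)\<^sup>2 * ((s x)\<^sup>2 * c {y, w})" by (simp add: mult_ac)
      then show ?thesis using sw0 by simp
    qed
    define s' where "s' v = (if v \<in> T then s v else s0 v)" for v
    have s'T: "s' v = s v" if "v \<in> T" for v using that by (simp add: s'_def)
    note s'pqw = s'T[of p] s'T[of q] s'T[of w]
    show ?thesis
    proof (rule that[of s'])
      show "0 < s' v" for v using spos s0 by (simp add: s'_def)
      show "s' v = s0 v" if "v \<notin> F" for v using that w(1) by (auto simp: s'_def s_def)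
      show "c {a, b} < s' a * s' b" if "a \<in> T" "b \<in> T" "a \<noteq> b" for a b
        using that pw pq' s'pqw unfolding Tpq(1) by (auto simp: insert_commute mult.commute)
      show "c {a, b} * c {a, d} \<le> (s' a)\<^sup>2 * c {b, d}" if "a \<in> T" "b \<in> T" "d \<in> T" "a \<noteq> b" "a \<noteq> d" "b \<noteq> d" for a b d
        using that gr_end[of p q] gr_end[of q p] chain s'pqw unfolding Tpq(1)
        by (auto simp: insert_commute mult.commute)
      show "\<exists>r\<in>T - {a, b}. c {a, r} * c {b, r} = (s' r)\<^sup>2 * c {a, b}"
        if ab: "a \<in> T" "b \<in> T" "a \<noteq> b" "{a, b} \<notin> E'" for a b
      proof -
        have "a \<noteq> w" "b \<noteq> w" using ab w(2) by (auto simp: insert_commute)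
        then show ?thesis using ab chain s'pqw Tpq
          by (intro bexI[of _ w]) (auto simp: insert_commute mult.commute)
      qed
    qed
  qed
qed

lemma card_2_subsets3:
  assumes "p \<noteq> q" "q \<noteq> r" "p \<noteq> r"
  shows "{e. e \<subseteq> {p, q, r} \<and> card e = 2} = {{p, q}, {q, r}, {p, r}}"
proof
  show "{e. e \<subseteq> {p, q, r} \<and> card e = 2} \<subseteq> {{p, q}, {q, r}, {p, r}}"
  proof
    fix e assume "e \<in> {e. e \<subseteq> {p, q, r} \<and> card e = 2}"
    then have e: "e \<subseteq> {p, q, r}" "card e = 2" by auto
    then obtain a b where ab: "e = {a, b}" "a \<noteq> b" by (auto simp: card_2_iff)
    then have "a \<in> {p, q, r}" "b \<in> {p, q, r}" using e by auto
    then show "e \<in> {{p, q}, {q, r}, {p, r}}" using ab by (auto simp: insert_commute)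
  qed
qed (use assms in auto)

lemma card_2_subsets2:
  assumes "p \<noteq> q"
  shows "{e. e \<subseteq> {p, q} \<and> card e = 2} = {{p, q}}"
proof
  show "{e. e \<subseteq> {p, q} \<and> card e = 2} \<subseteq> {{p, q}}"
    by (auto simp: card_2_iff)
qed (use assms in auto)

lemma card_2_subsets1:
  assumes "finite T" "card T \<le> 1"
  shows "{e. e \<subseteq> T \<and> card e = 2} = {}"
proof -
  have "card e \<noteq> 2" if "e \<subseteq> T" for e using card_mono[OF assms(1) that] assms(2) by linarith
  then show ?thesis by blast
qed

text \<open>Dividing by the spin sizes reduces to spins of size one with correlations
  \<open>c {p, q} / (s p * s q)\<close>; the couplings found there are divided by
  \<open>\<beta> * (s p * s q)\<close>. The last hypothesis says that at a missing edge the
  normalised correlation is the product of the other two, so the coupling is zero.\<close>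

lemma cell_couplings:
  fixes c :: "'v set \<Rightarrow> real" and s :: "'v \<Rightarrow> real"
  assumes T: "finite T" "card T \<le> 3" and s: "\<And>v. 0 < s v" and \<beta>: "0 < \<beta>" and E': "finite E'"
    and c: "\<And>p q. p \<in> T \<Longrightarrow> q \<in> T \<Longrightarrow> p \<noteq> q \<Longrightarrow> 0 < c {p, q}"
    and lt: "\<And>p q. p \<in> T \<Longrightarrow> q \<in> T \<Longrightarrow> p \<noteq> q \<Longrightarrow> c {p, q} < s p * s q"
    and tri: "\<And>p q r. p \<in> T \<Longrightarrow> q \<in> T \<Longrightarrow> r \<in> T \<Longrightarrow> p \<noteq> q \<Longrightarrow> p \<noteq> r \<Longrightarrow> q \<noteq> r \<Longrightarrow> c {p, q} * c {p, r} \<le> (s p)\<^sup>2 * c {q, r}"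
    and edge: "\<And>p q. p \<in> T \<Longrightarrow> q \<in> T \<Longrightarrow> p \<noteq> q \<Longrightarrow> {p, q} \<notin> E' \<Longrightarrow>
      \<exists>r\<in>T - {p, q}. c {p, r} * c {q, r} = (s r)\<^sup>2 * c {p, q}"
  obtains J Q where "\<And>e. 0 \<le> J e" "\<And>e. J e \<noteq> 0 \<Longrightarrow> e \<in> E' \<and> e \<subseteq> T" "0 < Q"
    "\<And>x. (\<forall>v\<in>T. x v \<in> {s v, - s v}) \<Longrightarrow> exp (\<beta> * (\<Sum>e\<in>E'. J e * (\<Prod>v\<in>e. x v))) =
       Q * (1 + (\<Sum>e | e \<subseteq> T \<and> card e = 2. c e / (\<Prod>v\<in>e. s v)\<^sup>2 * (\<Prod>v\<in>e. x v)))"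
proof -
  have unit: "x v / s v \<in> {1, -1}" if "x v \<in> {s v, - s v}" for x v using that s[of v] by auto
  consider "card T \<le> 1" | "card T = 2" | "card T = 3" using T(2) by linarith
  then show ?thesis
  proof cases
    case 1
    show ?thesis by (rule that[of "\<lambda>_. 0" 1]) (simp_all add: card_2_subsets1[OF T(1) 1])
  next
    case 2
    then obtain p q where pq: "T = {p, q}" "p \<noteq> q" by (auto simp: card_2_iff)
    then have e: "{p, q} \<in> E'" using edge[of p q] by auto
    define X where "X = c {p, q} / (s p * s q)"
    have X: "0 \<le> X" "X < 1" using c[of p q] lt[of p q] pq s[of p] s[of q] by (simp_all add: X_def)
    \<comment> \<open>Two terminals are treated as a triangle whose third spin is uncorrelated with
      both, so the other two couplings vanish.\<close>
    have z: "0 * 0 \<le> X" "(0::real) \<le> 0" "(0::real) < 1" "X * 0 \<le> 0" using X by simp_all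
    obtain a b d Q where abc0: "0 \<le> a" "0 < Q" "0 = X * 0 \<Longrightarrow> b = 0" "0 = X * 0 \<Longrightarrow> d = 0"
      "\<And>u v w. u \<in> {1, -1} \<Longrightarrow> v \<in> {1, -1} \<Longrightarrow> w \<in> {1, -1} \<Longrightarrow>
        exp (a * (u * v) + b * (v * w) + d * (u * w)) = Q * (1 + X * (u * v) + 0 * (v * w) + 0 * (u * w))"
      using triangle_couplings[OF X z(1-4,2-4)] by metis
    have "b = 0" "d = 0" using abc0(3,4) by simp_all
    note abc = abc0(1,2) this abc0(5)
    define J where "J e = (if e = {p, q} then a / (\<beta> * (s p * s q)) else 0)" for e
    show ?thesis
    proof (rule that[of J Q])
      show "0 \<le> J e" for e using abc \<beta> s[of p] s[of q] by (simp add: J_def)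
      show "J e \<noteq> 0 \<Longrightarrow> e \<in> E' \<and> e \<subseteq> T" for e using e pq by (auto simp: J_def split: if_splits)
      show "0 < Q" by fact
      fix x assume x: "\<forall>v\<in>T. x v \<in> {s v, - s v}"
      let ?u = "x p / s p" and ?v = "x q / s q"
      have "(\<Sum>e\<in>E'. J e * (\<Prod>v\<in>e. x v)) = (\<Sum>e\<in>{{p, q}}. J e * (\<Prod>v\<in>e. x v))"
        using e E' by (intro sum.mono_neutral_right) (auto simp: J_def)
      then have 1: "\<beta> * (\<Sum>e\<in>E'. J e * (\<Prod>v\<in>e. x v)) = a * (?u * ?v) + b * (?v * 1) + d * (?u * 1)"
        using \<beta> pq abc(3,4) by (simp add: J_def field_simps)
      have "exp (a * (?u * ?v) + b * (?v * 1) + d * (?u * 1)) = Q * (1 + X * (?u * ?v) + 0 * (?v * 1) + 0 * (?u * 1))"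
        using x pq unit by (intro abc(5)) auto
      then show "exp (\<beta> * (\<Sum>e\<in>E'. J e * (\<Prod>v\<in>e. x v))) =
         Q * (1 + (\<Sum>e | e \<subseteq> T \<and> card e = 2. c e / (\<Prod>v\<in>e. s v)\<^sup>2 * (\<Prod>v\<in>e. x v)))"
        unfolding 1 unfolding pq(1) card_2_subsets2[OF pq(2)] using pq(2)
        by (simp add: X_def power2_eq_square power_mult_distrib mult_ac)
    qed
  next
    case 3
    then obtain p q r where pqr: "T = {p, q, r}" "p \<noteq> q" "q \<noteq> r" "p \<noteq> r" by (auto simp: card_3_iff)
    note in_T = pqr(1)
    define X Y Z where XYZ: "X = c {p, q} / (s p * s q)" "Y = c {q, r} / (s q * s r)" "Z = c {p, r} / (s p * s r)"
    have sp: "0 < s p" "0 < s q" "0 < s r" using s by auto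
    have X: "0 \<le> X" "X < 1" "0 \<le> Y" "Y < 1" "0 \<le> Z" "Z < 1"
      using c[of p q] lt[of p q] c[of q r] lt[of q r] c[of p r] lt[of p r] pqr sp by (simp_all add: XYZ)
    have tr: "c {q, r} * c {p, r} \<le> (s r)\<^sup>2 * c {p, q}" "c {p, q} * c {p, r} \<le> (s p)\<^sup>2 * c {q, r}"
      "c {p, q} * c {q, r} \<le> (s q)\<^sup>2 * c {p, r}"
      using tri[of r q p] tri[of p q r] tri[of q p r] pqr by (auto simp: insert_commute)
    have T3: "Y * Z \<le> X" "X * Z \<le> Y" "X * Y \<le> Z"
    proof -
      have *: "a / (u * v) * (b / (u * w)) \<le> d / (v * w)" if "a * b \<le> u\<^sup>2 * d" "0 < u" "0 < v" "0 < w" for a b d u v w :: real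
        using that by (simp add: field_simps power2_eq_square)
      show "Y * Z \<le> X" using *[OF tr(1) sp(3,2,1)] by (simp add: XYZ mult.commute)
      show "X * Z \<le> Y" using *[OF tr(2) sp(1,2,3)] by (simp add: XYZ mult.commute)
      show "X * Y \<le> Z" using *[OF tr(3) sp(2,1,3)] by (simp add: XYZ mult.commute)
    qed
    obtain a b d Q where abc: "0 \<le> a" "0 \<le> b" "0 \<le> d" "0 < Q"
      "X = Y * Z \<Longrightarrow> a = 0" "Y = X * Z \<Longrightarrow> b = 0" "Z = X * Y \<Longrightarrow> d = 0"
      "\<And>u v w. u \<in> {1, -1} \<Longrightarrow> v \<in> {1, -1} \<Longrightarrow> w \<in> {1, -1} \<Longrightarrow>
        exp (a * (u * v) + b * (v * w) + d * (u * w)) = Q * (1 + X * (u * v) + Y * (v * w) + Z * (u * w))"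
      using triangle_couplings[of X Y Z] X T3 by blast
    have noedge: "d' / (v * w) = a' / (u * v) * (b' / (u * w))"
      if "a' * b' = u\<^sup>2 * d'" "0 < u" "0 < v" "0 < w" for a' b' d' u v w :: real
      using that by (simp add: field_simps power2_eq_square)
    have a0: "a = 0" if "{p, q} \<notin> E'"
    proof -
      have "c {p, r} * c {q, r} = (s r)\<^sup>2 * c {p, q}" using edge[of p q] pqr that by auto
      from noedge[OF this sp(3,1,2)] show ?thesis using abc(5) by (simp add: XYZ mult.commute)
    qed
    have b0: "b = 0" if "{q, r} \<notin> E'"
    proof -
      have "c {q, p} * c {r, p} = (s p)\<^sup>2 * c {q, r}" using edge[of q r] pqr that by auto
      from noedge[OF this sp(1,2,3)] show ?thesis using abc(6) by (simp add: XYZ mult.commute insert_commute)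
    qed
    have d0: "d = 0" if "{p, r} \<notin> E'"
    proof -
      have "c {p, q} * c {r, q} = (s q)\<^sup>2 * c {p, r}" using edge[of p r] pqr that by auto
      from noedge[OF this sp(2,1,3)] show ?thesis using abc(7) by (simp add: XYZ mult.commute insert_commute)
    qed
    have neq: "{p, q} \<noteq> {q, r}" "{p, q} \<noteq> {p, r}" "{q, r} \<noteq> {p, r}" using pqr by (auto simp: doubleton_eq_iff)
    define J where "J e = (if e = {p, q} then a / (\<beta> * (s p * s q)) else if e = {q, r} then b / (\<beta> * (s q * s r))
      else if e = {p, r} then d / (\<beta> * (s p * s r)) else 0)" for e
    have Jv: "J {p, q} = a / (\<beta> * (s p * s q))" "J {q, r} = b / (\<beta> * (s q * s r))" "J {p, r} = d / (\<beta> * (s p * s r))"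
      using neq by (auto simp: J_def)
    have J0: "J e \<noteq> 0 \<Longrightarrow> e \<in> E' \<and> e \<in> {{p, q}, {q, r}, {p, r}}" for e
      using a0 b0 d0 by (auto simp: J_def split: if_splits)
    show ?thesis
    proof (rule that[of J Q])
      show "0 \<le> J e" for e using abc(1-3) \<beta> sp by (simp add: J_def)
      show "J e \<noteq> 0 \<Longrightarrow> e \<in> E' \<and> e \<subseteq> T" for e using J0[of e] pqr(1) by auto
      show "0 < Q" by fact
      fix x assume x: "\<forall>v\<in>T. x v \<in> {s v, - s v}"
      let ?u = "x p / s p" and ?v = "x q / s q" and ?w = "x r / s r"
      have "(\<Sum>e\<in>E'. J e * (\<Prod>v\<in>e. x v)) = (\<Sum>e\<in>{e \<in> E'. J e \<noteq> 0}. J e * (\<Prod>v\<in>e. x v))"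
        using E' by (intro sum.mono_neutral_right) auto
      also have "\<dots> = (\<Sum>e\<in>{{p, q}, {q, r}, {p, r}}. J e * (\<Prod>v\<in>e. x v))"
        using J0 by (intro sum.mono_neutral_left) auto
      also have "\<dots> = J {p, q} * (x p * x q) + (J {q, r} * (x q * x r) + J {p, r} * (x p * x r))"
        using neq pqr(2-4) by simp
      finally have 1: "\<beta> * (\<Sum>e\<in>E'. J e * (\<Prod>v\<in>e. x v)) = a * (?u * ?v) + b * (?v * ?w) + d * (?u * ?w)"
        using \<beta> by (simp add: Jv distrib_left)
      have 2: "exp (a * (?u * ?v) + b * (?v * ?w) + d * (?u * ?w)) =
          Q * (1 + X * (?u * ?v) + Y * (?v * ?w) + Z * (?u * ?w))"
        using x pqr(1) unit by (intro abc(8)) auto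
      have 3: "(\<Sum>e\<in>{{p, q}, {q, r}, {p, r}}. c e / (\<Prod>v\<in>e. s v)\<^sup>2 * (\<Prod>v\<in>e. x v)) =
          X * (?u * ?v) + Y * (?v * ?w) + Z * (?u * ?w)"
        using neq pqr(2-4) by (simp add: XYZ power2_eq_square mult_ac)
      show "exp (\<beta> * (\<Sum>e\<in>E'. J e * (\<Prod>v\<in>e. x v))) =
         Q * (1 + (\<Sum>e | e \<subseteq> T \<and> card e = 2. c e / (\<Prod>v\<in>e. s v)\<^sup>2 * (\<Prod>v\<in>e. x v)))"
        unfolding 1 2 unfolding pqr(1) card_2_subsets3[OF pqr(2-4)] 3 by (simp add: add.assoc)
    qed
  qed
qed

section \<open>Replacing the components\<close>

definition cell_edges :: "'v set set \<Rightarrow> 'v set \<Rightarrow> 'v set set" where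
  "cell_edges E C = {e \<in> E. e \<inter> C \<noteq> {}}"

lemma cell_path:
  assumes C: "connected_in E C" and ab: "a \<in> C \<union> nbrs E C" "b \<in> C \<union> nbrs E C"
  obtains p where "simple_path_between (cell_edges E C) a p b" "set p \<subseteq> C \<union> {a, b}"
proof (cases "a = b")
  case True
  show ?thesis by (rule that[of "[a]"]) (simp_all add: True simple_path_between_def)
next
  case False
  let ?F = "cell_edges E C"
  have enter: "\<exists>d\<in>C. conn ?F (C \<union> {a, b}) x d" if "x \<in> {a, b}" for x
  proof (cases "x \<in> C")
    case True
    then show ?thesis using that by (intro bexI[of _ x] conn_refl) auto
  next
    case False
    then have "x \<in> nbrs E C" using ab that by blast
    then obtain d where d: "d \<in> C" "{d, x} \<in> E" by (auto simp: nbrs_def)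
    then have "{x, d} \<in> ?F" by (auto simp: cell_edges_def insert_commute)
    then show ?thesis using d(1) that by (intro bexI[of _ d] conn_edge) auto
  qed
  obtain d where d: "d \<in> C" "conn ?F (C \<union> {a, b}) a d" using enter[of a] by blast
  obtain e where e: "e \<in> C" "conn ?F (C \<union> {a, b}) b e" using enter[of b] by blast
  have "conn E C d e" by (rule connected_in_conn[OF C d(1) e(1)])
  then have "conn ?F (C \<union> {a, b}) d e"
  proof (induction rule: conn_induct)
    case refl
    then show ?case by simp
  next
    case (step y z)
    have "{y, z} \<in> ?F" using step.hyps(2,3) by (auto simp: cell_edges_def)
    then show ?case using step.hyps(3) by (intro conn_step[OF step.IH]) simp_all
  qed
  from conn_trans[OF d(2) conn_trans[OF this conn_sym[OF e(2)]]]
  show ?thesis by (rule conn_path) (rule that)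
qed

text \<open>Along a path in the cell from \<open>x\<close> to \<open>w\<close>, stop at the first
  marked vertex after \<open>x\<close>: all vertices in between are hidden, so the initial piece
  gives an edge of the path-induced graph.\<close>

lemma cell_terminal_edge:
  assumes C: "connected_in E C" and x: "x \<in> nbrs E C \<union> (C \<inter> W)" and w: "w \<in> C \<inter> W" "x \<noteq> w"
    and V': "V' \<inter> C = C \<inter> W" "nbrs E C \<subseteq> V'"
  shows "\<exists>w'\<in>C \<inter> W - {x}. {x, w'} \<in> path_induced_edges E V'"
proof -
  obtain p where p: "simple_path_between (cell_edges E C) x p w" "set p \<subseteq> C \<union> {x, w}"
    by (rule cell_path[OF C, of x w]) (use x w in auto)
  have p0: "p \<noteq> []" "hd p = x" "last p = w" "distinct p" "walk (cell_edges E C) p"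
    using p(1) by (simp_all add: simple_path_between_def)
  obtain p' where p': "p = x # p'" using p0(1,2) by (cases p) auto
  have "w \<in> set p'" using p0(1,3) p' w(2) by (metis last_ConsL last_ConsR last_in_set)
  then have "\<exists>y\<in>set p'. y \<in> W" using w(1) by blast
  then obtain ys y zs where s: "p' = ys @ y # zs" "y \<in> W" "\<forall>z\<in>set ys. z \<notin> W"
    by (elim split_list_first_propE)
  have sub: "set p' \<subseteq> C" using p(2) w(1) p0(4) by (auto simp: p')
  have y: "y \<in> C" "y \<noteq> x" "set ys \<subseteq> C" using sub s(1) p0(4) p' by auto
  have "walk (cell_edges E C) ((x # ys) @ [y])"
    using p0(5) walk_prefix[of "cell_edges E C" "x # ys" y zs] by (simp add: p' s(1))
  then have wk: "walk E (x # ys @ [y])"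
    by (rule_tac successively_mono[where P = "\<lambda>a b. {a, b} \<in> cell_edges E C"]) (auto simp: cell_edges_def)
  have "simple_path_between E x (x # ys @ [y]) y"
    unfolding simple_path_between_def using p0(4) wk by (auto simp: p' s(1))
  moreover have "set (x # ys @ [y]) \<inter> V' = {x, y}"
  proof -
    have "x \<in> V'" using x V' by blast
    moreover have "y \<in> V'" using y(1) s(2) V' by blast
    moreover have "set ys \<inter> V' = {}" using y(3) s(3) V'(1) by blast
    ultimately show ?thesis by auto
  qed
  ultimately have "{x, y} \<in> path_induced_edges E V'" by (rule path_induced_edge_path) (rule y(2)[symmetric])
  then show ?thesis using y s(2) by blast
qed

lemma boltzmann_weight_even:
  assumes "\<And>e. e \<in> E \<Longrightarrow> card e = 2"
  shows "boltzmann_weight E J \<beta> (\<lambda>v. - x v) = boltzmann_weight E J \<beta> x"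
proof -
  have "(\<Prod>v\<in>e. - x v) = (\<Prod>v\<in>e. x v)" if e: "e \<in> E" for e
  proof -
    obtain a b where "e = {a, b}" "a \<noteq> b" using assms[OF e] by (auto simp: card_2_iff)
    then show ?thesis by simp
  qed
  then show ?thesis unfolding boltzmann_weight_def by (simp cong: sum.cong)
qed

lemma (in reference_family) local_on_weight:
  assumes "\<And>e. e \<in> E \<Longrightarrow> J e \<noteq> 0 \<Longrightarrow> e \<subseteq> A" "S \<subseteq> A"
  shows "local_on A (\<lambda>x. (\<Prod>v\<in>S. x v) * boltzmann_weight E J \<beta> x)"
  unfolding local_on_def
proof (intro allI impI)
  fix x y :: "'v \<Rightarrow> real" assume xy: "\<forall>v\<in>A. x v = y v"
  have "(\<Prod>v\<in>S. x v) = (\<Prod>v\<in>S. y v)" using xy assms(2) by (intro prod.cong) auto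
  moreover have "(\<Sum>e\<in>E. J e * (\<Prod>v\<in>e. x v)) = (\<Sum>e\<in>E. J e * (\<Prod>v\<in>e. y v))"
  proof (rule sum.cong[OF refl])
    fix e assume e: "e \<in> E"
    show "J e * (\<Prod>v\<in>e. x v) = J e * (\<Prod>v\<in>e. y v)"
    proof (cases "J e = 0")
      case False
      then have "(\<Prod>v\<in>e. x v) = (\<Prod>v\<in>e. y v)" using assms(1)[OF e] xy by (intro prod.cong) auto
      then show ?thesis by simp
    qed simp
  qed
  ultimately show "(\<Prod>v\<in>S. x v) * boltzmann_weight E J \<beta> x = (\<Prod>v\<in>S. y v) * boltzmann_weight E J \<beta> y"
    by (simp add: boltzmann_weight_def)
qed

lemma (in reference_family) tame1_weight:
  assumes "finite_graph V E" "S \<subseteq> V"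
  shows "tame1 (\<lambda>x. (\<Prod>v\<in>S. x v) * boltzmann_weight E J \<beta> x)"
  by (rule tame1_mult[OF tame1_coords[OF assms(2)] tame1_boltzmann_weight[OF assms(1)]])

text \<open>On the support the weight is a combination of the constant and the pair products, so
  orthogonality of spin products picks out the coefficient belonging to \<open>S\<close>.\<close>

lemma (in reference_family) cell_moments:
  fixes c :: "'v set \<Rightarrow> real"
  assumes T: "T \<subseteq> V" "\<And>v. v \<in> T \<Longrightarrow> lam v = ising_measure (s v)" "\<And>v. v \<in> T \<Longrightarrow> 0 < s v"
    and E: "finite_graph V E"
    and w: "\<And>x. (\<forall>v\<in>T. x v \<in> {s v, - s v}) \<Longrightarrow> exp (\<beta> * (\<Sum>e\<in>E. J e * (\<Prod>v\<in>e. x v))) =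
       Q * (1 + (\<Sum>e | e \<subseteq> T \<and> card e = 2. c e / (\<Prod>v\<in>e. s v)\<^sup>2 * (\<Prod>v\<in>e. x v)))"
    and S: "S \<subseteq> T"
  shows "(\<integral>x. (\<Prod>v\<in>S. x v) * boltzmann_weight E J \<beta> x \<partial>M) =
    Q * (if S = {} then 1 else if card S = 2 then c S else 0)"
proof -
  let ?P = "{e. e \<subseteq> T \<and> card e = 2}"
  have fT: "finite T" using T(1) finite_V finite_subset by blast
  have fP: "finite ?P" using fT by simp
  have S': "S \<subseteq> V" using S T(1) by blast
  have PV: "e \<subseteq> V" if "e \<in> ?P" for e using that T(1) by blast
  have AE: "AE x in M. \<forall>v\<in>T. x v \<in> {s v, - s v}" by (rule AE_ising_family) (use T in auto)
  have t1: "tame1 (\<lambda>x. (\<Prod>v\<in>S. x v) * (c e / (\<Prod>v\<in>e. s v)\<^sup>2 * (\<Prod>v\<in>e. x v)))" if "e \<in> ?P" for e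
    by (rule tame1_mult[OF tame1_coords[OF S'] tame1_mult[OF tame1_const tame1_coords[OF PV[OF that]]]])
  have i_sum: "(\<integral>x. (\<Sum>e\<in>?P. (\<Prod>v\<in>S. x v) * (c e / (\<Prod>v\<in>e. s v)\<^sup>2 * (\<Prod>v\<in>e. x v))) \<partial>M) =
      (\<Sum>e\<in>?P. \<integral>x. (\<Prod>v\<in>S. x v) * (c e / (\<Prod>v\<in>e. s v)\<^sup>2 * (\<Prod>v\<in>e. x v)) \<partial>M)"
    by (rule Bochner_Integration.integral_sum) (rule tame1_integrable[OF t1])
  have t2: "tame1 (\<lambda>x. \<Sum>e\<in>?P. (\<Prod>v\<in>S. x v) * (c e / (\<Prod>v\<in>e. s v)\<^sup>2 * (\<Prod>v\<in>e. x v)))"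
    by (rule tame1_sum[OF t1])
  have t3: "tame1 (\<lambda>x. Q * ((\<Prod>v\<in>S. x v) + (\<Sum>e\<in>?P. (\<Prod>v\<in>S. x v) * (c e / (\<Prod>v\<in>e. s v)\<^sup>2 * (\<Prod>v\<in>e. x v)))))"
    by (rule tame1_mult[OF tame1_const tame1_add[OF tame1_coords[OF S'] t2]])
  have "(\<integral>x. (\<Prod>v\<in>S. x v) * boltzmann_weight E J \<beta> x \<partial>M) =
    (\<integral>x. Q * ((\<Prod>v\<in>S. x v) + (\<Sum>e\<in>?P. (\<Prod>v\<in>S. x v) * (c e / (\<Prod>v\<in>e. s v)\<^sup>2 * (\<Prod>v\<in>e. x v)))) \<partial>M)"
  proof (rule integral_cong_AE)
    show "AE x in M. (\<Prod>v\<in>S. x v) * boltzmann_weight E J \<beta> x =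
      Q * ((\<Prod>v\<in>S. x v) + (\<Sum>e\<in>?P. (\<Prod>v\<in>S. x v) * (c e / (\<Prod>v\<in>e. s v)\<^sup>2 * (\<Prod>v\<in>e. x v))))"
      using AE
    proof (rule AE_mp, intro AE_I2 impI)
      fix x assume x: "\<forall>v\<in>T. x v \<in> {s v, - s v}"
      show "(\<Prod>v\<in>S. x v) * boltzmann_weight E J \<beta> x =
        Q * ((\<Prod>v\<in>S. x v) + (\<Sum>e\<in>?P. (\<Prod>v\<in>S. x v) * (c e / (\<Prod>v\<in>e. s v)\<^sup>2 * (\<Prod>v\<in>e. x v))))"
        unfolding boltzmann_weight_def w[OF x] sum_distrib_left[symmetric] by (simp add: distrib_left)
    qed
  qed (rule tame1_measurable[OF tame1_weight[OF E S']], rule tame1_measurable[OF t3])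
  also have "\<dots> = Q * ((\<integral>x. (\<Prod>v\<in>S. x v) \<partial>M) +
      (\<Sum>e\<in>?P. \<integral>x. (\<Prod>v\<in>S. x v) * (c e / (\<Prod>v\<in>e. s v)\<^sup>2 * (\<Prod>v\<in>e. x v)) \<partial>M))"
    unfolding integral_mult_right_zero
      Bochner_Integration.integral_add[OF tame1_integrable[OF tame1_coords[OF S']] tame1_integrable[OF t2]]
      i_sum ..
  also have "(\<integral>x. (\<Prod>v\<in>S. x v) \<partial>M) = (if S = {} then 1 else 0)"
  proof -
    have "(\<integral>x. (\<Prod>v\<in>S. x v) * (\<Prod>v\<in>{}. x v) \<partial>M) = (if S = {} then \<Prod>v\<in>S. (s v)\<^sup>2 else 0)"
      using S S' T by (intro integral_coords2) auto
    then show ?thesis by (auto split: if_splits)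
  qed
  also have "(\<Sum>e\<in>?P. \<integral>x. (\<Prod>v\<in>S. x v) * (c e / (\<Prod>v\<in>e. s v)\<^sup>2 * (\<Prod>v\<in>e. x v)) \<partial>M) =
      (\<Sum>e\<in>?P. if e = S then c S else 0)"
  proof (rule sum.cong[OF refl])
    fix e assume e: "e \<in> ?P"
    have "(\<integral>x. (\<Prod>v\<in>S. x v) * (c e / (\<Prod>v\<in>e. s v)\<^sup>2 * (\<Prod>v\<in>e. x v)) \<partial>M) =
        (\<integral>x. c e / (\<Prod>v\<in>e. s v)\<^sup>2 * ((\<Prod>v\<in>S. x v) * (\<Prod>v\<in>e. x v)) \<partial>M)" by (simp only: mult.left_commute)
    also have "\<dots> = c e / (\<Prod>v\<in>e. s v)\<^sup>2 * (\<integral>x. (\<Prod>v\<in>S. x v) * (\<Prod>v\<in>e. x v) \<partial>M)"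
      by (rule integral_mult_right_zero)
    also have "(\<integral>x. (\<Prod>v\<in>S. x v) * (\<Prod>v\<in>e. x v) \<partial>M) = (if S = e then \<Prod>v\<in>S. (s v)\<^sup>2 else 0)"
      using S S' T e by (intro integral_coords2) auto
    also have "c e / (\<Prod>v\<in>e. s v)\<^sup>2 * (if S = e then \<Prod>v\<in>S. (s v)\<^sup>2 else 0) = (if e = S then c S else 0)"
    proof (cases "e = S")
      case True
      have "0 < (\<Prod>v\<in>S. s v)" using S T(3) by (intro prod_pos) auto
      then have "(\<Prod>v\<in>S. s v)\<^sup>2 \<noteq> 0" by simp
      then show ?thesis using True unfolding prod_power_distrib[symmetric] by simp
    qed simp
    finally show "(\<integral>x. (\<Prod>v\<in>S. x v) * (c e / (\<Prod>v\<in>e. s v)\<^sup>2 * (\<Prod>v\<in>e. x v)) \<partial>M) = (if e = S then c S else 0)" .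
  qed
  also have "\<dots> = (if card S = 2 then c S else 0)" using fP S by (simp add: sum.delta')
  finally show ?thesis by auto
qed

context ferromagnet
begin

text \<open>The hidden spins of a cell are replaced by couplings between its terminals.\<close>

lemma cell_model:
  assumes K: "K \<subseteq> V" "\<And>v. v \<in> K \<Longrightarrow> lam v = ising_measure (s0 v)" "\<And>v. 0 < s0 v"
    and C: "C \<subseteq> V - K" "C \<noteq> {}" "connected_in E C" "nbrs E C \<subseteq> K"
    and X: "X \<subseteq> V" "card (nbrs E C) + card (C \<inter> X) \<le> 3"
  defines "V' \<equiv> K \<union> X" and "T \<equiv> nbrs E C \<union> (C \<inter> X)"
  obtains s J' d where "\<And>v. 0 < s v" "\<And>v. v \<notin> C \<inter> X \<Longrightarrow> s v = s0 v"
    "\<And>e. 0 \<le> J' e" "\<And>e. J' e \<noteq> 0 \<Longrightarrow> e \<subseteq> T" "0 < d"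
    "\<And>lam' S. reference_family V' lam' \<Longrightarrow> (\<And>v. v \<in> T \<Longrightarrow> lam' v = ising_measure (s v)) \<Longrightarrow> S \<subseteq> T \<Longrightarrow>
      (\<integral>x. (\<Prod>v\<in>S. x v) * boltzmann_weight (path_induced_edges E V') J' \<beta> x \<partial>PiM V' lam') =
      d * (\<integral>x. (\<Prod>v\<in>S. x v) * boltzmann_weight (cell_edges E C) J \<beta> x \<partial>M)"
proof -
  let ?E' = "path_induced_edges E V'" and ?F = "cell_edges E C" and ?N = "nbrs E C"
  have finV': "finite V'" using K(1) X(1) finite_V finite_subset[of V' V] by (simp add: V'_def)
  have gF: "finite_graph V ?F" using graph by (auto simp: finite_graph_def cell_edges_def)
  have gE': "finite_graph V' ?E'"
    unfolding finite_graph_def using finV' path_induced_edges_Pow[of E V'] path_induced_edges_card[of _ E V'] by blast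
  have finE': "finite ?E'" using gE' finV' finite_subset[of ?E' "Pow V'"] by (auto simp: finite_graph_def)
  interpret L: ferromagnet V lam ?F J \<beta>
    by unfold_locales (use gF J_pos \<beta>_pos in \<open>auto simp: cell_edges_def\<close>)
  have NC: "?N \<inter> C = {}" by (auto simp: nbrs_def)
  have TV: "T \<subseteq> V" "T \<subseteq> V'" "T \<subseteq> C \<union> ?N" using C X K(1) by (auto simp: T_def V'_def)
  have finT: "finite T" using TV(1) finite_V finite_subset by blast
  have finN: "finite ?N" "finite (C \<inter> X)" using finT by (simp_all add: T_def)
  have "card T = card ?N + card (C \<inter> X)"
    unfolding T_def using finN NC by (intro card_Un_disjoint) auto
  then have cardT: "card T \<le> 3" using X(2) by simp
  have TF: "T - C \<inter> X = ?N" using NC by (auto simp: T_def)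
  define m where "m S = L.Ex (\<lambda>x. \<Prod>v\<in>S. x v)" for S
  define Z where "Z = L.Ex (\<lambda>_. 1)"
  have Z: "0 < Z" unfolding Z_def by (rule L.Ex_1_pos)
  have m2: "m {p, q} = L.Ex (\<lambda>x. x p * x q)" if "p \<noteq> q" for p q using that by (simp add: m_def)
  \<comment> \<open>Normalised moments of the cell alone, with the hidden vertices integrated out. A
    marked vertex inside \<open>C\<close> may carry any reference measure; the new cell only has to
    reproduce these numbers.\<close>
  define c where "c S = m S / Z" for S
  have mc: "m S = c S * Z" for S using Z by (simp add: c_def)
  have pos: "0 < c {p, q}" if pq: "p \<in> T" "q \<in> T" "p \<noteq> q" for p q
  proof -
    obtain \<pi> where "simple_path_between ?F p \<pi> q"
      by (rule cell_path[OF C(3), of p q]) (use pq TV(3) in auto)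
    then have "0 < L.Ex (\<lambda>x. x p * x q)" using pq TV(1) by (intro L.pair_pos) auto
    then show ?thesis using m2[OF pq(3)] Z by (simp add: c_def)
  qed
  have ising: "lam p = ising_measure (s0 p)" "p \<in> V" if "p \<in> ?N" for p using that C(4) K by auto
  have gr: "c {p, q} * c {p, r} < (s0 p)\<^sup>2 * c {q, r}"
    if pqr: "p \<in> T - C \<inter> X" "q \<in> T" "r \<in> T" "p \<noteq> q" "p \<noteq> r" "q \<noteq> r" for p q r
  proof -
    have p: "p \<in> ?N" using pqr(1) TF by simp
    obtain \<pi> where \<pi>: "simple_path_between ?F q \<pi> r" "set \<pi> \<subseteq> C \<union> {q, r}"
      by (rule cell_path[OF C(3), of q r]) (use pqr TV(3) in auto)
    have "p \<notin> set \<pi>" using \<pi>(2) p NC pqr by blast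
    then have "L.Ex (\<lambda>x. x p * x q) * L.Ex (\<lambda>x. x p * x r) < (s0 p)\<^sup>2 * L.Ex (\<lambda>x. x q * x r) * L.Ex (\<lambda>_. 1)"
      using pqr TV(1) ising[OF p] K(3) by (intro L.griffiths(2)[OF _ _ _ _ _ \<pi>(1)]) auto
    then have "(c {p, q} * Z) * (c {p, r} * Z) < (s0 p)\<^sup>2 * (c {q, r} * Z) * Z"
      unfolding mc[symmetric] m2[OF pqr(4)] m2[OF pqr(5)] m2[OF pqr(6)] Z_def[symmetric] .
    then have "(Z * Z) * (c {p, q} * c {p, r}) < (Z * Z) * ((s0 p)\<^sup>2 * c {q, r})" by (simp add: mult_ac)
    then show ?thesis using Z by simp
  qed
  \<comment> \<open>Griffiths with \<open>q = r\<close> and the one-vertex path \<open>[q]\<close>: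
    the squared correlation lies strictly below the product of the squared spins.\<close>
  have fixed: "c {p, q} < s0 p * s0 q" if pq: "p \<in> T - C \<inter> X" "q \<in> T - C \<inter> X" "p \<noteq> q" for p q
  proof -
    have p: "p \<in> ?N" and q: "q \<in> ?N" using pq TF by simp_all
    have "L.Ex (\<lambda>x. x p * x q) * L.Ex (\<lambda>x. x p * x q) < (s0 p)\<^sup>2 * L.Ex (\<lambda>x. x q * x q) * L.Ex (\<lambda>_. 1)"
      using ising[OF p] ising[OF q] K(3) pq(3)
      by (intro L.griffiths(2)[of p q q _ "[q]"]) (auto simp: simple_path_between_def)
    moreover have "L.Ex (\<lambda>x. x q * x q) = (s0 q)\<^sup>2 * Z"
      using L.Ex_ising_square[of q "s0 q" "\<lambda>_. 1"] ising[OF q] K(3) by (simp add: Z_def)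
    ultimately have "(c {p, q} * Z) * (c {p, q} * Z) < (s0 p)\<^sup>2 * ((s0 q)\<^sup>2 * Z) * Z"
      unfolding mc[symmetric] m2[OF pq(3)] Z_def[symmetric] by simp
    then have "(c {p, q} * Z)\<^sup>2 < (s0 p * s0 q * Z)\<^sup>2" by (simp add: power2_eq_square mult_ac)
    moreover have "0 \<le> s0 p * s0 q * Z" using K(3)[of p] K(3)[of q] Z by simp
    ultimately have "c {p, q} * Z < s0 p * s0 q * Z" by (rule power_less_imp_less_base)
    then show ?thesis using Z by simp
  qed
  have edges0: "{p, q} \<in> ?E'" if "C \<inter> X = {}" "p \<in> T" "q \<in> T" "p \<noteq> q" for p q
  proof (rule path_induced_via[of C])
    show "C \<inter> V' = {}" using that(1) C(1) by (auto simp: V'_def)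
  qed (use that C(3,4) in \<open>auto simp: T_def V'_def\<close>)
  have V'C: "V' \<inter> C = C \<inter> X" "?N \<subseteq> V'" using C(1,4) by (auto simp: V'_def)
  have edges1: "\<exists>w'\<in>C \<inter> X - {x}. {x, w'} \<in> ?E'" if "x \<in> T" "w \<in> C \<inter> X" "x \<noteq> w" for x w
    using that(1) unfolding T_def by (rule cell_terminal_edge[OF C(3) _ that(2,3) V'C])
  have FT: "C \<inter> X \<subseteq> T" by (simp add: T_def)
  have "\<exists>s. (\<forall>v. 0 < s v) \<and> (\<forall>v. v \<notin> C \<inter> X \<longrightarrow> s v = s0 v) \<and>
    (\<forall>p\<in>T. \<forall>q\<in>T. p \<noteq> q \<longrightarrow> c {p, q} < s p * s q) \<and>
    (\<forall>p\<in>T. \<forall>q\<in>T. \<forall>r\<in>T. p \<noteq> q \<longrightarrow> p \<noteq> r \<longrightarrow> q \<noteq> r \<longrightarrow> c {p, q} * c {p, r} \<le> (s p)\<^sup>2 * c {q, r}) \<and>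
    (\<forall>p\<in>T. \<forall>q\<in>T. p \<noteq> q \<longrightarrow> {p, q} \<notin> ?E' \<longrightarrow> (\<exists>r\<in>T - {p, q}. c {p, r} * c {q, r} = (s r)\<^sup>2 * c {p, q}))"
    (is "\<exists>s. ?S s")
  proof (rule cell_spins[of T "C \<inter> X" s0 c ?E'])
    fix s
    assume *: "\<And>v. 0 < s v" "\<And>v. v \<notin> C \<inter> X \<Longrightarrow> s v = s0 v"
      "\<And>p q. p \<in> T \<Longrightarrow> q \<in> T \<Longrightarrow> p \<noteq> q \<Longrightarrow> c {p, q} < s p * s q"
      "\<And>p q r. p \<in> T \<Longrightarrow> q \<in> T \<Longrightarrow> r \<in> T \<Longrightarrow> p \<noteq> q \<Longrightarrow> p \<noteq> r \<Longrightarrow> q \<noteq> r \<Longrightarrow> c {p, q} * c {p, r} \<le> (s p)\<^sup>2 * c {q, r}"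
      "\<And>p q. p \<in> T \<Longrightarrow> q \<in> T \<Longrightarrow> p \<noteq> q \<Longrightarrow> {p, q} \<notin> ?E' \<Longrightarrow>
        \<exists>r\<in>T - {p, q}. c {p, r} * c {q, r} = (s r)\<^sup>2 * c {p, q}"
    show ?thesis by (intro exI[of _ s] conjI allI ballI impI; rule *; assumption)
  qed (fact finT cardT FT K(3) pos fixed gr edges0 edges1)+
  then obtain s where S: "?S s" ..
  note s = S[THEN conjunct1, rule_format] S[THEN conjunct2, THEN conjunct1, rule_format]
    S[THEN conjunct2, THEN conjunct2, THEN conjunct1, rule_format]
    S[THEN conjunct2, THEN conjunct2, THEN conjunct2, THEN conjunct1, rule_format]
    S[THEN conjunct2, THEN conjunct2, THEN conjunct2, THEN conjunct2, rule_format]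
  have "\<exists>J' Q. (\<forall>e. 0 \<le> J' e) \<and> (\<forall>e. J' e \<noteq> 0 \<longrightarrow> e \<in> ?E' \<and> e \<subseteq> T) \<and> 0 < Q \<and>
    (\<forall>x. (\<forall>v\<in>T. x v \<in> {s v, - s v}) \<longrightarrow> exp (\<beta> * (\<Sum>e\<in>?E'. J' e * (\<Prod>v\<in>e. x v))) =
       Q * (1 + (\<Sum>e | e \<subseteq> T \<and> card e = 2. c e / (\<Prod>v\<in>e. s v)\<^sup>2 * (\<Prod>v\<in>e. x v))))"
    (is "\<exists>J' Q. ?J J' Q")
  proof (rule cell_couplings[of T s \<beta> ?E' c])
    fix J' Q
    assume *: "\<And>e. 0 \<le> J' e" "\<And>e. J' e \<noteq> 0 \<Longrightarrow> e \<in> ?E' \<and> e \<subseteq> T" "0 < Q"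
      "\<And>x. \<forall>v\<in>T. x v \<in> {s v, - s v} \<Longrightarrow> exp (\<beta> * (\<Sum>e\<in>?E'. J' e * (\<Prod>v\<in>e. x v))) =
       Q * (1 + (\<Sum>e | e \<subseteq> T \<and> card e = 2. c e / (\<Prod>v\<in>e. s v)\<^sup>2 * (\<Prod>v\<in>e. x v)))"
    have 1: "\<forall>e. 0 \<le> J' e" "\<forall>e. J' e \<noteq> 0 \<longrightarrow> e \<in> ?E' \<and> e \<subseteq> T" using *(1,2) by blast+
    have 2: "\<forall>x. (\<forall>v\<in>T. x v \<in> {s v, - s v}) \<longrightarrow> exp (\<beta> * (\<Sum>e\<in>?E'. J' e * (\<Prod>v\<in>e. x v))) =
       Q * (1 + (\<Sum>e | e \<subseteq> T \<and> card e = 2. c e / (\<Prod>v\<in>e. s v)\<^sup>2 * (\<Prod>v\<in>e. x v)))"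
      by (intro allI impI) (rule *(4))
    show ?thesis by (intro exI[of _ J'] exI[of _ Q] conjI 1 *(3) 2)
  qed (fact finT cardT s(1) \<beta>_pos finE' pos s(3,4,5))+
  then obtain J' Q where JQ: "?J J' Q" by (elim exE)
  note J' = JQ[THEN conjunct1, rule_format] JQ[THEN conjunct2, THEN conjunct1, rule_format]
    JQ[THEN conjunct2, THEN conjunct2, THEN conjunct1]
    JQ[THEN conjunct2, THEN conjunct2, THEN conjunct2, THEN spec, THEN mp]
  show ?thesis
  proof (rule that[of s J' "Q / Z"])
    show "0 < Q / Z" using J'(3) Z by simp
    show "J' e \<noteq> 0 \<Longrightarrow> e \<subseteq> T" for e using J'(2) by blast
    fix lam' :: "'v \<Rightarrow> real measure" and S
    assume lam': "reference_family V' lam'" and isg: "\<And>v. v \<in> T \<Longrightarrow> lam' v = ising_measure (s v)" and S: "S \<subseteq> T"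
    have "(\<integral>x. (\<Prod>v\<in>S. x v) * boltzmann_weight ?E' J' \<beta> x \<partial>PiM V' lam') =
        Q * (if S = {} then 1 else if card S = 2 then c S else 0)"
      by (rule reference_family.cell_moments[OF lam' TV(2) isg s(1) gE' J'(4) S])
    \<comment> \<open>With at most three terminals, only pairs matter besides the empty set: odd
      moments of the original cell vanish by the global spin flip.\<close>
    also have "(if S = {} then 1 else if card S = 2 then c S else 0) = m S / Z"
    proof -
      have "card S \<le> 3" using card_mono[OF finT S] cardT by simp
      moreover have "card S = 0 \<longleftrightarrow> S = {}" using finite_subset[OF S finT] by simp
      ultimately consider "S = {}" | "card S = 2" | "odd (card S)" "card S \<noteq> 0" by fastforce
      then show ?thesis
      proof cases
        case 1
        then show ?thesis using Z by (simp add: m_def Z_def)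
      next
        case 2
        then show ?thesis by (auto simp: c_def)
      next
        case 3
        have SV: "S \<subseteq> V" using S TV(1) by blast
        have "m S = 0"
          unfolding m_def L.Ex_def
        proof (rule integral_odd)
          show "tame1 (\<lambda>x. (\<Prod>v\<in>S. x v) * boltzmann_weight ?F J \<beta> x)" by (rule tame1_weight[OF gF SV])
          show "local_on V (\<lambda>x. (\<Prod>v\<in>S. x v) * boltzmann_weight ?F J \<beta> x)"
            using gF SV by (intro local_on_weight) (auto simp: finite_graph_def)
          fix x :: "'v \<Rightarrow> real"
          have "boltzmann_weight ?F J \<beta> (\<lambda>v. - x v) = boltzmann_weight ?F J \<beta> x"
            using gF by (intro boltzmann_weight_even) (auto simp: finite_graph_def)
          moreover have "(\<Prod>v\<in>S. - x v) = - (\<Prod>v\<in>S. x v)" using 3(1) by (simp add: prod_uminus)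
          ultimately show "(\<Prod>v\<in>S. - x v) * boltzmann_weight ?F J \<beta> (\<lambda>v. - x v) =
              - ((\<Prod>v\<in>S. x v) * boltzmann_weight ?F J \<beta> x)" by simp
        qed
        moreover have "S \<noteq> {}" "card S \<noteq> 2" using 3 by auto
        ultimately show ?thesis by simp
      qed
    qed
    finally show "(\<integral>x. (\<Prod>v\<in>S. x v) * boltzmann_weight ?E' J' \<beta> x \<partial>PiM V' lam') =
      Q / Z * (\<integral>x. (\<Prod>v\<in>S. x v) * boltzmann_weight ?F J \<beta> x \<partial>M)"
      by (simp add: m_def L.Ex_def)
  qed (use s(1,2) J'(1) in auto)
qed

end

lemma spin_expectation_cong:
  assumes "\<And>v. v \<in> V \<Longrightarrow> lam v = lam' v"
  shows "spin_expectation V E J \<beta> lam f = spin_expectation V E J \<beta> lam' f"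
proof -
  have "PiM V lam = PiM V lam'" using assms by (intro PiM_cong) auto
  then show ?thesis by (simp add: spin_expectation_def spin_measure_def partition_function_def)
qed

theorem theorem1:
  fixes V :: "'v set" and E :: "'v set set" and J :: "'v set \<Rightarrow> real"
    and \<beta> :: real and lam :: "'v \<Rightarrow> real measure" and ws :: "'v list"
  assumes "finite_graph V E"
    and "\<And>e. e \<in> E \<Longrightarrow> J e > 0"
    and "\<beta> > 0"
    and "\<And>v. v \<in> V \<Longrightarrow> reference_measure (lam v)"
    and "distinct ws" and "set ws \<subseteq> V"
    and "pfaffian_relations (spin_expectation V E J \<beta> lam) ws"
  shows "\<exists>U \<subseteq> V. (\<forall>u\<in>U. ising_type (lam u)) \<and>
    (let V' = U \<union> set ws; E' = path_induced_edges E V' in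
       planar_with_on_face V' E' (set ws) \<and>
       (\<exists>J' lam'. (\<forall>e\<in>E'. J' e \<ge> 0) \<and> (\<forall>v\<in>V'. ising_type (lam' v)) \<and>
          (\<forall>I \<subseteq> set ws.
             spin_expectation V E J \<beta> lam (\<lambda>\<phi>. \<Prod>v\<in>I. \<phi> v) =
             spin_expectation V' E' J' \<beta> lam' (\<lambda>\<sigma>. \<Prod>v\<in>I. \<sigma> v))))"
proof -
  let ?W = "set ws"
  have V: "finite V" "E \<subseteq> Pow V" "\<And>e. e \<in> E \<Longrightarrow> card e = 2" and finE: "finite E"
    using assms(1) finite_subset[of E "Pow V"] by (auto simp: finite_graph_def)
  \<comment> \<open>Outside \<open>V\<close> the given measures are arbitrary; Ising measures are
    filled in so that the locale applies, and expectations on \<open>V\<close> do not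
    change.\<close>
  define lam0 where "lam0 v = (if v \<in> V then lam v else ising_measure 1)" for v
  have "reference_measure (lam0 v)" for v
    using assms(4) reference_measure_ising[of 1] by (simp add: lam0_def)
  then interpret F: ferromagnet V lam0 E J \<beta>
    by unfold_locales (use V assms(1-3) in auto)
  have lam0: "spin_expectation V E J \<beta> lam = spin_expectation V E J \<beta> lam0"
    by (intro ext spin_expectation_cong) (simp add: lam0_def)
  have "\<exists>K. K \<subseteq> V \<and> (\<forall>v\<in>K. ising_type (lam0 v)) \<and>
    (\<forall>C. C \<subseteq> V - K \<longrightarrow> C \<noteq> {} \<longrightarrow> connected_in E C \<longrightarrow> nbrs E C \<subseteq> K \<longrightarrow> card (nbrs E C) + card (C \<inter> ?W) \<le> 3) \<and>
    planar_with_on_face (K \<union> ?W) (path_induced_edges E (K \<union> ?W)) ?W"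
    (is "\<exists>K. ?D K")
  proof (rule planar_decomposition[OF assms(1,5,6), of "\<lambda>v. ising_type (lam0 v)"])
    show "\<exists>v\<in>set p \<inter> set q. ising_type (lam0 v)"
      if "i < k" "k < j" "j < l" "l < length ws" "simple_path_between E (ws ! i) p (ws ! j)"
        "simple_path_between E (ws ! k) q (ws ! l)" for i k j l p q
      by (rule F.pfaffian_paths_meet[OF assms(6,5) assms(7)[unfolded lam0] that])
    fix K assume "K \<subseteq> V" "\<And>v. v \<in> K \<Longrightarrow> ising_type (lam0 v)"
      "\<And>C. C \<subseteq> V - K \<Longrightarrow> C \<noteq> {} \<Longrightarrow> connected_in E C \<Longrightarrow> nbrs E C \<subseteq> K \<Longrightarrow> card (nbrs E C) + card (C \<inter> ?W) \<le> 3"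
      "planar_with_on_face (K \<union> ?W) (path_induced_edges E (K \<union> ?W)) ?W"
    then have "?D K" by blast
    then show ?thesis ..
  qed
  then obtain K where D: "?D K" ..
  note K = D[THEN conjunct1] D[THEN conjunct2, THEN conjunct1, rule_format]
    D[THEN conjunct2, THEN conjunct2, THEN conjunct1, rule_format]
    D[THEN conjunct2, THEN conjunct2, THEN conjunct2]
  define V' where "V' = K \<union> ?W"
  define E' where "E' = path_induced_edges E V'"
  have finV': "finite V'" using K(1) V(1) finite_subset[of K V] by (simp add: V'_def)
  have gE': "finite_graph V' E'"
    unfolding finite_graph_def E'_def
    using finV' path_induced_edges_Pow[of E V'] path_induced_edges_card[of _ E V'] by blast
  have finE': "finite E'" using gE' finV' finite_subset[of E' "Pow V'"] by (auto simp: finite_graph_def)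
  have "\<forall>v. \<exists>s>0. v \<in> K \<longrightarrow> lam0 v = ising_measure s"
  proof
    fix v
    show "\<exists>s>0. v \<in> K \<longrightarrow> lam0 v = ising_measure s"
      using K(2)[of v] zero_less_one[where 'a = real] unfolding ising_type_def by blast
  qed
  then obtain s0 where s0: "\<And>v. 0 < s0 v" "\<And>v. v \<in> K \<Longrightarrow> lam0 v = ising_measure (s0 v)" by metis

  \<comment> \<open>Components of the complement of \<open>K\<close> and their replacements\<close>
  define comp where "comp v = {y. conn E (V - K) v y}" for v
  define CC where "CC = comp ` (V - K)"
  have finCC: "finite CC" using V(1) by (simp add: CC_def)
  have comp_self: "v \<in> comp v" if "v \<in> V - K" for v using that by (simp add: comp_def)
  have comp_eq: "comp u = comp v" if "u \<in> comp v" for u v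
  proof -
    have vu: "conn E (V - K) v u" using that by (simp add: comp_def)
    show ?thesis unfolding comp_def using conn_trans[OF vu] conn_trans[OF conn_sym[OF vu]] by blast
  qed
  have CC: "C \<subseteq> V - K" "C \<noteq> {}" "connected_in E C" "nbrs E C \<subseteq> K" if C: "C \<in> CC" for C
  proof -
    obtain v where v: "v \<in> V - K" "C = comp v" using C by (auto simp: CC_def)
    show CV: "C \<subseteq> V - K" unfolding v(2) comp_def using conn_snd by fastforce
    show "C \<noteq> {}" using comp_self[OF v(1)] v(2) by blast
    show "connected_in E C" unfolding v(2) comp_def by (rule component_connected)
    have "nbrs E C \<subseteq> V" using V(2) by (auto simp: nbrs_def)
    then show "nbrs E C \<subseteq> K" using component_nbrs[of E "V - K" v] unfolding v(2) comp_def by blast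
  qed
  have comp_CC: "comp u = C" if "C \<in> CC" "u \<in> C" for u C
    using that comp_eq by (auto simp: CC_def)
  have disjCC: "C \<inter> D = {}" if "C \<in> CC" "D \<in> CC" "C \<noteq> D" for C D
    using comp_CC[OF that(1)] comp_CC[OF that(2)] that(3) by blast
  have NC: "nbrs E C \<inter> C = {}" for C by (auto simp: nbrs_def)
  \<comment> \<open>The data of one replaced component (spins, couplings, proportionality constant)
    are bundled in a triple, so that they can be chosen for all components at once.\<close>
  define R where "R C t \<longleftrightarrow> (case t of (s, J', d) \<Rightarrow>
    (\<forall>v. 0 < s v) \<and> (\<forall>v. v \<notin> C \<inter> ?W \<longrightarrow> s v = s0 v) \<and> (\<forall>e. 0 \<le> J' e) \<and>
    (\<forall>e. J' e \<noteq> 0 \<longrightarrow> e \<subseteq> nbrs E C \<union> (C \<inter> ?W)) \<and> 0 < d \<and>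
    (\<forall>lam' S. reference_family V' lam' \<longrightarrow>
      (\<forall>v\<in>nbrs E C \<union> (C \<inter> ?W). lam' v = ising_measure (s v)) \<longrightarrow> S \<subseteq> nbrs E C \<union> (C \<inter> ?W) \<longrightarrow>
      (\<integral>x. (\<Prod>v\<in>S. x v) * boltzmann_weight E' J' \<beta> x \<partial>PiM V' lam') =
      d * (\<integral>x. (\<Prod>v\<in>S. x v) * boltzmann_weight (cell_edges E C) J \<beta> x \<partial>PiM V lam0)))"
    for C and t :: "('v \<Rightarrow> real) \<times> ('v set \<Rightarrow> real) \<times> real"
  have "\<forall>C\<in>CC. \<exists>t. R C t"
  proof
    fix C assume C: "C \<in> CC"
    show "\<exists>t. R C t"
    proof (rule F.cell_model[OF K(1) s0(2,1) CC[OF C] assms(6) K(3)[OF CC[OF C]]])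
      fix s J' d
      assume "\<And>v. 0 < s v" "\<And>v. v \<notin> C \<inter> ?W \<Longrightarrow> s v = s0 v"
        "\<And>e. 0 \<le> J' e" "\<And>e. J' e \<noteq> 0 \<Longrightarrow> e \<subseteq> nbrs E C \<union> (C \<inter> ?W)" "0 < d"
        "\<And>lam' S. reference_family (K \<union> ?W) lam' \<Longrightarrow> (\<And>v. v \<in> nbrs E C \<union> (C \<inter> ?W) \<Longrightarrow> lam' v = ising_measure (s v)) \<Longrightarrow>
          S \<subseteq> nbrs E C \<union> (C \<inter> ?W) \<Longrightarrow>
          (\<integral>x. (\<Prod>v\<in>S. x v) * boltzmann_weight (path_induced_edges E (K \<union> ?W)) J' \<beta> x \<partial>PiM (K \<union> ?W) lam') =
          d * (\<integral>x. (\<Prod>v\<in>S. x v) * boltzmann_weight (cell_edges E C) J \<beta> x \<partial>PiM V lam0)"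
      then have "R C (s, J', d)" unfolding R_def E'_def V'_def by simp
      then show ?thesis by blast
    qed
  qed
  then obtain t where t: "\<And>C. C \<in> CC \<Longrightarrow> R C (t C)" by metis
  define sC where "sC C = fst (t C)" for C
  define JC where "JC C = fst (snd (t C))" for C
  define dC where "dC C = snd (snd (t C))" for C
  have tR: "R C (sC C, JC C, dC C)" if "C \<in> CC" for C using t[OF that] by (simp add: sC_def JC_def dC_def)
  have sC: "0 < sC C v" "v \<notin> C \<inter> ?W \<Longrightarrow> sC C v = s0 v" if "C \<in> CC" for C v
    using tR[OF that] unfolding R_def by simp_all
  have JC: "0 \<le> JC C e" "JC C e \<noteq> 0 \<Longrightarrow> e \<subseteq> nbrs E C \<union> (C \<inter> ?W)" if "C \<in> CC" for C e
    using tR[OF that] unfolding R_def by simp_all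
  have dC: "0 < dC C" if "C \<in> CC" for C
    using tR[OF that] unfolding R_def by simp
  have cell: "(\<integral>x. (\<Prod>v\<in>S. x v) * boltzmann_weight E' (JC C) \<beta> x \<partial>PiM V' lam') =
      dC C * (\<integral>x. (\<Prod>v\<in>S. x v) * boltzmann_weight (cell_edges E C) J \<beta> x \<partial>PiM V lam0)"
    if "C \<in> CC" "reference_family V' lam'" "\<forall>v\<in>nbrs E C \<union> (C \<inter> ?W). lam' v = ising_measure (sC C v)"
      "S \<subseteq> nbrs E C \<union> (C \<inter> ?W)" for C lam' S
    using tR[OF that(1)] that(2-4) unfolding R_def by simp

  \<comment> \<open>Spins and couplings of the new model\<close>
  define s where "s v = (if v \<in> V - K then sC (comp v) v else s0 v)" for v
  have s_pos: "0 < s v" for v using s0(1) sC(1) by (auto simp: s_def CC_def)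
  have s_K: "s v = s0 v" if "v \<in> K" for v using that by (simp add: s_def)
  \<comment> \<open>A vertex of \<open>K\<close> may border several components, but each of them
    leaves the spin \<open>s0\<close> there unchanged, so the separate choices fit together.\<close>
  have s_C: "s v = sC C v" if C: "C \<in> CC" and v: "v \<in> nbrs E C \<union> (C \<inter> ?W)" for C v
  proof (cases "v \<in> C")
    case True
    then have "v \<in> V - K" using CC(1)[OF C] by blast
    then show ?thesis using comp_CC[OF C True] by (simp add: s_def)
  next
    case False
    then have "v \<in> K" using v CC(4)[OF C] by blast
    then show ?thesis using s_K sC(2)[OF C, of v] False by simp
  qed
  define lam' where "lam' v = ising_measure (s v)" for v
  have lamK: "lam0 v = ising_measure (s v)" if "v \<in> K" for v using s0(2)[OF that] s_K[OF that] by simp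
  interpret G: reference_family V' lam'
    by unfold_locales (use finV' reference_measure_ising[OF s_pos] in \<open>simp_all add: lam'_def\<close>)
  define EK where "EK = {e \<in> E. e \<subseteq> K}"
  \<comment> \<open>An edge of the path-induced graph may arise from an edge inside \<open>K\<close>
    and from several components at once; the couplings add up.\<close>
  define J' where "J' e = (if e \<in> EK then J e else 0) + (\<Sum>C\<in>CC. JC C e)" for e
  have J'_nonneg: "0 \<le> J' e" for e
    using JC(1) assms(2)[of e] by (auto simp: J'_def EK_def less_imp_le intro!: add_nonneg_nonneg sum_nonneg)
  have EK_E': "EK \<subseteq> E'"
  proof
    fix e assume e: "e \<in> EK"
    then obtain a b where ab: "e = {a, b}" "a \<noteq> b" using V(3)[of e] by (auto simp: EK_def card_2_iff)
    then show "e \<in> E'" using e unfolding E'_def V'_def ab(1)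
      by (intro path_induced_edgeI) (auto simp: EK_def)
  qed
  have gEK: "finite_graph V EK" "finite_graph V' EK"
    using assms(1) finV' by (auto simp: finite_graph_def EK_def V'_def)
  have gC: "finite_graph V (cell_edges E C)" for C
    using assms(1) by (auto simp: finite_graph_def cell_edges_def)
  have edge_cell: "e \<subseteq> nbrs E C \<union> C" if C: "C \<in> CC" and e: "e \<in> cell_edges E C" for e C
  proof
    fix b assume b: "b \<in> e"
    obtain a where a: "a \<in> e" "a \<in> C" "e \<in> E" using e by (auto simp: cell_edges_def)
    show "b \<in> nbrs E C \<union> C"
    proof (cases "b = a")
      case False
      obtain p q where "e = {p, q}" using V(3)[OF a(3)] by (auto simp: card_2_iff)
      then have "e = {a, b}" using a(1) b False by auto
      then show ?thesis using a by (auto simp: nbrs_def)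
    qed (use a in simp)
  qed

  \<comment> \<open>Factorisation of both weights over \<open>K\<close> and the components\<close>
  have E_split: "(\<Sum>e\<in>E. f e) = (\<Sum>e\<in>EK. f e) + (\<Sum>C\<in>CC. \<Sum>e\<in>cell_edges E C. f e)" for f :: "'v set \<Rightarrow> real"
  proof -
    have fin: "finite (cell_edges E C)" "finite EK" for C using finE by (simp_all add: cell_edges_def EK_def)
    have U: "E = EK \<union> (\<Union>C\<in>CC. cell_edges E C)"
    proof
      show "E \<subseteq> EK \<union> (\<Union>C\<in>CC. cell_edges E C)"
      proof
        fix e assume e: "e \<in> E"
        show "e \<in> EK \<union> (\<Union>C\<in>CC. cell_edges E C)"
        proof (cases "e \<subseteq> K")
          case True
          then show ?thesis using e by (simp add: EK_def)
        next
          case False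
          then obtain v where v: "v \<in> e" "v \<notin> K" by blast
          then have vV: "v \<in> V - K" using e V(2) by blast
          then have "e \<in> cell_edges E (comp v)" using e v comp_self by (auto simp: cell_edges_def)
          then show ?thesis using vV by (auto simp: CC_def)
        qed
      qed
    qed (auto simp: EK_def cell_edges_def)
    have d1: "EK \<inter> (\<Union>C\<in>CC. cell_edges E C) = {}" using CC(1) by (fastforce simp: EK_def cell_edges_def)
    have d2: "cell_edges E C \<inter> cell_edges E D = {}" if CD: "C \<in> CC" "D \<in> CC" "C \<noteq> D" for C D
    proof (rule ccontr)
      assume "cell_edges E C \<inter> cell_edges E D \<noteq> {}"
      then obtain e where e: "e \<in> cell_edges E C" "e \<in> cell_edges E D" by blast
      then obtain a where a: "a \<in> e" "a \<in> D" by (auto simp: cell_edges_def)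
      have "a \<in> nbrs E C \<union> C" using edge_cell[OF CD(1) e(1)] a(1) by blast
      moreover have "a \<notin> K" using CC(1)[OF CD(2)] a(2) by blast
      ultimately show False using CC(4)[OF CD(1)] disjCC[OF CD] a(2) by blast
    qed
    have "(\<Sum>e\<in>E. f e) = (\<Sum>e\<in>EK. f e) + (\<Sum>e\<in>(\<Union>C\<in>CC. cell_edges E C). f e)"
      by (subst U, rule sum.union_disjoint) (use fin finCC d1 in auto)
    also have "(\<Sum>e\<in>(\<Union>C\<in>CC. cell_edges E C). f e) = (\<Sum>C\<in>CC. \<Sum>e\<in>cell_edges E C. f e)"
      by (rule sum.UNION_disjoint) (use finCC fin d2 in auto)
    finally show ?thesis .
  qed
  have weight: "boltzmann_weight E J \<beta> x =
      boltzmann_weight EK J \<beta> x * (\<Prod>C\<in>CC. boltzmann_weight (cell_edges E C) J \<beta> x)" for x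
    unfolding boltzmann_weight_def E_split distrib_left exp_add sum_distrib_left exp_sum[OF finCC] ..
  have weight': "boltzmann_weight E' J' \<beta> x =
      boltzmann_weight EK J \<beta> x * (\<Prod>C\<in>CC. boltzmann_weight E' (JC C) \<beta> x)" for x
  proof -
    have "(\<Sum>e\<in>E'. J' e * (\<Prod>v\<in>e. x v)) = (\<Sum>e\<in>E'. (if e \<in> EK then J e else 0) * (\<Prod>v\<in>e. x v)) +
        (\<Sum>e\<in>E'. \<Sum>C\<in>CC. JC C e * (\<Prod>v\<in>e. x v))"
      unfolding J'_def distrib_right sum.distrib sum_distrib_right ..
    also have "(\<Sum>e\<in>E'. (if e \<in> EK then J e else 0) * (\<Prod>v\<in>e. x v)) = (\<Sum>e\<in>EK. J e * (\<Prod>v\<in>e. x v))"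
      using EK_E' finE' by (intro sum.mono_neutral_cong_right) auto
    also have "(\<Sum>e\<in>E'. \<Sum>C\<in>CC. JC C e * (\<Prod>v\<in>e. x v)) = (\<Sum>C\<in>CC. \<Sum>e\<in>E'. JC C e * (\<Prod>v\<in>e. x v))"
      by (rule sum.swap)
    finally have *: "(\<Sum>e\<in>E'. J' e * (\<Prod>v\<in>e. x v)) =
      (\<Sum>e\<in>EK. J e * (\<Prod>v\<in>e. x v)) + (\<Sum>C\<in>CC. \<Sum>e\<in>E'. JC C e * (\<Prod>v\<in>e. x v))" .
    show ?thesis unfolding boltzmann_weight_def * distrib_left exp_add sum_distrib_left[of \<beta> _ CC] exp_sum[OF finCC] ..
  qed

  \<comment> \<open>Comparison of the spin integrals of the two models\<close>
  define d where "d = (\<Prod>C\<in>CC. dC C)"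
  have d_pos: "0 < d" unfolding d_def using dC by (intro prod_pos) simp
  \<comment> \<open>The constant \<open>d\<close> does not depend on \<open>I\<close>, so it cancels
    against the partition functions. Both integrals are expanded over the same spin configurations
    on \<open>K\<close>.\<close>
  have main: "(\<integral>x. (\<Prod>v\<in>I. x v) * boltzmann_weight E' J' \<beta> x \<partial>PiM V' lam') =
      d * (\<integral>x. (\<Prod>v\<in>I. x v) * boltzmann_weight E J \<beta> x \<partial>PiM V lam0)" if I: "I \<subseteq> ?W" for I
  proof -
    define g where "g x = (\<Prod>v\<in>I \<inter> K. x v) * boltzmann_weight EK J \<beta> x" for x :: "'v \<Rightarrow> real"
    define h where "h C x = (\<Prod>v\<in>I \<inter> C. x v) * boltzmann_weight (cell_edges E C) J \<beta> x" for C and x :: "'v \<Rightarrow> real"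
    define h' where "h' C x = (\<Prod>v\<in>I \<inter> C. x v) * boltzmann_weight E' (JC C) \<beta> x" for C and x :: "'v \<Rightarrow> real"
    have IV: "I \<subseteq> V" "I \<subseteq> V'" using I assms(6) by (auto simp: V'_def)
    have finI: "finite I" using I finite_subset by blast
    have I_split: "(\<Prod>v\<in>I. x v) = (\<Prod>v\<in>I \<inter> K. x v) * (\<Prod>C\<in>CC. \<Prod>v\<in>I \<inter> C. x v)" for x :: "'v \<Rightarrow> real"
    proof -
      have U: "I = (I \<inter> K) \<union> (\<Union>C\<in>CC. I \<inter> C)"
        using IV(1) comp_self by (auto simp: CC_def)
      have d1: "(I \<inter> K) \<inter> (\<Union>C\<in>CC. I \<inter> C) = {}" using CC(1) by blast
      have "(\<Prod>v\<in>I. x v) = (\<Prod>v\<in>I \<inter> K. x v) * (\<Prod>v\<in>(\<Union>C\<in>CC. I \<inter> C). x v)"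
        by (subst U, rule prod.union_disjoint) (use finI finCC d1 in auto)
      also have "(\<Prod>v\<in>(\<Union>C\<in>CC. I \<inter> C). x v) = (\<Prod>C\<in>CC. \<Prod>v\<in>I \<inter> C. x v)"
        by (rule prod.UNION_disjoint) (use finCC finI disjCC in blast)+
      finally show ?thesis .
    qed
    have eq: "(\<Prod>v\<in>I. x v) * boltzmann_weight E J \<beta> x = g x * (\<Prod>C\<in>CC. h C x)" for x
      unfolding I_split weight g_def h_def prod.distrib by (simp only: mult_ac)
    have eq': "(\<Prod>v\<in>I. x v) * boltzmann_weight E' J' \<beta> x = g x * (\<Prod>C\<in>CC. h' C x)" for x
      unfolding I_split weight' g_def h'_def prod.distrib by (simp only: mult_ac)
    have gK: "F.local_on K g" "G.local_on K g"
      unfolding g_def by (rule F.local_on_weight G.local_on_weight; auto simp: EK_def)+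
    have gT: "F.tame1 g" "G.tame1 g"
      unfolding g_def using gEK IV by (auto intro!: F.tame1_weight G.tame1_weight)
    have hT: "F.tame1 (h C)" "G.tame1 (h' C)" for C
      unfolding h_def h'_def using gC gE' IV by (auto intro!: F.tame1_weight G.tame1_weight)
    have hL: "F.local_on (nbrs E C \<union> C) (h C)" if "C \<in> CC" for C
      unfolding h_def using edge_cell[OF that] by (intro F.local_on_weight) auto
    have h'L: "G.local_on (nbrs E C \<union> (C \<inter> ?W)) (h' C)" if "C \<in> CC" for C
      unfolding h'_def using JC(2)[OF that] I by (intro G.local_on_weight) auto
    let ?m = "\<lambda>C B. \<integral>x. (\<Prod>v\<in>B. x v) * h C x \<partial>PiM V lam0" and ?m' = "\<lambda>C B. \<integral>x. (\<Prod>v\<in>B. x v) * h' C x \<partial>PiM V' lam'"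
    \<comment> \<open>The boundary spins \<open>B\<close> from the pin expansion and the marked
      spins \<open>I \<inter> C\<close> are disjoint and together form a set of terminals, so the
      cell identity applies to their union.\<close>
    have m: "?m' C B = dC C * ?m C B" if C: "C \<in> CC" and B: "B \<subseteq> nbrs E C" for C B
    proof -
      have finB: "finite B" using B CC(4)[OF C] K(1) V(1) finite_subset by (meson order_trans)
      have "B \<inter> (I \<inter> C) = {}" using B NC[of C] by blast
      then have BI: "(\<Prod>v\<in>B. x v) * ((\<Prod>v\<in>I \<inter> C. x v) * y) = (\<Prod>v\<in>B \<union> (I \<inter> C). x v) * y"
        for x :: "'v \<Rightarrow> real" and y :: real
        using finB finI by (simp add: prod.union_disjoint mult.assoc)
      show ?thesis unfolding h_def h'_def BI
        by (rule cell[OF C G.reference_family_axioms])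
          (use B I s_C[OF C] in \<open>auto simp: lam'_def\<close>)
    qed
    have "(\<integral>x. g x * (\<Prod>C\<in>CC. h C x) \<partial>PiM V lam0) =
      (\<Sum>\<tau>\<in>PiE K (\<lambda>v. {s v, - s v}). g \<tau> / 2 ^ card K *
        (\<Prod>C\<in>CC. \<Sum>B\<in>Pow (nbrs E C). (\<Prod>v\<in>B. \<tau> v / (s v)\<^sup>2) * ?m C B))"
      by (rule F.cell_expansion[where D = "\<lambda>C. C"])
        (use K(1) lamK s_pos finCC CC(1,4) disjCC hT(1) hL gT(1) gK(1) in \<open>auto simp: disjoint_family_on_def\<close>)
    moreover have "(\<integral>x. g x * (\<Prod>C\<in>CC. h' C x) \<partial>PiM V' lam') =
      (\<Sum>\<tau>\<in>PiE K (\<lambda>v. {s v, - s v}). g \<tau> / 2 ^ card K *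
        (\<Prod>C\<in>CC. \<Sum>B\<in>Pow (nbrs E C). (\<Prod>v\<in>B. \<tau> v / (s v)\<^sup>2) * ?m' C B))"
    proof (rule G.cell_expansion[where D = "\<lambda>C. C \<inter> ?W"])
      show "C \<inter> ?W \<subseteq> V' - K" if "C \<in> CC" for C using CC(1)[OF that] by (auto simp: V'_def)
      show "disjoint_family_on (\<lambda>C. C \<inter> ?W) CC" using disjCC by (fastforce simp: disjoint_family_on_def)
    qed (use s_pos finCC CC(4) hT(2) h'L gT(2) gK(2) in \<open>auto simp: V'_def lam'_def\<close>)
    moreover have "g \<tau> / 2 ^ card K * (\<Prod>C\<in>CC. \<Sum>B\<in>Pow (nbrs E C). (\<Prod>v\<in>B. \<tau> v / (s v)\<^sup>2) * ?m' C B) =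
        d * (g \<tau> / 2 ^ card K * (\<Prod>C\<in>CC. \<Sum>B\<in>Pow (nbrs E C). (\<Prod>v\<in>B. \<tau> v / (s v)\<^sup>2) * ?m C B))" for \<tau>
    proof -
      have "(\<Prod>C\<in>CC. \<Sum>B\<in>Pow (nbrs E C). (\<Prod>v\<in>B. \<tau> v / (s v)\<^sup>2) * ?m' C B) =
        (\<Prod>C\<in>CC. dC C * (\<Sum>B\<in>Pow (nbrs E C). (\<Prod>v\<in>B. \<tau> v / (s v)\<^sup>2) * ?m C B))"
      proof (rule prod.cong[OF refl])
        fix C assume C: "C \<in> CC"
        show "(\<Sum>B\<in>Pow (nbrs E C). (\<Prod>v\<in>B. \<tau> v / (s v)\<^sup>2) * ?m' C B) =
            dC C * (\<Sum>B\<in>Pow (nbrs E C). (\<Prod>v\<in>B. \<tau> v / (s v)\<^sup>2) * ?m C B)"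
          unfolding sum_distrib_left using m[OF C] by (intro sum.cong refl) (simp add: mult.left_commute)
      qed
      then show ?thesis unfolding prod.distrib d_def by (simp only: mult.left_commute)
    qed
    ultimately show ?thesis unfolding eq eq' by (simp only: sum_distrib_left)
  qed
  have Z: "0 < (\<integral>x. boltzmann_weight E J \<beta> x \<partial>PiM V lam0)" using F.Ex_1_pos by (simp add: F.Ex_def)
  have Z': "(\<integral>x. boltzmann_weight E' J' \<beta> x \<partial>PiM V' lam') = d * (\<integral>x. boltzmann_weight E J \<beta> x \<partial>PiM V lam0)"
    using main[of "{}"] by simp
  have eq: "spin_expectation V E J \<beta> lam (\<lambda>\<phi>. \<Prod>v\<in>I. \<phi> v) = spin_expectation V' E' J' \<beta> lam' (\<lambda>\<sigma>. \<Prod>v\<in>I. \<sigma> v)"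
    if I: "I \<subseteq> ?W" for I
  proof -
    have IV: "I \<subseteq> V" "I \<subseteq> V'" using I assms(6) by (auto simp: V'_def)
    have Z0: "0 < (\<integral>x. boltzmann_weight E' J' \<beta> x \<partial>PiM V' lam')" unfolding Z' using d_pos Z by simp
    show ?thesis
      unfolding lam0 F.spin_expectation_ratio[OF assms(1) F.tame1_coords[OF IV(1)] Z]
        G.spin_expectation_ratio[OF gE' G.tame1_coords[OF IV(2)] Z0] main[OF I] Z'
      using d_pos by simp
  qed
  have model: "\<exists>J' lam'. (\<forall>e\<in>E'. J' e \<ge> 0) \<and> (\<forall>v\<in>V'. ising_type (lam' v)) \<and>
      (\<forall>I \<subseteq> ?W. spin_expectation V E J \<beta> lam (\<lambda>\<phi>. \<Prod>v\<in>I. \<phi> v) =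
         spin_expectation V' E' J' \<beta> lam' (\<lambda>\<sigma>. \<Prod>v\<in>I. \<sigma> v))"
  proof (intro exI[of _ J'] exI[of _ lam'] conjI ballI allI impI)
    show "ising_type (lam' v)" for v using s_pos by (auto simp: lam'_def ising_type_def)
  qed (rule J'_nonneg, erule eq)
  have isK: "\<forall>u\<in>K. ising_type (lam u)" using K(1,2) by (auto simp: lam0_def subset_iff)
  show ?thesis
    unfolding Let_def
    by (rule exI[of _ K]) (intro conjI K(1,4) isK model[unfolded E'_def V'_def])
qed

end
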